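(* Let $V$ be a complex finite-dimensional vector space and $\tilde V=V\otimes\mathbb{C}[t,t^{-1}]$, graded by $\tilde V_n=V\otimes t^n$, $n\in\mathbb{Z}$. Then: 1) for every $\alpha\in\mathbb{C}$, the space $W^{\frac{\infty}{2}+*}(\tilde V)$ is a module over $\hat S'(2,\alpha)$ with central charge $3\dim V$; 2) if $\alpha\in\mathbb{C}\setminus\mathbb{Z}$, then $W^{\frac{\infty}{2}+*}(\tilde V)$ is a module over $\widehat{\mathrm{Der}}\,S'(2,\alpha)$.
   Context: Semi-infinite spaces. Let $V=\bigoplus_{n\in\mathbb{Z}}V_n$ be a graded complex vector space with $\dim V_n<\infty$, $V'=\bigoplus_n V_n^*$ its restricted dual, $V_+=\bigoplus_{n>0}V_n$, $V_-=\bigoplus_{n\le 0}V_n$, $V_-'=\bigoplus_{n\le 0}V_n^*$. On $V\oplus V'$ let $(\cdot,\cdot)$ be the natural skew-symmetric form and $\{\cdot,\cdot\}$ the natural symmetric form ($V$ and $V'$ isotropic, $(x',x)=-(x,x')=x'(x)$, $\{x',x\}=x'(x)$ for $x\in V$, $x'\in V'$). Let $H(V)$ (resp. $C(V)$) be the quotient of the tensor algebra of $V\oplus V'$ by the relations $xy-yx=(x,y)$ (resp. $xy+yx=\{x,y\}$). Let $S^{\frac{\infty}{2}+*}(V)$ (resp. $\Lambda^{\frac{\infty}{2}+*}(V)$) be the $H(V)$-module (resp. $C(V)$-module) induced from the trivial one-dimensional representation of the subalgebra $S^*(V_+\oplus V_-')\subset H(V)$ (resp. $\Lambda^*(V_+\oplus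 V_-')\subset C(V)$), in which $V_+\oplus V_-'$ acts by $0$. Set $W^{\frac{\infty}{2}+*}(V)=S^{\frac{\infty}{2}+*}(V)\otimes\Lambda^{\frac{\infty}{2}+*}(V)$, a superspace with $\mathbb{Z}/2$-grading given by the parity of the $\Lambda$-factor. (This is applied to the graded space $\tilde V$.) The superalgebra $S'(2,\alpha)$. Let $W(2)$ be the Lie superalgebra of all derivations of $\mathbb{C}[t,t^{-1}]\otimes\Lambda(2)$, where $\Lambda(2)$ is the Grassmann algebra in odd variables $\theta_1,\theta_2$ and $t$ is even. Put $\mathrm{Div}(f\partial_t+f_1\partial_1+f_2\partial_2)=\partial_tf+\sum_i(-1)^{p(f_i)}\partial_if_i$, $S(2,\alpha)=\{D\in W(2)\mid\mathrm{Div}(t^{\alpha}D)=0\}$ (with $\mathrm{Div}(fD)=Df+f\,\mathrm{Div}D$ for even $f$), and $S'(2,\alpha)=[S(2,\alpha),S(2,\alpha)]$. A basis of $S'(2,\alpha)$ is ($n\in\mathbb{Z}$): $\mathcal{L}_n^{\alpha}=-t^n(t\partial_t+\frac12(n+\alpha+1)(\theta_1\partial_1+\theta_2\partial_2))$, $E_n=t^n\theta_2\partial_1$, $H_n=t^n(\theta_2\partial_2-\theta_1\partial_1)$, $F_n=t^n\theta_1\partial_2$, $h_n^{\alpha}=t^n\theta_2\partial_t-(n+\alpha)t^{n-1}\theta_1\theta_2\partial_1$, $p_n=-t^{n+1}\partial_2$, $x_n=t^{n+1}\partial_1$, $y_n^{\alpha}=t^n\theta_1\partial_t+(n+\alpha)t^{n-1}\theta_1\theta_2\partial_2$.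 $\hat S'(2,\alpha)=S'(2,\alpha)\oplus\mathbb{C}C$ is the central extension by the 2-cocycle whose nonzero values on basis elements are (up to super-skew-symmetry) $c(\mathcal{L}_n^{\alpha},\mathcal{L}_k^{\alpha})=\frac{C}{12}n(n^2-1)\delta_{n,-k}$, $c(E_n,F_k)=\frac{C}{6}n\delta_{n,-k}$, $c(H_n,H_k)=\frac{C}{3}n\delta_{n,-k}$, $c(h_n^{\alpha},p_k)=\frac{C}{6}\big((n-1+\frac{\alpha+1}{2})^2-\frac14\big)\delta_{n,-k}$, $c(x_n,y_k^{\alpha})=-\frac{C}{6}\big((-n-1+\frac{\alpha+1}{2})^2-\frac14\big)\delta_{n,-k}$. A module has central charge $c$ if $C$ acts as multiplication by $c$. $\mathrm{Der}\,S'(2,\alpha)$ is the Lie superalgebra of all derivations of $S'(2,\alpha)$. For $\alpha\notin\mathbb{Z}$ it is $S'(2,\alpha)\oplus\mathbb{C}\mathcal{H}$ ($S'(2,\alpha)$ identified with the inner derivations), where $[\mathcal{H},x_k]=x_k$, $[\mathcal{H},p_k]=p_k$, $[\mathcal{H},h_k^\alpha]=-h_k^\alpha$, $[\mathcal{H},y_k^\alpha]=-y_k^\alpha$ and $\mathcal{H}$ acts by $0$ on the even part. $\widehat{\mathrm{Der}}\,S'(2,\alpha)=\mathrm{Der}\,S'(2,\alpha)\oplus\mathbb{C}C$ is the non-trivial central extension by the 2-cocycle which is zero on pairs involving $\mathcal{H}$ and whose nonzero values on basis elements of $S'(2,\alpha)$ are (up to super-skew-symmetry) $c(\mathcal{L}_n^{\alpha},\mathcal{L}_k^{\alpha})=\frac{C}{12}n(n^2-1)\delta_{n,-k}$,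 $c(E_n,F_k)=\frac{C}{6}n\delta_{n,-k}$, $c(H_n,H_k)=\frac{C}{3}n\delta_{n,-k}$, $c(h_n^{\alpha},p_k)=\frac{C}{6}\big((n-1+\frac{\alpha+1}{2})^2-\frac14\big)\delta_{n,-k}$, $c(x_n,y_k^{\alpha})=-\frac{C}{6}\big((-n-1+\frac{\alpha+1}{2})^2-\frac14\big)\delta_{n,-k}$. *)

theory Defs
  imports
    Complex_Main
    "HOL-Library.Poly_Mapping"
    "HOL-Library.Function_Algebras"
    "HOL-Library.Product_Plus"
    "HOL-Algebra.Module"
    "HOL-Algebra.QuotRing"
begin

section \<open>Complex vector spaces and algebras given by carriers\<close>

definition complex_ring :: "complex ring" where
  "complex_ring = \<lparr>carrier = UNIV, mult = (*), one = 1, zero = 0, add = (+)\<rparr>"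

text \<open>
  A complex vector space is a module record over \<open>complex_ring\<close>; its fields \<open>mult\<close> and \<open>one\<close>
  are used only when the space is an algebra.
\<close>

definition lin_span :: "(complex, 'a, 'm) module_scheme \<Rightarrow> 'a set \<Rightarrow> 'a set" where
  "lin_span M X = \<Inter>{N. submodule N complex_ring M \<and> X \<subseteq> N}"

text \<open>
  The quotient by a subspace \<open>N\<close>. When \<open>N\<close> is a two-sided ideal of an algebra,
  this is the quotient algebra: the library quotient \<open>M Quot N\<close> together with scalar multiplication.
\<close>

definition quotient :: "(complex, 'a, 'm) module_scheme \<Rightarrow> 'a set \<Rightarrow> (complex, 'a set) module" where
  "quotient M N =
    \<lparr>carrier = a_rcosets\<^bsub>M\<^esub> N, mult = rcoset_mult M N, one = N +>\<^bsub>M\<^esub> \<one>\<^bsub>M\<^esub>,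
     zero = N, add = set_add M,
     smult = (\<lambda>c X. N <+>\<^bsub>M\<^esub> ((\<lambda>x. c \<odot>\<^bsub>M\<^esub> x) ` X))\<rparr>"

definition pm_scale :: "complex \<Rightarrow> ('k \<Rightarrow>\<^sub>0 complex) \<Rightarrow> ('k \<Rightarrow>\<^sub>0 complex)" where
  "pm_scale c p = Poly_Mapping.map (\<lambda>z. c * z) p"

subsection \<open>Tensor products of vector spaces\<close>

definition free_space :: "'k set \<Rightarrow> (complex, 'k \<Rightarrow>\<^sub>0 complex) module" where
  "free_space K =
    \<lparr>carrier = {p. Poly_Mapping.keys p \<subseteq> K}, mult = undefined, one = undefined,
     zero = 0, add = (+), smult = pm_scale\<rparr>"

definition bilinear_relations ::
  "(complex, 'a, 'm) module_scheme \<Rightarrow> (complex, 'b, 'n) module_scheme \<Rightarrow> ('a \<times> 'b \<Rightarrow>\<^sub>0 complex) set"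
where
  "bilinear_relations M N =
     {Poly_Mapping.single (x \<oplus>\<^bsub>M\<^esub> x', y) 1 - Poly_Mapping.single (x, y) 1
        - Poly_Mapping.single (x', y) 1 | x x' y. x \<in> carrier M \<and> x' \<in> carrier M \<and> y \<in> carrier N}
   \<union> {Poly_Mapping.single (x, y \<oplus>\<^bsub>N\<^esub> y') 1 - Poly_Mapping.single (x, y) 1
        - Poly_Mapping.single (x, y') 1 | x y y'. x \<in> carrier M \<and> y \<in> carrier N \<and> y' \<in> carrier N}
   \<union> {Poly_Mapping.single (c \<odot>\<^bsub>M\<^esub> x, y) 1 - Poly_Mapping.single (x, y) c
        | c x y. x \<in> carrier M \<and> y \<in> carrier N}
   \<union> {Poly_Mapping.single (x, c \<odot>\<^bsub>N\<^esub> y) 1 - Poly_Mapping.single (x, y) c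
        | c x y. x \<in> carrier M \<and> y \<in> carrier N}"

definition tensor_kernel ::
  "(complex, 'a, 'm) module_scheme \<Rightarrow> (complex, 'b, 'n) module_scheme \<Rightarrow> ('a \<times> 'b \<Rightarrow>\<^sub>0 complex) set"
where
  "tensor_kernel M N =
     lin_span (free_space (carrier M \<times> carrier N)) (bilinear_relations M N)"

definition tensor_product ::
  "(complex, 'a, 'm) module_scheme \<Rightarrow> (complex, 'b, 'n) module_scheme
     \<Rightarrow> (complex, ('a \<times> 'b \<Rightarrow>\<^sub>0 complex) set) module"
where
  "tensor_product M N = quotient (free_space (carrier M \<times> carrier N)) (tensor_kernel M N)"

definition pure_tensor ::
  "(complex, 'a, 'm) module_scheme \<Rightarrow> (complex, 'b, 'n) module_scheme
     \<Rightarrow> 'a \<Rightarrow> 'b \<Rightarrow> ('a \<times> 'b \<Rightarrow>\<^sub>0 complex) set"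
where
  "pure_tensor M N x y =
     tensor_kernel M N +>\<^bsub>free_space (carrier M \<times> carrier N)\<^esub> Poly_Mapping.single (x, y) 1"

subsection \<open>The tensor algebra\<close>

datatype 'u word = Word (letters: "'u list")

instantiation word :: (type) monoid_add
begin

definition zero_word :: "'a word" where "zero_word = Word []"

definition plus_word :: "'a word \<Rightarrow> 'a word \<Rightarrow> 'a word" where
  "plus_word v w = Word (letters v @ letters w)"

instance
  by standard (auto simp: zero_word_def plus_word_def)

end

text \<open>
  With concatenation as the addition of words, the convolution product of
  \<open>'u word \<Rightarrow>\<^sub>0 complex\<close> is that of the free associative algebra. The tensor algebra of a
  vector space \<open>U\<close> is the quotient of the free algebra on the set \<open>U\<close> by the relations
  making \<open>U\<close> embed linearly. Here \<open>U\<close> is a subspace of a type with scalar multiplication \<open>s\<close>.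
\<close>

definition free_algebra :: "'u set \<Rightarrow> (complex, 'u word \<Rightarrow>\<^sub>0 complex) module" where
  "free_algebra U =
    \<lparr>carrier = {p. \<forall>w\<in>Poly_Mapping.keys p. set (letters w) \<subseteq> U}, mult = (*), one = 1,
     zero = 0, add = (+), smult = pm_scale\<rparr>"

definition letter :: "'u \<Rightarrow> ('u word \<Rightarrow>\<^sub>0 complex)" where
  "letter u = Poly_Mapping.single (Word [u]) 1"

definition linear_relations ::
  "(complex \<Rightarrow> 'u::ab_group_add \<Rightarrow> 'u) \<Rightarrow> 'u set \<Rightarrow> ('u word \<Rightarrow>\<^sub>0 complex) set" where
  "linear_relations s U =
     {letter (u + v) - letter u - letter v | u v. u \<in> U \<and> v \<in> U}
   \<union> {letter (s c u) - pm_scale c (letter u) | c u. u \<in> U}"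

definition tensor_algebra ::
  "(complex \<Rightarrow> 'u::ab_group_add \<Rightarrow> 'u) \<Rightarrow> 'u set \<Rightarrow> (complex, ('u word \<Rightarrow>\<^sub>0 complex) set) module" where
  "tensor_algebra s U = quotient (free_algebra U) (Idl\<^bsub>free_algebra U\<^esub> (linear_relations s U))"

definition tensor_incl ::
  "(complex \<Rightarrow> 'u::ab_group_add \<Rightarrow> 'u) \<Rightarrow> 'u set \<Rightarrow> 'u \<Rightarrow> ('u word \<Rightarrow>\<^sub>0 complex) set" where
  "tensor_incl s U u = (Idl\<^bsub>free_algebra U\<^esub> (linear_relations s U)) +>\<^bsub>free_algebra U\<^esub> letter u"

section \<open>Semi-infinite spaces\<close>

text \<open>
  A graded vector space \<open>V\<close> is a type with scalar multiplication \<open>sc\<close> together with its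
  homogeneous subspaces \<open>G n\<close>, whose direct sum is the whole type.
\<close>

subsection \<open>The space \<open>V \<oplus> V'\<close> and its two forms\<close>

definition restricted_dual ::
  "(complex \<Rightarrow> 'v::ab_group_add \<Rightarrow> 'v) \<Rightarrow> (int \<Rightarrow> 'v set) \<Rightarrow> ('v \<Rightarrow> complex) set" where
  "restricted_dual sc G =
     {\<phi>. Vector_Spaces.linear sc (*) \<phi> \<and> finite {n. \<exists>v\<in>G n. \<phi> v \<noteq> 0}}"

definition double_space ::
  "(complex \<Rightarrow> 'v::ab_group_add \<Rightarrow> 'v) \<Rightarrow> (int \<Rightarrow> 'v set) \<Rightarrow> ('v \<times> ('v \<Rightarrow> complex)) set" where
  "double_space sc G = UNIV \<times> restricted_dual sc G"

definition double_scale ::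
  "(complex \<Rightarrow> 'v \<Rightarrow> 'v) \<Rightarrow> complex \<Rightarrow> 'v \<times> ('v \<Rightarrow> complex) \<Rightarrow> 'v \<times> ('v \<Rightarrow> complex)" where
  "double_scale sc c u = (sc c (fst u), (\<lambda>y. c * snd u y))"

definition skew_form :: "'v \<times> ('v \<Rightarrow> complex) \<Rightarrow> 'v \<times> ('v \<Rightarrow> complex) \<Rightarrow> complex" where
  "skew_form u v = snd u (fst v) - snd v (fst u)"

definition sym_form :: "'v \<times> ('v \<Rightarrow> complex) \<Rightarrow> 'v \<times> ('v \<Rightarrow> complex) \<Rightarrow> complex" where
  "sym_form u v = snd u (fst v) + snd v (fst u)"

text \<open>The subspace \<open>V\<^sub>+ \<oplus> V\<^sub>-'\<close>; a functional in \<open>V'\<close> lies in \<open>V\<^sub>-'\<close> iff it vanishes on \<open>V\<^sub>+\<close>.\<close>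

definition annihilators ::
  "(complex \<Rightarrow> 'v::ab_group_add \<Rightarrow> 'v) \<Rightarrow> (int \<Rightarrow> 'v set) \<Rightarrow> ('v \<times> ('v \<Rightarrow> complex)) set" where
  "annihilators sc G =
     Modules.module.span sc (\<Union>n\<in>{0<..}. G n)
       \<times> {\<phi> \<in> restricted_dual sc G. \<forall>n>0. \<forall>v\<in>G n. \<phi> v = 0}"

subsection \<open>The algebras \<open>H(V)\<close> and \<open>C(V)\<close> and the induced modules\<close>

type_synonym 'v tensors = "('v \<times> ('v \<Rightarrow> complex)) word \<Rightarrow>\<^sub>0 complex"

definition T_alg ::
  "(complex \<Rightarrow> 'v::ab_group_add \<Rightarrow> 'v) \<Rightarrow> (int \<Rightarrow> 'v set) \<Rightarrow> (complex, 'v tensors set) module" where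
  "T_alg sc G = tensor_algebra (double_scale sc) (double_space sc G)"

definition T_incl ::
  "(complex \<Rightarrow> 'v::ab_group_add \<Rightarrow> 'v) \<Rightarrow> (int \<Rightarrow> 'v set) \<Rightarrow> 'v \<times> ('v \<Rightarrow> complex) \<Rightarrow> 'v tensors set" where
  "T_incl sc G = tensor_incl (double_scale sc) (double_space sc G)"

definition H_ideal ::
  "(complex \<Rightarrow> 'v::ab_group_add \<Rightarrow> 'v) \<Rightarrow> (int \<Rightarrow> 'v set) \<Rightarrow> 'v tensors set set" where
  "H_ideal sc G = (let T = T_alg sc G; \<iota> = T_incl sc G in
     Idl\<^bsub>T\<^esub> {(\<iota> x \<otimes>\<^bsub>T\<^esub> \<iota> y \<ominus>\<^bsub>T\<^esub> \<iota> y \<otimes>\<^bsub>T\<^esub> \<iota> x) \<ominus>\<^bsub>T\<^esub> (skew_form x y \<odot>\<^bsub>T\<^esub> \<one>\<^bsub>T\<^esub>)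
            | x y. x \<in> double_space sc G \<and> y \<in> double_space sc G})"

definition H_alg ::
  "(complex \<Rightarrow> 'v::ab_group_add \<Rightarrow> 'v) \<Rightarrow> (int \<Rightarrow> 'v set) \<Rightarrow> (complex, 'v tensors set set) module" where
  "H_alg sc G = quotient (T_alg sc G) (H_ideal sc G)"

definition H_incl ::
  "(complex \<Rightarrow> 'v::ab_group_add \<Rightarrow> 'v) \<Rightarrow> (int \<Rightarrow> 'v set) \<Rightarrow> 'v \<times> ('v \<Rightarrow> complex) \<Rightarrow> 'v tensors set set"
where
  "H_incl sc G u = H_ideal sc G +>\<^bsub>T_alg sc G\<^esub> T_incl sc G u"

definition C_ideal ::
  "(complex \<Rightarrow> 'v::ab_group_add \<Rightarrow> 'v) \<Rightarrow> (int \<Rightarrow> 'v set) \<Rightarrow> 'v tensors set set" where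
  "C_ideal sc G = (let T = T_alg sc G; \<iota> = T_incl sc G in
     Idl\<^bsub>T\<^esub> {(\<iota> x \<otimes>\<^bsub>T\<^esub> \<iota> y \<oplus>\<^bsub>T\<^esub> \<iota> y \<otimes>\<^bsub>T\<^esub> \<iota> x) \<ominus>\<^bsub>T\<^esub> (sym_form x y \<odot>\<^bsub>T\<^esub> \<one>\<^bsub>T\<^esub>)
            | x y. x \<in> double_space sc G \<and> y \<in> double_space sc G})"

definition C_alg ::
  "(complex \<Rightarrow> 'v::ab_group_add \<Rightarrow> 'v) \<Rightarrow> (int \<Rightarrow> 'v set) \<Rightarrow> (complex, 'v tensors set set) module" where
  "C_alg sc G = quotient (T_alg sc G) (C_ideal sc G)"

definition C_incl ::
  "(complex \<Rightarrow> 'v::ab_group_add \<Rightarrow> 'v) \<Rightarrow> (int \<Rightarrow> 'v set) \<Rightarrow> 'v \<times> ('v \<Rightarrow> complex) \<Rightarrow> 'v tensors set set"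
where
  "C_incl sc G u = C_ideal sc G +>\<^bsub>T_alg sc G\<^esub> T_incl sc G u"

text \<open>
  Let \<open>A\<close> be an algebra and \<open>B\<close> the subalgebra generated by a set \<open>X\<close>, with the trivial
  one-dimensional representation in which \<open>X\<close> acts by \<open>0\<close>. The induced module
  \<open>A \<otimes>\<^sub>B \<complex>\<close> is the quotient of \<open>A\<close> by the left ideal \<open>A X\<close>, since \<open>B X\<close> is the kernel
  of the augmentation of \<open>B\<close>; the vacuum vector is the class of \<open>1\<close>.
\<close>

definition left_ideal_gen :: "(complex, 'a, 'm) module_scheme \<Rightarrow> 'a set \<Rightarrow> 'a set" where
  "left_ideal_gen A X = lin_span A {a \<otimes>\<^bsub>A\<^esub> x | a x. a \<in> carrier A \<and> x \<in> X}"

definition induced_trivial :: "(complex, 'a, 'm) module_scheme \<Rightarrow> 'a set \<Rightarrow> (complex, 'a set) module" where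
  "induced_trivial A X = quotient A (left_ideal_gen A X)"

definition semi_inf_S ::
  "(complex \<Rightarrow> 'v::ab_group_add \<Rightarrow> 'v) \<Rightarrow> (int \<Rightarrow> 'v set) \<Rightarrow> (complex, 'v tensors set set set) module"
where
  "semi_inf_S sc G = induced_trivial (H_alg sc G) (H_incl sc G ` annihilators sc G)"

definition semi_inf_Lambda ::
  "(complex \<Rightarrow> 'v::ab_group_add \<Rightarrow> 'v) \<Rightarrow> (int \<Rightarrow> 'v set) \<Rightarrow> (complex, 'v tensors set set set) module"
where
  "semi_inf_Lambda sc G = induced_trivial (C_alg sc G) (C_incl sc G ` annihilators sc G)"

text \<open>
  Parities are Booleans, \<open>True\<close> being odd; addition of parities is \<open>\<noteq>\<close>.
  The component of parity \<open>i\<close> of \<open>semi_inf_Lambda\<close> is spanned by the classes of the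
  products \<open>u\<^sub>1 \<dots> u\<^sub>k\<close> of elements of \<open>V \<oplus> V'\<close> with \<open>k\<close> of parity \<open>i\<close>.
\<close>

definition Lambda_part ::
  "(complex \<Rightarrow> 'v::ab_group_add \<Rightarrow> 'v) \<Rightarrow> (int \<Rightarrow> 'v set) \<Rightarrow> bool \<Rightarrow> 'v tensors set set set set" where
  "Lambda_part sc G i = (let A = C_alg sc G in
     lin_span (semi_inf_Lambda sc G)
       {left_ideal_gen A (C_incl sc G ` annihilators sc G)
          +>\<^bsub>A\<^esub> foldr (\<lambda>u a. C_incl sc G u \<otimes>\<^bsub>A\<^esub> a) us \<one>\<^bsub>A\<^esub>
        | us. set us \<subseteq> double_space sc G \<and> odd (length us) = i})"

record 'a superspace = "(complex, 'a) module" +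
  part :: "bool \<Rightarrow> 'a set"

type_synonym 'v weil_vector =
  "('v tensors set set set \<times> 'v tensors set set set \<Rightarrow>\<^sub>0 complex) set"

definition semi_inf_W ::
  "(complex \<Rightarrow> 'v::ab_group_add \<Rightarrow> 'v) \<Rightarrow> (int \<Rightarrow> 'v set) \<Rightarrow> 'v weil_vector superspace" where
  "semi_inf_W sc G =
    (let S = semi_inf_S sc G; L = semi_inf_Lambda sc G; T = tensor_product S L in
     module.extend T
       (superspace.fields
         (\<lambda>i. lin_span T {pure_tensor S L x y | x y. x \<in> carrier S \<and> y \<in> Lambda_part sc G i})))"

subsection \<open>The loop space \<open>V \<otimes> \<complex>[t, 1/t]\<close>\<close>

text \<open>A finitely supported function \<open>f\<close> represents \<open>\<Sum>n. f n \<otimes> t^n\<close>.\<close>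

definition loop_scale ::
  "(complex \<Rightarrow> 'v::ab_group_add \<Rightarrow> 'v) \<Rightarrow> complex \<Rightarrow> (int \<Rightarrow>\<^sub>0 'v) \<Rightarrow> (int \<Rightarrow>\<^sub>0 'v)" where
  "loop_scale sc c f = Poly_Mapping.map (sc c) f"

definition loop_deg :: "int \<Rightarrow> (int \<Rightarrow>\<^sub>0 'v::zero) set" where
  "loop_deg n = range (Poly_Mapping.single n)"

section \<open>Lie superalgebras and their modules\<close>

record 'a lie_superalgebra = "'a superspace" +
  lie_bracket :: "'a \<Rightarrow> 'a \<Rightarrow> 'a"

definition ksign :: "bool \<Rightarrow> complex" where
  "ksign i = (if i then -1 else 1)"

text \<open>
  A module over a Lie superalgebra \<open>g\<close>: an even linear map \<open>\<rho>\<close> from \<open>g\<close> to the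
  endomorphisms of a superspace \<open>M\<close> taking the bracket to the supercommutator.
\<close>

definition lie_super_module ::
  "('a, 'm) lie_superalgebra_scheme \<Rightarrow> ('w, 'n) superspace_scheme \<Rightarrow> ('a \<Rightarrow> 'w \<Rightarrow> 'w) \<Rightarrow> bool" where
  "lie_super_module g M \<rho> \<longleftrightarrow>
     (\<forall>x\<in>carrier g. \<forall>m\<in>carrier M. \<rho> x m \<in> carrier M)
   \<and> (\<forall>x\<in>carrier g. \<forall>m\<in>carrier M. \<forall>n\<in>carrier M. \<rho> x (m \<oplus>\<^bsub>M\<^esub> n) = \<rho> x m \<oplus>\<^bsub>M\<^esub> \<rho> x n)
   \<and> (\<forall>x\<in>carrier g. \<forall>m\<in>carrier M. \<forall>c. \<rho> x (c \<odot>\<^bsub>M\<^esub> m) = c \<odot>\<^bsub>M\<^esub> \<rho> x m)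
   \<and> (\<forall>x\<in>carrier g. \<forall>y\<in>carrier g. \<forall>m\<in>carrier M. \<rho> (x \<oplus>\<^bsub>g\<^esub> y) m = \<rho> x m \<oplus>\<^bsub>M\<^esub> \<rho> y m)
   \<and> (\<forall>x\<in>carrier g. \<forall>m\<in>carrier M. \<forall>c. \<rho> (c \<odot>\<^bsub>g\<^esub> x) m = c \<odot>\<^bsub>M\<^esub> \<rho> x m)
   \<and> (\<forall>i j. \<forall>x\<in>part g i. \<forall>m\<in>part M j. \<rho> x m \<in> part M (i \<noteq> j))
   \<and> (\<forall>i j. \<forall>x\<in>part g i. \<forall>y\<in>part g j. \<forall>m\<in>carrier M.
        \<rho> (lie_bracket g x y) m
          = \<rho> x (\<rho> y m) \<ominus>\<^bsub>M\<^esub> (ksign (i \<and> j) \<odot>\<^bsub>M\<^esub> \<rho> y (\<rho> x m)))"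

text \<open>
  The central extension \<open>g \<oplus> \<complex>C\<close> by a 2-cocycle \<open>c\<close>, with \<open>(x, a)\<close> standing for \<open>x + aC\<close>.
\<close>

definition central_extension ::
  "('a, 'm) lie_superalgebra_scheme \<Rightarrow> ('a \<Rightarrow> 'a \<Rightarrow> complex) \<Rightarrow> ('a \<times> complex) lie_superalgebra" where
  "central_extension g c =
    \<lparr>carrier = carrier g \<times> UNIV, mult = undefined, one = undefined,
     zero = (\<zero>\<^bsub>g\<^esub>, 0),
     add = (\<lambda>(x, a) (y, b). (x \<oplus>\<^bsub>g\<^esub> y, a + b)),
     smult = (\<lambda>k (x, a). (k \<odot>\<^bsub>g\<^esub> x, k * a)),
     part = (\<lambda>i. part g i \<times> (if i then {0} else UNIV)),
     lie_bracket = (\<lambda>(x, a) (y, b). (lie_bracket g x y, c x y))\<rparr>"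

definition has_central_charge ::
  "('a, 'm) lie_superalgebra_scheme \<Rightarrow> ('w, 'n) superspace_scheme
     \<Rightarrow> ('a \<times> complex \<Rightarrow> 'w \<Rightarrow> 'w) \<Rightarrow> complex \<Rightarrow> bool" where
  "has_central_charge g M \<rho> k \<longleftrightarrow> (\<forall>m\<in>carrier M. \<rho> (\<zero>\<^bsub>g\<^esub>, 1) m = k \<odot>\<^bsub>M\<^esub> m)"

subsection \<open>Supercommutators\<close>

text \<open>
  Let \<open>\<epsilon>\<close> be the parity automorphism of a superspace with scalar multiplication \<open>s\<close>. Then
  \<open>op_part s \<epsilon> i D\<close> is the component of parity \<open>i\<close> of the operator \<open>D\<close>.
\<close>

definition op_scale :: "(complex \<Rightarrow> 'b \<Rightarrow> 'b) \<Rightarrow> complex \<Rightarrow> ('a \<Rightarrow> 'b) \<Rightarrow> ('a \<Rightarrow> 'b)" where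
  "op_scale s c D = (\<lambda>a. s c (D a))"

definition op_part ::
  "(complex \<Rightarrow> 'a::ab_group_add \<Rightarrow> 'a) \<Rightarrow> ('a \<Rightarrow> 'a) \<Rightarrow> bool \<Rightarrow> ('a \<Rightarrow> 'a) \<Rightarrow> ('a \<Rightarrow> 'a)" where
  "op_part s \<epsilon> i D = (\<lambda>a. s (1/2) (D a + s (ksign i) (\<epsilon> (D (\<epsilon> a)))))"

definition supercommutator ::
  "(complex \<Rightarrow> 'a::ab_group_add \<Rightarrow> 'a) \<Rightarrow> ('a \<Rightarrow> 'a) \<Rightarrow> ('a \<Rightarrow> 'a) \<Rightarrow> ('a \<Rightarrow> 'a) \<Rightarrow> ('a \<Rightarrow> 'a)" where
  "supercommutator s \<epsilon> D E = (\<lambda>a. \<Sum>i\<in>UNIV. \<Sum>j\<in>UNIV.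
     op_part s \<epsilon> i D (op_part s \<epsilon> j E a)
       - s (ksign (i \<and> j)) (op_part s \<epsilon> j E (op_part s \<epsilon> i D a)))"

text \<open>The Lie superalgebra \<open>P False \<oplus> P True\<close> for subspaces \<open>P i\<close> of a type.\<close>

definition lie_superalgebra_of ::
  "(complex \<Rightarrow> 'a::ab_group_add \<Rightarrow> 'a) \<Rightarrow> (bool \<Rightarrow> 'a set) \<Rightarrow> ('a \<Rightarrow> 'a \<Rightarrow> 'a) \<Rightarrow> 'a lie_superalgebra" where
  "lie_superalgebra_of s P b =
    \<lparr>carrier = {x + y | x y. x \<in> P False \<and> y \<in> P True}, mult = undefined, one = undefined,
     zero = 0, add = (+), smult = s, part = P, lie_bracket = b\<rparr>"

section \<open>The superalgebra \<open>S'(2,\<alpha>)\<close>\<close>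

subsection \<open>The algebra \<open>\<complex>[t, 1/t] \<otimes> \<Lambda>(2)\<close>\<close>

type_synonym laurent = "int \<Rightarrow>\<^sub>0 complex"

text \<open>\<open>(a\<^sub>0, a\<^sub>1, a\<^sub>2, a\<^sub>3)\<close> stands for \<open>a\<^sub>0 + a\<^sub>1 \<theta>\<^sub>1 + a\<^sub>2 \<theta>\<^sub>2 + a\<^sub>3 \<theta>\<^sub>1 \<theta>\<^sub>2\<close>.\<close>

type_synonym salg = "laurent \<times> laurent \<times> laurent \<times> laurent"

abbreviation tpow :: "int \<Rightarrow> complex \<Rightarrow> laurent" where
  "tpow n c \<equiv> Poly_Mapping.single n c"

definition smul :: "salg \<Rightarrow> salg \<Rightarrow> salg" where
  "smul = (\<lambda>(a0, a1, a2, a3) (b0, b1, b2, b3).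
     (a0 * b0, a0 * b1 + a1 * b0, a0 * b2 + a2 * b0, a0 * b3 + a3 * b0 + a1 * b2 - a2 * b1))"

definition sscale :: "complex \<Rightarrow> salg \<Rightarrow> salg" where
  "sscale c = (\<lambda>(a0, a1, a2, a3). (pm_scale c a0, pm_scale c a1, pm_scale c a2, pm_scale c a3))"

definition spart :: "bool \<Rightarrow> salg set" where
  "spart i = (if i then {(0, a, b, 0) | a b. True} else {(a, 0, 0, b) | a b. True})"

definition sparity :: "salg \<Rightarrow> salg" where
  "sparity = (\<lambda>(a0, a1, a2, a3). (a0, - a1, - a2, a3))"

definition t_elem :: salg where "t_elem = (tpow 1 1, 0, 0, 0)"
definition th1 :: salg where "th1 = (0, 1, 0, 0)"
definition th2 :: salg where "th2 = (0, 0, 1, 0)"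

definition laurent_deriv :: "laurent \<Rightarrow> laurent" where
  "laurent_deriv p =
     (\<Sum>n\<in>Poly_Mapping.keys p. tpow (n - 1) (of_int n * Poly_Mapping.lookup p n))"

definition dt :: "salg \<Rightarrow> salg" where
  "dt = (\<lambda>(a0, a1, a2, a3).
     (laurent_deriv a0, laurent_deriv a1, laurent_deriv a2, laurent_deriv a3))"

definition d1 :: "salg \<Rightarrow> salg" where "d1 = (\<lambda>(a0, a1, a2, a3). (a1, 0, a3, 0))"
definition d2 :: "salg \<Rightarrow> salg" where "d2 = (\<lambda>(a0, a1, a2, a3). (a2, - a3, 0, 0))"

subsection \<open>\<open>W(2)\<close>, \<open>S(2,\<alpha>)\<close> and \<open>S'(2,\<alpha>)\<close>\<close>

type_synonym sop = "salg \<Rightarrow> salg"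

abbreviation sop_scale :: "complex \<Rightarrow> sop \<Rightarrow> sop" where
  "sop_scale \<equiv> op_scale sscale"

definition sop_parity :: "sop \<Rightarrow> sop" where
  "sop_parity D = sparity \<circ> D \<circ> sparity"

abbreviation sbracket :: "sop \<Rightarrow> sop \<Rightarrow> sop" where
  "sbracket \<equiv> supercommutator sscale sparity"

definition W2 :: "bool \<Rightarrow> sop set" where
  "W2 i = {D. Vector_Spaces.linear sscale sscale D
     \<and> (\<forall>j. \<forall>a\<in>spart j. D a \<in> spart (i \<noteq> j))
     \<and> (\<forall>j. \<forall>a\<in>spart j. \<forall>b.
          D (smul a b) = smul (D a) b + sscale (ksign (i \<and> j)) (smul a (D b)))}"

text \<open>
  A derivation is \<open>D = f \<partial>\<^sub>t + f\<^sub>1 \<partial>\<^sub>1 + f\<^sub>2 \<partial>\<^sub>2\<close> with \<open>f = D t\<close>, \<open>f\<^sub>i = D \<theta>\<^sub>i\<close>.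
\<close>

definition Div :: "sop \<Rightarrow> salg" where
  "Div D = dt (D t_elem) + d1 (sparity (D th1)) + d2 (sparity (D th2))"

text \<open>
  By \<open>Div (f D) = D f + f Div D\<close> we have \<open>Div (t^\<alpha> D) = t^\<alpha> (\<alpha> t^(-1) D t + Div D)\<close>; the factor
  \<open>t^\<alpha>\<close>, which does not lie in the algebra, is invertible, and the other factor is \<open>twisted_Div \<alpha> D\<close>.
\<close>

definition twisted_Div :: "complex \<Rightarrow> sop \<Rightarrow> salg" where
  "twisted_Div \<alpha> D = smul (tpow (-1) \<alpha>, 0, 0, 0) (D t_elem) + Div D"

definition S2 :: "complex \<Rightarrow> bool \<Rightarrow> sop set" where
  "S2 \<alpha> i = {D \<in> W2 i. twisted_Div \<alpha> D = 0}"

definition S2'_part :: "complex \<Rightarrow> bool \<Rightarrow> sop set" where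
  "S2'_part \<alpha> i =
     Modules.module.span sop_scale {sbracket D E | D E j k. D \<in> S2 \<alpha> j \<and> E \<in> S2 \<alpha> k \<and> i = (j \<noteq> k)}"

definition S2' :: "complex \<Rightarrow> sop lie_superalgebra" where
  "S2' \<alpha> = lie_superalgebra_of sop_scale (S2'_part \<alpha>) sbracket"

subsection \<open>The basis and the cocycle\<close>

datatype gen = gL | gE | gH | gF | gh | gp | gx | gy

definition vfield :: "salg \<Rightarrow> salg \<Rightarrow> salg \<Rightarrow> sop" where
  "vfield f f1 f2 = (\<lambda>a. smul f (dt a) + smul f1 (d1 a) + smul f2 (d2 a))"

fun S2'_basis :: "complex \<Rightarrow> gen \<times> int \<Rightarrow> sop" where
  "S2'_basis \<alpha> (gL, n) =
     vfield (tpow (n + 1) (-1), 0, 0, 0)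
            (0, tpow n (- (of_int n + \<alpha> + 1) / 2), 0, 0)
            (0, 0, tpow n (- (of_int n + \<alpha> + 1) / 2), 0)"
| "S2'_basis \<alpha> (gE, n) = vfield 0 (0, 0, tpow n 1, 0) 0"
| "S2'_basis \<alpha> (gH, n) = vfield 0 (0, tpow n (-1), 0, 0) (0, 0, tpow n 1, 0)"
| "S2'_basis \<alpha> (gF, n) = vfield 0 0 (0, tpow n 1, 0, 0)"
| "S2'_basis \<alpha> (gh, n) =
     vfield (0, 0, tpow n 1, 0) (0, 0, 0, tpow (n - 1) (- (of_int n + \<alpha>))) 0"
| "S2'_basis \<alpha> (gp, n) = vfield 0 0 (tpow (n + 1) (-1), 0, 0, 0)"
| "S2'_basis \<alpha> (gx, n) = vfield 0 (tpow (n + 1) 1, 0, 0, 0) 0"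
| "S2'_basis \<alpha> (gy, n) =
     vfield (0, tpow n 1, 0, 0) 0 (0, 0, 0, tpow (n - 1) (of_int n + \<alpha>))"

definition S2'_coord :: "complex \<Rightarrow> sop \<Rightarrow> gen \<times> int \<Rightarrow> complex" where
  "S2'_coord \<alpha> X b =
     Modules.module.representation sop_scale (range (S2'_basis \<alpha>)) X (S2'_basis \<alpha> b)"

text \<open>
  The coefficient of \<open>C\<close>; the values on \<open>(F, E)\<close>, \<open>(p, h)\<close> and \<open>(y, x)\<close> follow by super-skew-symmetry
  (symmetry on odd elements).
\<close>

fun cocycle_basis :: "complex \<Rightarrow> gen \<times> int \<Rightarrow> gen \<times> int \<Rightarrow> complex" where
  "cocycle_basis \<alpha> (gL, n) (gL, k) = (if n = - k then of_int n * ((of_int n)\<^sup>2 - 1) / 12 else 0)"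
| "cocycle_basis \<alpha> (gE, n) (gF, k) = (if n = - k then of_int n / 6 else 0)"
| "cocycle_basis \<alpha> (gF, k) (gE, n) = (if n = - k then - (of_int n / 6) else 0)"
| "cocycle_basis \<alpha> (gH, n) (gH, k) = (if n = - k then of_int n / 3 else 0)"
| "cocycle_basis \<alpha> (gh, n) (gp, k) =
     (if n = - k then ((of_int n - 1 + (\<alpha> + 1) / 2)\<^sup>2 - 1/4) / 6 else 0)"
| "cocycle_basis \<alpha> (gp, k) (gh, n) =
     (if n = - k then ((of_int n - 1 + (\<alpha> + 1) / 2)\<^sup>2 - 1/4) / 6 else 0)"
| "cocycle_basis \<alpha> (gx, n) (gy, k) =
     (if n = - k then - (((- of_int n - 1 + (\<alpha> + 1) / 2)\<^sup>2 - 1/4) / 6) else 0)"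
| "cocycle_basis \<alpha> (gy, k) (gx, n) =
     (if n = - k then - (((- of_int n - 1 + (\<alpha> + 1) / 2)\<^sup>2 - 1/4) / 6) else 0)"
| "cocycle_basis \<alpha> _ _ = 0"

definition S2'_cocycle :: "complex \<Rightarrow> sop \<Rightarrow> sop \<Rightarrow> complex" where
  "S2'_cocycle \<alpha> X Y =
     (\<Sum>a | S2'_coord \<alpha> X a \<noteq> 0. \<Sum>b | S2'_coord \<alpha> Y b \<noteq> 0.
        S2'_coord \<alpha> X a * S2'_coord \<alpha> Y b * cocycle_basis \<alpha> a b)"

definition hat_S2' :: "complex \<Rightarrow> (sop \<times> complex) lie_superalgebra" where
  "hat_S2' \<alpha> = central_extension (S2' \<alpha>) (S2'_cocycle \<alpha>)"

section \<open>Derivations of \<open>S'(2,\<alpha>)\<close>\<close>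

text \<open>
  Derivations of \<open>g\<close> are functions on the ambient type, made unique by requiring the value \<open>0\<close>
  outside the carrier.
\<close>

definition derivations ::
  "('a::ab_group_add, 'm) lie_superalgebra_scheme \<Rightarrow> bool \<Rightarrow> ('a \<Rightarrow> 'a) set" where
  "derivations g i = {\<delta>.
     (\<forall>x. x \<notin> carrier g \<longrightarrow> \<delta> x = 0)
   \<and> (\<forall>x\<in>carrier g. \<forall>y\<in>carrier g. \<delta> (x \<oplus>\<^bsub>g\<^esub> y) = \<delta> x \<oplus>\<^bsub>g\<^esub> \<delta> y)
   \<and> (\<forall>x\<in>carrier g. \<forall>c. \<delta> (c \<odot>\<^bsub>g\<^esub> x) = c \<odot>\<^bsub>g\<^esub> \<delta> x)
   \<and> (\<forall>j. \<forall>x\<in>part g j. \<delta> x \<in> part g (i \<noteq> j))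
   \<and> (\<forall>j. \<forall>x\<in>part g j. \<forall>y\<in>carrier g.
        \<delta> (lie_bracket g x y)
          = lie_bracket g (\<delta> x) y \<oplus>\<^bsub>g\<^esub> (ksign (i \<and> j) \<odot>\<^bsub>g\<^esub> lie_bracket g x (\<delta> y)))}"

definition Der_S2' :: "complex \<Rightarrow> (sop \<Rightarrow> sop) lie_superalgebra" where
  "Der_S2' \<alpha> =
     lie_superalgebra_of (op_scale sop_scale) (derivations (S2' \<alpha>))
       (supercommutator sop_scale sop_parity)"

definition ad :: "complex \<Rightarrow> sop \<Rightarrow> (sop \<Rightarrow> sop)" where
  "ad \<alpha> X = (\<lambda>Y. if Y \<in> carrier (S2' \<alpha>) then lie_bracket (S2' \<alpha>) X Y else 0)"

fun calH_weight :: "gen \<Rightarrow> complex" where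
  "calH_weight gx = 1"
| "calH_weight gp = 1"
| "calH_weight gh = -1"
| "calH_weight gy = -1"
| "calH_weight _ = 0"

definition calH :: "complex \<Rightarrow> (sop \<Rightarrow> sop)" where
  "calH \<alpha> = (\<lambda>Y. if Y \<in> carrier (S2' \<alpha>)
     then \<Sum>b | S2'_coord \<alpha> Y b \<noteq> 0.
            sop_scale (S2'_coord \<alpha> Y b * calH_weight (fst b)) (S2'_basis \<alpha> b)
     else 0)"

text \<open>
  For \<open>\<alpha> \<notin> \<int>\<close> every derivation is uniquely \<open>ad X + l calH\<close>. The cocycle on derivations is zero
  on pairs involving \<open>calH\<close> and agrees with \<open>S2'_cocycle\<close> on inner derivations.
\<close>

definition inner_component :: "complex \<Rightarrow> (sop \<Rightarrow> sop) \<Rightarrow> sop" where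
  "inner_component \<alpha> \<delta> =
     (THE X. X \<in> carrier (S2' \<alpha>) \<and> (\<exists>l. \<delta> = ad \<alpha> X + op_scale sop_scale l (calH \<alpha>)))"

definition Der_cocycle :: "complex \<Rightarrow> (sop \<Rightarrow> sop) \<Rightarrow> (sop \<Rightarrow> sop) \<Rightarrow> complex" where
  "Der_cocycle \<alpha> \<delta> \<delta>' = S2'_cocycle \<alpha> (inner_component \<alpha> \<delta>) (inner_component \<alpha> \<delta>')"

definition hat_Der_S2' :: "complex \<Rightarrow> ((sop \<Rightarrow> sop) \<times> complex) lie_superalgebra" where
  "hat_Der_S2' \<alpha> = central_extension (Der_S2' \<alpha>) (Der_cocycle \<alpha>)"

end

theory Submission
  imports Defs
begin

text \<open>
  Identify the generators of the Weyl and Clifford algebras of \<open>V \<otimes> \<complex>[t, 1/t]\<close> with functions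
  \<open>t^n s \<otimes> v\<close>, where \<open>s\<close> is \<open>1\<close> or \<open>\<theta>\<^sub>1 \<theta>\<^sub>2\<close> for the Clifford and \<open>\<theta>\<^sub>1\<close> or \<open>\<theta>\<^sub>2\<close> for the Weyl generators, so
  that the two forms become the residue of the product. The operators
  \<open>f \<mapsto> X f - (\<alpha>/2) t^(-1) X(t) f\<close>, for \<open>X\<close> in \<open>S'(2,\<alpha>)\<close>, are then infinitesimal symmetries of this
  form. Such a symmetry acts on the Fock space as a superderivation plus a normally ordered
  quadratic correction, and brackets are preserved up to a scalar, which is a supertrace. On the
  basis this supertrace is \<open>3 dim V\<close> times the given cocycle plus a coboundary.

  For \<open>\<alpha> \<notin> \<int>\<close>, subtracting an inner derivation makes any derivation commute with a diagonal
  operator whose weights separate the basis except for \<open>\<L>\<^sub>n\<close> and \<open>H\<^sub>n\<close>; a few brackets then show that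
  every derivation is \<open>ad X + l \<H>\<close>. Up to sign, \<open>\<H>\<close> is the degree in the variables \<open>\<theta>\<^sub>i\<close>; shifted by a
  constant it is a symmetry of the form too, with zero anomaly.
\<close>

section \<open>Linear maps out of finitely supported functions\<close>

text \<open>Odd elements of the superalgebra exchange Weyl and Clifford generators, so the action
  does not respect the two factors of the tensor product. Both families therefore become letters of
  one superalgebra, and the Fock space is the free algebra on the letters modulo a left ideal. All
  operators live on the free algebra; whether they descend is a question about ideals, and the
  iterated cosets that make up \<open>semi_inf_W\<close> are compared with this model only once. A
  bracket of two extended operators fails by right multiplication by a fixed element, a quadratic
  part plus a scalar. Annihilators send this element into the vacuum ideal, which forces the
  quadratic part into that ideal as well; no irreducibility of the Fock space enters. The
  supertraces are finite because a Laurent monomial moves only finitely many annihilators across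
  exponent zero. Integral \<open>\<alpha>\<close> is excluded in the second statement because odd
  elements such as \<open>x\<close> and \<open>h\<close> have the same weight under
  \<open>H\<close>, and weights under \<open>L_0\<close> that differ by \<open>\<alpha> - 1\<close>
  up to an integer: only for \<open>\<alpha> \<notin> \<int>\<close> does a diagonal operator tell
  them apart.\<close>

type_synonym 'u free = "'u word \<Rightarrow>\<^sub>0 complex"

lemma lookup_pm_scale [simp]: "Poly_Mapping.lookup (pm_scale c p) k = c * Poly_Mapping.lookup p k"
  by (simp add: pm_scale_def Poly_Mapping.map.rep_eq when_def)

interpretation pm: vector_space pm_scale
  by unfold_locales (auto intro!: poly_mapping_eqI simp: lookup_add algebra_simps)

lemma pm_scale_single [simp]: "pm_scale c (Poly_Mapping.single k d) = Poly_Mapping.single k (c * d)"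
  by (auto intro!: poly_mapping_eqI simp: lookup_single when_def)

lemma keys_pm_scale: "Poly_Mapping.keys (pm_scale c p) \<subseteq> Poly_Mapping.keys p"
  by (auto simp: in_keys_iff)

lemma pm_decomp: "(p :: 'k \<Rightarrow>\<^sub>0 complex) = (\<Sum>k\<in>Poly_Mapping.keys p. Poly_Mapping.single k (Poly_Mapping.lookup p k))"
  by (rule poly_mapping_eqI)
     (auto simp: lookup_sum lookup_single when_def in_keys_iff)

definition pm_lin :: "('k \<Rightarrow> 'm \<Rightarrow>\<^sub>0 complex) \<Rightarrow> ('k \<Rightarrow>\<^sub>0 complex) \<Rightarrow> ('m \<Rightarrow>\<^sub>0 complex)" where
  "pm_lin f p = (\<Sum>k\<in>Poly_Mapping.keys p. pm_scale (Poly_Mapping.lookup p k) (f k))"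

lemma pm_lin_superset:
  assumes "finite A" "Poly_Mapping.keys p \<subseteq> A"
  shows "pm_lin f p = (\<Sum>k\<in>A. pm_scale (Poly_Mapping.lookup p k) (f k))"
  unfolding pm_lin_def
  by (rule sum.mono_neutral_left) (use assms in \<open>auto simp: in_keys_iff\<close>)

lemma pm_lin_add: "pm_lin f (p + q) = pm_lin f p + pm_lin f q"
proof -
  let ?A = "Poly_Mapping.keys p \<union> Poly_Mapping.keys q"
  have *: "Poly_Mapping.keys (p + q) \<subseteq> ?A"
    by (rule keys_add)
  show ?thesis
    by (subst pm_lin_superset[of ?A "p + q"], simp, rule *,
        subst pm_lin_superset[of ?A p], simp, simp,
        subst pm_lin_superset[of ?A q], simp, simp)
       (simp add: lookup_add pm.scale_left_distrib sum.distrib)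
qed

lemma pm_lin_scale: "pm_lin f (pm_scale c p) = pm_scale c (pm_lin f p)"
  by (subst pm_lin_superset[of "Poly_Mapping.keys p"])
     (auto simp: pm_lin_def pm.scale_sum_right keys_pm_scale)

lemma pm_lin_single [simp]: "pm_lin f (Poly_Mapping.single k c) = pm_scale c (f k)"
  by (subst pm_lin_superset[of "{k}"]) auto

lemma pm_lin_zero [simp]: "pm_lin f 0 = 0"
  by (simp add: pm_lin_def)

lemma pm_lin_minus: "pm_lin f (- p) = - pm_lin f p"
  using pm_lin_add[of f p "- p"] by (simp add: eq_neg_iff_add_eq_0 add.commute)

lemma pm_lin_diff: "pm_lin f (p - q) = pm_lin f p - pm_lin f q"
  by (metis pm_lin_add pm_lin_minus diff_conv_add_uminus)

lemma pm_lin_sum: "pm_lin f (sum g A) = (\<Sum>x\<in>A. pm_lin f (g x))"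
  by (induction A rule: infinite_finite_induct) (auto simp: pm_lin_add)

lemma pm_induct [case_names zero add single]:
  fixes p :: "'k \<Rightarrow>\<^sub>0 complex"
  assumes "P 0" "\<And>p q. P p \<Longrightarrow> P q \<Longrightarrow> P (p + q)" "\<And>k c. P (Poly_Mapping.single k c)"
  shows "P p"
proof -
  have "P (\<Sum>k\<in>A. Poly_Mapping.single k (Poly_Mapping.lookup p k))" if "finite A" for A
    using that by induction (auto intro: assms)
  then show ?thesis
    using pm_decomp[of p] by (metis finite_keys)
qed

lemma pm_lin_fun_add: "pm_lin (\<lambda>k. f k + g k) p = pm_lin f p + pm_lin g p"
  by (simp add: pm_lin_def pm.scale_right_distrib sum.distrib)

lemma pm_lin_fun_scale: "pm_lin (\<lambda>k. pm_scale c (f k)) p = pm_scale c (pm_lin f p)"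
  by (simp add: pm_lin_def pm.scale_sum_right mult.commute)

lemma pm_lin_comp: "pm_lin f (pm_lin g p) = pm_lin (\<lambda>k. pm_lin f (g k)) p"
  by (induction p rule: pm_induct) (auto simp: pm_lin_add pm_lin_scale)

lemma lookup_pm_lin:
  "Poly_Mapping.lookup (pm_lin f p) m =
     (\<Sum>k\<in>Poly_Mapping.keys p. Poly_Mapping.lookup p k * Poly_Mapping.lookup (f k) m)"
  by (simp add: pm_lin_def lookup_sum)

subsection \<open>The free associative algebra\<close>

lemma word_mult: "Poly_Mapping.single (Word u) c * Poly_Mapping.single (Word v) d = Poly_Mapping.single (Word (u @ v)) (c * d :: complex)"
  by (simp add: mult_single plus_word_def)

lemma one_word: "(1 :: 'a free) = Poly_Mapping.single (Word []) 1"
  by (metis single_one zero_word_def)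

lemma pm_scale_conv_single: "pm_scale c p = Poly_Mapping.single 0 c * (p :: 'a::monoid_add \<Rightarrow>\<^sub>0 complex)"
  by (simp add: pm_scale_def mult_map_scale_conv_mult)

lemma mult_scale_left [simp]: "pm_scale c p * q = pm_scale c (p * q :: 'a::monoid_add \<Rightarrow>\<^sub>0 complex)"
proof -
  have "pm_scale c p = Poly_Mapping.single 0 c * p" for p :: "'a \<Rightarrow>\<^sub>0 complex"
    by (rule pm_scale_conv_single)
  then show ?thesis by (simp add: mult.assoc)
qed

text \<open>Scalars are the elements \<open>Poly_Mapping.single 0 c\<close>. On the left the rule is
  associativity alone; on the right it says that they are central, which is checked on
  monomials.\<close>

lemma mult_scale_right [simp]: "p * pm_scale c q = pm_scale c (p * q :: 'a::monoid_add \<Rightarrow>\<^sub>0 complex)"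
proof (induction q rule: pm_induct)
  case (single k d)
  show ?case
    by (induction p rule: pm_induct)
       (auto simp: distrib_right pm.scale_right_distrib mult_single mult.left_commute)
qed (auto simp: distrib_left pm.scale_right_distrib)

lemma word_Cons: "Poly_Mapping.single (Word (l # w)) (1::complex) = letter l * Poly_Mapping.single (Word w) 1"
  by (simp add: letter_def word_mult)

text \<open>Linear identities need to be tested only at \<open>1\<close> and under left
  multiplication by one letter, which matches the recursion defining superderivations.\<close>

lemma word_induct [case_names zero add scale one letter]:
  fixes p :: "'a free"
  assumes "P 0" "\<And>p q. P p \<Longrightarrow> P q \<Longrightarrow> P (p + q)" "\<And>c p. P p \<Longrightarrow> P (pm_scale c p)"
    and "P 1" "\<And>l p. P p \<Longrightarrow> P (letter l * p)"
  shows "P p"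
proof (induction p rule: pm_induct)
  case (single k c)
  have "P (Poly_Mapping.single (Word w) 1)" for w
  proof (induction w)
    case Nil
    show ?case using assms(4) by (simp only: one_word)
  next
    case (Cons l w)
    show ?case by (simp only: word_Cons assms(5)[OF Cons.IH])
  qed
  from assms(3)[OF this[of "letters k"], of c] show ?case by simp
next
  case zero show ?case by (rule assms(1))
next
  case (add p q) then show ?case by (rule assms(2))
qed

section \<open>Presentations of vector spaces and algebras\<close>

lemma cring_complex_ring: "cring complex_ring"
proof (rule cringI)
  show "abelian_group complex_ring"
    by (rule abelian_groupI) (auto simp: complex_ring_def intro: exI[of _ "- x" for x])
  show "comm_monoid complex_ring"
    by (rule comm_monoidI) (auto simp: complex_ring_def)
qed (auto simp: complex_ring_def distrib_right)

lemma carrier_complex_ring [simp]: "carrier complex_ring = UNIV"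
  by (simp add: complex_ring_def)

definition subsp :: "('k \<Rightarrow>\<^sub>0 complex) set \<Rightarrow> bool" where
  "subsp P \<longleftrightarrow> 0 \<in> P \<and> (\<forall>x\<in>P. \<forall>y\<in>P. x + y \<in> P) \<and> (\<forall>c. \<forall>x\<in>P. pm_scale c x \<in> P)"

lemma subspD: "subsp P \<Longrightarrow> 0 \<in> P" "subsp P \<Longrightarrow> x \<in> P \<Longrightarrow> y \<in> P \<Longrightarrow> x + y \<in> P"
  "subsp P \<Longrightarrow> x \<in> P \<Longrightarrow> pm_scale c x \<in> P"
  by (auto simp: subsp_def)

lemma subsp_minus: "subsp P \<Longrightarrow> x \<in> P \<Longrightarrow> - x \<in> P"
  using subspD(3)[of P x "-1"] by simp

lemma subsp_diff: "subsp P \<Longrightarrow> x \<in> P \<Longrightarrow> y \<in> P \<Longrightarrow> x - y \<in> P"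
  using subspD(2)[of P x "- y"] subsp_minus[of P y] by simp

lemma subsp_sum: "subsp P \<Longrightarrow> (\<And>i. i \<in> I \<Longrightarrow> f i \<in> P) \<Longrightarrow> sum f I \<in> P"
  by (induction I rule: infinite_finite_induct) (auto simp: subspD)

text \<open>Scalars occur only on generators, so inductions have three cases; closure under all
  scalars is recovered in \<open>subsp_lhull\<close>.\<close>

inductive_set lhull :: "('k \<Rightarrow>\<^sub>0 complex) set \<Rightarrow> ('k \<Rightarrow>\<^sub>0 complex) set" for R where
  zero: "0 \<in> lhull R"
| add: "x \<in> lhull R \<Longrightarrow> y \<in> lhull R \<Longrightarrow> x + y \<in> lhull R"
| gen: "r \<in> R \<Longrightarrow> pm_scale c r \<in> lhull R"

lemma subsp_lhull: "subsp (lhull R)"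
proof -
  have "pm_scale c x \<in> lhull R" if "x \<in> lhull R" for c x
    using that
  proof induction
    case (gen r d)
    then show ?case using lhull.gen[of r R "c * d"] by simp
  qed (auto simp: pm.scale_right_distrib intro: lhull.intros)
  then show ?thesis by (auto simp: subsp_def intro: lhull.intros)
qed

lemma lhull_base: "r \<in> R \<Longrightarrow> r \<in> lhull R"
  using lhull.gen[of r R 1] by simp

lemma lhull_minimal: "subsp P \<Longrightarrow> R \<subseteq> P \<Longrightarrow> lhull R \<subseteq> P"
proof
  fix x assume "x \<in> lhull R" and P: "subsp P" "R \<subseteq> P"
  then show "x \<in> P" by induction (auto simp: subspD)
qed

text \<open>Scalars are absorbed into \<open>a\<close>. Multipliers are restricted to
  \<open>P\<close> because the free algebra on a set of generators is only a subalgebra of the whole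
  type.\<close>

inductive_set ihull :: "('k::monoid_add \<Rightarrow>\<^sub>0 complex) set \<Rightarrow> ('k \<Rightarrow>\<^sub>0 complex) set \<Rightarrow> ('k \<Rightarrow>\<^sub>0 complex) set" for P R where
  zero: "0 \<in> ihull P R"
| add: "x \<in> ihull P R \<Longrightarrow> y \<in> ihull P R \<Longrightarrow> x + y \<in> ihull P R"
| gen: "r \<in> R \<Longrightarrow> a \<in> P \<Longrightarrow> b \<in> P \<Longrightarrow> a * r * b \<in> ihull P R"

text \<open>
  \<open>M\<close> is the quotient of the subspace \<open>P\<close> of a space of finitely supported functions by the
  subspace \<open>N\<close>, with quotient map \<open>q\<close>.
\<close>

locale presented =
  fixes M :: "(complex, 'a, 'm) module_scheme" (structure)
    and q :: "('k \<Rightarrow>\<^sub>0 complex) \<Rightarrow> 'a" and P N :: "('k \<Rightarrow>\<^sub>0 complex) set"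
  assumes P: "subsp P" and N: "subsp N" "N \<subseteq> P"
    and carrier: "carrier M = q ` P"
    and q_add: "\<And>x y. x \<in> P \<Longrightarrow> y \<in> P \<Longrightarrow> q (x + y) = q x \<oplus> q y"
    and q_scale: "\<And>c x. x \<in> P \<Longrightarrow> q (pm_scale c x) = c \<odot>\<^bsub>M\<^esub> q x"
    and q_zero: "\<zero> = q 0"
    and q_eq: "\<And>x y. x \<in> P \<Longrightarrow> y \<in> P \<Longrightarrow> q x = q y \<longleftrightarrow> x - y \<in> N"
begin

lemma abelian_group: "abelian_group M"
proof (rule abelian_groupI)
  fix x y z assume x: "x \<in> carrier M" and y: "y \<in> carrier M"
  then obtain x' y' where e: "x = q x'" "x' \<in> P" "y = q y'" "y' \<in> P" by (auto simp: carrier)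
  show "x \<oplus> y \<in> carrier M" using e P by (auto simp: carrier subspD simp flip: q_add)
  show "x \<oplus> y = y \<oplus> x" using e by (simp add: add.commute flip: q_add)
  assume "z \<in> carrier M"
  then obtain z' where "z = q z'" "z' \<in> P" by (auto simp: carrier)
  then show "x \<oplus> y \<oplus> z = x \<oplus> (y \<oplus> z)" using e P by (simp add: add.assoc subspD flip: q_add)
next
  show "\<zero> \<in> carrier M" using P by (auto simp: carrier q_zero subspD)
  fix x assume "x \<in> carrier M"
  then obtain x' where e: "x = q x'" "x' \<in> P" by (auto simp: carrier)
  then show "\<zero> \<oplus> x = x" using P by (simp add: q_zero subspD flip: q_add)
  have "q (- x') \<oplus> x = \<zero>" using e P by (simp add: q_zero subsp_minus flip: q_add)
  then show "\<exists>y\<in>carrier M. y \<oplus> x = \<zero>" using e P by (auto simp: carrier subsp_minus)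
qed

lemma q_minus: "x \<in> P \<Longrightarrow> \<ominus> q x = q (- x)"
proof -
  interpret abelian_group M by (rule abelian_group)
  assume x: "x \<in> P"
  then have "q (- x) \<oplus> q x = \<zero>" using P by (simp add: q_zero subsp_minus flip: q_add)
  then show ?thesis using x P by (intro minus_equality) (auto simp: carrier subsp_minus)
qed

lemma q_diff: "x \<in> P \<Longrightarrow> y \<in> P \<Longrightarrow> q x \<ominus> q y = q (x - y)"
  using P by (simp add: a_minus_def q_minus subsp_minus flip: q_add)

lemma module: "module complex_ring M"
proof (rule moduleI[OF cring_complex_ring abelian_group])
  fix a b x y assume x: "x \<in> carrier M"
  then obtain x' where e: "x = q x'" "x' \<in> P" by (auto simp: carrier)
  show "a \<odot>\<^bsub>M\<^esub> x \<in> carrier M" using e P by (auto simp: carrier subspD simp flip: q_scale)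
  show "(a \<oplus>\<^bsub>complex_ring\<^esub> b) \<odot>\<^bsub>M\<^esub> x = a \<odot>\<^bsub>M\<^esub> x \<oplus> b \<odot>\<^bsub>M\<^esub> x"
    using e P by (simp add: complex_ring_def pm.scale_left_distrib subspD flip: q_add q_scale)
  show "(a \<otimes>\<^bsub>complex_ring\<^esub> b) \<odot>\<^bsub>M\<^esub> x = a \<odot>\<^bsub>M\<^esub> (b \<odot>\<^bsub>M\<^esub> x)"
    using e P by (simp add: complex_ring_def subspD flip: q_scale)
  show "\<one>\<^bsub>complex_ring\<^esub> \<odot>\<^bsub>M\<^esub> x = x"
    using e by (simp add: complex_ring_def flip: q_scale)
  assume "y \<in> carrier M"
  then obtain y' where e': "y = q y'" "y' \<in> P" by (auto simp: carrier)
  show "a \<odot>\<^bsub>M\<^esub> (x \<oplus> y) = a \<odot>\<^bsub>M\<^esub> x \<oplus> a \<odot>\<^bsub>M\<^esub> y"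
    using e e' P by (simp add: pm.scale_right_distrib subspD flip: q_add q_scale)
qed

lemma submodule_image:
  assumes "subsp K" "K \<subseteq> P"
  shows "submodule (q ` K) complex_ring M"
proof (rule module.submoduleI[OF module])
  show "q ` K \<subseteq> carrier M" using assms by (auto simp: carrier)
  show "\<zero> \<in> q ` K" using assms by (auto simp: q_zero subspD)
  show "\<ominus> a \<in> q ` K" if "a \<in> q ` K" for a using that assms by (auto simp: q_minus subset_iff subsp_minus)
  show "a \<oplus> b \<in> q ` K" if "a \<in> q ` K" "b \<in> q ` K" for a b
    using that assms by (auto simp: subset_iff subspD simp flip: q_add)
  show "a \<odot>\<^bsub>M\<^esub> b \<in> q ` K" if "b \<in> q ` K" for a b
    using that assms by (auto simp: subset_iff subspD simp flip: q_scale)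
qed

text \<open>The preimage under \<open>q\<close> of a subspace of \<open>M\<close> is a subspace
  containing \<open>N\<close>. Putting \<open>N\<close> among the generators does not change the
  image, and makes the hull the full kernel of the quotient map that follows.\<close>

lemma lin_span_image:
  assumes "R \<subseteq> P"
  shows "lin_span M (q ` R) = q ` lhull (N \<union> R)"
proof
  have sub: "lhull (N \<union> R) \<subseteq> P" by (rule lhull_minimal) (use P N assms in auto)
  show "lin_span M (q ` R) \<subseteq> q ` lhull (N \<union> R)"
    unfolding lin_span_def
    by (rule Inter_lower) (use submodule_image[OF subsp_lhull sub] lhull_base in blast)
  show "q ` lhull (N \<union> R) \<subseteq> lin_span M (q ` R)"
    unfolding lin_span_def
  proof (rule Inter_greatest)
    fix K assume "K \<in> {K. submodule K complex_ring M \<and> q ` R \<subseteq> K}"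
    then have K: "submodule K complex_ring M" "q ` R \<subseteq> K" by auto
    note E = module.submoduleE[OF module K(1)]
    have zero: "\<zero> \<in> K"
      using submodule.axioms(1)[OF K(1)] subgroup.one_closed by fastforce
    have "subsp {x \<in> P. q x \<in> K}"
      using P E(4,5) zero by (auto simp: subsp_def q_add q_scale q_zero)
    moreover have "N \<union> R \<subseteq> {x \<in> P. q x \<in> K}"
    proof -
      have "q x = \<zero>" if "x \<in> N" for x
        using that N P q_eq[of x 0] by (auto simp: q_zero subspD)
      then show ?thesis using zero K(2) N assms by auto
    qed
    ultimately have "lhull (N \<union> R) \<subseteq> {x \<in> P. q x \<in> K}" by (rule lhull_minimal)
    then show "q ` lhull (N \<union> R) \<subseteq> K" by auto
  qed
qed

lemma coset_image:
  assumes "x \<in> P" "K \<subseteq> P"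
  shows "q ` K +>\<^bsub>M\<^esub> q x = {q (k + x) | k. k \<in> K}"
proof -
  have "q ` K +>\<^bsub>M\<^esub> q x = {q k \<oplus> q x | k. k \<in> K}" by (auto simp: a_r_coset_def')
  also have "\<dots> = {q (k + x) | k. k \<in> K}"
    using assms by (intro Collect_cong) (metis q_add subsetD)
  finally show ?thesis .
qed

text \<open>A quotient of a quotient of \<open>P\<close> is again a quotient of \<open>P\<close>,
  with a larger kernel. This collapses the tower of cosets (tensor algebra, Weyl or Clifford
  algebra, induced module) to one space of words and one subspace of it.\<close>

lemma presented_quotient:
  assumes K: "subsp K" "N \<subseteq> K" "K \<subseteq> P"
  shows "presented (quotient M (q ` K)) (\<lambda>x. q ` K +>\<^bsub>M\<^esub> q x) P K"
proof
  let ?c = "\<lambda>x. {q (k + x) | k. k \<in> K}"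
  have kP: "k \<in> P" if "k \<in> K" for k using that K by auto
  note co = coset_image[OF _ K(3)]
  show "subsp P" "subsp K" "K \<subseteq> P" by (fact P K)+
  show "carrier (quotient M (q ` K)) = (\<lambda>x. q ` K +>\<^bsub>M\<^esub> q x) ` P"
    by (auto simp: quotient_def A_RCOSETS_def' carrier)
  show "\<zero>\<^bsub>quotient M (q ` K)\<^esub> = q ` K +>\<^bsub>M\<^esub> q 0"
    using P co[of 0] by (auto simp: quotient_def subspD)
  fix x y assume x: "x \<in> P"
  show "q ` K +>\<^bsub>M\<^esub> q (pm_scale c x) = c \<odot>\<^bsub>quotient M (q ` K)\<^esub> (q ` K +>\<^bsub>M\<^esub> q x)" for c
  proof -
    have "q ` K <+>\<^bsub>M\<^esub> (\<lambda>x. c \<odot>\<^bsub>M\<^esub> x) ` ?c x = ?c (pm_scale c x)"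
    proof (intro equalityI subsetI)
      fix z assume "z \<in> q ` K <+>\<^bsub>M\<^esub> (\<lambda>x. c \<odot>\<^bsub>M\<^esub> x) ` ?c x"
      then obtain k k' where k: "k \<in> K" "k' \<in> K" "z = q k \<oplus> c \<odot>\<^bsub>M\<^esub> q (k' + x)"
        by (auto simp: set_add_def')
      have "z = q ((k + pm_scale c k') + pm_scale c x)"
        using k x kP P by (simp add: subspD pm.scale_right_distrib add.assoc flip: q_scale q_add)
      moreover have "k + pm_scale c k' \<in> K" using k K by (simp add: subspD)
      ultimately show "z \<in> ?c (pm_scale c x)" by blast
    next
      fix z assume "z \<in> ?c (pm_scale c x)"
      then obtain k where k: "k \<in> K" "z = q (k + pm_scale c x)" by blast
      have "z = q k \<oplus> c \<odot>\<^bsub>M\<^esub> q (0 + x)"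
        using k x kP P by (simp add: subspD flip: q_scale q_add)
      then show "z \<in> q ` K <+>\<^bsub>M\<^esub> (\<lambda>x. c \<odot>\<^bsub>M\<^esub> x) ` ?c x"
        using k subspD(1)[OF K(1)] unfolding set_add_def' by blast
    qed
    then show ?thesis using x P by (simp add: quotient_def co subspD)
  qed
  assume y: "y \<in> P"
  show "q ` K +>\<^bsub>M\<^esub> q (x + y) = (q ` K +>\<^bsub>M\<^esub> q x) \<oplus>\<^bsub>quotient M (q ` K)\<^esub> (q ` K +>\<^bsub>M\<^esub> q y)"
  proof -
    have "?c x <+>\<^bsub>M\<^esub> ?c y = ?c (x + y)"
    proof (intro equalityI subsetI)
      fix z assume "z \<in> ?c x <+>\<^bsub>M\<^esub> ?c y"
      then obtain k k' where k: "k \<in> K" "k' \<in> K" "z = q (k + x) \<oplus> q (k' + y)"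
        by (auto simp: set_add_def')
      have "z = q ((k + k') + (x + y))"
        using k x y kP P by (simp add: subspD algebra_simps flip: q_add)
      moreover have "k + k' \<in> K" using k K by (simp add: subspD)
      ultimately show "z \<in> ?c (x + y)" by blast
    next
      fix z assume "z \<in> ?c (x + y)"
      then obtain k where k: "k \<in> K" "z = q (k + (x + y))" by blast
      have "z = q (k + x) \<oplus> q (0 + y)"
        using k x y kP P by (simp add: subspD add.assoc flip: q_add)
      then show "z \<in> ?c x <+>\<^bsub>M\<^esub> ?c y"
        using k subspD(1)[OF K(1)] unfolding set_add_def' by blast
    qed
    then show ?thesis using x y P by (simp add: quotient_def co subspD)
  qed
  show "(q ` K +>\<^bsub>M\<^esub> q x = q ` K +>\<^bsub>M\<^esub> q y) \<longleftrightarrow> x - y \<in> K"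
  proof
    assume "q ` K +>\<^bsub>M\<^esub> q x = q ` K +>\<^bsub>M\<^esub> q y"
    then have e: "?c x = ?c y" using x y by (simp add: co)
    have "q (0 + x) \<in> ?c x" using subspD(1)[OF K(1)] by blast
    then obtain k where k: "k \<in> K" "q x = q (k + y)" unfolding e by auto
    then have "x - (k + y) \<in> K" using q_eq[of x "k + y"] x y kP P K by (auto simp: subspD)
    from subspD(2)[OF K(1) this k(1)] show "x - y \<in> K" by (simp add: algebra_simps)
  next
    assume d: "x - y \<in> K"
    have "?c x = ?c y"
    proof (intro equalityI subsetI)
      fix z assume "z \<in> ?c x"
      then obtain k where "k \<in> K" "z = q (k + x)" by blast
      then have "z = q ((k + (x - y)) + y)" "k + (x - y) \<in> K" using d K by (simp_all add: subspD)
      then show "z \<in> ?c y" by blast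
    next
      fix z assume "z \<in> ?c y"
      then obtain k where "k \<in> K" "z = q (k + y)" by blast
      then have "z = q ((k - (x - y)) + x)" "k - (x - y) \<in> K" using d K by (simp_all add: subsp_diff)
      then show "z \<in> ?c x" by blast
    qed
    then show "q ` K +>\<^bsub>M\<^esub> q x = q ` K +>\<^bsub>M\<^esub> q y" using x y by (simp add: co)
  qed
qed

end

locale presented_algebra = presented M q P N
  for M :: "(complex, 'a, 'm) module_scheme" (structure)
    and q :: "('k::monoid_add \<Rightarrow>\<^sub>0 complex) \<Rightarrow> 'a" and P N :: "('k \<Rightarrow>\<^sub>0 complex) set" +
  assumes P_one: "1 \<in> P" and P_mult: "\<And>x y. x \<in> P \<Longrightarrow> y \<in> P \<Longrightarrow> x * y \<in> P"
    and N_ideal: "\<And>x y. x \<in> P \<Longrightarrow> y \<in> N \<Longrightarrow> x * y \<in> N" "\<And>x y. x \<in> P \<Longrightarrow> y \<in> N \<Longrightarrow> y * x \<in> N"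
    and q_one: "\<one> = q 1" and q_mult: "\<And>x y. x \<in> P \<Longrightarrow> y \<in> P \<Longrightarrow> q (x * y) = q x \<otimes> q y"
begin

lemma ring: "ring M"
proof (rule ringI[OF abelian_group])
  show "monoid M"
  proof (rule monoidI)
    fix x y z assume x: "x \<in> carrier M" and y: "y \<in> carrier M"
    then obtain x' y' where e: "x = q x'" "x' \<in> P" "y = q y'" "y' \<in> P" by (auto simp: carrier)
    show "x \<otimes> y \<in> carrier M" using e by (auto simp: carrier P_mult simp flip: q_mult)
    assume "z \<in> carrier M"
    then obtain z' where "z = q z'" "z' \<in> P" by (auto simp: carrier)
    then show "x \<otimes> y \<otimes> z = x \<otimes> (y \<otimes> z)" using e by (simp add: mult.assoc P_mult flip: q_mult)
  next
    show "\<one> \<in> carrier M" using P_one by (auto simp: carrier q_one)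
    fix x assume "x \<in> carrier M"
    then obtain x' where e: "x = q x'" "x' \<in> P" by (auto simp: carrier)
    show "\<one> \<otimes> x = x" "x \<otimes> \<one> = x" using e P_one by (simp_all add: q_one flip: q_mult)
  qed
  fix x y z assume "x \<in> carrier M" "y \<in> carrier M" "z \<in> carrier M"
  then obtain x' y' z' where e: "x = q x'" "x' \<in> P" "y = q y'" "y' \<in> P" "z = q z'" "z' \<in> P"
    by (auto simp: carrier)
  then show "(x \<oplus> y) \<otimes> z = x \<otimes> z \<oplus> y \<otimes> z" "z \<otimes> (x \<oplus> y) = z \<otimes> x \<oplus> z \<otimes> y"
    using P by (simp_all add: P_mult subspD algebra_simps flip: q_add q_mult)
qed

lemma subsp_ihull: "subsp (ihull P R)"
proof -
  have "pm_scale c x \<in> ihull P R" if "x \<in> ihull P R" for c x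
    using that
  proof induction
    case (gen r a b)
    then show ?case using ihull.gen[of r R "pm_scale c a" P b] P by (simp add: subspD)
  qed (auto simp: pm.scale_right_distrib intro: ihull.intros)
  then show ?thesis by (auto simp: subsp_def intro: ihull.intros)
qed

lemma ihull_base: "r \<in> R \<Longrightarrow> r \<in> ihull P R"
  using ihull.gen[of r R 1 P 1] P_one by simp

lemma ihull_mult:
  assumes "x \<in> ihull P R" "a \<in> P"
  shows "a * x \<in> ihull P R" "x * a \<in> ihull P R"
  using assms(1)
proof induction
  case (gen r c d)
  { case 1 show ?case using ihull.gen[of r R "a * c" P d] gen assms(2) by (simp add: P_mult mult.assoc) }
  { case 2 show ?case using ihull.gen[of r R c P "d * a"] gen assms(2) by (simp add: P_mult mult.assoc) }
qed (auto simp: distrib_left distrib_right intro: ihull.intros)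

lemma ihull_sub: "R \<subseteq> P \<Longrightarrow> ihull P R \<subseteq> P"
proof
  fix x assume "x \<in> ihull P R" and R: "R \<subseteq> P"
  then show "x \<in> P"
  proof induction
    case (gen r a b)
    then have "r \<in> P" using R by auto
    then show ?case using gen by (intro P_mult)
  qed (use P in \<open>auto simp: subspD\<close>)
qed

text \<open>The same pullback argument as for spans: the elements of \<open>P\<close> that
  \<open>q\<close> maps into an ideal absorb multiplication and contain \<open>N\<close>.\<close>

lemma Idl_image:
  assumes "R \<subseteq> P"
  shows "Idl (q ` R) = q ` ihull P (N \<union> R)"
proof
  have sub: "ihull P (N \<union> R) \<subseteq> P" by (rule ihull_sub) (use N assms in auto)
  have inP: "x \<in> P" if "x \<in> ihull P (N \<union> R)" for x using that sub by auto
  have "ideal (q ` ihull P (N \<union> R)) M"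
  proof (rule idealI[OF ring])
    show "subgroup (q ` ihull P (N \<union> R)) (add_monoid M)"
      using submodule.axioms(1)[OF submodule_image[OF subsp_ihull sub]] .
    fix a x assume "a \<in> q ` ihull P (N \<union> R)" "x \<in> carrier M"
    then obtain a' x' where e: "a = q a'" "a' \<in> ihull P (N \<union> R)" "x = q x'" "x' \<in> P" by (auto simp: carrier)
    then show "x \<otimes> a \<in> q ` ihull P (N \<union> R)" "a \<otimes> x \<in> q ` ihull P (N \<union> R)"
      using ihull_mult[OF e(2,4)] inP[OF e(2)] by (auto simp flip: q_mult)
  qed
  then show "Idl (q ` R) \<subseteq> q ` ihull P (N \<union> R)"
    unfolding genideal_def by (intro Inter_lower) (use ihull_base in blast)
  show "q ` ihull P (N \<union> R) \<subseteq> Idl (q ` R)"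
    unfolding genideal_def
  proof (rule Inter_greatest)
    fix K assume "K \<in> {I. ideal I M \<and> q ` R \<subseteq> I}"
    then have K: "ideal K M" "q ` R \<subseteq> K" by auto
    interpret ideal K M by (rule K(1))
    have "q x \<in> K" if "x \<in> ihull P (N \<union> R)" for x
      using that
    proof induction
      case zero
      show ?case by (simp flip: q_zero)
    next
      case (add x y)
      then show ?case by (simp add: inP q_add)
    next
      case (gen r a b)
      have "q r \<in> K"
      proof (cases "r \<in> R")
        case True
        then show ?thesis using K by auto
      next
        case False
        then have "q r = \<zero>" using gen N P q_eq[of r 0] by (auto simp: q_zero subspD)
        then show ?thesis by simp
      qed
      moreover have "r \<in> P" using gen N assms by auto
      moreover have "q a \<in> carrier M" "q b \<in> carrier M" using gen by (auto simp: carrier)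
      ultimately have "q a \<otimes> q r \<otimes> q b \<in> K" by (intro I_l_closed I_r_closed)
      then show ?case using gen \<open>r \<in> P\<close> by (simp add: q_mult P_mult)
    qed
    then show "q ` ihull P (N \<union> R) \<subseteq> K" by auto
  qed
qed

lemma presented_algebra_quotient:
  assumes R: "R \<subseteq> P"
  shows "presented_algebra (quotient M (Idl (q ` R))) (\<lambda>x. Idl (q ` R) +>\<^bsub>M\<^esub> q x) P (ihull P (N \<union> R))"
  unfolding Idl_image[OF R]
proof -
  let ?K = "ihull P (N \<union> R)"
  have sub: "?K \<subseteq> P" by (rule ihull_sub) (use N assms in auto)
  have NK: "N \<subseteq> ?K" using ihull_base by blast
  interpret Q: presented "quotient M (q ` ?K)" "\<lambda>x. q ` ?K +>\<^bsub>M\<^esub> q x" P ?K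
    by (rule presented_quotient[OF subsp_ihull NK sub])
  have inP: "x \<in> P" if "x \<in> ?K" for x using that sub by auto
  let ?c = "\<lambda>x. {q (k + x) | k. k \<in> ?K}"
  note co = coset_image[OF _ sub]
  show "presented_algebra (quotient M (q ` ?K)) (\<lambda>x. q ` ?K +>\<^bsub>M\<^esub> q x) P ?K"
  proof
    show "1 \<in> P" by (rule P_one)
    show "x * y \<in> P" if "x \<in> P" "y \<in> P" for x y using that by (rule P_mult)
    show "x * y \<in> ?K" "y * x \<in> ?K" if "x \<in> P" "y \<in> ?K" for x y using that ihull_mult by auto
    show "\<one>\<^bsub>quotient M (q ` ?K)\<^esub> = q ` ?K +>\<^bsub>M\<^esub> q 1" by (simp add: quotient_def q_one)
    fix x y assume x: "x \<in> P" and y: "y \<in> P"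
    \<comment> \<open>The product of two cosets is a union over all pairs of representatives; each
      pair gives the same coset, so the union collapses.\<close>
    have c: "q ` ?K +>\<^bsub>M\<^esub> (q (k + x) \<otimes> q (k' + y)) = q ` ?K +>\<^bsub>M\<^esub> q (x * y)" if "k \<in> ?K" "k' \<in> ?K" for k k'
    proof -
      have "q (k + x) \<otimes> q (k' + y) = q ((k + x) * (k' + y))"
        using that inP x y P by (simp add: q_mult subspD)
      moreover have "(k + x) * (k' + y) - x * y \<in> ?K"
      proof -
        have "(k + x) * (k' + y) - x * y = k * (k' + y) + x * k'" by (simp add: algebra_simps)
        moreover have "k * (k' + y) \<in> ?K" "x * k' \<in> ?K"
          using ihull_mult(2)[OF that(1), of "k' + y"] ihull_mult(1)[OF that(2) x] that inP y P
          by (simp_all add: subspD)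
        ultimately show ?thesis by (simp add: ihull.add)
      qed
      ultimately show ?thesis
        using Q.q_eq[of "(k + x) * (k' + y)" "x * y"] that inP x y P by (simp add: P_mult subspD)
    qed
    have ne: "q (0 + x) \<in> ?c x" "q (0 + y) \<in> ?c y" using ihull.zero by blast+
    have "(\<Union>a\<in>?c x. \<Union>b\<in>?c y. q ` ?K +>\<^bsub>M\<^esub> (a \<otimes> b)) = q ` ?K +>\<^bsub>M\<^esub> q (x * y)" (is "?U = ?V")
    proof
      show "?U \<subseteq> ?V" by (intro UN_least) (use c in blast)
      have "?V = q ` ?K +>\<^bsub>M\<^esub> (q (0 + x) \<otimes> q (0 + y))" by (rule c[symmetric]) (rule ihull.zero)+
      then show "?V \<subseteq> ?U" using ne by blast
    qed
    then show "q ` ?K +>\<^bsub>M\<^esub> q (x * y) = (q ` ?K +>\<^bsub>M\<^esub> q x) \<otimes>\<^bsub>quotient M (q ` ?K)\<^esub> (q ` ?K +>\<^bsub>M\<^esub> q y)"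
      by (simp only: co[OF x] co[OF y] co[OF P_mult[OF x y]] quotient_def rcoset_mult_def monoid.simps)
  qed
qed

end

section \<open>Presentation of the semi-infinite spaces\<close>

definition words_in :: "'u set \<Rightarrow> 'u free set" where
  "words_in U = {p. \<forall>w\<in>Poly_Mapping.keys p. set (letters w) \<subseteq> U}"

lemma subsp_words_in: "subsp (words_in U)"
  unfolding subsp_def words_in_def
proof (intro conjI ballI allI; clarsimp)
  fix x y w z
  assume "\<forall>w\<in>Poly_Mapping.keys x. set (letters w) \<subseteq> U" "\<forall>w\<in>Poly_Mapping.keys y. set (letters w) \<subseteq> U"
    "w \<in> Poly_Mapping.keys (x + y :: 'a free)" "z \<in> set (letters w)"
  then show "z \<in> U" using keys_add[of x y] by blast
next
  fix c x w z
  assume "\<forall>w\<in>Poly_Mapping.keys x. set (letters w) \<subseteq> U"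
    "w \<in> Poly_Mapping.keys (pm_scale c x :: 'a free)" "z \<in> set (letters w)"
  then show "z \<in> U" using keys_pm_scale[of c x] by blast
qed

lemma words_in_mult: "x \<in> words_in U \<Longrightarrow> y \<in> words_in U \<Longrightarrow> x * y \<in> words_in U"
  unfolding words_in_def
proof clarsimp
  fix w z
  assume x: "\<forall>w\<in>Poly_Mapping.keys x. set (letters w) \<subseteq> U" and y: "\<forall>w\<in>Poly_Mapping.keys y. set (letters w) \<subseteq> U"
    and w: "w \<in> Poly_Mapping.keys (x * y)" "z \<in> set (letters w)"
  then obtain a b where "w = a + b" "a \<in> Poly_Mapping.keys x" "b \<in> Poly_Mapping.keys y"
    using keys_mult[of x y] by blast
  then show "z \<in> U" using x y w(2) by (auto simp: plus_word_def)
qed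

lemma words_in_word: "set w \<subseteq> U \<Longrightarrow> Poly_Mapping.single (Word w) c \<in> words_in U"
  by (auto simp: words_in_def)

lemma words_in_letter: "u \<in> U \<Longrightarrow> letter u \<in> words_in U"
  by (auto simp: letter_def intro: words_in_word)

lemma words_in_one: "1 \<in> words_in U"
  unfolding one_word by (rule words_in_word) simp

lemma words_in_induct [consumes 1, case_names zero add scale word]:
  assumes "p \<in> words_in U" "P 0" "\<And>p q. P p \<Longrightarrow> P q \<Longrightarrow> P (p + q)" "\<And>c p. P p \<Longrightarrow> P (pm_scale c p)"
    "\<And>w. set w \<subseteq> U \<Longrightarrow> P (Poly_Mapping.single (Word w) 1)"
  shows "P p"
proof -
  have "P (\<Sum>k\<in>A. Poly_Mapping.single k (Poly_Mapping.lookup p k))" if "finite A" "A \<subseteq> Poly_Mapping.keys p" for A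
    using that
  proof induction
    case (insert k A)
    have "set (letters k) \<subseteq> U" using assms(1) insert by (auto simp: words_in_def)
    then have "P (pm_scale (Poly_Mapping.lookup p k) (Poly_Mapping.single (Word (letters k)) 1))"
      by (intro assms(4,5))
    then have "P (Poly_Mapping.single k (Poly_Mapping.lookup p k))" by simp
    then show ?case using insert by (simp add: assms(3))
  qed (simp add: assms(2))
  then show ?thesis using pm_decomp[of p] by (metis finite_keys order_refl)
qed

lemma presented_free_algebra: "presented_algebra (free_algebra U) (\<lambda>x. x) (words_in U) {0}"
  by unfold_locales
     (auto simp: free_algebra_def words_in_def[symmetric] subsp_words_in words_in_mult words_in_one subspD[OF subsp_words_in]
       subsp_def[of "{0}"])

text \<open>The ideals of the free algebra presenting the algebra with relations \<open>R\<close> and its induced module.\<close>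

definition ker_T :: "(complex \<Rightarrow> 'u::ab_group_add \<Rightarrow> 'u) \<Rightarrow> 'u set \<Rightarrow> 'u free set" where
  "ker_T s U = ihull (words_in U) ({0} \<union> linear_relations s U)"

definition ker_A :: "(complex \<Rightarrow> 'u::ab_group_add \<Rightarrow> 'u) \<Rightarrow> 'u set \<Rightarrow> 'u free set \<Rightarrow> 'u free set" where
  "ker_A s U R = ihull (words_in U) (ker_T s U \<union> R)"

definition ker_M :: "(complex \<Rightarrow> 'u::ab_group_add \<Rightarrow> 'u) \<Rightarrow> 'u set \<Rightarrow> 'u free set \<Rightarrow> 'u set \<Rightarrow> 'u free set" where
  "ker_M s U R X = lhull (ker_A s U R \<union> {p * letter u | p u. p \<in> words_in U \<and> u \<in> X})"

definition T_map :: "(complex \<Rightarrow> 'u::ab_group_add \<Rightarrow> 'u) \<Rightarrow> 'u set \<Rightarrow> 'u free \<Rightarrow> 'u free set" where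
  "T_map s U p = (Idl\<^bsub>free_algebra U\<^esub> (linear_relations s U)) +>\<^bsub>free_algebra U\<^esub> p"

lemma presented_T:
  assumes "linear_relations s U \<subseteq> words_in U"
  shows "presented_algebra (tensor_algebra s U) (T_map s U) (words_in U) (ker_T s U)"
  using presented_algebra.presented_algebra_quotient[OF presented_free_algebra[of U] assms]
  unfolding tensor_algebra_def T_map_def[abs_def] ker_T_def by simp

definition A_map :: "(complex \<Rightarrow> 'u::ab_group_add \<Rightarrow> 'u) \<Rightarrow> 'u set \<Rightarrow> 'u free set \<Rightarrow> 'u free \<Rightarrow> 'u free set set" where
  "A_map s U R p = (Idl\<^bsub>tensor_algebra s U\<^esub> (T_map s U ` R)) +>\<^bsub>tensor_algebra s U\<^esub> T_map s U p"

definition A_alg :: "(complex \<Rightarrow> 'u::ab_group_add \<Rightarrow> 'u) \<Rightarrow> 'u set \<Rightarrow> 'u free set \<Rightarrow> (complex, 'u free set set) module" where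
  "A_alg s U R = quotient (tensor_algebra s U) (Idl\<^bsub>tensor_algebra s U\<^esub> (T_map s U ` R))"

lemma presented_A:
  assumes "linear_relations s U \<subseteq> words_in U" "R \<subseteq> words_in U"
  shows "presented_algebra (A_alg s U R) (A_map s U R) (words_in U) (ker_A s U R)"
  using presented_algebra.presented_algebra_quotient[OF presented_T[OF assms(1)] assms(2)]
  unfolding A_alg_def A_map_def[abs_def] ker_A_def .

definition M_map :: "(complex \<Rightarrow> 'u::ab_group_add \<Rightarrow> 'u) \<Rightarrow> 'u set \<Rightarrow> 'u free set \<Rightarrow> 'u set \<Rightarrow> 'u free \<Rightarrow> 'u free set set set" where
  "M_map s U R X p = left_ideal_gen (A_alg s U R) ((\<lambda>u. A_map s U R (letter u)) ` X) +>\<^bsub>A_alg s U R\<^esub> A_map s U R p"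

text \<open>Linear relations, the form and the vacuum condition now sit in one kernel
  \<open>ker_M\<close>, and a vector of the induced module is handled through a combination of words
  representing it.\<close>

lemma presented_M:
  assumes "linear_relations s U \<subseteq> words_in U" "R \<subseteq> words_in U" "X \<subseteq> U"
  shows "presented (induced_trivial (A_alg s U R) ((\<lambda>u. A_map s U R (letter u)) ` X)) (M_map s U R X) (words_in U) (ker_M s U R X)"
proof -
  interpret A: presented_algebra "A_alg s U R" "A_map s U R" "words_in U" "ker_A s U R"
    by (rule presented_A[OF assms(1,2)])
  let ?R = "{p * letter u | p u. p \<in> words_in U \<and> u \<in> X}"
  have R: "?R \<subseteq> words_in U" using assms(3) by (auto intro!: words_in_mult words_in_letter)
  have gen: "left_ideal_gen (A_alg s U R) ((\<lambda>u. A_map s U R (letter u)) ` X) = A_map s U R ` ker_M s U R X"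
  proof -
    have "{a \<otimes>\<^bsub>A_alg s U R\<^esub> x | a x. a \<in> carrier (A_alg s U R) \<and> x \<in> (\<lambda>u. A_map s U R (letter u)) ` X} = A_map s U R ` ?R"
    proof (intro equalityI subsetI)
      fix z assume "z \<in> {a \<otimes>\<^bsub>A_alg s U R\<^esub> x | a x. a \<in> carrier (A_alg s U R) \<and> x \<in> (\<lambda>u. A_map s U R (letter u)) ` X}"
      then obtain p u where z: "p \<in> words_in U" "u \<in> X" "z = A_map s U R p \<otimes>\<^bsub>A_alg s U R\<^esub> A_map s U R (letter u)"
        by (auto simp: A.carrier)
      then have "z = A_map s U R (p * letter u)" using assms(3) by (auto simp: A.q_mult words_in_letter)
      then show "z \<in> A_map s U R ` ?R" using z by blast
    next
      fix z assume "z \<in> A_map s U R ` ?R"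
      then obtain p u where z: "p \<in> words_in U" "u \<in> X" "z = A_map s U R (p * letter u)" by blast
      then have "z = A_map s U R p \<otimes>\<^bsub>A_alg s U R\<^esub> A_map s U R (letter u)"
        using assms(3) by (auto simp: A.q_mult words_in_letter)
      then show "z \<in> {a \<otimes>\<^bsub>A_alg s U R\<^esub> x | a x. a \<in> carrier (A_alg s U R) \<and> x \<in> (\<lambda>u. A_map s U R (letter u)) ` X}"
        using z A.carrier by blast
    qed
    then show ?thesis
      unfolding left_ideal_gen_def ker_M_def by (simp add: A.lin_span_image[OF R])
  qed
  have "presented (quotient (A_alg s U R) (A_map s U R ` ker_M s U R X)) (\<lambda>x. A_map s U R ` ker_M s U R X +>\<^bsub>A_alg s U R\<^esub> A_map s U R x) (words_in U) (ker_M s U R X)"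
  proof (rule A.presented_quotient)
    show "subsp (ker_M s U R X)" unfolding ker_M_def by (rule subsp_lhull)
    show "ker_A s U R \<subseteq> ker_M s U R X" unfolding ker_M_def using lhull_base by blast
    show "ker_M s U R X \<subseteq> words_in U"
      unfolding ker_M_def by (rule lhull_minimal[OF A.P]) (use R A.N in auto)
  qed
  then show ?thesis
    unfolding induced_trivial_def gen M_map_def[abs_def] .
qed

lemma Collect_image2:
  assumes "\<And>x y. x \<in> U \<Longrightarrow> y \<in> U \<Longrightarrow> f x y = h (g x y)"
  shows "{f x y | x y. x \<in> U \<and> y \<in> U} = h ` {g x y | x y. x \<in> U \<and> y \<in> U}" (is "?L = ?R")
proof (intro equalityI subsetI)
  fix z assume "z \<in> ?L"
  then obtain x y where z: "x \<in> U" "y \<in> U" "z = f x y" by blast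
  then show "z \<in> ?R" unfolding z(3) assms[OF z(1,2)] by blast
next
  fix z assume "z \<in> ?R"
  then obtain x y where z: "x \<in> U" "y \<in> U" "z = h (g x y)" by blast
  then show "z \<in> ?L" unfolding z(3) assms[OF z(1,2), symmetric] by blast
qed

lemma Collect_image1:
  assumes "\<And>x. P x \<Longrightarrow> f x = h (g x)"
  shows "{f x | x. P x} = h ` {g x | x. P x}" (is "?L = ?R")
proof (intro equalityI subsetI)
  fix z assume "z \<in> ?L"
  then obtain x where z: "P x" "z = f x" by blast
  then show "z \<in> ?R" unfolding z(2) assms[OF z(1)] by blast
next
  fix z assume "z \<in> ?R"
  then obtain x where z: "P x" "z = h (g x)" by blast
  then show "z \<in> ?L" unfolding z(2) assms[OF z(1), symmetric] by blast
qed

subsection \<open>The concrete algebras\<close>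

text \<open>The sign \<open>e = 1\<close> with the skew form gives the Weyl relation,
  \<open>e = -1\<close> with the symmetric form the Clifford relation, so that both algebras are
  treated together.\<close>

definition sign_rel :: "complex \<Rightarrow> ('u \<Rightarrow> 'u \<Rightarrow> complex) \<Rightarrow> 'u \<Rightarrow> 'u \<Rightarrow> 'u free" where
  "sign_rel e b x y = letter x * letter y - pm_scale e (letter y * letter x) - pm_scale (b x y) 1"

definition sign_rels :: "complex \<Rightarrow> ('u \<Rightarrow> 'u \<Rightarrow> complex) \<Rightarrow> 'u set \<Rightarrow> 'u free set" where
  "sign_rels e b U = {sign_rel e b x y | x y. x \<in> U \<and> y \<in> U}"

lemma sign_rels_words: "sign_rels e b U \<subseteq> words_in U"
  by (auto simp: sign_rels_def sign_rel_def words_in_letter words_in_one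
      intro!: subsp_diff[OF subsp_words_in] words_in_mult subspD(3)[OF subsp_words_in])

locale double =
  fixes sc :: "complex \<Rightarrow> 'v::ab_group_add \<Rightarrow> 'v" and G :: "int \<Rightarrow> 'v set"
  assumes vs: "vector_space sc"
begin

abbreviation "ds \<equiv> double_scale sc"
abbreviation "U \<equiv> double_space sc G"
abbreviation "An \<equiv> annihilators sc G"

lemma restricted_dual_add: "\<phi> \<in> restricted_dual sc G \<Longrightarrow> \<psi> \<in> restricted_dual sc G \<Longrightarrow> \<phi> + \<psi> \<in> restricted_dual sc G"
proof -
  assume p: "\<phi> \<in> restricted_dual sc G" "\<psi> \<in> restricted_dual sc G"
  interpret p: Vector_Spaces.linear sc "(*)" \<phi> using p by (simp add: restricted_dual_def)
  interpret q: Vector_Spaces.linear sc "(*)" \<psi> using p by (simp add: restricted_dual_def)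
  have "Vector_Spaces.linear sc (*) (\<phi> + \<psi>)"
    by unfold_locales (simp_all add: p.add q.add p.scale q.scale algebra_simps)
  moreover have s: "{n. \<exists>v\<in>G n. (\<phi> + \<psi>) v \<noteq> 0} \<subseteq> {n. \<exists>v\<in>G n. \<phi> v \<noteq> 0} \<union> {n. \<exists>v\<in>G n. \<psi> v \<noteq> 0}" by auto
  moreover have f: "finite ({n. \<exists>v\<in>G n. \<phi> v \<noteq> 0} \<union> {n. \<exists>v\<in>G n. \<psi> v \<noteq> 0})" using p by (simp add: restricted_dual_def)
  ultimately show ?thesis using finite_subset[OF s f] by (simp add: restricted_dual_def)
qed

lemma restricted_dual_scale: "\<phi> \<in> restricted_dual sc G \<Longrightarrow> (\<lambda>y. c * \<phi> y) \<in> restricted_dual sc G"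
proof -
  assume p: "\<phi> \<in> restricted_dual sc G"
  interpret p: Vector_Spaces.linear sc "(*)" \<phi> using p by (simp add: restricted_dual_def)
  have "Vector_Spaces.linear sc (*) (\<lambda>y. c * \<phi> y)"
    by unfold_locales (simp_all only: p.add p.scale distrib_left mult.left_commute)
  moreover have s: "{n. \<exists>v\<in>G n. c * \<phi> v \<noteq> 0} \<subseteq> {n. \<exists>v\<in>G n. \<phi> v \<noteq> 0}" by auto
  moreover have f: "finite {n. \<exists>v\<in>G n. \<phi> v \<noteq> 0}" using p by (simp add: restricted_dual_def)
  ultimately show ?thesis using finite_subset[OF s f] by (simp add: restricted_dual_def)
qed

lemma U_add: "u \<in> U \<Longrightarrow> v \<in> U \<Longrightarrow> u + v \<in> U"
  by (auto simp: double_space_def restricted_dual_add)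

lemma U_scale: "u \<in> U \<Longrightarrow> ds c u \<in> U"
  by (auto simp: double_space_def double_scale_def restricted_dual_scale)

lemma U_zero: "(0, 0) \<in> U"
proof -
  have "vector_space_pair sc ((*) :: complex \<Rightarrow> _)"
    using vs unfolding vector_space_pair_def by (auto intro!: vector_space.intro simp: algebra_simps)
  then have "Vector_Spaces.linear sc (*) (\<lambda>_. 0 :: complex)"
    by (rule vector_space_pair.linear_zero)
  then show ?thesis by (auto simp: double_space_def restricted_dual_def zero_fun_def)
qed

lemma An_U: "An \<subseteq> U"
  by (auto simp: annihilators_def double_space_def)

lemma linear_relations_words: "linear_relations ds U \<subseteq> words_in U"
proof -
  have "letter (u + v) - letter u - letter v \<in> words_in U" if "u \<in> U" "v \<in> U" for u v
    using that by (intro subsp_diff[OF subsp_words_in] words_in_letter U_add)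
  moreover have "letter (ds c u) - pm_scale c (letter u) \<in> words_in U" if "u \<in> U" for c u
    using that by (intro subsp_diff[OF subsp_words_in] subspD(3)[OF subsp_words_in] words_in_letter U_scale)
  ultimately show ?thesis
    unfolding linear_relations_def by (intro Un_least subsetI; elim CollectE exE conjE; simp only:)
qed

sublocale T: presented_algebra "T_alg sc G" "T_map ds U" "words_in U" "ker_T ds U"
  unfolding T_alg_def by (rule presented_T[OF linear_relations_words])

lemma T_incl_map: "T_incl sc G u = T_map ds U (letter u)"
  by (simp add: T_incl_def tensor_incl_def T_map_def)

definition "hrels = sign_rels 1 skew_form U"
definition "crels = sign_rels (-1) sym_form U"

lemma H_ideal_eq: "H_ideal sc G = Idl\<^bsub>T_alg sc G\<^esub> (T_map ds U ` hrels)"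
proof -
  have e: "(T_incl sc G x \<otimes>\<^bsub>T_alg sc G\<^esub> T_incl sc G y \<ominus>\<^bsub>T_alg sc G\<^esub> T_incl sc G y \<otimes>\<^bsub>T_alg sc G\<^esub> T_incl sc G x) \<ominus>\<^bsub>T_alg sc G\<^esub> (skew_form x y \<odot>\<^bsub>T_alg sc G\<^esub> \<one>\<^bsub>T_alg sc G\<^esub>)
     = T_map ds U (sign_rel 1 skew_form x y)" if "x \<in> U" "y \<in> U" for x y
    using that unfolding T_incl_map T.q_one sign_rel_def
    by (simp add: words_in_letter words_in_mult words_in_one T.q_diff subsp_diff[OF subsp_words_in] subspD(3)[OF subsp_words_in] flip: T.q_mult T.q_scale)
  show ?thesis
    unfolding H_ideal_def Let_def hrels_def sign_rels_def
    by (rule arg_cong[where f = "genideal _"], rule Collect_image2, rule e)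
qed

lemma C_ideal_eq: "C_ideal sc G = Idl\<^bsub>T_alg sc G\<^esub> (T_map ds U ` crels)"
proof -
  have e: "(T_incl sc G x \<otimes>\<^bsub>T_alg sc G\<^esub> T_incl sc G y \<oplus>\<^bsub>T_alg sc G\<^esub> T_incl sc G y \<otimes>\<^bsub>T_alg sc G\<^esub> T_incl sc G x) \<ominus>\<^bsub>T_alg sc G\<^esub> (sym_form x y \<odot>\<^bsub>T_alg sc G\<^esub> \<one>\<^bsub>T_alg sc G\<^esub>)
     = T_map ds U (sign_rel (-1) sym_form x y)" if "x \<in> U" "y \<in> U" for x y
    using that unfolding T_incl_map T.q_one sign_rel_def
    by (simp add: words_in_letter words_in_mult words_in_one T.q_diff subspD[OF subsp_words_in] flip: T.q_mult T.q_scale T.q_add)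
  show ?thesis
    unfolding C_ideal_def Let_def crels_def sign_rels_def
    by (rule arg_cong[where f = "genideal _"], rule Collect_image2, rule e)
qed

lemma H_alg_eq: "H_alg sc G = A_alg ds U hrels"
  by (simp add: H_alg_def H_ideal_eq A_alg_def T_alg_def)

lemma C_alg_eq: "C_alg sc G = A_alg ds U crels"
  by (simp add: C_alg_def C_ideal_eq A_alg_def T_alg_def)

lemma H_incl_eq: "H_incl sc G u = A_map ds U hrels (letter u)"
  by (simp add: H_incl_def H_ideal_eq A_map_def T_incl_map T_alg_def)

lemma C_incl_eq: "C_incl sc G u = A_map ds U crels (letter u)"
  by (simp add: C_incl_def C_ideal_eq A_map_def T_incl_map T_alg_def)

abbreviation "piS \<equiv> M_map ds U hrels An"
abbreviation "piL \<equiv> M_map ds U crels An"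
abbreviation "kerS \<equiv> ker_M ds U hrels An"
abbreviation "kerL \<equiv> ker_M ds U crels An"

sublocale S: presented "semi_inf_S sc G" piS "words_in U" kerS
  unfolding semi_inf_S_def H_alg_eq H_incl_eq[abs_def]
  by (rule presented_M[OF linear_relations_words _ An_U]) (simp add: hrels_def sign_rels_words)

sublocale L: presented "semi_inf_Lambda sc G" piL "words_in U" kerL
  unfolding semi_inf_Lambda_def C_alg_eq C_incl_eq[abs_def]
  by (rule presented_M[OF linear_relations_words _ An_U]) (simp add: crels_def sign_rels_words)

text \<open>The products defining \<open>Lambda_part\<close> are classes of single words. Elements
  of \<open>kerL\<close>, which also enter the hull, need not have a definite parity.\<close>

lemma Lambda_part_eq: "Lambda_part sc G i =
   piL ` lhull (kerL \<union> {Poly_Mapping.single (Word us) 1 | us. set us \<subseteq> U \<and> odd (length us) = i})"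
proof -
  interpret A: presented_algebra "A_alg ds U crels" "A_map ds U crels" "words_in U" "ker_A ds U crels"
    by (rule presented_A[OF linear_relations_words]) (simp add: crels_def sign_rels_words)
  have f: "foldr (\<lambda>u a. C_incl sc G u \<otimes>\<^bsub>C_alg sc G\<^esub> a) us \<one>\<^bsub>C_alg sc G\<^esub> = A_map ds U crels (Poly_Mapping.single (Word us) 1)"
    if "set us \<subseteq> U" for us
    using that
  proof (induction us)
    case Nil
    then show ?case by (simp add: C_alg_eq A.q_one flip: one_word)
  next
    case (Cons u us)
    then show ?case
      by (simp add: C_alg_eq C_incl_eq word_Cons A.q_mult words_in_letter words_in_word)
  qed
  let ?W = "{Poly_Mapping.single (Word us) (1 :: complex) | us. set us \<subseteq> U \<and> odd (length us) = i}"
  have "{left_ideal_gen (C_alg sc G) (C_incl sc G ` An) +>\<^bsub>C_alg sc G\<^esub> foldr (\<lambda>u a. C_incl sc G u \<otimes>\<^bsub>C_alg sc G\<^esub> a) us \<one>\<^bsub>C_alg sc G\<^esub>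
        | us. set us \<subseteq> U \<and> odd (length us) = i} = piL ` ?W"
    by (rule Collect_image1) (simp add: M_map_def C_alg_eq C_incl_eq[abs_def] f[unfolded C_alg_eq C_incl_eq])
  moreover have "?W \<subseteq> words_in U" using words_in_word by blast
  ultimately show ?thesis
    unfolding Lambda_part_def Let_def by (simp only: L.lin_span_image)
qed

end

subsection \<open>Tensor products\<close>

definition supported :: "'k set \<Rightarrow> ('k \<Rightarrow>\<^sub>0 complex) set" where
  "supported K = {p. Poly_Mapping.keys p \<subseteq> K}"

lemma subsp_supported: "subsp (supported K)"
  unfolding subsp_def supported_def
proof (intro conjI ballI allI; clarsimp)
  fix x y w
  assume "Poly_Mapping.keys x \<subseteq> K" "Poly_Mapping.keys y \<subseteq> K" "w \<in> Poly_Mapping.keys (x + y :: 'a \<Rightarrow>\<^sub>0 complex)"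
  then show "w \<in> K" using keys_add[of x y] by blast
next
  fix c x w
  assume "Poly_Mapping.keys x \<subseteq> K" "w \<in> Poly_Mapping.keys (pm_scale c x :: 'a \<Rightarrow>\<^sub>0 complex)"
  then show "w \<in> K" using keys_pm_scale[of c x] by blast
qed

lemma supported_single: "k \<in> K \<Longrightarrow> Poly_Mapping.single k c \<in> supported K"
  by (simp add: supported_def)

lemma presented_free_space: "presented (free_space K) (\<lambda>x. x) (supported K) {0}"
  by unfold_locales
     (auto simp: free_space_def supported_def[symmetric] subsp_supported subspD[OF subsp_supported] subsp_def[of "{0}"])

definition ker_tensor :: "(complex, 'a, 'm) module_scheme \<Rightarrow> (complex, 'b, 'n) module_scheme \<Rightarrow> ('a \<times> 'b \<Rightarrow>\<^sub>0 complex) set" where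
  "ker_tensor M N = lhull ({0} \<union> bilinear_relations M N)"

definition tensor_map :: "(complex, 'a, 'm) module_scheme \<Rightarrow> (complex, 'b, 'n) module_scheme
     \<Rightarrow> ('a \<times> 'b \<Rightarrow>\<^sub>0 complex) \<Rightarrow> ('a \<times> 'b \<Rightarrow>\<^sub>0 complex) set" where
  "tensor_map M N p = tensor_kernel M N +>\<^bsub>free_space (carrier M \<times> carrier N)\<^esub> p"

lemma bilinear_relations_supported:
  assumes "module complex_ring M" "module complex_ring N"
  shows "bilinear_relations M N \<subseteq> supported (carrier M \<times> carrier N)"
proof -
  interpret M: module complex_ring M by fact
  interpret N: module complex_ring N by fact
  let ?P = "supported (carrier M \<times> carrier N)"
  note d = subsp_diff[OF subsp_supported]
  have "Poly_Mapping.single (x \<oplus>\<^bsub>M\<^esub> x', y) 1 - Poly_Mapping.single (x, y) 1 - Poly_Mapping.single (x', y) 1 \<in> ?P"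
    if "x \<in> carrier M" "x' \<in> carrier M" "y \<in> carrier N" for x x' y
    using that by (intro d supported_single) auto
  moreover have "Poly_Mapping.single (x, y \<oplus>\<^bsub>N\<^esub> y') 1 - Poly_Mapping.single (x, y) 1 - Poly_Mapping.single (x, y') 1 \<in> ?P"
    if "x \<in> carrier M" "y \<in> carrier N" "y' \<in> carrier N" for x y y'
    using that by (intro d supported_single) auto
  moreover have "Poly_Mapping.single (c \<odot>\<^bsub>M\<^esub> x, y) 1 - Poly_Mapping.single (x, y) c \<in> ?P"
    if "x \<in> carrier M" "y \<in> carrier N" for c x y
    using that by (intro d supported_single) auto
  moreover have "Poly_Mapping.single (x, c \<odot>\<^bsub>N\<^esub> y) 1 - Poly_Mapping.single (x, y) c \<in> ?P"
    if "x \<in> carrier M" "y \<in> carrier N" for c x y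
    using that by (intro d supported_single) auto
  ultimately show ?thesis
    unfolding bilinear_relations_def by (intro Un_least subsetI; elim CollectE exE conjE; simp only:)
qed

lemma presented_tensor:
  assumes "module complex_ring M" "module complex_ring N"
  shows "presented (tensor_product M N) (tensor_map M N) (supported (carrier M \<times> carrier N)) (ker_tensor M N)"
proof -
  interpret F: presented "free_space (carrier M \<times> carrier N)" "\<lambda>x. x" "supported (carrier M \<times> carrier N)" "{0}"
    by (rule presented_free_space)
  note b = bilinear_relations_supported[OF assms]
  have k: "tensor_kernel M N = ker_tensor M N"
    unfolding tensor_kernel_def ker_tensor_def using F.lin_span_image[OF b] by simp
  have "presented (quotient (free_space (carrier M \<times> carrier N)) ((\<lambda>x. x) ` ker_tensor M N))
     (\<lambda>x. (\<lambda>x. x) ` ker_tensor M N +>\<^bsub>free_space (carrier M \<times> carrier N)\<^esub> x) (supported (carrier M \<times> carrier N)) (ker_tensor M N)"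
  proof (rule F.presented_quotient)
    show "subsp (ker_tensor M N)" unfolding ker_tensor_def by (rule subsp_lhull)
    show "{0} \<subseteq> ker_tensor M N" unfolding ker_tensor_def using lhull.zero by blast
    show "ker_tensor M N \<subseteq> supported (carrier M \<times> carrier N)"
      unfolding ker_tensor_def by (rule lhull_minimal[OF subsp_supported]) (use b subspD(1)[OF subsp_supported] in auto)
  qed
  then show ?thesis
    unfolding tensor_product_def tensor_map_def[abs_def] k by simp
qed

lemma pure_tensor_map: "pure_tensor M N x y = tensor_map M N (Poly_Mapping.single (x, y) 1)"
  by (simp add: pure_tensor_def tensor_map_def)

definition teq :: "(complex, 'a, 'm) module_scheme \<Rightarrow> (complex, 'b, 'n) module_scheme
     \<Rightarrow> ('a \<times> 'b \<Rightarrow>\<^sub>0 complex) \<Rightarrow> ('a \<times> 'b \<Rightarrow>\<^sub>0 complex) \<Rightarrow> bool" where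
  "teq M N p q \<longleftrightarrow> p - q \<in> ker_tensor M N"

lemma subsp_ker_tensor: "subsp (ker_tensor M N)"
  unfolding ker_tensor_def by (rule subsp_lhull)

lemma teq_refl [simp]: "teq M N p p"
  by (simp add: teq_def subspD(1)[OF subsp_ker_tensor])

lemma teq_sym: "teq M N p q \<Longrightarrow> teq M N q p"
  using subsp_minus[OF subsp_ker_tensor, of "p - q" M N] by (simp add: teq_def)

lemma teq_trans: "teq M N p q \<Longrightarrow> teq M N q r \<Longrightarrow> teq M N p r"
  using subspD(2)[OF subsp_ker_tensor, of "p - q" M N "q - r"] by (simp add: teq_def)

lemma teq_add: "teq M N p q \<Longrightarrow> teq M N p' q' \<Longrightarrow> teq M N (p + p') (q + q')"
  using subspD(2)[OF subsp_ker_tensor, of "p - q" M N "p' - q'"] by (simp add: teq_def algebra_simps)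

lemma teq_scale: "teq M N p q \<Longrightarrow> teq M N (pm_scale c p) (pm_scale c q)"
  using subspD(3)[OF subsp_ker_tensor, of "p - q" M N c] by (simp add: teq_def pm.scale_right_diff_distrib)

lemma teq_bilinear:
  shows "x \<in> carrier M \<Longrightarrow> x' \<in> carrier M \<Longrightarrow> y \<in> carrier N \<Longrightarrow>
      teq M N (Poly_Mapping.single (x \<oplus>\<^bsub>M\<^esub> x', y) 1) (Poly_Mapping.single (x, y) 1 + Poly_Mapping.single (x', y) 1)"
    and "x \<in> carrier M \<Longrightarrow> y \<in> carrier N \<Longrightarrow> y' \<in> carrier N \<Longrightarrow>
      teq M N (Poly_Mapping.single (x, y \<oplus>\<^bsub>N\<^esub> y') 1) (Poly_Mapping.single (x, y) 1 + Poly_Mapping.single (x, y') 1)"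
    and "x \<in> carrier M \<Longrightarrow> y \<in> carrier N \<Longrightarrow>
      teq M N (Poly_Mapping.single (c \<odot>\<^bsub>M\<^esub> x, y) 1) (pm_scale c (Poly_Mapping.single (x, y) 1))"
    and "x \<in> carrier M \<Longrightarrow> y \<in> carrier N \<Longrightarrow>
      teq M N (Poly_Mapping.single (x, c \<odot>\<^bsub>N\<^esub> y) 1) (pm_scale c (Poly_Mapping.single (x, y) 1))"
proof -
  have b: "p - q \<in> bilinear_relations M N \<Longrightarrow> teq M N p q" for p q
    unfolding teq_def ker_tensor_def by (rule lhull_base) simp
  show "teq M N (Poly_Mapping.single (x \<oplus>\<^bsub>M\<^esub> x', y) 1) (Poly_Mapping.single (x, y) 1 + Poly_Mapping.single (x', y) 1)"
    if "x \<in> carrier M" "x' \<in> carrier M" "y \<in> carrier N"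
    by (rule b) (use that in \<open>unfold bilinear_relations_def diff_diff_eq[symmetric], blast\<close>)
  show "teq M N (Poly_Mapping.single (x, y \<oplus>\<^bsub>N\<^esub> y') 1) (Poly_Mapping.single (x, y) 1 + Poly_Mapping.single (x, y') 1)"
    if "x \<in> carrier M" "y \<in> carrier N" "y' \<in> carrier N"
    by (rule b) (use that in \<open>unfold bilinear_relations_def diff_diff_eq[symmetric], blast\<close>)
  show "teq M N (Poly_Mapping.single (c \<odot>\<^bsub>M\<^esub> x, y) 1) (pm_scale c (Poly_Mapping.single (x, y) 1))"
    if "x \<in> carrier M" "y \<in> carrier N"
    by (rule b) (use that in \<open>unfold bilinear_relations_def pm_scale_single mult_1_right, blast\<close>)
  show "teq M N (Poly_Mapping.single (x, c \<odot>\<^bsub>N\<^esub> y) 1) (pm_scale c (Poly_Mapping.single (x, y) 1))"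
    if "x \<in> carrier M" "y \<in> carrier N"
    by (rule b) (use that in \<open>unfold bilinear_relations_def pm_scale_single mult_1_right, blast\<close>)
qed

context double begin

abbreviation "SS \<equiv> semi_inf_S sc G"
abbreviation "LL \<equiv> semi_inf_Lambda sc G"
abbreviation "Wmap \<equiv> tensor_map SS LL"

sublocale W: presented "semi_inf_W sc G" Wmap "supported (carrier SS \<times> carrier LL)" "ker_tensor SS LL"
proof -
  interpret T: presented "tensor_product SS LL" Wmap "supported (carrier SS \<times> carrier LL)" "ker_tensor SS LL"
    by (rule presented_tensor[OF S.module L.module])
  have f: "carrier (semi_inf_W sc G) = carrier (tensor_product SS LL)" "zero (semi_inf_W sc G) = zero (tensor_product SS LL)"
    "add (semi_inf_W sc G) = add (tensor_product SS LL)" "smult (semi_inf_W sc G) = smult (tensor_product SS LL)"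
    by (simp_all add: semi_inf_W_def Let_def module.defs superspace.defs)
  show "presented (semi_inf_W sc G) Wmap (supported (carrier SS \<times> carrier LL)) (ker_tensor SS LL)"
    by unfold_locales (simp_all add: f T.P T.N T.carrier T.q_add T.q_scale T.q_zero T.q_eq)
qed

lemma W_part_eq: "part (semi_inf_W sc G) i =
   Wmap ` lhull (ker_tensor SS LL \<union> {Poly_Mapping.single (x, y) 1 | x y. x \<in> carrier SS \<and> y \<in> Lambda_part sc G i})"
proof -
  interpret T: presented "tensor_product SS LL" Wmap "supported (carrier SS \<times> carrier LL)" "ker_tensor SS LL"
    by (rule presented_tensor[OF S.module L.module])
  let ?R = "{Poly_Mapping.single (x, y) (1::complex) | x y. x \<in> carrier SS \<and> y \<in> Lambda_part sc G i}"
  have sub: "Lambda_part sc G i \<subseteq> carrier LL"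
  proof -
    have "lhull (kerL \<union> {Poly_Mapping.single (Word us) 1 | us. set us \<subseteq> U \<and> odd (length us) = i}) \<subseteq> words_in U"
    proof (rule lhull_minimal[OF L.P])
      have "{Poly_Mapping.single (Word us) (1::complex) | us. set us \<subseteq> U \<and> odd (length us) = i} \<subseteq> words_in U"
        using words_in_word by blast
      then show "kerL \<union> {Poly_Mapping.single (Word us) 1 | us. set us \<subseteq> U \<and> odd (length us) = i} \<subseteq> words_in U"
        using L.N by simp
    qed
    then show ?thesis unfolding Lambda_part_eq L.carrier by (rule image_mono)
  qed
  have R: "?R \<subseteq> supported (carrier SS \<times> carrier LL)"
  proof
    fix p assume "p \<in> ?R"
    then obtain x y where p: "p = Poly_Mapping.single (x, y) 1" "x \<in> carrier SS" "y \<in> Lambda_part sc G i" by blast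
    show "p \<in> supported (carrier SS \<times> carrier LL)" unfolding p(1) by (rule supported_single) (use p sub in auto)
  qed
  have "part (semi_inf_W sc G) i = lin_span (tensor_product SS LL) {pure_tensor SS LL x y | x y. x \<in> carrier SS \<and> y \<in> Lambda_part sc G i}"
    by (simp add: semi_inf_W_def Let_def module.defs superspace.defs)
  also have "{pure_tensor SS LL x y | x y. x \<in> carrier SS \<and> y \<in> Lambda_part sc G i} = Wmap ` ?R"
  proof (intro equalityI subsetI)
    fix z assume "z \<in> {pure_tensor SS LL x y | x y. x \<in> carrier SS \<and> y \<in> Lambda_part sc G i}"
    then obtain x y where z: "x \<in> carrier SS" "y \<in> Lambda_part sc G i" "z = pure_tensor SS LL x y" by blast
    then show "z \<in> Wmap ` ?R" unfolding z(3) pure_tensor_map by blast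
  next
    fix z assume "z \<in> Wmap ` ?R"
    then obtain x y where z: "x \<in> carrier SS" "y \<in> Lambda_part sc G i" "z = Wmap (Poly_Mapping.single (x, y) 1)" by blast
    then show "z \<in> {pure_tensor SS LL x y | x y. x \<in> carrier SS \<and> y \<in> Lambda_part sc G i}"
      unfolding z(3) pure_tensor_map[symmetric] by blast
  qed
  finally show ?thesis by (simp only: T.lin_span_image[OF R])
qed

end

section \<open>Oscillator representations\<close>

lemma ksign_mult [simp]: "ksign i * ksign i = 1"
  by (simp add: ksign_def)

lemma ksign_simps [simp]: "ksign False = 1" "ksign True = -1"
  by (simp_all add: ksign_def)

subsection \<open>Superderivations of the free algebra\<close>

definition ell :: "('l \<Rightarrow>\<^sub>0 complex) \<Rightarrow> 'l free" where
  "ell = pm_lin letter"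

lemma ell_simps [simp]: "ell 0 = 0" "ell (v + w) = ell v + ell w" "ell (v - w) = ell v - ell w"
  "ell (pm_scale c v) = pm_scale c (ell v)" "ell (Poly_Mapping.single l c) = pm_scale c (letter l)"
  "ell (- v) = - ell v"
  by (simp_all add: ell_def pm_lin_add pm_lin_diff pm_lin_scale pm_lin_minus)

text \<open>\<open>pm_lin\<close> read as the action of a matrix on the span of the letters:
  \<open>A l\<close> is the column of the letter \<open>l\<close>.\<close>

definition ext :: "('l \<Rightarrow> 'l \<Rightarrow>\<^sub>0 complex) \<Rightarrow> ('l \<Rightarrow>\<^sub>0 complex) \<Rightarrow> ('l \<Rightarrow>\<^sub>0 complex)" where
  "ext = pm_lin"

locale super_letters =
  fixes par :: "'l \<Rightarrow> bool"
begin

definition wpar :: "'l list \<Rightarrow> bool" where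
  "wpar w = odd (length (filter par w))"

lemma wpar_simps [simp]: "wpar [] = False" "wpar (l # w) = (par l \<noteq> wpar w)"
  "wpar (u @ v) = (wpar u \<noteq> wpar v)"
  by (auto simp: wpar_def)

text \<open>The parity automorphism if \<open>i\<close> holds and the identity otherwise: the Koszul
  sign for moving an operator of parity \<open>i\<close> past a word.\<close>

definition sig :: "bool \<Rightarrow> 'l free \<Rightarrow> 'l free" where
  "sig i = pm_lin (\<lambda>w. Poly_Mapping.single w (ksign (i \<and> wpar (letters w))))"

lemma sig_simps [simp]: "sig i 0 = 0" "sig i (p + q) = sig i p + sig i q" "sig i (p - q) = sig i p - sig i q"
  "sig i (pm_scale c p) = pm_scale c (sig i p)" "sig i (- p) = - sig i p"
  "sig i (sum f A) = (\<Sum>x\<in>A. sig i (f x))"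
  by (simp_all add: sig_def pm_lin_add pm_lin_diff pm_lin_scale pm_lin_minus pm_lin_sum)

lemma sig_word: "sig i (Poly_Mapping.single (Word w) 1) = pm_scale (ksign (i \<and> wpar w)) (Poly_Mapping.single (Word w) 1)"
  by (simp add: sig_def)

lemma sig_letter [simp]: "sig i (letter l) = pm_scale (ksign (i \<and> par l)) (letter l)"
  by (simp add: letter_def sig_word del: pm_scale_single)

lemma sig_one [simp]: "sig i 1 = 1"
  unfolding one_word by (simp add: sig_word)

lemma sig_mult_letter: "sig i (letter l * p) = sig i (letter l) * sig i p"
proof (induction p rule: pm_induct)
  case (single k c)
  obtain w where k: "k = Word w" by (cases k)
  show ?case unfolding k
    by (auto simp: letter_def word_mult sig_def ksign_def)
qed (simp_all add: distrib_left)

lemma sig_mult [simp]: "sig i (p * q) = sig i p * sig i q"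
proof (induction p rule: word_induct)
  case (letter l p)
  then show ?case
    by (simp only: mult.assoc sig_mult_letter)
qed (simp_all add: distrib_right)

lemma sig_sig: "sig i (sig j p) = sig (i \<noteq> j) p"
  by (induction p rule: word_induct) (auto simp: ksign_def)

lemma sig_False [simp]: "sig False p = p"
  by (induction p rule: word_induct) auto

lemma sig_sig_same [simp]: "sig i (sig i p) = p"
  by (simp add: sig_sig)

definition hom :: "bool \<Rightarrow> ('l \<Rightarrow>\<^sub>0 complex) \<Rightarrow> bool" where
  "hom i v \<longleftrightarrow> (\<forall>m\<in>Poly_Mapping.keys v. par m = i)"

lemma sig_ell: "hom i v \<Longrightarrow> sig j (ell v) = pm_scale (ksign (j \<and> i)) (ell v)"
  by (auto simp: ell_def pm_lin_def hom_def pm.scale_sum_right mult.commute intro!: sum.cong)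

fun derw :: "bool \<Rightarrow> ('l \<Rightarrow> 'l \<Rightarrow>\<^sub>0 complex) \<Rightarrow> 'l list \<Rightarrow> 'l free" where
  "derw i A [] = 0"
| "derw i A (l # w) = ell (A l) * Poly_Mapping.single (Word w) 1 + sig i (letter l) * derw i A w"

definition der :: "bool \<Rightarrow> ('l \<Rightarrow> 'l \<Rightarrow>\<^sub>0 complex) \<Rightarrow> 'l free \<Rightarrow> 'l free" where
  "der i A = pm_lin (\<lambda>w. derw i A (letters w))"

lemma der_simps [simp]: "der i A 0 = 0" "der i A (p + q) = der i A p + der i A q"
  "der i A (p - q) = der i A p - der i A q"
  "der i A (pm_scale c p) = pm_scale c (der i A p)" "der i A (- p) = - der i A p"
  "der i A (sum f X) = (\<Sum>x\<in>X. der i A (f x))"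
  by (simp_all add: der_def pm_lin_add pm_lin_diff pm_lin_scale pm_lin_minus pm_lin_sum)

lemma der_one [simp]: "der i A 1 = 0"
  unfolding one_word by (simp add: der_def)

lemma der_mult_letter: "der i A (letter l * p) = ell (A l) * p + sig i (letter l) * der i A p"
proof (induction p rule: pm_induct)
  case (single k c)
  obtain w where k: "k = Word w" by (cases k)
  have "der i A (letter l * Poly_Mapping.single (Word w) c) = pm_scale c (derw i A (l # w))"
    by (simp add: letter_def word_mult der_def del: derw.simps)
  also have "\<dots> = ell (A l) * pm_scale c (Poly_Mapping.single (Word w) 1) + sig i (letter l) * der i A (Poly_Mapping.single (Word w) c)"
    by (simp add: der_def pm.scale_right_distrib mult.left_commute mult.commute del: pm_scale_single)
  finally show ?case by (simp add: k)
qed (simp_all add: distrib_left)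

lemma der_letter [simp]: "der i A (letter l) = ell (A l)"
  using der_mult_letter[of i A l 1] by simp

lemma der_mult: "der i A (p * q) = der i A p * q + sig i p * der i A q"
proof (induction p rule: word_induct)
  case (letter l p)
  have "der i A (letter l * p * q) = ell (A l) * (p * q) + sig i (letter l) * der i A (p * q)"
    by (simp only: mult.assoc der_mult_letter)
  also have "\<dots> = der i A (letter l * p) * q + sig i (letter l * p) * der i A q"
    unfolding letter der_mult_letter
    by (simp add: distrib_left distrib_right mult.assoc pm.scale_right_distrib)
  finally show ?case .
qed (simp_all add: distrib_right pm.scale_right_distrib)

lemma der_ell: "der i A (ell v) = ell (ext A v)"
  by (induction v rule: pm_induct) (simp_all add: ext_def pm_lin_add)

lemma der_add: "der i (\<lambda>l. A l + B l) p = der i A p + der i B p"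
  by (induction p rule: word_induct)
     (auto simp: der_mult_letter distrib_left distrib_right pm.scale_right_distrib)

lemma der_scale: "der i (\<lambda>l. pm_scale c (A l)) p = pm_scale c (der i A p)"
  by (induction p rule: word_induct)
     (auto simp: der_mult_letter distrib_left distrib_right pm.scale_right_distrib mult.commute)

definition hmap :: "bool \<Rightarrow> ('l \<Rightarrow> 'l \<Rightarrow>\<^sub>0 complex) \<Rightarrow> bool" where
  "hmap i A \<longleftrightarrow> (\<forall>l. hom (i \<noteq> par l) (A l))"

lemma sig_der:
  assumes "hmap i A"
  shows "sig j (der i A p) = pm_scale (ksign (i \<and> j)) (der i A (sig j p))"
proof (induction p rule: word_induct)
  case (letter l p)
  have "hom (i \<noteq> par l) (A l)" using assms by (simp add: hmap_def)
  then show ?case using letter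
    by (simp add: der_mult_letter sig_ell pm.scale_right_distrib)
       (auto simp: ksign_def algebra_simps)
qed (simp_all add: pm.scale_right_distrib mult.commute)

text \<open>The supercommutator of two superderivations is a superderivation, and both sides agree
  on letters by the assumption on \<open>C\<close>.\<close>

lemma der_bracket:
  assumes "hmap i A" "hmap j B" and C: "\<And>l. C l = ext A (B l) - pm_scale (ksign (i \<and> j)) (ext B (A l))"
  shows "der i A (der j B p) - pm_scale (ksign (i \<and> j)) (der j B (der i A p)) = der (i \<noteq> j) C p"
proof (induction p rule: word_induct)
  case (letter l p)
  have h: "hom (i \<noteq> par l) (A l)" "hom (j \<noteq> par l) (B l)" using assms by (simp_all add: hmap_def)
  have *: "der i A (der j B p) = der (i \<noteq> j) C p + pm_scale (ksign (i \<and> j)) (der j B (der i A p))"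
    using letter by (simp add: algebra_simps)
  show ?case
    unfolding der_mult_letter der_simps
    apply (simp add: der_mult_letter der_mult der_ell sig_ell[OF h(1)] sig_ell[OF h(2)] * C)
    by (cases i; cases j; cases "par l")
       (simp_all add: algebra_simps pm.scale_right_distrib)
next
  case (add p q)
  then show ?case by (simp add: algebra_simps pm.scale_right_distrib)
next
  case (scale c p)
  have "pm_scale c (der i A (der j B p)) - pm_scale (ksign (i \<and> j)) (pm_scale c (der j B (der i A p)))
     = pm_scale c (der i A (der j B p) - pm_scale (ksign (i \<and> j)) (der j B (der i A p)))"
    by (simp add: pm.scale_right_diff_distrib mult.commute)
  then show ?case using scale by simp
qed simp_all

end

text \<open>
  The letters are the generators of the Weyl and Clifford algebras together; \<open>par\<close> is \<open>True\<close> on the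
  Clifford ones. Letters that are not \<open>live\<close> are superfluous names, set to zero below.
\<close>

locale oscillator = super_letters par for par :: "'l \<Rightarrow> bool" +
  fixes dual :: "'l \<Rightarrow> 'l" and g :: "'l \<Rightarrow> complex" and ann live :: "'l \<Rightarrow> bool"
  assumes dual_dual [simp]: "dual (dual l) = l"
    and par_dual [simp]: "par (dual l) = par l"
    and ann_dual [simp]: "ann (dual l) \<longleftrightarrow> \<not> ann l"
    and live_dual [simp]: "live (dual l) = live l"
    and g_dual: "g (dual l) = - ksign (par l) * g l"
    and g_sq [simp]: "g l * g l = 1"
begin

lemma dual_eq_iff: "dual l = m \<longleftrightarrow> l = dual m"
  by auto

definition form :: "'l \<Rightarrow> 'l \<Rightarrow> complex" where
  "form l m = (if live l \<and> m = dual l then g l else 0)"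

definition ccr :: "'l \<Rightarrow> 'l \<Rightarrow> 'l free" where
  "ccr l m = letter l * letter m - pm_scale (ksign (par l \<and> par m)) (letter m * letter l) - pm_scale (form l m) 1"

inductive_set two_sided :: "'l free set" where
  zero: "0 \<in> two_sided"
| add: "p \<in> two_sided \<Longrightarrow> q \<in> two_sided \<Longrightarrow> p + q \<in> two_sided"
| ccr: "x * ccr l m * y \<in> two_sided"
| dead: "\<not> live l \<Longrightarrow> x * letter l * y \<in> two_sided"

text \<open>Only a left ideal: annihilators vanish at the right end of a word, next to the vacuum.
  The quotient of the free algebra by it is the Fock space.\<close>

inductive_set vac_ideal :: "'l free set" where
  two: "p \<in> two_sided \<Longrightarrow> p \<in> vac_ideal"
| add: "p \<in> vac_ideal \<Longrightarrow> q \<in> vac_ideal \<Longrightarrow> p + q \<in> vac_ideal"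
| ann: "ann l \<Longrightarrow> x * letter l \<in> vac_ideal"

lemma two_mult_left: "p \<in> two_sided \<Longrightarrow> a * p \<in> two_sided"
proof (induction rule: two_sided.induct)
  case (ccr x l m y)
  then show ?case using two_sided.ccr[of "a * x" l m y] by (simp add: mult.assoc)
next
  case (dead l x y)
  then show ?case using two_sided.dead[of l "a * x" y] by (simp add: mult.assoc)
qed (auto simp: distrib_left intro: two_sided.intros)

lemma two_mult_right: "p \<in> two_sided \<Longrightarrow> p * a \<in> two_sided"
proof (induction rule: two_sided.induct)
  case (ccr x l m y)
  then show ?case using two_sided.ccr[of x l m "y * a"] by (simp add: mult.assoc)
next
  case (dead l x y)
  then show ?case using two_sided.dead[of l x "y * a"] by (simp add: mult.assoc)
qed (auto simp: distrib_right intro: two_sided.intros)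

lemma two_scale: "p \<in> two_sided \<Longrightarrow> pm_scale c p \<in> two_sided"
  using two_mult_left[of p "pm_scale c 1"] by simp

lemma two_minus: "p \<in> two_sided \<Longrightarrow> - p \<in> two_sided"
  using two_scale[of p "-1"] by simp

lemma two_diff: "p \<in> two_sided \<Longrightarrow> q \<in> two_sided \<Longrightarrow> p - q \<in> two_sided"
  using two_sided.add[of p "- q"] two_minus by simp

lemma two_sum: "(\<And>x. x \<in> A \<Longrightarrow> f x \<in> two_sided) \<Longrightarrow> sum f A \<in> two_sided"
  by (induction A rule: infinite_finite_induct) (auto intro: two_sided.intros)

lemma vac_zero [simp]: "0 \<in> vac_ideal"
  by (intro vac_ideal.two two_sided.zero)

lemma vac_mult: "p \<in> vac_ideal \<Longrightarrow> a * p \<in> vac_ideal"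
proof (induction rule: vac_ideal.induct)
  case (ann l x)
  then show ?case using vac_ideal.ann[of l "a * x"] by (simp add: mult.assoc)
qed (auto simp: distrib_left two_mult_left intro: vac_ideal.intros)

lemma vac_scale: "p \<in> vac_ideal \<Longrightarrow> pm_scale c p \<in> vac_ideal"
  using vac_mult[of p "pm_scale c 1"] by simp

lemma vac_minus: "p \<in> vac_ideal \<Longrightarrow> - p \<in> vac_ideal"
  using vac_scale[of p "-1"] by simp

lemma vac_diff: "p \<in> vac_ideal \<Longrightarrow> q \<in> vac_ideal \<Longrightarrow> p - q \<in> vac_ideal"
  using vac_ideal.add[of p "- q"] vac_minus by simp

lemma vac_sum: "(\<And>x. x \<in> A \<Longrightarrow> f x \<in> vac_ideal) \<Longrightarrow> sum f A \<in> vac_ideal"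
  by (induction A rule: infinite_finite_induct) (auto intro: vac_ideal.intros)

subsection \<open>Congruences\<close>

text \<open>\<open>\<approx>\<close> is equality in the oscillator algebra and is compatible with
  multiplication on both sides; \<open>\<doteq>\<close> is equality after application to the vacuum
  and is compatible with left multiplication only.\<close>

definition eqt (infix "\<approx>" 50) where "p \<approx> q \<longleftrightarrow> p - q \<in> two_sided"
definition eqv (infix "\<doteq>" 50) where "p \<doteq> q \<longleftrightarrow> p - q \<in> vac_ideal"

lemma eqt_refl [simp]: "p \<approx> p" by (simp add: eqt_def two_sided.zero)
lemma eqt_sym: "p \<approx> q \<Longrightarrow> q \<approx> p" using two_minus by (force simp: eqt_def)
lemma eqt_trans [trans]: "p \<approx> q \<Longrightarrow> q \<approx> r \<Longrightarrow> p \<approx> r"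
  using two_sided.add[of "p - q" "q - r"] by (simp add: eqt_def)
lemma eqt_add: "p \<approx> q \<Longrightarrow> p' \<approx> q' \<Longrightarrow> p + p' \<approx> q + q'"
  using two_sided.add[of "p - q" "p' - q'"] by (simp add: eqt_def algebra_simps)
lemma eqt_diff: "p \<approx> q \<Longrightarrow> p' \<approx> q' \<Longrightarrow> p - p' \<approx> q - q'"
  using two_diff[of "p - q" "p' - q'"] by (simp add: eqt_def algebra_simps)
lemma eqt_scale: "p \<approx> q \<Longrightarrow> pm_scale c p \<approx> pm_scale c q"
  using two_scale[of "p - q" c] by (simp add: eqt_def pm.scale_right_diff_distrib)
lemma eqt_mult: "p \<approx> q \<Longrightarrow> a * p * b \<approx> a * q * b"
  using two_mult_left[OF two_mult_right, of "p - q" a b] by (simp add: eqt_def algebra_simps)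
lemma eqt_mult_left: "p \<approx> q \<Longrightarrow> a * p \<approx> a * q"
  using eqt_mult[of p q a 1] by simp
lemma eqt_mult_right: "p \<approx> q \<Longrightarrow> p * b \<approx> q * b"
  using eqt_mult[of p q 1 b] by simp
lemma eqt_sum: "(\<And>x. x \<in> A \<Longrightarrow> f x \<approx> h x) \<Longrightarrow> sum f A \<approx> sum h A"
  by (induction A rule: infinite_finite_induct) (auto intro: eqt_add)

lemma eqv_refl [simp]: "p \<doteq> p" by (simp add: eqv_def)
lemma eqv_sym: "p \<doteq> q \<Longrightarrow> q \<doteq> p" using vac_minus by (force simp: eqv_def)
lemma eqv_trans [trans]: "p \<doteq> q \<Longrightarrow> q \<doteq> r \<Longrightarrow> p \<doteq> r"
  using vac_ideal.add[of "p - q" "q - r"] by (simp add: eqv_def)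
lemma eqv_add: "p \<doteq> q \<Longrightarrow> p' \<doteq> q' \<Longrightarrow> p + p' \<doteq> q + q'"
  using vac_ideal.add[of "p - q" "p' - q'"] by (simp add: eqv_def algebra_simps)
lemma eqv_diff: "p \<doteq> q \<Longrightarrow> p' \<doteq> q' \<Longrightarrow> p - p' \<doteq> q - q'"
  using vac_diff[of "p - q" "p' - q'"] by (simp add: eqv_def algebra_simps)
lemma eqv_scale: "p \<doteq> q \<Longrightarrow> pm_scale c p \<doteq> pm_scale c q"
  using vac_scale[of "p - q" c] by (simp add: eqv_def pm.scale_right_diff_distrib)
lemma eqv_mult_left: "p \<doteq> q \<Longrightarrow> a * p \<doteq> a * q"
  using vac_mult[of "p - q" a] by (simp add: eqv_def algebra_simps)
lemma eqv_sum: "(\<And>x. x \<in> A \<Longrightarrow> f x \<doteq> h x) \<Longrightarrow> sum f A \<doteq> sum h A"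
  by (induction A rule: infinite_finite_induct) (auto intro: eqv_add)
lemma eqt_eqv: "p \<approx> q \<Longrightarrow> p \<doteq> q"
  by (simp add: eqt_def eqv_def vac_ideal.two)
lemma eqv_zero_iff: "p \<doteq> 0 \<longleftrightarrow> p \<in> vac_ideal"
  by (simp add: eqv_def)
lemma eqv_mem: "p \<doteq> q \<Longrightarrow> q \<in> vac_ideal \<Longrightarrow> p \<in> vac_ideal"
  using vac_ideal.add[of "p - q" q] by (simp add: eqv_def)
lemma eqv_ann: "ann l \<Longrightarrow> x * letter l \<doteq> 0"
  by (simp add: eqv_zero_iff vac_ideal.ann)

lemma swap_letters: "letter l * letter m \<approx> pm_scale (ksign (par l \<and> par m)) (letter m * letter l) + pm_scale (form l m) 1"
  using two_sided.ccr[of 1 l m 1] by (simp add: eqt_def ccr_def algebra_simps)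

lemma dead_zero: "\<not> live l \<Longrightarrow> letter l \<approx> 0"
  using two_sided.dead[of l 1 1] by (simp add: eqt_def)

definition pairing :: "('l \<Rightarrow>\<^sub>0 complex) \<Rightarrow> 'l \<Rightarrow> complex" where
  "pairing v m = (if live m then Poly_Mapping.lookup v (dual m) * g (dual m) else 0)"

lemma pairing_sum: "(\<Sum>k\<in>Poly_Mapping.keys v. Poly_Mapping.lookup v k * form k m) = pairing v m"
proof -
  have "(\<Sum>k\<in>Poly_Mapping.keys v. Poly_Mapping.lookup v k * form k m)
      = (\<Sum>k\<in>Poly_Mapping.keys v. if k = dual m then pairing v m else 0)"
    by (rule sum.cong) (auto simp: form_def pairing_def)
  also have "\<dots> = pairing v m"
    by (auto simp: pairing_def in_keys_iff)
  finally show ?thesis .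
qed

lemma swap_ell:
  assumes "hom i v"
  shows "ell v * letter m \<approx> pm_scale (ksign (i \<and> par m)) (letter m * ell v) + pm_scale (pairing v m) 1"
proof -
  have "ell v * letter m = (\<Sum>k\<in>Poly_Mapping.keys v. pm_scale (Poly_Mapping.lookup v k) (letter k * letter m))"
    by (simp add: ell_def pm_lin_def sum_distrib_right)
  also have "\<dots> \<approx> (\<Sum>k\<in>Poly_Mapping.keys v. pm_scale (Poly_Mapping.lookup v k)
      (pm_scale (ksign (par k \<and> par m)) (letter m * letter k) + pm_scale (form k m) 1))"
    by (intro eqt_sum eqt_scale swap_letters)
  also have "\<dots> = (\<Sum>k\<in>Poly_Mapping.keys v. pm_scale (ksign (i \<and> par m)) (pm_scale (Poly_Mapping.lookup v k) (letter m * letter k))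
      + pm_scale (Poly_Mapping.lookup v k * form k m) 1)"
    using assms by (intro sum.cong) (auto simp: hom_def pm.scale_right_distrib mult.commute)
  also have "\<dots> = pm_scale (ksign (i \<and> par m)) (letter m * ell v) + pm_scale (pairing v m) 1"
    by (simp add: sum.distrib ell_def pm_lin_def sum_distrib_left pm.scale_sum_right
        flip: pairing_sum pm.scale_sum_left)
  finally show ?thesis .
qed

subsection \<open>Infinitesimal symmetries of the form\<close>

definition cre :: "('l \<Rightarrow>\<^sub>0 complex) \<Rightarrow> ('l \<Rightarrow>\<^sub>0 complex)" where
  "cre = pm_lin (\<lambda>m. if ann m then 0 else Poly_Mapping.single m 1)"

lemma lookup_cre [simp]: "Poly_Mapping.lookup (cre v) m = (if ann m then 0 else Poly_Mapping.lookup v m)"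
proof -
  have "Poly_Mapping.lookup (cre v) m = (\<Sum>k\<in>Poly_Mapping.keys v. if k = m then (if ann m then 0 else Poly_Mapping.lookup v m) else 0)"
    unfolding cre_def lookup_pm_lin by (rule sum.cong) (auto simp: lookup_single when_def)
  then show ?thesis by (auto simp: in_keys_iff)
qed

lemma ell_cre: "x * ell v \<doteq> x * ell (cre v)"
proof -
  have "ell (cre v) = (\<Sum>k\<in>Poly_Mapping.keys v. pm_scale (Poly_Mapping.lookup v k) (if ann k then 0 else letter k))"
    unfolding ell_def cre_def pm_lin_comp by (simp add: pm_lin_def if_distrib cong: if_cong)
  moreover have "ell v = (\<Sum>k\<in>Poly_Mapping.keys v. pm_scale (Poly_Mapping.lookup v k) (letter k))"
    by (simp add: ell_def pm_lin_def)
  ultimately show ?thesis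
    by (auto simp: sum_distrib_left eqv_zero_iff vac_ideal.ann intro!: eqv_sum eqv_scale)
qed

definition supp :: "('l \<Rightarrow> 'l \<Rightarrow>\<^sub>0 complex) \<Rightarrow> 'l set" where
  "supp A = {l. ann l \<and> live l \<and> cre (A l) \<noteq> 0}"

text \<open>
  Infinitesimal symmetries of the form with only finitely many matrix coefficients from annihilators
  to creators, as needed for the vacuum to have an image.
\<close>

definition osp :: "bool \<Rightarrow> ('l \<Rightarrow> 'l \<Rightarrow>\<^sub>0 complex) \<Rightarrow> bool" where
  "osp i A \<longleftrightarrow> hmap i A \<and> (\<forall>l. \<forall>m\<in>Poly_Mapping.keys (A l). live m = live l)
     \<and> (\<forall>l m. live l \<longrightarrow> live m \<longrightarrow> pairing (A l) m = ksign (par l \<and> par m) * pairing (A m) l)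
     \<and> finite (supp A)"

lemma osp_pairing:
  assumes "osp i A"
  shows "pairing (A l) m = ksign (par l \<and> par m) * pairing (A m) l"
proof (cases "live l \<and> live m")
  case True
  then show ?thesis using assms unfolding osp_def by blast
next
  case False
  have lv: "live m = live l" if "m \<in> Poly_Mapping.keys (A l)" for l m
    using assms that unfolding osp_def by blast
  have "Poly_Mapping.lookup (A l) (dual m) = 0" if "live l \<noteq> live m"
    using lv that by (metis in_keys_iff live_dual)
  moreover have "Poly_Mapping.lookup (A m) (dual l) = 0" if "live l \<noteq> live m"
    using lv that by (metis in_keys_iff live_dual)
  ultimately show ?thesis using False by (auto simp: pairing_def)
qed

lemma sig_two: "p \<in> two_sided \<Longrightarrow> sig i p \<in> two_sided"
proof (induction rule: two_sided.induct)
  case (ccr x l m y)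
  have "form l m = ksign (i \<and> par l) * ksign (i \<and> par m) * form l m"
    by (auto simp: form_def ksign_def)
  then have "sig i (ccr l m) = pm_scale (ksign (i \<and> par l) * ksign (i \<and> par m)) (ccr l m)"
    by (simp add: ccr_def pm.scale_right_diff_distrib) (simp add: mult_ac)
  then show ?case by (auto intro!: two_sided.ccr two_scale)
next
  case (dead l x y)
  then show ?case by (auto intro!: two_sided.dead two_scale)
qed (auto intro: two_sided.intros)

lemma ell_dead:
  assumes "\<And>m. m \<in> Poly_Mapping.keys v \<Longrightarrow> \<not> live m"
  shows "ell v \<in> two_sided"
  unfolding ell_def pm_lin_def
  by (intro two_sum two_scale) (use assms dead_zero in \<open>auto simp: eqt_def\<close>)

text \<open>Differentiating a commutation relation leaves two pairings, and these cancel exactly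
  when \<open>A\<close> is an infinitesimal symmetry of the form.\<close>

lemma der_ccr:
  assumes A: "osp i A"
  shows "der i A (ccr l m) \<in> two_sided"
proof -
  have h: "hom (i \<noteq> par l) (A l)" "hom (i \<noteq> par m) (A m)"
    using A unfolding osp_def hmap_def by blast+
  let ?s = "ksign (par l \<and> par m)"
  have "der i A (ccr l m) =
      (ell (A l) * letter m - pm_scale (ksign ((i \<noteq> par l) \<and> par m)) (letter m * ell (A l)))
      - pm_scale ?s (ell (A m) * letter l - pm_scale (ksign ((i \<noteq> par m) \<and> par l)) (letter l * ell (A m)))"
    by (simp add: ccr_def der_mult pm.scale_right_diff_distrib pm.scale_right_distrib)
       (auto simp: ksign_def)
  also have "\<dots> \<approx> pm_scale (pairing (A l) m) 1 - pm_scale ?s (pm_scale (pairing (A m) l) 1)"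
    using swap_ell[OF h(1), of m] swap_ell[OF h(2), of l]
    by (intro eqt_diff eqt_scale) (simp_all add: eqt_def algebra_simps)
  also have "\<dots> = 0"
    using osp_pairing[OF A, of l m] by simp
  finally show ?thesis by (simp add: eqt_def)
qed

lemma two_mult: "p \<in> two_sided \<Longrightarrow> a * p * b \<in> two_sided"
  by (intro two_mult_right two_mult_left)

lemma der_two:
  assumes A: "osp i A" and "p \<in> two_sided"
  shows "der i A p \<in> two_sided"
proof -
  have *: "der i A (x * r * y) \<in> two_sided"
    if r: "r \<in> two_sided" "der i A r \<in> two_sided" for x r y
  proof -
    have "der i A (x * r * y) = der i A x * r * y + sig i x * der i A r * y + sig i x * sig i r * der i A y"
      by (simp add: der_mult distrib_right)
    then show ?thesis
      using two_mult[OF r(1)] two_mult[OF r(2)] two_mult[OF sig_two[OF r(1)]]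
      by (simp add: two_sided.add)
  qed
  show ?thesis
    using assms(2)
  proof (induction rule: two_sided.induct)
    case (ccr x l m y)
    show ?case
      using two_sided.ccr[of 1 l m 1] der_ccr[OF A] by (intro *) simp_all
  next
    case (dead l x y)
    have "ell (A l) \<in> two_sided"
      by (rule ell_dead) (use A dead in \<open>unfold osp_def, blast\<close>)
    then show ?case
      using two_sided.dead[of l 1 1] dead by (intro *) simp_all
  qed (auto intro: two_sided.intros)
qed

end

section \<open>The image of the vacuum\<close>

context oscillator begin

lemma osp_hom: "osp i A \<Longrightarrow> hom (i \<noteq> par l) (A l)"
  unfolding osp_def hmap_def by blast

lemma osp_hmap: "osp i A \<Longrightarrow> hmap i A"
  unfolding osp_def by blast

lemma osp_live: "osp i A \<Longrightarrow> m \<in> Poly_Mapping.keys (A l) \<Longrightarrow> live m = live l"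
  unfolding osp_def by blast

lemma osp_finite: "osp i A \<Longrightarrow> finite (supp A)"
  unfolding osp_def by blast

lemma hom_cre: "hom i v \<Longrightarrow> hom i (cre v)"
  by (auto simp: hom_def in_keys_iff split: if_splits)

lemma keys_cre: "Poly_Mapping.keys (cre v) = {m \<in> Poly_Mapping.keys v. \<not> ann m}"
  by (auto simp: in_keys_iff split: if_splits)

lemma cre_simps [simp]: "cre (v + w) = cre v + cre w" "cre (pm_scale c v) = pm_scale c (cre v)" "cre 0 = 0"
  by (simp_all add: cre_def pm_lin_add pm_lin_scale)

text \<open>
  The image of the vacuum: the quadratic element in the creators for which the operator extending
  \<open>A\<close> respects the relations that annihilators kill the vacuum.
\<close>

definition vac_image :: "('l \<Rightarrow> 'l \<Rightarrow>\<^sub>0 complex) \<Rightarrow> 'l free" where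
  "vac_image A = (\<Sum>l\<in>supp A. pm_scale (g (dual l) / 2) (ell (cre (A l)) * letter (dual l)))"

lemma vac_image_superset:
  assumes "finite J" "supp A \<subseteq> J" "J \<subseteq> {l. ann l \<and> live l}"
  shows "vac_image A = (\<Sum>l\<in>J. pm_scale (g (dual l) / 2) (ell (cre (A l)) * letter (dual l)))"
  unfolding vac_image_def
  by (rule sum.mono_neutral_left) (use assms in \<open>auto simp: supp_def\<close>)

text \<open>Moving the annihilator \<open>k\<close> to the vacuum through a product of two letters
  leaves one contraction with each factor, and the uncontracted term vanishes.\<close>

lemma ann_step:
  assumes "hom i v" "ann k" "live k"
  shows "letter k * ell (cre v) * letter d \<doteq>
    pm_scale (Poly_Mapping.lookup v (dual k) * g k) (letter d)
     + pm_scale (ksign (par k \<and> i) * form k d) (ell (cre v))"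
proof -
  let ?c = "ell (cre v)" and ?s = "ksign (par k \<and> i)" and ?t = "ksign (par k \<and> par d)"
  have pk: "pairing (cre v) k = Poly_Mapping.lookup v (dual k) * g (dual k)"
    using assms by (simp add: pairing_def)
  have "letter k * ?c \<approx> pm_scale ?s (?c * letter k - pm_scale (pairing (cre v) k) 1)"
  proof -
    have "?c * letter k - pm_scale (pairing (cre v) k) 1 \<approx> pm_scale ?s (letter k * ?c)"
      using swap_ell[OF hom_cre[OF assms(1)], of k]
      by (simp add: eqt_def algebra_simps conj_commute)
    from eqt_sym[OF eqt_scale[OF this, of ?s]] show ?thesis
      by simp
  qed
  from eqt_mult_right[OF this, of "letter d"]
  have 1: "letter k * ?c * letter d \<approx> pm_scale ?s (?c * (letter k * letter d)) - pm_scale (?s * pairing (cre v) k) (letter d)"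
    by (simp add: left_diff_distrib mult.assoc pm.scale_right_diff_distrib)
  have 2: "?c * (letter k * letter d) \<approx> ?c * (pm_scale ?t (letter d * letter k) + pm_scale (form k d) 1)"
    by (intro eqt_mult_left swap_letters)
  have 3: "?c * (pm_scale ?t (letter d * letter k) + pm_scale (form k d) 1) \<doteq> pm_scale (form k d) ?c"
    using eqv_ann[OF \<open>ann k\<close>, of "pm_scale ?t (?c * letter d)"]
    by (simp add: eqv_def distrib_left mult.assoc)
  have 4: "letter k * ?c * letter d \<doteq> pm_scale ?s (pm_scale (form k d) ?c) - pm_scale (?s * pairing (cre v) k) (letter d)"
    using eqt_eqv[OF 1] eqv_diff[OF eqv_scale[OF eqv_trans[OF eqt_eqv[OF 2] 3], of ?s] eqv_refl]
    by (rule eqv_trans)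
  have "Poly_Mapping.lookup v (dual k) * (- (?s * g (dual k))) = Poly_Mapping.lookup v (dual k) * g k"
  proof (cases "Poly_Mapping.lookup v (dual k) = 0")
    case False
    then have "par k = i"
      using assms(1) unfolding hom_def by (metis in_keys_iff par_dual)
    then show ?thesis by (auto simp: g_dual ksign_def)
  qed simp
  then have "- (?s * pairing (cre v) k) = Poly_Mapping.lookup v (dual k) * g k"
    by (simp add: pk mult_ac)
  then have "- pm_scale (?s * pairing (cre v) k) (letter d) = pm_scale (Poly_Mapping.lookup v (dual k) * g k) (letter d)"
    by (metis pm.scale_minus_left)
  then show ?thesis
    using 4 unfolding diff_conv_add_uminus by (simp only: pm.scale_scale add.commute)
qed

text \<open>By the symmetry of \<open>A\<close>, contracting \<open>letter k\<close> with either
  factor of \<open>vac_image A\<close> gives the same vector. The factor \<open>1 / 2\<close> in the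
  definition makes the two contributions add up to \<open>- ell (cre (A k))\<close>, which cancels
  what \<open>ell (A k)\<close> leaves on the vacuum.\<close>

lemma vac_image_ann:
  assumes A: "osp i A" and k: "ann k"
  shows "ell (A k) + sig i (letter k) * vac_image A \<in> vac_ideal"
proof (cases "live k")
  case False
  have "ell (A k) \<in> two_sided"
    by (rule ell_dead) (use osp_live[OF A] False in blast)
  moreover have "letter k * vac_image A \<in> two_sided"
    using two_sided.dead[of k 1] False by simp
  ultimately show ?thesis
    by (simp add: vac_ideal.intros two_scale)
next
  case True
  \<comment> \<open>The contraction with the second factor selects the term \<open>l = k\<close>, so
    \<open>k\<close> is added to the index set even when \<open>cre (A k) = 0\<close>.\<close>
  let ?J = "insert k (supp A)" and ?s = "ksign (i \<and> par k)"
  have J: "finite ?J" "supp A \<subseteq> ?J" "?J \<subseteq> {l. ann l \<and> live l}"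
    using osp_finite[OF A] k True by (auto simp: supp_def)
  have "letter k * vac_image A = (\<Sum>l\<in>?J. pm_scale (g (dual l) / 2) (letter k * ell (cre (A l)) * letter (dual l)))"
    by (simp add: vac_image_superset[OF J] sum_distrib_left mult.assoc)
  moreover have "(\<Sum>l\<in>?J. pm_scale (g (dual l) / 2) (letter k * ell (cre (A l)) * letter (dual l))) \<doteq>
    (\<Sum>l\<in>?J. pm_scale (g (dual l) / 2)
      (pm_scale (Poly_Mapping.lookup (A l) (dual k) * g k) (letter (dual l))
     + pm_scale (ksign (par k \<and> (i \<noteq> par l)) * form k (dual l)) (ell (cre (A l)))))"
    by (rule eqv_sum, rule eqv_scale, rule ann_step[OF osp_hom[OF A] k True])
  moreover have "(\<Sum>l\<in>?J. pm_scale (g (dual l) / 2)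
      (pm_scale (Poly_Mapping.lookup (A l) (dual k) * g k) (letter (dual l))
     + pm_scale (ksign (par k \<and> (i \<noteq> par l)) * form k (dual l)) (ell (cre (A l)))))
    = (\<Sum>l\<in>?J. pm_scale (- ?s / 2 * Poly_Mapping.lookup (A k) (dual l)) (letter (dual l)))
      + (\<Sum>l\<in>?J. if l = k then pm_scale (- ?s / 2) (ell (cre (A k))) else 0)"
  proof (rule trans[OF sum.cong[OF refl] sum.distrib])
    fix l assume l: "l \<in> ?J"
    then have ll: "live l" "ann l" using J by auto
    have "Poly_Mapping.lookup (A l) (dual k) * g (dual k) = ksign (par l \<and> par k) * (Poly_Mapping.lookup (A k) (dual l) * g (dual l))"
      using osp_pairing[OF A, of l k] ll True by (simp add: pairing_def)
    then have "Poly_Mapping.lookup (A l) (dual k) * g k = - ksign (par k) * ksign (par l \<and> par k) * (Poly_Mapping.lookup (A k) (dual l) * g (dual l))"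
      by (auto simp: g_dual ksign_def split: if_splits) (metis minus_minus)+
    moreover have "par l = (i \<noteq> par k)" if "Poly_Mapping.lookup (A k) (dual l) \<noteq> 0"
      using osp_hom[OF A, of k] that unfolding hom_def by (metis in_keys_iff par_dual)
    ultimately have "g (dual l) / 2 * (Poly_Mapping.lookup (A l) (dual k) * g k) = - ?s / 2 * Poly_Mapping.lookup (A k) (dual l)"
      by (cases "Poly_Mapping.lookup (A k) (dual l) = 0") (auto simp: ksign_def mult.left_commute)
    then have 1: "pm_scale (g (dual l) / 2) (pm_scale (Poly_Mapping.lookup (A l) (dual k) * g k) (letter (dual l)))
      = pm_scale (- ?s / 2 * Poly_Mapping.lookup (A k) (dual l)) (letter (dual l))"
      by simp
    have 2: "pm_scale (g (dual l) / 2) (pm_scale (ksign (par k \<and> (i \<noteq> par l)) * form k (dual l)) (ell (cre (A l))))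
      = (if l = k then pm_scale (- ?s / 2) (ell (cre (A k))) else 0)"
      using True by (auto simp: form_def g_dual ksign_def dual_eq_iff)
    show "pm_scale (g (dual l) / 2)
      (pm_scale (Poly_Mapping.lookup (A l) (dual k) * g k) (letter (dual l))
     + pm_scale (ksign (par k \<and> (i \<noteq> par l)) * form k (dual l)) (ell (cre (A l))))
     = pm_scale (- ?s / 2 * Poly_Mapping.lookup (A k) (dual l)) (letter (dual l))
      + (if l = k then pm_scale (- ?s / 2) (ell (cre (A k))) else 0)"
      unfolding pm.scale_right_distrib 1 2 ..
  qed
  moreover have "(\<Sum>l\<in>?J. if l = k then pm_scale (- ?s / 2) (ell (cre (A k))) else 0) = pm_scale (- ?s / 2) (ell (cre (A k)))"
    using J(1) by simp
  moreover have "(\<Sum>l\<in>?J. pm_scale (- ?s / 2 * Poly_Mapping.lookup (A k) (dual l)) (letter (dual l)))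
      = pm_scale (- ?s / 2) (ell (cre (A k)))"
  proof -
    have "ell (cre (A k)) = (\<Sum>m\<in>dual ` ?J. pm_scale (Poly_Mapping.lookup (cre (A k)) m) (letter m))"
      unfolding ell_def
    proof (rule pm_lin_superset)
      \<comment> \<open>A creator \<open>m\<close> occurring in \<open>A k\<close> forces, by
        symmetry, the creator \<open>dual k\<close> to occur in the image of the annihilator
        \<open>dual m\<close>; hence \<open>supp A\<close> already lists every such
        \<open>dual m\<close>.\<close>
      show "Poly_Mapping.keys (cre (A k)) \<subseteq> dual ` ?J"
      proof
        fix m assume m: "m \<in> Poly_Mapping.keys (cre (A k))"
        then have m': "\<not> ann m" "live m" "Poly_Mapping.lookup (A k) m \<noteq> 0"
          using osp_live[OF A, of m k] True by (auto simp: keys_cre in_keys_iff)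
        have "pairing (A k) (dual m) \<noteq> 0"
          using m' by (simp add: pairing_def) (metis g_sq mult_zero_left zero_neq_one)
        then have "pairing (A (dual m)) k \<noteq> 0"
          using osp_pairing[OF A, of k "dual m"] by auto
        then have "Poly_Mapping.lookup (cre (A (dual m))) (dual k) \<noteq> 0"
          using k by (auto simp: pairing_def split: if_splits)
        then have "cre (A (dual m)) \<noteq> 0"
          by (metis lookup_zero)
        then have "dual m \<in> supp A"
          using m' by (simp add: supp_def)
        then show "m \<in> dual ` ?J" by (metis dual_dual image_eqI insertCI)
      qed
    qed (use J in auto)
    also have "\<dots> = (\<Sum>l\<in>?J. pm_scale (Poly_Mapping.lookup (cre (A k)) (dual l)) (letter (dual l)))"
      by (rule sum.reindex_cong[of dual]) (auto intro!: inj_onI simp: dual_eq_iff)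
    also have "\<dots> = (\<Sum>l\<in>?J. pm_scale (Poly_Mapping.lookup (A k) (dual l)) (letter (dual l)))"
      using J by (intro sum.cong) auto
    finally show ?thesis
      by (simp add: pm.scale_sum_right)
  qed
  ultimately have "letter k * vac_image A \<doteq> pm_scale (- ?s / 2) (ell (cre (A k))) + pm_scale (- ?s / 2) (ell (cre (A k)))"
    by argo
  moreover have "- ?s / 2 + - ?s / 2 = - ?s" by (simp add: ksign_def)
  ultimately have "letter k * vac_image A \<doteq> pm_scale (- ?s) (ell (cre (A k)))"
    by (simp only: pm.scale_left_distrib[symmetric])
  from eqv_scale[OF this, of ?s] have "sig i (letter k) * vac_image A \<doteq> - ell (cre (A k))"
    by simp
  from eqv_add[OF ell_cre[of 1 "A k"] this] show ?thesis
    by (simp add: eqv_zero_iff)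
qed

subsection \<open>The representation\<close>

text \<open>A superderivation kills \<open>1\<close>; the second term prescribes the value on the
  vacuum. By \<open>rho_mult\<close> the commutator with left multiplications is still that of the
  superderivation.\<close>

definition rho :: "bool \<Rightarrow> ('l \<Rightarrow> 'l \<Rightarrow>\<^sub>0 complex) \<Rightarrow> 'l free \<Rightarrow> 'l free" where
  "rho i A p = der i A p + sig i p * vac_image A"

lemma rho_simps [simp]: "rho i A 0 = 0" "rho i A (p + q) = rho i A p + rho i A q"
  "rho i A (p - q) = rho i A p - rho i A q" "rho i A (pm_scale c p) = pm_scale c (rho i A p)"
  by (simp_all add: rho_def algebra_simps pm.scale_right_distrib)

lemma rho_mult: "rho i A (x * p) = der i A x * p + sig i x * rho i A p"
  by (simp add: rho_def der_mult algebra_simps)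

text \<open>The operator descends to the Fock space: on the two-sided part because \<open>A\<close>
  preserves the form, on the annihilators by the choice of \<open>vac_image\<close>.\<close>

lemma rho_vac:
  assumes A: "osp i A" and "p \<in> vac_ideal"
  shows "rho i A p \<in> vac_ideal"
  using assms(2)
proof (induction rule: vac_ideal.induct)
  case (two p)
  then show ?case
    unfolding rho_def
    by (intro vac_ideal.two two_sided.add der_two[OF A] two_mult_right sig_two)
next
  case (ann l x)
  have "rho i A (letter l) \<in> vac_ideal"
    using vac_image_ann[OF A ann] by (simp add: rho_def)
  then show ?case
    unfolding rho_mult by (intro vac_ideal.add vac_mult vac_ideal.ann ann)
qed (simp add: vac_ideal.add)

text \<open>Consists of explicit polynomials in creators and not of classes, because
  \<open>sig\<close> and the counting of factors refer to representatives. The index is the total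
  parity.\<close>

inductive_set quad :: "bool \<Rightarrow> 'l free set" for i where
  zero: "0 \<in> quad i"
| add: "p \<in> quad i \<Longrightarrow> q \<in> quad i \<Longrightarrow> p + q \<in> quad i"
| prod: "\<not> ann a \<Longrightarrow> \<not> ann b \<Longrightarrow> (par a \<noteq> par b) = i \<Longrightarrow> pm_scale c (letter a * letter b) \<in> quad i"

lemma quad_scale: "p \<in> quad i \<Longrightarrow> pm_scale c p \<in> quad i"
proof (induction rule: quad.induct)
  case (prod a b d)
  then show ?case using quad.prod[of a b i "c * d"] by simp
qed (auto simp: pm.scale_right_distrib intro: quad.intros)

lemma quad_diff: "p \<in> quad i \<Longrightarrow> q \<in> quad i \<Longrightarrow> p - q \<in> quad i"
  using quad.add[of p i "pm_scale (-1) q"] quad_scale[of q i "-1"] by simp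

lemma quad_sum: "(\<And>x. x \<in> X \<Longrightarrow> f x \<in> quad i) \<Longrightarrow> sum f X \<in> quad i"
  by (induction X rule: infinite_finite_induct) (auto intro: quad.intros)

lemma quad_ell_letter: "hom j v \<Longrightarrow> \<not> ann b \<Longrightarrow> (j \<noteq> par b) = i \<Longrightarrow> ell (cre v) * letter b \<in> quad i"
  unfolding ell_def pm_lin_def sum_distrib_right
  by (intro quad_sum) (auto simp: keys_cre hom_def intro!: quad.prod)

lemma quad_letter_ell: "hom j v \<Longrightarrow> \<not> ann b \<Longrightarrow> (j \<noteq> par b) = i \<Longrightarrow> letter b * ell (cre v) \<in> quad i"
  unfolding ell_def pm_lin_def sum_distrib_left
  by (intro quad_sum) (auto simp: keys_cre hom_def intro!: quad.prod)

lemma quad_vac_image: "osp i A \<Longrightarrow> vac_image A \<in> quad i"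
  unfolding vac_image_def
  by (intro quad_sum quad_scale quad_ell_letter, rule osp_hom) (auto simp: supp_def)

lemma sig_quad: "p \<in> quad i \<Longrightarrow> sig j p = pm_scale (ksign (i \<and> j)) p"
  by (induction rule: quad.induct) (auto simp: pm.scale_right_distrib ksign_def)

definition scom :: "bool \<Rightarrow> bool \<Rightarrow> 'l free \<Rightarrow> 'l free \<Rightarrow> bool" where
  "scom i j p q \<longleftrightarrow> p * q \<approx> pm_scale (ksign (i \<and> j)) (q * p)"

lemma scom_sym: "scom i j p q \<Longrightarrow> scom j i q p"
  unfolding scom_def using eqt_sym[OF eqt_scale[of "p * q" "pm_scale (ksign (i \<and> j)) (q * p)" "ksign (i \<and> j)"]]
  by (simp add: conj_commute)

lemma scom_mult:
  assumes "scom i j p q" "scom i k p r"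
  shows "scom i (j \<noteq> k) p (q * r)"
proof -
  have "p * q * r \<approx> pm_scale (ksign (i \<and> j)) (q * (p * r))"
    using eqt_mult_right[OF assms(1)[unfolded scom_def], of r] by (simp add: mult.assoc)
  also have "\<dots> \<approx> pm_scale (ksign (i \<and> j)) (q * pm_scale (ksign (i \<and> k)) (r * p))"
    by (intro eqt_scale eqt_mult_left assms(2)[unfolded scom_def])
  finally show ?thesis
    by (auto simp: scom_def mult.assoc ksign_def split: if_splits)
qed

text \<open>The dual of a creator is an annihilator, so the form vanishes on two creators.\<close>

lemma scom_letters: "\<not> ann a \<Longrightarrow> \<not> ann b \<Longrightarrow> scom (par a) (par b) (letter a) (letter b)"
  using swap_letters[of a b] by (auto simp: scom_def form_def split: if_splits)

lemma scom_zero: "scom i j p 0" "scom i j 0 p"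
  by (simp_all add: scom_def)

lemma scom_add: "scom i j p q \<Longrightarrow> scom i j p r \<Longrightarrow> scom i j p (q + r)"
  unfolding scom_def using eqt_add[of "p * q" "pm_scale (ksign (i \<and> j)) (q * p)" "p * r" "pm_scale (ksign (i \<and> j)) (r * p)"]
  by (simp add: algebra_simps pm.scale_right_distrib)

lemma scom_scale: "scom i j p q \<Longrightarrow> scom i j p (pm_scale c q)"
  unfolding scom_def using eqt_scale[of "p * q" "pm_scale (ksign (i \<and> j)) (q * p)" c] by (simp add: mult.commute)

lemma scom_letter_quad:
  assumes "q \<in> quad j" "\<not> ann a"
  shows "scom (par a) j (letter a) q"
  using assms(1)
proof induction
  case (prod b c d)
  from prod(3) have j: "j = (par b \<noteq> par c)" by simp
  show ?case unfolding j
    by (intro scom_scale scom_mult scom_letters assms(2) prod(1,2))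
qed (auto intro: scom_zero scom_add)

lemma scom_quad:
  assumes "p \<in> quad i" "q \<in> quad j"
  shows "scom i j p q"
proof (rule scom_sym, use assms(1) in induction)
  case (prod b c d)
  from prod(3) have i: "i = (par b \<noteq> par c)" by simp
  show ?case unfolding i
    by (intro scom_scale scom_mult scom_sym[OF scom_letter_quad] assms(2) prod(1,2))
qed (auto intro: scom_zero scom_add)

end

section \<open>Normal ordering and the anomaly of the bracket\<close>

context oscillator begin

text \<open>Normal ordering on the vacuum: the annihilators in \<open>v\<close> move past
  \<open>d\<close> and die, and the single letter dual to \<open>d\<close> leaves a scalar.\<close>

lemma ell_letter_vac:
  assumes "hom i v" "\<not> ann d" "live d"
  shows "ell v * letter d \<doteq> ell (cre v) * letter d + pm_scale (Poly_Mapping.lookup v (dual d) * g (dual d)) 1"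
proof -
  let ?w = "v - cre v"
  have "hom i ?w"
    using assms(1) by (auto simp: hom_def in_keys_iff lookup_minus split: if_splits)
  from swap_ell[OF this, of d]
  have 1: "ell ?w * letter d \<doteq> pm_scale (ksign (i \<and> par d)) (letter d * ell ?w) + pm_scale (pairing ?w d) 1"
    by (rule eqt_eqv)
  have "cre ?w = 0"
    by (rule poly_mapping_eqI) (simp add: lookup_minus)
  then have "letter d * ell ?w \<doteq> 0"
    using ell_cre[of "letter d" ?w] by simp
  from eqv_add[OF eqv_scale[OF this] eqv_refl]
  have 2: "pm_scale (ksign (i \<and> par d)) (letter d * ell ?w) + pm_scale (pairing ?w d) 1 \<doteq> pm_scale (pairing ?w d) 1"
    by simp
  have "pairing ?w d = Poly_Mapping.lookup v (dual d) * g (dual d)"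
    using assms by (simp add: pairing_def lookup_minus)
  with eqv_trans[OF 1 2] show ?thesis
    by (simp add: eqv_def algebra_simps)
qed

text \<open>The supertrace over annihilators of \<open>A\<close> after the creator part of
  \<open>B\<close>. It is a finite sum because only the annihilators in \<open>supp B\<close>
  contribute.\<close>

definition tr :: "('l \<Rightarrow> 'l \<Rightarrow>\<^sub>0 complex) \<Rightarrow> ('l \<Rightarrow> 'l \<Rightarrow>\<^sub>0 complex) \<Rightarrow> complex" where
  "tr A B = (\<Sum>l\<in>supp B. ksign (par l) * Poly_Mapping.lookup (ext A (cre (B l))) l)"

text \<open>A super analogue of the standard 2-cocycle on infinite matrices that cut the space into
  two halves; the factor \<open>1 / 2\<close> is inherited from \<open>vac_image\<close>.\<close>

definition anomaly :: "bool \<Rightarrow> bool \<Rightarrow> ('l \<Rightarrow> 'l \<Rightarrow>\<^sub>0 complex) \<Rightarrow> ('l \<Rightarrow> 'l \<Rightarrow>\<^sub>0 complex) \<Rightarrow> complex" where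
  "anomaly i j A B = - (tr A B - ksign (i \<and> j) * tr B A) / 2"

lemma hom_ext:
  assumes "hmap i A" "hom j v"
  shows "hom (i \<noteq> j) (ext A v)"
  unfolding hom_def
proof
  fix m assume "m \<in> Poly_Mapping.keys (ext A v)"
  then have "Poly_Mapping.lookup (ext A v) m \<noteq> 0" by (simp add: in_keys_iff)
  then obtain k where "k \<in> Poly_Mapping.keys v" "Poly_Mapping.lookup (A k) m \<noteq> 0"
    unfolding ext_def lookup_pm_lin by (metis (no_types, lifting) mult_zero_right sum.not_neutral_contains_not_neutral)
  then show "par m = (i \<noteq> j)"
    using assms by (auto simp: hmap_def hom_def in_keys_iff)
qed

lemma hom_single: "hom (par a) (Poly_Mapping.single a c)"
  by (simp add: hom_def)

text \<open>Applying \<open>A\<close> to a product of two creators may produce an annihilator in the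
  first factor; bringing the result into normal order creates the scalars that sum to the
  supertrace.\<close>

lemma der_vac_image:
  assumes A: "osp i A" and B: "osp j B"
  obtains Z where "Z \<in> quad (i \<noteq> j)" "der i A (vac_image B) \<doteq> Z + pm_scale (- tr A B / 2) 1"
proof
  let ?c = "\<lambda>l. cre (B l)"
  let ?f = "\<lambda>l. ell (cre (ext A (?c l))) * letter (dual l)
          + pm_scale (ksign (i \<and> (j \<noteq> par l))) (ell (?c l) * ell (cre (A (dual l))))"
  show "(\<Sum>l\<in>supp B. pm_scale (g (dual l) / 2) (?f l)) \<in> quad (i \<noteq> j)"
  proof (intro quad_sum quad_scale quad.add)
    fix l assume l: "l \<in> supp B"
    then have na: "\<not> ann (dual l)" by (simp add: supp_def)
    have h: "hom (j \<noteq> par l) (?c l)" by (intro hom_cre osp_hom[OF B])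
    show "ell (cre (ext A (?c l))) * letter (dual l) \<in> quad (i \<noteq> j)"
      by (rule quad_ell_letter[OF hom_ext[OF osp_hmap[OF A] h]]) (use na in auto)
    have "ell (?c l) * ell (cre (A (dual l)))
      = (\<Sum>k\<in>Poly_Mapping.keys (?c l). pm_scale (Poly_Mapping.lookup (?c l) k) (letter k * ell (cre (A (dual l)))))"
      by (simp add: ell_def pm_lin_def sum_distrib_right)
    also have "\<dots> \<in> quad (i \<noteq> j)"
    proof (intro quad_sum quad_scale)
      fix k assume "k \<in> Poly_Mapping.keys (?c l)"
      then have "\<not> ann k" "par k = (j \<noteq> par l)"
        using h by (auto simp: keys_cre hom_def)
      then show "letter k * ell (cre (A (dual l))) \<in> quad (i \<noteq> j)"
        by (intro quad_letter_ell[OF osp_hom[OF A]]) auto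
    qed
    finally show "ell (?c l) * ell (cre (A (dual l))) \<in> quad (i \<noteq> j)" .
  qed
  have e1: "der i A (vac_image B) \<doteq> (\<Sum>l\<in>supp B. pm_scale (g (dual l) / 2)
      (?f l + pm_scale (Poly_Mapping.lookup (ext A (?c l)) l * g l) 1))"
    unfolding vac_image_def der_simps
  proof (rule eqv_sum, rule eqv_scale)
    fix l assume l: "l \<in> supp B"
    then have na: "\<not> ann (dual l)" "live (dual l)" by (simp_all add: supp_def)
    have h: "hom (j \<noteq> par l) (?c l)" by (intro hom_cre osp_hom[OF B])
    have "der i A (ell (?c l) * letter (dual l)) = ell (ext A (?c l)) * letter (dual l)
       + pm_scale (ksign (i \<and> (j \<noteq> par l))) (ell (?c l) * ell (A (dual l)))"
      by (simp add: der_mult der_ell sig_ell[OF h])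
    moreover have 2: "ell (ext A (?c l)) * letter (dual l) \<doteq> ell (cre (ext A (?c l))) * letter (dual l)
      + pm_scale (Poly_Mapping.lookup (ext A (?c l)) l * g l) 1"
      using ell_letter_vac[OF hom_ext[OF osp_hmap[OF A] h] na] by simp
    moreover have 3: "pm_scale (ksign (i \<and> (j \<noteq> par l))) (ell (?c l) * ell (A (dual l))) \<doteq>
        pm_scale (ksign (i \<and> (j \<noteq> par l))) (ell (?c l) * ell (cre (A (dual l))))"
      by (intro eqv_scale ell_cre)
    ultimately show "der i A (ell (?c l) * letter (dual l)) \<doteq> ?f l + pm_scale (Poly_Mapping.lookup (ext A (?c l)) l * g l) 1"
      using eqv_add[OF 2 3] by (simp add: eqv_def algebra_simps)
  qed
  have e2: "(\<Sum>l\<in>supp B. pm_scale (g (dual l) / 2) (?f l + pm_scale (Poly_Mapping.lookup (ext A (?c l)) l * g l) 1))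
    = (\<Sum>l\<in>supp B. pm_scale (g (dual l) / 2) (?f l)) + pm_scale (- tr A B / 2) 1"
  proof -
    \<comment> \<open>The sign of the supertrace originates here, from
      \<open>g (dual l) * g l = - ksign (par l)\<close>.\<close>
    have "g (dual l) / 2 * (x * g l) = - (ksign (par l) * x) / 2 * (g l * g l)" for l x
      by (simp add: g_dual)
    then have "pm_scale (g (dual l) / 2) (pm_scale (Poly_Mapping.lookup (ext A (?c l)) l * g l) (1 :: 'l free))
       = pm_scale (- (ksign (par l) * Poly_Mapping.lookup (ext A (?c l)) l) / 2) 1" for l
      by simp
    then show ?thesis
      by (simp only: pm.scale_right_distrib sum.distrib tr_def)
         (simp add: sum_negf sum_divide_distrib flip: pm.scale_sum_left)
  qed
  show "der i A (vac_image B) \<doteq> (\<Sum>l\<in>supp B. pm_scale (g (dual l) / 2) (?f l)) + pm_scale (- tr A B / 2) 1"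
    using e1 unfolding e2 .
qed

text \<open>
  The Euler operator multiplies quadratic elements in the creators by two, so that such an element
  vanishes if it is killed by all annihilators.
\<close>

lemma quad_euler:
  assumes "Z \<in> quad m"
  shows "\<exists>J0. finite J0 \<and> J0 \<subseteq> {k. ann k \<and> live k} \<and> (\<forall>J. finite J \<longrightarrow> J0 \<subseteq> J \<longrightarrow> J \<subseteq> {k. ann k \<and> live k} \<longrightarrow>
    (\<Sum>k\<in>J. pm_scale (g k) (letter (dual k) * (letter k * Z))) \<doteq> pm_scale 2 Z)"
  using assms
proof induction
  case zero
  show ?case by (intro exI[of _ "{}"]) auto
next
  case (add p q)
  from add.IH(1) obtain J1 where J1: "finite J1" "J1 \<subseteq> {k. ann k \<and> live k}"
    "\<And>J. finite J \<Longrightarrow> J1 \<subseteq> J \<Longrightarrow> J \<subseteq> {k. ann k \<and> live k} \<Longrightarrow> (\<Sum>k\<in>J. pm_scale (g k) (letter (dual k) * (letter k * p))) \<doteq> pm_scale 2 p"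
    by (elim exE conjE) simp
  from add.IH(2) obtain J2 where J2: "finite J2" "J2 \<subseteq> {k. ann k \<and> live k}"
    "\<And>J. finite J \<Longrightarrow> J2 \<subseteq> J \<Longrightarrow> J \<subseteq> {k. ann k \<and> live k} \<Longrightarrow> (\<Sum>k\<in>J. pm_scale (g k) (letter (dual k) * (letter k * q))) \<doteq> pm_scale 2 q"
    by (elim exE conjE) simp
  \<comment> \<open>The claim is made for every larger \<open>J\<close> so that the sums for
    \<open>p\<close> and \<open>q\<close> can be taken over the same set.\<close>
  show ?case
  proof (intro exI[of _ "J1 \<union> J2"] conjI allI impI)
    fix J assume "finite J" "J1 \<union> J2 \<subseteq> J" "J \<subseteq> {k. ann k \<and> live k}"
    then show "(\<Sum>k\<in>J. pm_scale (g k) (letter (dual k) * (letter k * (p + q)))) \<doteq> pm_scale 2 (p + q)"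
      using eqv_add[OF J1(3)[of J] J2(3)[of J]]
      by (simp add: distrib_left pm.scale_right_distrib sum.distrib)
  qed (use J1 J2 in auto)
next
  case (prod a b c)
  let ?Z = "pm_scale c (letter a * letter b)"
  show ?case
  proof (cases "live a \<and> live b")
    case False
    then have "letter a * letter b \<in> two_sided"
      using two_sided.dead[of a 1 "letter b"] two_sided.dead[of b "letter a" 1] by auto
    then have Z: "?Z \<in> vac_ideal" by (intro vac_ideal.two two_scale)
    have "(\<Sum>k\<in>J. pm_scale (g k) (letter (dual k) * (letter k * ?Z))) - pm_scale 2 ?Z \<in> vac_ideal" for J
      by (intro vac_diff vac_sum vac_scale vac_mult Z)
    then show ?thesis unfolding eqv_def by blast
  next
    case True
    have step: "letter k * ?Z \<doteq> pm_scale c (pm_scale (form k a) (letter b)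
        + pm_scale (ksign (par k \<and> par a) * form k b) (letter a))" if k: "ann k" "live k" for k
    proof -
      have c: "cre (Poly_Mapping.single a 1) = Poly_Mapping.single a 1"
        using prod by (intro poly_mapping_eqI) (auto simp: lookup_single when_def)
      have "Poly_Mapping.lookup (Poly_Mapping.single a 1) (dual k) * g k = form k a"
        using k by (auto simp: form_def lookup_single when_def)
      then show ?thesis
        using eqv_scale[OF ann_step[OF hom_single[of a 1] k, of b], of c]
        unfolding c by (simp add: mult.assoc)
    qed
    show ?thesis
    proof (intro exI[of _ "{dual a, dual b}"] conjI allI impI)
      show "{dual a, dual b} \<subseteq> {k. ann k \<and> live k}" using prod True by auto
      fix J assume J: "finite J" "{dual a, dual b} \<subseteq> J" "J \<subseteq> {k. ann k \<and> live k}"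
      have 1: "(\<Sum>k\<in>J. pm_scale (g k) (letter (dual k) * (letter k * ?Z))) \<doteq>
        (\<Sum>k\<in>J. pm_scale (g k) (letter (dual k) * pm_scale c (pm_scale (form k a) (letter b)
        + pm_scale (ksign (par k \<and> par a) * form k b) (letter a))))"
        by (rule eqv_sum, rule eqv_scale, rule eqv_mult_left, rule step) (use J in auto)
      have 2: "(\<Sum>k\<in>J. pm_scale (g k) (letter (dual k) * pm_scale c (pm_scale (form k a) (letter b)
        + pm_scale (ksign (par k \<and> par a) * form k b) (letter a))))
        = (\<Sum>k\<in>J. (if k = dual a then ?Z else 0) + (if k = dual b then pm_scale (c * ksign (par a \<and> par b)) (letter b * letter a) else 0))"
      proof (rule sum.cong[OF refl])
        fix k assume "k \<in> J"
        then have lk: "live k" using J by auto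
        have "pm_scale (g k) (letter (dual k) * pm_scale c (pm_scale (form k a) (letter b)
            + pm_scale (ksign (par k \<and> par a) * form k b) (letter a)))
          = pm_scale (c * (g k * form k a)) (letter (dual k) * letter b)
            + pm_scale (c * ksign (par k \<and> par a) * (g k * form k b)) (letter (dual k) * letter a)"
          by (simp add: distrib_left pm.scale_right_distrib mult_ac)
        then show "pm_scale (g k) (letter (dual k) * pm_scale c (pm_scale (form k a) (letter b)
            + pm_scale (ksign (par k \<and> par a) * form k b) (letter a)))
          = (if k = dual a then ?Z else 0) + (if k = dual b then pm_scale (c * ksign (par a \<and> par b)) (letter b * letter a) else 0)"
          using lk by (auto simp: form_def conj_commute)
      qed
      have 3: "(\<Sum>k\<in>J. (if k = dual a then ?Z else 0) + (if k = dual b then pm_scale (c * ksign (par a \<and> par b)) (letter b * letter a) else 0))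
        = ?Z + pm_scale (c * ksign (par a \<and> par b)) (letter b * letter a)"
        using J by (simp add: sum.distrib)
      have 4: "pm_scale (c * ksign (par a \<and> par b)) (letter b * letter a) \<doteq> ?Z"
        using eqt_eqv[OF eqt_scale[OF eqt_sym[OF scom_letters[OF prod(1,2), unfolded scom_def]], of c]] by simp
      from eqv_add[OF eqv_refl[of ?Z] this] 1
      show "(\<Sum>k\<in>J. pm_scale (g k) (letter (dual k) * (letter k * ?Z))) \<doteq> pm_scale 2 ?Z"
        unfolding 2 3 by (metis (no_types, lifting) eqv_trans pm.scale_left_distrib pm.scale_one one_add_one)
    qed simp
  qed
qed

lemma quad_vac:
  assumes "Z \<in> quad m" "\<And>k. ann k \<Longrightarrow> live k \<Longrightarrow> letter k * Z \<in> vac_ideal"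
  shows "Z \<in> vac_ideal"
proof -
  obtain J where J: "finite J" "J \<subseteq> {k. ann k \<and> live k}"
    "(\<Sum>k\<in>J. pm_scale (g k) (letter (dual k) * (letter k * Z))) \<doteq> pm_scale 2 Z"
    using quad_euler[OF assms(1)] by (elim exE conjE) simp
  have "(\<Sum>k\<in>J. pm_scale (g k) (letter (dual k) * (letter k * Z))) \<in> vac_ideal"
    by (intro vac_sum vac_scale vac_mult assms(2)) (use J in auto)
  from eqv_mem[OF eqv_sym[OF J(3)] this] have "pm_scale (1/2) (pm_scale 2 Z) \<in> vac_ideal"
    by (rule vac_scale)
  then show ?thesis by simp
qed

lemma tr_parity:
  assumes A: "osp i A" and B: "osp j B" and "i \<noteq> j"
  shows "tr A B = 0"
  unfolding tr_def
proof (intro sum.neutral ballI)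
  fix l
  have "hom (i \<noteq> (j \<noteq> par l)) (ext A (cre (B l)))"
    by (intro hom_ext osp_hmap[OF A] hom_cre osp_hom[OF B])
  then have "Poly_Mapping.lookup (ext A (cre (B l))) l = 0"
    using \<open>i \<noteq> j\<close> unfolding hom_def by (metis in_keys_iff)
  then show "ksign (par l) * Poly_Mapping.lookup (ext A (cre (B l))) l = 0" by simp
qed

text \<open>The superderivation parts cancel, and the defect becomes right multiplication by a fixed
  element \<open>ZZ\<close>. Annihilators map \<open>ZZ\<close> into the vacuum ideal because all
  three operators preserve that ideal. Up to \<open>\<doteq>\<close>, \<open>ZZ\<close> is a
  quadratic polynomial in creators plus the anomaly; scalars pass this test by themselves, so the
  quadratic part must pass it too, and \<open>quad_vac\<close> removes it.\<close>

theorem rho_bracket: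
  assumes A: "osp i A" and B: "osp j B" and C: "osp (i \<noteq> j) C"
    and br: "\<And>l. C l = ext A (B l) - pm_scale (ksign (i \<and> j)) (ext B (A l))"
  shows "rho i A (rho j B p) - pm_scale (ksign (i \<and> j)) (rho j B (rho i A p)) - rho (i \<noteq> j) C p
     \<doteq> pm_scale (anomaly i j A B) p"
proof -
  let ?s = "ksign (i \<and> j)" and ?a = "vac_image A" and ?b = "vac_image B" and ?c = "vac_image C"
  define ZZ where "ZZ = der i A ?b + sig i ?b * ?a - pm_scale ?s (der j B ?a + sig j ?a * ?b) - ?c"
  \<comment> \<open>Every term containing a derivative of \<open>p\<close> cancels; the sign
    operators survive only as the combined \<open>sig (i \<noteq> j)\<close>.\<close>
  have T: "rho i A (rho j B p) - pm_scale ?s (rho j B (rho i A p)) - rho (i \<noteq> j) C p = sig (i \<noteq> j) p * ZZ" for p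
  proof -
    have 1: "der i A (der j B p) = pm_scale ?s (der j B (der i A p)) + der (i \<noteq> j) C p"
      using der_bracket[OF osp_hmap[OF A] osp_hmap[OF B] br, of p] by (simp add: algebra_simps)
    have 2: "sig i (der j B p) = pm_scale ?s (der j B (sig i p))"
      "sig j (der i A p) = pm_scale ?s (der i A (sig j p))"
      using sig_der[OF osp_hmap[OF B], of i p] sig_der[OF osp_hmap[OF A], of j p] by (simp_all add: conj_commute)
    have 3: "sig i (sig j p) = sig (i \<noteq> j) p" "sig j (sig i p) = sig (i \<noteq> j) p"
      by (cases i; cases j; simp add: sig_sig)+
    show ?thesis
      unfolding rho_def ZZ_def der_simps sig_simps der_mult sig_mult 1 2 3
      by (simp add: algebra_simps pm.scale_right_distrib pm.scale_right_diff_distrib)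
  qed
  have ZZvac: "letter k * ZZ \<in> vac_ideal" if "ann k" for k
  proof -
    have k: "letter k \<in> vac_ideal" using vac_ideal.ann[OF that, of 1] by simp
    have "sig (i \<noteq> j) (letter k) * ZZ \<in> vac_ideal"
      unfolding T[symmetric] by (intro vac_diff vac_scale rho_vac[OF A] rho_vac[OF B] rho_vac[OF C] k)
    from vac_scale[OF this, of "ksign ((i \<noteq> j) \<and> par k)"] show ?thesis by simp
  qed
  obtain Z1 where Z1: "Z1 \<in> quad (i \<noteq> j)" "der i A ?b \<doteq> Z1 + pm_scale (- tr A B / 2) 1"
    using der_vac_image[OF A B] .
  obtain Z2 where Z2: "Z2 \<in> quad (i \<noteq> j)" "der j B ?a \<doteq> Z2 + pm_scale (- tr B A / 2) 1"
    using der_vac_image[OF B A] unfolding neq_commute[of j i] .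
  define Z where "Z = Z1 - pm_scale ?s Z2 - ?c"
  have Zq: "Z \<in> quad (i \<noteq> j)"
    unfolding Z_def by (intro quad_diff quad_scale Z1 Z2 quad_vac_image C)
  have sq: "sig i ?b = pm_scale ?s ?b" "sig j ?a = pm_scale ?s ?a"
    using sig_quad[OF quad_vac_image[OF A], of j] sig_quad[OF quad_vac_image[OF B], of i]
    by (simp_all add: conj_commute)
  have com: "?a * ?b \<doteq> pm_scale ?s (?b * ?a)"
    using scom_quad[OF quad_vac_image[OF A] quad_vac_image[OF B]] by (simp add: scom_def eqt_eqv)
  have e1: "ZZ = (der i A ?b - pm_scale ?s (der j B ?a)) - (?a * ?b - pm_scale ?s (?b * ?a)) - ?c"
    by (simp add: ZZ_def sq algebra_simps pm.scale_right_distrib)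
  have e2: "(der i A ?b - pm_scale ?s (der j B ?a)) - (?a * ?b - pm_scale ?s (?b * ?a)) - ?c \<doteq> ((Z1 + pm_scale (- tr A B / 2) 1) - pm_scale ?s (Z2 + pm_scale (- tr B A / 2) 1)) - 0 - ?c"
  proof (intro eqv_diff eqv_scale Z1 Z2 eqv_refl)
    show "?a * ?b - pm_scale ?s (?b * ?a) \<doteq> 0" using com by (simp add: eqv_def)
  qed
  have e3: "((Z1 + pm_scale (- tr A B / 2) 1) - pm_scale ?s (Z2 + pm_scale (- tr B A / 2) 1)) - 0 - ?c
    = Z + pm_scale (anomaly i j A B) 1"
  proof -
    have "pm_scale (anomaly i j A B) (1 :: 'l free) = pm_scale (- tr A B / 2) 1 - pm_scale ?s (pm_scale (- tr B A / 2) 1)"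
      unfolding pm.scale_scale pm.scale_left_diff_distrib[symmetric] anomaly_def
      by (rule arg_cong2[of _ _ _ _ pm_scale]) (simp_all add: field_simps)
    then show ?thesis by (simp add: Z_def algebra_simps pm.scale_right_distrib)
  qed
  have ZZ: "ZZ \<doteq> Z + pm_scale (anomaly i j A B) 1"
    using e2 unfolding e1 e3 .
  have "Z \<in> vac_ideal"
  proof (rule quad_vac[OF Zq])
    fix k assume k: "ann k"
    have "letter k * Z \<doteq> letter k * ZZ - pm_scale (anomaly i j A B) (letter k)"
      using eqv_sym[OF eqv_mult_left[OF ZZ, of "letter k"]]
      by (simp add: eqv_def algebra_simps)
    moreover have "letter k * ZZ - pm_scale (anomaly i j A B) (letter k) \<in> vac_ideal"
      using vac_ideal.ann[OF k, of 1] by (intro vac_diff vac_scale ZZvac k) simp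
    ultimately show "letter k * Z \<in> vac_ideal" by (rule eqv_mem)
  qed
  then have "ZZ \<doteq> pm_scale (anomaly i j A B) 1"
    using eqv_trans[OF ZZ] eqv_add[of Z 0 "pm_scale (anomaly i j A B) 1"] by (simp add: eqv_zero_iff)
  from eqv_mult_left[OF this, of "sig (i \<noteq> j) p"]
  have "sig (i \<noteq> j) p * ZZ \<doteq> pm_scale (anomaly i j A B) (sig (i \<noteq> j) p)"
    by simp
  \<comment> \<open>For \<open>i \<noteq> j\<close> both supertraces vanish, and for
    \<open>i = j\<close> the map \<open>sig\<close> is the identity.\<close>
  moreover have "pm_scale (anomaly i j A B) (sig (i \<noteq> j) p) = pm_scale (anomaly i j A B) p"
    using tr_parity[OF A B] tr_parity[OF B A] by (cases "i = j") (auto simp: anomaly_def)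
  ultimately show ?thesis unfolding T by (simp only:)
qed

subsection \<open>Linearity\<close>

lemma pairing_add: "pairing (v + w) m = pairing v m + pairing w m"
  by (simp add: pairing_def lookup_add distrib_right)

lemma pairing_scale: "pairing (pm_scale c v) m = c * pairing v m"
  by (simp add: pairing_def)

lemma supp_add: "supp (\<lambda>l. A l + B l) \<subseteq> supp A \<union> supp B"
  by (auto simp: supp_def)

lemma osp_add:
  assumes A: "osp i A" and B: "osp i B"
  shows "osp i (\<lambda>l. A l + B l)"
  unfolding osp_def hmap_def
proof (intro conjI allI ballI impI)
  have keys: "Poly_Mapping.keys (A l + B l) \<subseteq> Poly_Mapping.keys (A l) \<union> Poly_Mapping.keys (B l)" for l
    by (rule keys_add)
  show "hom (i \<noteq> par l) (A l + B l)" for l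
    using osp_hom[OF A, of l] osp_hom[OF B, of l] keys[of l] unfolding hom_def by blast
  show "live m = live l" if "m \<in> Poly_Mapping.keys (A l + B l)" for l m
    using osp_live[OF A, of m l] osp_live[OF B, of m l] keys[of l] that by blast
  show "pairing (A l + B l) m = ksign (par l \<and> par m) * pairing (A m + B m) l" for l m
    using osp_pairing[OF A, of l m] osp_pairing[OF B, of l m]
    by (simp add: pairing_add distrib_left)
  show "finite (supp (\<lambda>l. A l + B l))"
    by (rule finite_subset[OF supp_add]) (simp add: osp_finite[OF A] osp_finite[OF B])
qed

lemma osp_scale:
  assumes A: "osp i A"
  shows "osp i (\<lambda>l. pm_scale c (A l))"
  unfolding osp_def hmap_def
proof (intro conjI allI ballI impI)
  show "hom (i \<noteq> par l) (pm_scale c (A l))" for l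
    using osp_hom[OF A, of l] keys_pm_scale[of c "A l"] unfolding hom_def by blast
  show "live m = live l" if "m \<in> Poly_Mapping.keys (pm_scale c (A l))" for l m
    using osp_live[OF A, of m l] keys_pm_scale[of c "A l"] that by blast
  show "pairing (pm_scale c (A l)) m = ksign (par l \<and> par m) * pairing (pm_scale c (A m)) l" for l m
    using osp_pairing[OF A, of l m] by (simp add: pairing_scale mult.left_commute)
  have "supp (\<lambda>l. pm_scale c (A l)) \<subseteq> supp A" by (auto simp: supp_def)
  then show "finite (supp (\<lambda>l. pm_scale c (A l)))"
    using finite_subset osp_finite[OF A] by metis
qed

lemma rho_add:
  assumes A: "osp i A" and B: "osp i B"
  shows "rho i (\<lambda>l. A l + B l) p = rho i A p + rho i B p"
proof -
  let ?J = "supp A \<union> supp B"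
  have J: "finite ?J" "supp A \<subseteq> ?J" "supp B \<subseteq> ?J" "?J \<subseteq> {l. ann l \<and> live l}"
    using osp_finite[OF A] osp_finite[OF B] by (auto simp: supp_def)
  have "vac_image (\<lambda>l. A l + B l) = vac_image A + vac_image B"
    unfolding vac_image_superset[OF J(1) supp_add J(4)] vac_image_superset[OF J(1,2,4)] vac_image_superset[OF J(1,3,4)]
    by (simp add: distrib_right pm.scale_right_distrib sum.distrib)
  then show ?thesis by (simp add: rho_def der_add algebra_simps)
qed

lemma rho_scale:
  assumes A: "osp i A"
  shows "rho i (\<lambda>l. pm_scale c (A l)) p = pm_scale c (rho i A p)"
proof -
  have J: "finite (supp A)" "supp (\<lambda>l. pm_scale c (A l)) \<subseteq> supp A" "supp A \<subseteq> {l. ann l \<and> live l}"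
    using osp_finite[OF A] by (auto simp: supp_def)
  have "vac_image (\<lambda>l. pm_scale c (A l)) = pm_scale c (vac_image A)"
    unfolding vac_image_superset[OF J] vac_image_def
    by (simp add: pm.scale_sum_right mult.commute)
  then show ?thesis by (simp add: rho_def der_scale pm.scale_right_distrib)
qed

lemma sig_rho:
  assumes A: "osp i A"
  shows "sig j (rho i A p) = pm_scale (ksign (i \<and> j)) (rho i A (sig j p))"
  using sig_der[OF osp_hmap[OF A], of j p] sig_quad[OF quad_vac_image[OF A], of j]
  by (cases i; cases j; simp add: rho_def sig_sig)

end

section \<open>Laurent polynomials in two odd variables\<close>

lemma vector_space_op_scale:
  fixes s :: "complex \<Rightarrow> 'b::ab_group_add \<Rightarrow> 'b"
  assumes "vector_space s"
  shows "vector_space (op_scale s :: complex \<Rightarrow> ('a \<Rightarrow> 'b) \<Rightarrow> ('a \<Rightarrow> 'b))"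
proof -
  interpret vector_space s by fact
  show ?thesis
    by unfold_locales (auto simp: op_scale_def fun_eq_iff scale_left_distrib scale_right_distrib)
qed

lemma sscale_simp [simp]: "sscale c (a0, a1, a2, a3) = (pm_scale c a0, pm_scale c a1, pm_scale c a2, pm_scale c a3)"
  by (simp add: sscale_def)

interpretation sv: vector_space sscale
  by unfold_locales
     (auto simp: sscale_def pm.scale_left_distrib pm.scale_right_distrib split: prod.splits)

interpretation ov: vector_space sop_scale
  by (rule vector_space_op_scale) unfold_locales

lemma laurent_deriv_pm_lin: "laurent_deriv = pm_lin (\<lambda>n. tpow (n - 1) (of_int n))"
  by (rule ext) (simp add: laurent_deriv_def pm_lin_def mult.commute)

lemma laurent_deriv_simps [simp]:
  "laurent_deriv 0 = 0" "laurent_deriv (a + b) = laurent_deriv a + laurent_deriv b"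
  "laurent_deriv (a - b) = laurent_deriv a - laurent_deriv b" "laurent_deriv (- a) = - laurent_deriv a"
  "laurent_deriv (pm_scale c a) = pm_scale c (laurent_deriv a)"
  "laurent_deriv (tpow n c) = tpow (n - 1) (of_int n * c)"
  by (simp_all add: laurent_deriv_pm_lin pm_lin_add pm_lin_diff pm_lin_minus pm_lin_scale mult.commute)

lemma laurent_deriv_one [simp]: "laurent_deriv 1 = 0"
  by (metis laurent_deriv_simps(6) mult_zero_left of_int_0 single_one single_zero)

lemma laurent_deriv_mult: "laurent_deriv (a * b) = laurent_deriv a * b + a * laurent_deriv b"
proof (induction a rule: pm_induct)
  case (single m c)
  show ?case
  proof (induction b rule: pm_induct)
    case (single n d)
    show ?case by (simp add: mult_single algebra_simps flip: single_add)
  qed (simp_all add: algebra_simps)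
qed (simp_all add: algebra_simps)

lemma smul_simp [simp]: "smul (a0, a1, a2, a3) (b0, b1, b2, b3) =
     (a0 * b0, a0 * b1 + a1 * b0, a0 * b2 + a2 * b0, a0 * b3 + a3 * b0 + a1 * b2 - a2 * b1)"
  by (simp add: smul_def)

lemma sparity_simp [simp]: "sparity (a0, a1, a2, a3) = (a0, - a1, - a2, a3)"
  by (simp add: sparity_def)

lemma dt_simp [simp]: "dt (a0, a1, a2, a3) = (laurent_deriv a0, laurent_deriv a1, laurent_deriv a2, laurent_deriv a3)"
  by (simp add: dt_def)

lemma d1_simp [simp]: "d1 (a0, a1, a2, a3) = (a1, 0, a3, 0)" by (simp add: d1_def)
lemma d2_simp [simp]: "d2 (a0, a1, a2, a3) = (a2, - a3, 0, 0)" by (simp add: d2_def)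

lemma smul_assoc: "smul (smul a b) c = smul a (smul b c)"
  by (cases a; cases b; cases c) (simp add: algebra_simps)

lemma smul_add_left: "smul (a + b) c = smul a c + smul b c"
  by (cases a; cases b; cases c) (simp add: algebra_simps)
lemma smul_add_right: "smul c (a + b) = smul c a + smul c b"
  by (cases a; cases b; cases c) (simp add: algebra_simps)
lemma smul_diff_left: "smul (a - b) c = smul a c - smul b c"
  by (cases a; cases b; cases c) (simp add: algebra_simps)
lemma smul_diff_right: "smul c (a - b) = smul c a - smul c b"
  by (cases a; cases b; cases c) (simp add: algebra_simps)
lemma smul_scale_left [simp]: "smul (sscale k a) b = sscale k (smul a b)"
  by (cases a; cases b) (simp add: pm.scale_right_distrib pm.scale_right_diff_distrib)
lemma smul_scale_right [simp]: "smul a (sscale k b) = sscale k (smul a b)"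
  by (cases a; cases b) (simp add: pm.scale_right_distrib pm.scale_right_diff_distrib)
lemma smul_zero [simp]: "smul 0 a = 0" "smul a 0 = 0"
  by (cases a, simp add: zero_prod_def)+

lemma smul_commute: "a \<in> spart i \<Longrightarrow> b \<in> spart j \<Longrightarrow> smul a b = sscale (ksign (i \<and> j)) (smul b a)"
  by (auto simp: spart_def split: if_splits)

lemma spart_smul: "a \<in> spart i \<Longrightarrow> b \<in> spart j \<Longrightarrow> smul a b \<in> spart (i \<noteq> j)"
  by (auto simp: spart_def split: if_splits)

lemma sparity_spart: "a \<in> spart i \<Longrightarrow> sparity a = sscale (ksign i) a"
  by (auto simp: spart_def split: if_splits)

lemma sparity_sparity [simp]: "sparity (sparity a) = a"
  by (cases a) simp

lemma sparity_add: "sparity (a + b) = sparity a + sparity b"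
  by (cases a; cases b) simp

lemma sparity_scale: "sparity (sscale c a) = sscale c (sparity a)"
  by (cases a) simp

lemma salg_split:
  obtains a0 a1 where "a = a0 + a1" "a0 \<in> spart False" "a1 \<in> spart True"
proof (cases a)
  case (fields w x y z)
  show ?thesis
    by (rule that[of "(w, 0, 0, z)" "(0, x, y, 0)"]) (auto simp: fields spart_def)
qed

subsection \<open>Homogeneous operators\<close>

lemma W2_linear: "D \<in> W2 i \<Longrightarrow> Vector_Spaces.linear sscale sscale D"
  by (simp add: W2_def)

lemma
  assumes "D \<in> W2 i"
  shows W2_add: "D (a + b) = D a + D b" and W2_scale: "D (sscale c a) = sscale c (D a)"
proof -
  interpret Vector_Spaces.linear sscale sscale D
    using assms by (rule W2_linear)
  show "D (a + b) = D a + D b" "D (sscale c a) = sscale c (D a)"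
    by (rule add, rule scale)
qed

lemma W2_spart: "D \<in> W2 i \<Longrightarrow> a \<in> spart j \<Longrightarrow> D a \<in> spart (i \<noteq> j)"
  by (simp add: W2_def)

lemma W2_leibniz: "D \<in> W2 i \<Longrightarrow> a \<in> spart j \<Longrightarrow>
   D (smul a b) = smul (D a) b + sscale (ksign (i \<and> j)) (smul a (D b))"
  unfolding W2_def by blast

lemma W2_parity: "D \<in> W2 i \<Longrightarrow> sparity (D (sparity a)) = sscale (ksign i) (D a)"
proof (rule salg_split[of a])
  fix a0 a1 assume D: "D \<in> W2 i" and a: "a = a0 + a1" "a0 \<in> spart False" "a1 \<in> spart True"
  show ?thesis
    unfolding a(1) sparity_add sparity_spart[OF a(2)] sparity_spart[OF a(3)]
      W2_add[OF D] W2_scale[OF D] sparity_scale sv.scale_right_distrib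
      sparity_spart[OF W2_spart[OF D a(2)]] sparity_spart[OF W2_spart[OF D a(3)]]
    by (cases i) simp_all
qed

lemma W2_op_part: "D \<in> W2 i \<Longrightarrow> op_part sscale sparity j D = (if i = j then D else 0)"
proof (rule ext)
  fix a assume D: "D \<in> W2 i"
  have "D a + D a = sscale 2 (D a)"
    by (metis one_add_one sv.scale_left_distrib sv.scale_one)
  then show "op_part sscale sparity j D a = (if i = j then D else 0) a"
    by (auto simp: op_part_def W2_parity[OF D] ksign_def)
qed

lemma W2_zero: "D \<in> W2 i \<Longrightarrow> D 0 = 0"
  using W2_scale[of D i 0 0] by simp

text \<open>On homogeneous operators the double sum over parity components in
  \<open>supercommutator\<close> has a single nonzero term.\<close>

lemma sbracket_W2:
  assumes "D \<in> W2 i" "E \<in> W2 j"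
  shows "sbracket D E a = D (E a) - sscale (ksign (i \<and> j)) (E (D a))"
  unfolding supercommutator_def UNIV_bool
  using assms
  by (cases i; cases j) (simp_all add: W2_op_part W2_zero)

lemma W2_bracket:
  assumes D: "D \<in> W2 i" and E: "E \<in> W2 j"
  shows "sbracket D E \<in> W2 (i \<noteq> j)"
  unfolding W2_def mem_Collect_eq
proof (intro conjI allI ballI)
  note simps = sbracket_W2[OF D E] W2_add[OF D] W2_add[OF E] W2_scale[OF D] W2_scale[OF E]
  show "Vector_Spaces.linear sscale sscale (sbracket D E)"
    by unfold_locales
       (simp_all add: simps sv.scale_right_distrib sv.scale_right_diff_distrib mult.commute)
  fix k a assume a: "a \<in> spart k"
  have "D (E a) \<in> spart (i \<noteq> (j \<noteq> k))" "E (D a) \<in> spart (j \<noteq> (i \<noteq> k))"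
    by (intro W2_spart[OF D] W2_spart[OF E] a)+
  then show "sbracket D E a \<in> spart ((i \<noteq> j) \<noteq> k)"
    unfolding simps by (cases i; cases j; cases k) (auto simp: spart_def)
  fix b
  show "sbracket D E (smul a b) = smul (sbracket D E a) b + sscale (ksign ((i \<noteq> j) \<and> k)) (smul a (sbracket D E b))"
    unfolding simps W2_leibniz[OF D a] W2_leibniz[OF E a]
      W2_leibniz[OF D W2_spart[OF E a]] W2_leibniz[OF E W2_spart[OF D a]]
    by (cases i; cases j; cases k) (simp_all add: smul_diff_left smul_diff_right smul_add_left smul_add_right sv.scale_right_distrib sv.scale_right_diff_distrib)
qed

lemma t_spart [simp]: "t_elem \<in> spart False" "th1 \<in> spart True" "th2 \<in> spart True"
  "(a, 0, 0, b) \<in> spart False" "(0, a, b, 0) \<in> spart True" "0 \<in> spart i"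
  by (auto simp: spart_def t_elem_def th1_def th2_def zero_prod_def)

lemma W2_one: "D \<in> W2 i \<Longrightarrow> D (1, 0, 0, 0) = 0"
proof -
  assume D: "D \<in> W2 i"
  obtain w x y z where e: "D (1, 0, 0, 0) = (w, x, y, z)" by (metis surj_pair)
  have "D (smul (1, 0, 0, 0) (1, 0, 0, 0)) = (w, x, y, z) + (w, x, y, z)"
    by (subst W2_leibniz[OF D, of _ False]) (simp_all add: e)
  then show ?thesis using e by (simp add: zero_prod_def)
qed

subsection \<open>The twisted action on functions\<close>

text \<open>
  The action \<open>f \<mapsto> X f + (1/2) Div(X) f\<close> on half densities, in the case
  \<open>Div X = - \<alpha> t^(-1) X(t)\<close>; it preserves the residue pairing.
\<close>

definition tw :: "complex \<Rightarrow> sop \<Rightarrow> sop" where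
  "tw \<alpha> X f = X f + smul (smul (tpow (-1) (- \<alpha> / 2), 0, 0, 0) (X t_elem)) f"

text \<open>The Leibniz rule applied to \<open>t * t^(-1) = 1\<close>; as \<open>t^(-1)\<close> is
  even it may be moved past the value of \<open>D\<close> on \<open>t\<close> without a
  sign.\<close>

lemma W2_tinv:
  assumes D: "D \<in> W2 i"
  shows "D (tpow (-1) c, 0, 0, 0) = smul (tpow (-2) (- c), 0, 0, 0) (D t_elem)"
proof -
  let ?u = "(tpow (-1) 1, 0, 0, 0) :: salg"
  have tu: "smul t_elem ?u = (1, 0, 0, 0)" "smul ?u t_elem = (1, 0, 0, 0)"
    by (simp_all add: t_elem_def mult_single)
  have one: "smul (1, 0, 0, 0) a = a" for a by (cases a) simp
  have u: "?u \<in> spart False" by simp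
  have "smul (D t_elem) ?u + smul t_elem (D ?u) = 0"
    using W2_leibniz[OF D t_spart(1), of ?u] W2_one[OF D] tu by simp
  then have "smul ?u (smul (D t_elem) ?u + smul t_elem (D ?u)) = 0" by simp
  then have "D ?u = - smul ?u (smul (D t_elem) ?u)"
    by (simp add: smul_add_right one tu flip: smul_assoc) (simp add: eq_neg_iff_add_eq_0 add.commute)
  also have "smul (D t_elem) ?u = smul ?u (D t_elem)"
    using smul_commute[OF W2_spart[OF D t_spart(1)] u] by simp
  also have "- smul ?u (smul ?u (D t_elem)) = smul (tpow (-2) (-1), 0, 0, 0) (D t_elem)"
    by (cases "D t_elem") (simp add: mult_single single_uminus flip: mult.assoc)
  finally have "sscale c (D ?u) = sscale c (smul (tpow (-2) (-1), 0, 0, 0) (D t_elem))" by simp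
  then show ?thesis
    by (simp flip: W2_scale[OF D] smul_scale_left)
qed

text \<open>The multiplier in \<open>tw\<close> is formally \<open>- \<alpha> / 2\<close> times
  \<open>X\<close> applied to the logarithm of \<open>t\<close>, hence a 1-cocycle with values in
  functions. The computation with \<open>M\<close> verifies this cocycle identity without the
  logarithm, for all of \<open>W2\<close>.\<close>

lemma tw_bracket:
  assumes X: "X \<in> W2 i" and Y: "Y \<in> W2 j"
  shows "tw \<alpha> (sbracket X Y) f = tw \<alpha> X (tw \<alpha> Y f) - sscale (ksign (i \<and> j)) (tw \<alpha> Y (tw \<alpha> X f))"
proof -
  let ?s = "ksign (i \<and> j)"
  define u where "u = ((tpow (-1) (- \<alpha> / 2), 0, 0, 0) :: salg)"
  define MX where "MX = smul u (X t_elem)"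
  define MY where "MY = smul u (Y t_elem)"
  have u: "u \<in> spart False" by (simp add: u_def)
  have Xt: "X t_elem \<in> spart i" and Yt: "Y t_elem \<in> spart j"
    using W2_spart[OF X t_spart(1)] W2_spart[OF Y t_spart(1)] by simp_all
  have MXs: "MX \<in> spart i" and MYs: "MY \<in> spart j"
    using spart_smul[OF u Xt] spart_smul[OF u Yt] by (simp_all add: MX_def MY_def)
  have twX: "tw \<alpha> X f = X f + smul MX f" and twY: "tw \<alpha> Y f = Y f + smul MY f" for f
    by (simp_all add: tw_def MX_def MY_def u_def)
  have XMY: "X MY = smul (X u) (Y t_elem) + smul u (X (Y t_elem))"
    unfolding MY_def using W2_leibniz[OF X u] by simp
  have YMX: "Y MX = smul (Y u) (X t_elem) + smul u (Y (X t_elem))"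
    unfolding MX_def using W2_leibniz[OF Y u] by simp
  let ?v = "(tpow (-2) (- (- \<alpha> / 2)), 0, 0, 0) :: salg"
  have "smul (X u) (Y t_elem) = sscale ?s (smul (Y u) (X t_elem))"
    using smul_commute[OF Xt Yt] unfolding u_def W2_tinv[OF X] W2_tinv[OF Y] smul_assoc by simp
  then have M: "X MY - sscale ?s (Y MX) = smul u (sbracket X Y t_elem)"
    unfolding XMY YMX sbracket_W2[OF X Y]
    by (simp add: smul_diff_right sv.scale_right_distrib)
  have MM: "smul MX (smul MY f) = sscale ?s (smul MY (smul MX f))"
    using smul_commute[OF MXs MYs] by (simp flip: smul_assoc)
  have "tw \<alpha> X (tw \<alpha> Y f) - sscale ?s (tw \<alpha> Y (tw \<alpha> X f)) =
     (X (Y f) - sscale ?s (Y (X f))) + (smul (X MY) f - sscale ?s (smul (Y MX) f))"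
    unfolding twX twY
    by (simp add: W2_add[OF X] W2_add[OF Y] W2_leibniz[OF X MYs] W2_leibniz[OF Y MXs]
       smul_add_right sv.scale_right_distrib MM conj_commute)
  also have "smul (X MY) f - sscale ?s (smul (Y MX) f) = smul (X MY - sscale ?s (Y MX)) f"
    by (simp add: smul_diff_left)
  finally show ?thesis
    by (simp add: M tw_def u_def flip: sbracket_W2[OF X Y])
qed

subsection \<open>Derivations as vector fields\<close>

lemma vfield_W2:
  assumes "f \<in> spart i" "f1 \<in> spart (\<not> i)" "f2 \<in> spart (\<not> i)"
  shows "vfield f f1 f2 \<in> W2 i"
  unfolding W2_def mem_Collect_eq
proof (intro conjI allI ballI)
  show "Vector_Spaces.linear sscale sscale (vfield f f1 f2)"
  proof unfold_locales
    fix a b c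
    show "vfield f f1 f2 (a + b) = vfield f f1 f2 a + vfield f f1 f2 b"
      by (cases a; cases b; cases f; cases f1; cases f2) (simp add: vfield_def algebra_simps)
    show "vfield f f1 f2 (sscale c a) = sscale c (vfield f f1 f2 a)"
      by (cases a; cases f; cases f1; cases f2)
         (simp add: vfield_def pm.scale_right_distrib pm.scale_right_diff_distrib)
  qed
  fix j a assume a: "a \<in> spart j"
  show "vfield f f1 f2 a \<in> spart (i \<noteq> j)"
    using assms a by (auto simp: vfield_def spart_def split: if_splits)
  fix b
  show "vfield f f1 f2 (smul a b) = smul (vfield f f1 f2 a) b + sscale (ksign (i \<and> j)) (smul a (vfield f f1 f2 b))"
    using assms a by (cases b; cases i; cases j)
      (auto simp: vfield_def spart_def laurent_deriv_mult algebra_simps)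
qed

lemma vfield_gens [simp]: "vfield f f1 f2 t_elem = f" "vfield f f1 f2 th1 = f1" "vfield f f1 f2 th2 = f2"
  by (cases f; cases f1; cases f2; simp add: vfield_def t_elem_def th1_def th2_def zero_prod_def)+

text \<open>The element \<open>t\<close> generates only the nonnegative powers; the downward half of
  the induction uses that the value on \<open>t^(-1)\<close> is determined by the value on
  \<open>t\<close>.\<close>

lemma W2_ext:
  assumes D: "D \<in> W2 i" and E: "E \<in> W2 i"
    and t: "D t_elem = E t_elem" and th: "D th1 = E th1" "D th2 = E th2"
  shows "D = E"
proof
  fix a :: salg
  have tn: "D (tpow n 1, 0, 0, 0) = E (tpow n 1, 0, 0, 0)" for n
  proof (induction n rule: int_induct[where k = 0])
    case base
    show ?case using W2_one[OF D] W2_one[OF E] by simp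
  next
    case (step1 n)
    have "(tpow (n + 1) 1, 0, 0, 0) = smul t_elem (tpow n 1, 0, 0, 0)"
      by (simp add: t_elem_def mult_single add.commute)
    then show ?case
      using W2_leibniz[OF D t_spart(1)] W2_leibniz[OF E t_spart(1)] step1 t by simp
  next
    case (step2 n)
    have "(tpow (n - 1) 1, 0, 0, 0) = smul (tpow (-1) 1, 0, 0, 0) (tpow n 1, 0, 0, 0)"
      by (simp add: mult_single)
    then show ?case
      by (simp only: W2_leibniz[OF D t_spart(4)[of "tpow (-1) 1" 0]] W2_leibniz[OF E t_spart(4)[of "tpow (-1) 1" 0]]
        step2 t W2_tinv[OF D] W2_tinv[OF E])
  qed
  have 0: "D (x, 0, 0, 0) = E (x, 0, 0, 0)" for x
  proof (induction x rule: pm_induct)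
    case (single k c)
    have "(tpow k c, 0, 0, 0) = sscale c (tpow k 1, 0, 0, 0)" by simp
    then show ?case by (simp only: W2_scale[OF D] W2_scale[OF E] tn)
  next
    case (add p q)
    have "((p + q, 0, 0, 0) :: salg) = (p, 0, 0, 0) + (q, 0, 0, 0)" by simp
    then show ?case by (simp only: W2_add[OF D] W2_add[OF E] add)
  qed (simp add: W2_zero[OF D] W2_zero[OF E] flip: zero_prod_def)
  have 1: "D (0, x, 0, 0) = E (0, x, 0, 0)" for x
    using W2_leibniz[OF D t_spart(4)[of x 0], of th1] W2_leibniz[OF E t_spart(4)[of x 0], of th1] th 0[of x]
    by (simp add: th1_def)
  have 2: "D (0, 0, x, 0) = E (0, 0, x, 0)" for x
    using W2_leibniz[OF D t_spart(4)[of x 0], of th2] W2_leibniz[OF E t_spart(4)[of x 0], of th2] th 0[of x]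
    by (simp add: th2_def)
  have 3: "D (0, 0, 0, x) = E (0, 0, 0, x)" for x
    using W2_leibniz[OF D t_spart(5)[of x 0], of th2] W2_leibniz[OF E t_spart(5)[of x 0], of th2] th 1[of x]
    by (simp add: th2_def)
  obtain w x y z where a: "a = (w, x, y, z)" by (metis surj_pair)
  have "a = (w, 0, 0, 0) + (0, x, 0, 0) + (0, 0, y, 0) + (0, 0, 0, z)" by (simp add: a)
  then show "D a = E a" by (simp only: W2_add[OF D] W2_add[OF E] 0 1 2 3)
qed

lemma W2_vfield:
  assumes D: "D \<in> W2 i"
  shows "D = vfield (D t_elem) (D th1) (D th2)"
proof (rule W2_ext[OF D])
  show "vfield (D t_elem) (D th1) (D th2) \<in> W2 i"
    by (rule vfield_W2) (use W2_spart[OF D t_spart(1)] W2_spart[OF D t_spart(2)] W2_spart[OF D t_spart(3)] in auto)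
qed auto

lemma W2_even_cases:
  assumes D: "D \<in> W2 False"
  obtains a b p q r s where "D = vfield (a, 0, 0, b) (0, p, q, 0) (0, r, s, 0)"
proof -
  have "D t_elem \<in> spart False" "D th1 \<in> spart True" "D th2 \<in> spart True"
    using W2_spart[OF D t_spart(1)] W2_spart[OF D t_spart(2)] W2_spart[OF D t_spart(3)] by simp_all
  then show ?thesis using that W2_vfield[OF D] by (auto simp: spart_def)
qed

lemma W2_odd_cases:
  assumes D: "D \<in> W2 True"
  obtains a b p q r s where "D = vfield (0, a, b, 0) (p, 0, 0, q) (r, 0, 0, s)"
proof -
  have "D t_elem \<in> spart True" "D th1 \<in> spart False" "D th2 \<in> spart False"
    using W2_spart[OF D t_spart(1)] W2_spart[OF D t_spart(2)] W2_spart[OF D t_spart(3)] by simp_all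
  then show ?thesis using that W2_vfield[OF D] by (auto simp: spart_def)
qed

text \<open>\<open>t^(-\<alpha>) d/dt (t^\<alpha> a)\<close>.\<close>

definition tder :: "complex \<Rightarrow> laurent \<Rightarrow> laurent" where
  "tder \<alpha> a = laurent_deriv a + tpow (-1) \<alpha> * a"

lemma tder_simps [simp]: "tder \<alpha> 0 = 0" "tder \<alpha> (a + b) = tder \<alpha> a + tder \<alpha> b"
  "tder \<alpha> (a - b) = tder \<alpha> a - tder \<alpha> b" "tder \<alpha> (- a) = - tder \<alpha> a"
  "tder \<alpha> (pm_scale c a) = pm_scale c (tder \<alpha> a)"
  "tder \<alpha> (tpow n c) = tpow (n - 1) ((of_int n + \<alpha>) * c)"
  by (simp_all add: tder_def algebra_simps pm.scale_right_distrib mult_single flip: single_add)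

lemma twisted_Div_even:
  "twisted_Div \<alpha> (vfield (a, 0, 0, b) (0, p, q, 0) (0, r, s, 0)) = (tder \<alpha> a - p - s, 0, 0, tder \<alpha> b)"
  by (simp add: twisted_Div_def Div_def tder_def)

lemma twisted_Div_odd:
  "twisted_Div \<alpha> (vfield (0, a, b, 0) (p, 0, 0, q) (r, 0, 0, s)) = (0, tder \<alpha> a - s, tder \<alpha> b + q, 0)"
  by (simp add: twisted_Div_def Div_def tder_def)

text \<open>
  For \<open>\<alpha> \<in> \<int>\<close> the algebra \<open>S(2,\<alpha>)\<close> also contains \<open>t^(-\<alpha>) \<theta>\<^sub>1 \<theta>\<^sub>2 \<partial>\<^sub>t\<close>, which does not lie in \<open>S'(2,\<alpha>)\<close>; the
  condition on the last component excludes it.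
\<close>

definition sdiv :: "complex \<Rightarrow> bool \<Rightarrow> sop \<Rightarrow> bool" where
  "sdiv \<alpha> i D \<longleftrightarrow> D \<in> S2 \<alpha> i \<and> snd (snd (snd (D t_elem))) = 0"

lemma vfield_apply: "vfield (f0, f1, f2, f3) (g0, g1, g2, g3) (h0, h1, h2, h3) (a0, a1, a2, a3) =
  smul (f0, f1, f2, f3) (laurent_deriv a0, laurent_deriv a1, laurent_deriv a2, laurent_deriv a3)
   + smul (g0, g1, g2, g3) (a1, 0, a3, 0) + smul (h0, h1, h2, h3) (a2, - a3, 0, 0)"
  by (simp add: vfield_def)

lemma vfield_bracket:
  assumes "vfield f f1 f2 \<in> W2 i" "vfield g g1 g2 \<in> W2 j"
  shows "sbracket (vfield f f1 f2) (vfield g g1 g2) =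
    vfield (vfield f f1 f2 g - sscale (ksign (i \<and> j)) (vfield g g1 g2 f))
     (vfield f f1 f2 g1 - sscale (ksign (i \<and> j)) (vfield g g1 g2 f1))
     (vfield f f1 f2 g2 - sscale (ksign (i \<and> j)) (vfield g g1 g2 f2))"
  using W2_vfield[OF W2_bracket[OF assms]] unfolding sbracket_W2[OF assms] by simp

text \<open>Here \<open>D\<close> and \<open>E\<close> are arbitrary in \<open>S2 \<alpha>\<close>,
  so for integral \<open>\<alpha>\<close> they may involve the extra field. The last component of
  the bracket on \<open>t_elem\<close> still cancels in the even case: the divergence condition
  expresses \<open>p + s\<close> by \<open>a\<close> and the derivative of \<open>b\<close> by
  \<open>b\<close> itself.\<close>

lemma sdiv_bracket:
  assumes D: "D \<in> S2 \<alpha> i" and E: "E \<in> S2 \<alpha> j"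
  shows "sdiv \<alpha> (i \<noteq> j) (sbracket D E)"
proof -
  have DW: "D \<in> W2 i" and EW: "E \<in> W2 j" using D E by (auto simp: S2_def)
  note BW = W2_bracket[OF DW EW]
  have "twisted_Div \<alpha> (sbracket D E) = 0 \<and> snd (snd (snd (sbracket D E t_elem))) = 0"
  proof (cases i; cases j)
    assume ij: "i" "j"
    obtain a b p q r s where D1: "D = vfield (0, a, b, 0) (p, 0, 0, q) (r, 0, 0, s)"
      using W2_odd_cases[of D] DW ij by (metis (full_types))
    obtain a' b' p' q' r' s' where E1: "E = vfield (0, a', b', 0) (p', 0, 0, q') (r', 0, 0, s')"
      using W2_odd_cases[of E] EW ij by (metis (full_types))
    have "s = tder \<alpha> a" "q = - tder \<alpha> b" "s' = tder \<alpha> a'" "q' = - tder \<alpha> b'"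
      using D E unfolding D1 E1 S2_def mem_Collect_eq twisted_Div_odd by (auto simp: zero_prod_def eq_neg_iff_add_eq_0 add.commute)
    then show ?thesis
      using vfield_bracket[OF DW[unfolded D1] EW[unfolded E1]] ij unfolding D1 E1
      by (simp add: vfield_apply twisted_Div_even tder_def laurent_deriv_mult) (simp add: algebra_simps zero_prod_def)
  next
    assume ij: "i" "\<not> j"
    obtain a b p q r s where D1: "D = vfield (0, a, b, 0) (p, 0, 0, q) (r, 0, 0, s)"
      using W2_odd_cases[of D] DW ij by (metis (full_types))
    obtain a' b' p' q' r' s' where E1: "E = vfield (a', 0, 0, b') (0, p', q', 0) (0, r', s', 0)"
      using W2_even_cases[of E] EW ij by (metis (full_types))
    have "s = tder \<alpha> a" "q = - tder \<alpha> b" "s' = tder \<alpha> a' - p'" "laurent_deriv b' = - (tpow (-1) \<alpha> * b')"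
      using D E unfolding D1 E1 S2_def mem_Collect_eq twisted_Div_odd twisted_Div_even tder_def by (auto simp: zero_prod_def eq_neg_iff_add_eq_0 algebra_simps)
    then show ?thesis
      using vfield_bracket[OF DW[unfolded D1] EW[unfolded E1]] ij unfolding D1 E1
      by (simp add: vfield_apply twisted_Div_odd tder_def laurent_deriv_mult) (simp add: algebra_simps zero_prod_def)
  next
    assume ij: "\<not> i" "j"
    obtain a b p q r s where E1: "E = vfield (0, a, b, 0) (p, 0, 0, q) (r, 0, 0, s)"
      using W2_odd_cases[of E] EW ij by (metis (full_types))
    obtain a' b' p' q' r' s' where D1: "D = vfield (a', 0, 0, b') (0, p', q', 0) (0, r', s', 0)"
      using W2_even_cases[of D] DW ij by (metis (full_types))
    have "s = tder \<alpha> a" "q = - tder \<alpha> b" "s' = tder \<alpha> a' - p'" "laurent_deriv b' = - (tpow (-1) \<alpha> * b')"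
      using D E unfolding D1 E1 S2_def mem_Collect_eq twisted_Div_odd twisted_Div_even tder_def by (auto simp: zero_prod_def eq_neg_iff_add_eq_0 algebra_simps)
    then show ?thesis
      using vfield_bracket[OF DW[unfolded D1] EW[unfolded E1]] ij unfolding D1 E1
      by (simp add: vfield_apply twisted_Div_odd tder_def laurent_deriv_mult) (simp add: algebra_simps zero_prod_def)
  next
    assume ij: "\<not> i" "\<not> j"
    obtain a b p q r s where D1: "D = vfield (a, 0, 0, b) (0, p, q, 0) (0, r, s, 0)"
      using W2_even_cases[of D] DW ij by (metis (full_types))
    obtain a' b' p' q' r' s' where E1: "E = vfield (a', 0, 0, b') (0, p', q', 0) (0, r', s', 0)"
      using W2_even_cases[of E] EW ij by (metis (full_types))
    have "s = tder \<alpha> a - p" "laurent_deriv b = - (tpow (-1) \<alpha> * b)" "s' = tder \<alpha> a' - p'" "laurent_deriv b' = - (tpow (-1) \<alpha> * b')"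
      using D E unfolding D1 E1 S2_def mem_Collect_eq twisted_Div_odd twisted_Div_even tder_def by (auto simp: zero_prod_def eq_neg_iff_add_eq_0 algebra_simps)
    then show ?thesis
      using vfield_bracket[OF DW[unfolded D1] EW[unfolded E1]] ij unfolding D1 E1
      by (simp add: vfield_apply twisted_Div_even tder_def laurent_deriv_mult) (simp add: algebra_simps zero_prod_def)
  qed
  then show ?thesis using BW by (simp add: sdiv_def S2_def)
qed

subsection \<open>Generating fields\<close>

fun gpar :: "gen \<Rightarrow> bool" where
  "gpar gL = False" | "gpar gE = False" | "gpar gH = False" | "gpar gF = False"
| "gpar gh = True" | "gpar gp = True" | "gpar gx = True" | "gpar gy = True"

fun gshift :: "gen \<Rightarrow> int" where
  "gshift gL = 1" | "gshift gp = 1" | "gshift gx = 1" | "gshift _ = 0"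

text \<open>The basis fields with the power of \<open>t\<close> replaced by an arbitrary Laurent
  polynomial, so that brackets become identities in \<open>b\<close> and its derivative and need no
  distinction of exponents.\<close>

fun field :: "complex \<Rightarrow> gen \<Rightarrow> laurent \<Rightarrow> sop" where
  "field \<alpha> gL b = vfield (- b, 0, 0, 0) (0, pm_scale (- 1 / 2) (tder \<alpha> b), 0, 0) (0, 0, pm_scale (- 1 / 2) (tder \<alpha> b), 0)"
| "field \<alpha> gE b = vfield 0 (0, 0, b, 0) 0"
| "field \<alpha> gH b = vfield 0 (0, - b, 0, 0) (0, 0, b, 0)"
| "field \<alpha> gF b = vfield 0 0 (0, b, 0, 0)"
| "field \<alpha> gh b = vfield (0, 0, b, 0) (0, 0, 0, - tder \<alpha> b) 0"
| "field \<alpha> gp b = vfield 0 0 (- b, 0, 0, 0)"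
| "field \<alpha> gx b = vfield 0 (b, 0, 0, 0) 0"
| "field \<alpha> gy b = vfield (0, b, 0, 0) 0 (0, 0, 0, tder \<alpha> b)"

fun crd :: "gen \<Rightarrow> sop \<Rightarrow> laurent" where
  "crd gL D = - fst (D t_elem)"
| "crd gE D = fst (snd (snd (D th1)))"
| "crd gH D = pm_scale (1 / 2) (fst (snd (snd (D th2))) - fst (snd (D th1)))"
| "crd gF D = fst (snd (D th2))"
| "crd gh D = fst (snd (snd (D t_elem)))"
| "crd gp D = - fst (D th2)"
| "crd gx D = fst (D th1)"
| "crd gy D = fst (snd (D t_elem))"

lemma UNIV_gen: "(UNIV :: gen set) = {gL, gE, gH, gF, gh, gp, gx, gy}"
proof (rule UNIV_eq_I)
  show "g \<in> {gL, gE, gH, gF, gh, gp, gx, gy}" for g by (cases g) auto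
qed

lemma basis_field: "S2'_basis \<alpha> (g, n) = field \<alpha> g (tpow (n + gshift g) 1)"
  by (cases g) (simp_all add: single_uminus[symmetric] algebra_simps add_divide_distrib diff_divide_distrib)

lemma vfield_add: "vfield (f + g) (f1 + g1) (f2 + g2) = vfield f f1 f2 + vfield g g1 g2"
  by (rule ext) (simp add: vfield_def smul_add_left)

lemma vfield_scale: "vfield (sscale c f) (sscale c f1) (sscale c f2) = sop_scale c (vfield f f1 f2)"
  by (rule ext) (simp add: vfield_def op_scale_def sv.scale_right_distrib)

lemma field_add: "field \<alpha> g (a + b) = field \<alpha> g a + field \<alpha> g b"
  by (cases g) (simp_all add: vfield_add[symmetric] pm.scale_right_distrib)

lemma field_scale: "field \<alpha> g (pm_scale c a) = sop_scale c (field \<alpha> g a)"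
  by (cases g) (simp_all add: vfield_scale[symmetric] mult.commute)

lemma field_zero [simp]: "field \<alpha> g 0 = 0"
  using field_scale[of \<alpha> g 0 0] by simp

lemma field_W2: "field \<alpha> g b \<in> W2 (gpar g)"
  by (cases g) (auto intro!: vfield_W2)

lemma half_add_half: "pm_scale (1 / 2) a + pm_scale (1 / 2) a = a"
  by (simp flip: pm.scale_left_distrib)

lemma field_sdiv: "sdiv \<alpha> (gpar g) (field \<alpha> g b)"
proof -
  have *: "- tder \<alpha> b - pm_scale (- 1 / 2) (tder \<alpha> b) - pm_scale (- 1 / 2) (tder \<alpha> b) = 0"
    using half_add_half[of "tder \<alpha> b"] by (simp add: eq_neg_iff_add_eq_0 add.assoc)
  have "twisted_Div \<alpha> (field \<alpha> g b) = 0"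
    by (cases g; simp only: field.simps zero_prod_def twisted_Div_even twisted_Div_odd tder_simps * ; simp)
  moreover have "snd (snd (snd (field \<alpha> g b t_elem))) = 0"
    by (cases g) (simp_all add: zero_prod_def)
  ultimately show ?thesis
    by (simp add: sdiv_def S2_def field_W2)
qed

lemma crd_add: "crd g (D + E) = crd g D + crd g E"
  by (cases g) (simp_all add: pm.scale_right_distrib pm.scale_right_diff_distrib)

lemma crd_scale: "crd g (sop_scale c D) = pm_scale c (crd g D)"
  by (cases g)
     (cases "D t_elem"; cases "D th1"; cases "D th2";
      simp add: op_scale_def pm.scale_right_diff_distrib mult.commute)+

lemma crd_zero [simp]: "crd g 0 = 0"
  by (cases g) simp_all

lemma crd_field: "crd g (field \<alpha> g' b) = (if g = g' then b else 0)"
proof -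
  have "pm_scale (1/2) b + pm_scale (1/2) b = b"
    by (simp flip: pm.scale_left_distrib)
  then show ?thesis
    by (cases g; cases g') (simp_all add: zero_prod_def pm.scale_right_distrib)
qed

lemma crd_sum: "crd g (sum f A) = (\<Sum>x\<in>A. crd g (f x))"
proof (induction A rule: infinite_finite_induct)
  case (insert x F)
  then show ?case by (simp only: sum.insert crd_add not_False_eq_True)
qed (simp_all only: sum.infinite sum.empty crd_zero not_False_eq_True)

lemma gpar_sets: "{g. \<not> gpar g} = {gL, gE, gH, gF}" "{g. gpar g} = {gh, gp, gx, gy}"
proof -
  have "\<not> gpar g \<longleftrightarrow> g \<in> {gL, gE, gH, gF}" "gpar g \<longleftrightarrow> g \<in> {gh, gp, gx, gy}" for g
    by (cases g; simp)+
  then show "{g. \<not> gpar g} = {gL, gE, gH, gF}" "{g. gpar g} = {gh, gp, gx, gy}" by blast+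
qed

text \<open>In each parity the divergence condition leaves four free Laurent polynomials, those read
  off by \<open>crd\<close>. In the even case it fixes the sum \<open>p + s\<close>, while half the
  difference is the coordinate along \<open>gH\<close>.\<close>

lemma sdiv_decomp:
  assumes "sdiv \<alpha> i D"
  shows "D = (\<Sum>g | gpar g = i. field \<alpha> g (crd g D))"
proof (cases i)
  case False
  have G: "{g. gpar g = i} = {gL, gE, gH, gF}"
    using False gpar_sets by simp
  have D: "D \<in> W2 False" "twisted_Div \<alpha> D = 0" "snd (snd (snd (D t_elem))) = 0"
    using assms False by (auto simp: sdiv_def S2_def)
  obtain a b p q r s where E: "D = vfield (a, 0, 0, b) (0, p, q, 0) (0, r, s, 0)"
    using W2_even_cases[OF D(1)] .
  have b: "b = 0" using D(3) by (simp add: E)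
  have t: "tder \<alpha> a = p + s"
    using D(2) unfolding E twisted_Div_even by (simp add: zero_prod_def algebra_simps)
  have h: "p = pm_scale (1/2) (p + s) - pm_scale (1/2) (s - p)" "s = pm_scale (1/2) (p + s) + pm_scale (1/2) (s - p)"
  proof -
    have *: "x + y - (y - x) = x + x" "x + y + (y - x) = y + y" for x y :: laurent
      by simp_all
    show "p = pm_scale (1/2) (p + s) - pm_scale (1/2) (s - p)" "s = pm_scale (1/2) (p + s) + pm_scale (1/2) (s - p)"
      by (simp_all only: pm.scale_right_distrib pm.scale_right_diff_distrib * half_add_half)
  qed
  have "vfield (a, 0, 0, b) (0, p, q, 0) (0, r, s, 0) = field \<alpha> gL (- a) + (field \<alpha> gE q + (field \<alpha> gH (pm_scale (1/2) (s - p)) + field \<alpha> gF r))"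
  proof -
    have n: "pm_scale (1 / 2) (- p - s) = - pm_scale (1/2) (p + s)"
      by (simp flip: pm.scale_minus_right)
    have h': "pm_scale (1/2) (s - p) + pm_scale (1/2) (p + s) = s"
      using h(2) by (simp only: add.commute)
    show ?thesis
      by (simp add: vfield_add[symmetric] b t zero_prod_def n h' h(1)[symmetric] h(2)[symmetric])
  qed
  moreover have "crd gL D = - a" "crd gE D = q" "crd gH D = pm_scale (1/2) (s - p)" "crd gF D = r"
    by (simp_all add: E)
  ultimately show ?thesis
    unfolding G by (simp add: E del: field.simps crd.simps)
next
  case True
  have G: "{g. gpar g = i} = {gh, gp, gx, gy}"
    using True gpar_sets by simp
  have D: "D \<in> W2 True" "twisted_Div \<alpha> D = 0"
    using assms True by (auto simp: sdiv_def S2_def)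
  obtain a b p q r s where E: "D = vfield (0, a, b, 0) (p, 0, 0, q) (r, 0, 0, s)"
    using W2_odd_cases[OF D(1)] .
  have t: "s = tder \<alpha> a" "q = - tder \<alpha> b"
    using D(2) unfolding E twisted_Div_odd by (auto simp: zero_prod_def eq_neg_iff_add_eq_0 add.commute)
  have "vfield (0, a, b, 0) (p, 0, 0, q) (r, 0, 0, s) = field \<alpha> gh b + (field \<alpha> gp (- r) + (field \<alpha> gx p + field \<alpha> gy a))"
    by (simp add: vfield_add[symmetric] t zero_prod_def)
  moreover have "crd gh D = b" "crd gp D = - r" "crd gx D = p" "crd gy D = a"
    by (simp_all add: E)
  ultimately show ?thesis
    unfolding G by (simp add: E del: field.simps crd.simps)
qed

lemma spart_add: "a \<in> spart i \<Longrightarrow> b \<in> spart i \<Longrightarrow> a + b \<in> spart i"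
  by (auto simp: spart_def)

lemma spart_scale: "a \<in> spart i \<Longrightarrow> sscale c a \<in> spart i"
  by (auto simp: spart_def)

lemma W2_subspace_add:
  assumes D: "D \<in> W2 i" and E: "E \<in> W2 i"
  shows "D + E \<in> W2 i"
proof -
  have "vfield (D t_elem + E t_elem) (D th1 + E th1) (D th2 + E th2) \<in> W2 i"
    using W2_spart[OF D t_spart(1)] W2_spart[OF D t_spart(2)] W2_spart[OF D t_spart(3)]
         W2_spart[OF E t_spart(1)] W2_spart[OF E t_spart(2)] W2_spart[OF E t_spart(3)]
    by (intro vfield_W2 spart_add) simp_all
  then show ?thesis
    by (simp only: vfield_add W2_vfield[OF D, symmetric] W2_vfield[OF E, symmetric])
qed

lemma W2_subspace_scale:
  assumes D: "D \<in> W2 i"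
  shows "sop_scale c D \<in> W2 i"
proof -
  have "vfield (sscale c (D t_elem)) (sscale c (D th1)) (sscale c (D th2)) \<in> W2 i"
    using W2_spart[OF D t_spart(1)] W2_spart[OF D t_spart(2)] W2_spart[OF D t_spart(3)]
    by (intro vfield_W2 spart_scale) simp_all
  then show ?thesis
    by (simp only: vfield_scale W2_vfield[OF D, symmetric])
qed

lemma twisted_Div_add: "twisted_Div \<alpha> (D + E) = twisted_Div \<alpha> D + twisted_Div \<alpha> E"
  by (cases "D t_elem"; cases "D th1"; cases "D th2"; cases "E t_elem"; cases "E th1"; cases "E th2")
     (simp add: twisted_Div_def Div_def algebra_simps)

lemma twisted_Div_scale: "twisted_Div \<alpha> (sop_scale c D) = sscale c (twisted_Div \<alpha> D)"
  by (cases "D t_elem"; cases "D th1"; cases "D th2")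
     (simp add: twisted_Div_def Div_def op_scale_def pm.scale_right_distrib pm.scale_right_diff_distrib)

lemma sdiv_add: "sdiv \<alpha> i D \<Longrightarrow> sdiv \<alpha> i E \<Longrightarrow> sdiv \<alpha> i (D + E)"
  by (simp add: sdiv_def S2_def W2_subspace_add twisted_Div_add)

lemma sdiv_scale:
  assumes "sdiv \<alpha> i D"
  shows "sdiv \<alpha> i (sop_scale c D)"
proof -
  have "snd (snd (snd (sop_scale c D t_elem))) = 0"
    using assms by (cases "D t_elem") (simp add: sdiv_def op_scale_def)
  then show ?thesis
    using assms by (simp add: sdiv_def S2_def W2_subspace_scale twisted_Div_scale)
qed

lemma sdiv_zero: "sdiv \<alpha> i 0"
  using sdiv_scale[OF field_sdiv[of \<alpha> "if i then gx else gL" 0], of 0] by (cases i) auto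

lemma bracket_eqI:
  assumes "D \<in> W2 i" "E \<in> W2 j" "R \<in> W2 k" "k = (i \<noteq> j)"
    and "\<And>a. a \<in> {t_elem, th1, th2} \<Longrightarrow> D (E a) - sscale (ksign (i \<and> j)) (E (D a)) = R a"
  shows "sbracket D E = R"
proof (rule W2_ext[OF W2_bracket[OF assms(1,2)]])
  show "R \<in> W2 (i \<noteq> j)" using assms(3,4) by simp
qed (simp_all only: sbracket_W2[OF assms(1,2)] assms(5) insert_iff simp_thms)

lemma field_bracket_sl2:
  "sbracket (field \<alpha> gH a) (field \<alpha> gE b) = field \<alpha> gE (a * b + a * b)"
  "sbracket (field \<alpha> gH a) (field \<alpha> gF b) = field \<alpha> gF (- (a * b) - a * b)"
  "sbracket (field \<alpha> gE a) (field \<alpha> gF b) = field \<alpha> gH (a * b)"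
  by (rule bracket_eqI[OF field_W2 field_W2 field_W2];
      auto simp: vfield_apply t_elem_def th1_def th2_def zero_prod_def algebra_simps)+

lemma field_bracket_H1:
  "sbracket (field \<alpha> gH 1) (field \<alpha> gx b) = field \<alpha> gx b"
  "sbracket (field \<alpha> gH 1) (field \<alpha> gp b) = field \<alpha> gp (- b)"
  "sbracket (field \<alpha> gH 1) (field \<alpha> gh b) = field \<alpha> gh b"
  "sbracket (field \<alpha> gH 1) (field \<alpha> gy b) = field \<alpha> gy (- b)"
  "sbracket (field \<alpha> gH 1) (field \<alpha> gE b) = field \<alpha> gE (b + b)"
  "sbracket (field \<alpha> gH 1) (field \<alpha> gF b) = field \<alpha> gF (- b - b)"
  by (rule bracket_eqI[OF field_W2 field_W2 field_W2];
      auto simp: vfield_apply t_elem_def th1_def th2_def zero_prod_def algebra_simps)+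

lemma field_bracket_LL: "sbracket (field \<alpha> gL a) (field \<alpha> gL b) = field \<alpha> gL (laurent_deriv a * b - a * laurent_deriv b)"
proof (rule bracket_eqI[OF field_W2 field_W2 field_W2])
  have K: "pm_scale (- 1 / 2) c = tpow 0 (- 1 / 2) * c" for c :: laurent
    by (rule pm_scale_conv_single)
  show "field \<alpha> gL a (field \<alpha> gL b z) - sscale (ksign (gpar gL \<and> gpar gL)) (field \<alpha> gL b (field \<alpha> gL a z)) =
    field \<alpha> gL (laurent_deriv a * b - a * laurent_deriv b) z" if "z \<in> {t_elem, th1, th2}" for z
    using that
    by (auto simp: vfield_apply t_elem_def th1_def th2_def zero_prod_def K tder_def laurent_deriv_mult mult_single)
       (simp_all add: algebra_simps flip: pm_scale_conv_single)
qed auto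

section \<open>Basis, coordinates and cocycle of the derived algebra\<close>

lemma field_S2: "field \<alpha> g b \<in> S2 \<alpha> (gpar g)"
  using field_sdiv[of \<alpha> g b] by (simp add: sdiv_def)

definition gbasis :: "complex \<Rightarrow> bool \<Rightarrow> sop set" where
  "gbasis \<alpha> i = S2'_basis \<alpha> ` {b. gpar (fst b) = i}"

abbreviation gspan :: "complex \<Rightarrow> bool \<Rightarrow> sop set" where
  "gspan \<alpha> i \<equiv> ov.span (gbasis \<alpha> i)"

lemma range_basis: "range (S2'_basis \<alpha>) = gbasis \<alpha> False \<union> gbasis \<alpha> True"
  by (auto simp: gbasis_def)

lemma field_gbasis: "field \<alpha> g b \<in> gspan \<alpha> (gpar g)"
proof (induction b rule: pm_induct)
  case (single k c)
  have "field \<alpha> g (tpow k c) = sop_scale c (S2'_basis \<alpha> (g, k - gshift g))"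
    unfolding basis_field by (simp flip: field_scale)
  moreover have "S2'_basis \<alpha> (g, k - gshift g) \<in> gbasis \<alpha> (gpar g)"
    unfolding gbasis_def by (rule imageI) simp
  ultimately show ?case
    by (simp only: ov.span_scale ov.span_base)
next
  case zero
  show ?case by (simp only: field_zero ov.span_zero)
next
  case (add p q)
  then show ?case by (simp only: field_add ov.span_add)
qed

lemma sdiv_span:
  assumes "sdiv \<alpha> i D"
  shows "D \<in> gspan \<alpha> i"
  by (subst sdiv_decomp[OF assms], rule ov.span_sum) (use field_gbasis in auto)

lemma bracket_S2'_part: "D \<in> S2 \<alpha> j \<Longrightarrow> E \<in> S2 \<alpha> k \<Longrightarrow> sbracket D E \<in> S2'_part \<alpha> (j \<noteq> k)"
  unfolding S2'_part_def by (rule ov.span_base) blast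

lemma S2'_part_scale: "D \<in> S2'_part \<alpha> i \<Longrightarrow> sop_scale c D \<in> S2'_part \<alpha> i"
  unfolding S2'_part_def by (rule ov.span_scale)

text \<open>The element \<open>field \<alpha> gH 1\<close> acts with nonzero eigenvalue on every
  family except \<open>gL\<close> and \<open>gH\<close>; the family \<open>gH\<close> consists of
  brackets of \<open>gE\<close> with \<open>gF\<close>.\<close>

lemma field_S2'_part: "field \<alpha> g (tpow n 1) \<in> S2'_part \<alpha> (gpar g)"
proof -
  have half: "tpow n 1 = pm_scale (1/2) (tpow n 1 + tpow n 1)" "tpow n 1 = pm_scale (- 1/2) (- tpow n 1 - tpow n 1)"
  proof -
    have "pm_scale (- 1/2) (- a - a) = pm_scale (1/2) a + pm_scale (1/2) a" for a :: laurent
      by (simp add: pm.scale_right_diff_distrib)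
    then show "tpow n 1 = pm_scale (- 1/2) (- tpow n 1 - tpow n 1)"
      by (simp only: half_add_half)
    show "tpow n 1 = pm_scale (1/2) (tpow n 1 + tpow n 1)"
      by (simp only: pm.scale_right_distrib half_add_half)
  qed
  have neg: "tpow n 1 = pm_scale (-1) (- tpow n (1 :: complex))" by (simp add: single_uminus)
  note br = bracket_S2'_part[OF field_S2[of \<alpha> gH 1] field_S2[of \<alpha> g "tpow n 1"]]
  show ?thesis
  proof (cases g)
    case gL
    \<comment> \<open>The field for \<open>t^1\<close> has eigenvalue \<open>1 - n\<close> on the
      one for \<open>t^n\<close>; the exceptional field \<open>n = 1\<close> is reached from the
      exponents 2 and 0.\<close>
    show ?thesis
    proof (cases "n = 1")
      case False
      have "tpow n 1 = pm_scale (1 / (1 - of_int n)) (laurent_deriv (tpow 1 1) * tpow n 1 - tpow 1 1 * laurent_deriv (tpow n 1))"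
        using False by (simp add: mult_single field_simps flip: single_diff)
      then show ?thesis
        using S2'_part_scale[OF bracket_S2'_part[OF field_S2[of \<alpha> gL "tpow 1 1"] field_S2[of \<alpha> gL "tpow n 1"]], of "1 / (1 - of_int n)"]
        unfolding field_bracket_LL gL by (simp only: field_scale[symmetric] gpar.simps) simp
    next
      case True
      have "tpow n 1 = pm_scale (1 / 2) (laurent_deriv (tpow 2 1) * tpow 0 1 - tpow 2 1 * laurent_deriv (tpow 0 1))"
        using True by (simp add: mult_single field_simps flip: single_diff)
      then show ?thesis
        using S2'_part_scale[OF bracket_S2'_part[OF field_S2[of \<alpha> gL "tpow 2 1"] field_S2[of \<alpha> gL "tpow 0 1"]], of "1 / 2"]
        unfolding field_bracket_LL gL by (simp only: field_scale[symmetric] gpar.simps) simp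
    qed
  next
    case gE
    show ?thesis unfolding gE
      by (subst half(1), subst field_scale, rule S2'_part_scale)
         (use br[unfolded gE field_bracket_H1] in \<open>simp del: field.simps\<close>)
  next
    case gF
    show ?thesis unfolding gF
      by (subst half(2), subst field_scale, rule S2'_part_scale)
         (use br[unfolded gF field_bracket_H1] in \<open>simp del: field.simps\<close>)
  next
    case gH
    show ?thesis
      using bracket_S2'_part[OF field_S2[of \<alpha> gE "tpow n 1"] field_S2[of \<alpha> gF 1]]
      unfolding field_bracket_sl2 gH by (simp del: field.simps)
  next
    case gx
    show ?thesis using br unfolding gx field_bracket_H1 by (simp del: field.simps)
  next
    case gh
    show ?thesis using br unfolding gh field_bracket_H1 by (simp del: field.simps)
  next
    case gp
    show ?thesis unfolding gp
      by (subst neg, subst field_scale, rule S2'_part_scale)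
         (use br[unfolded gp field_bracket_H1] in \<open>simp del: field.simps\<close>)
  next
    case gy
    show ?thesis unfolding gy
      by (subst neg, subst field_scale, rule S2'_part_scale)
         (use br[unfolded gy field_bracket_H1] in \<open>simp del: field.simps\<close>)
  qed
qed

lemma S2'_part_sdiv:
  assumes "D \<in> S2'_part \<alpha> i"
  shows "sdiv \<alpha> i D"
  using assms unfolding S2'_part_def
proof (induction rule: ov.span_induct_alt)
  case base
  show ?case by (rule sdiv_zero)
next
  case (step c x y)
  then obtain D E j k where "x = sbracket D E" "D \<in> S2 \<alpha> j" "E \<in> S2 \<alpha> k" "i = (j \<noteq> k)"
    by blast
  then have "sdiv \<alpha> i x" using sdiv_bracket[of D \<alpha> j E k] by simp
  then show ?case using step(2) by (intro sdiv_add sdiv_scale)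
qed

text \<open>A circle of inclusions: brackets satisfy \<open>sdiv\<close>, solutions of
  \<open>sdiv\<close> are combinations of the basis fields, and each basis field is a multiple of a
  bracket.\<close>

lemma S2'_part_span: "S2'_part \<alpha> i = gspan \<alpha> i"
proof
  show "S2'_part \<alpha> i \<subseteq> gspan \<alpha> i"
    using S2'_part_sdiv sdiv_span by blast
  have "gbasis \<alpha> i \<subseteq> S2'_part \<alpha> i"
  proof
    fix x assume "x \<in> gbasis \<alpha> i"
    then obtain g n where "x = S2'_basis \<alpha> (g, n)" "gpar g = i"
      unfolding gbasis_def by (elim imageE) (metis (mono_tags, lifting) mem_Collect_eq prod.collapse)
    then show "x \<in> S2'_part \<alpha> i"
      using field_S2'_part[of \<alpha> g "n + gshift g"] by (simp only: basis_field)
  qed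
  then show "gspan \<alpha> i \<subseteq> S2'_part \<alpha> i"
    unfolding S2'_part_def by (rule ov.span_minimal) (rule ov.subspace_span)
qed

lemma S2'_part_iff: "D \<in> S2'_part \<alpha> i \<longleftrightarrow> sdiv \<alpha> i D"
  using S2'_part_sdiv sdiv_span by (auto simp: S2'_part_span)

lemma carrier_S2': "carrier (S2' \<alpha>) = ov.span (range (S2'_basis \<alpha>))"
  unfolding S2'_def lie_superalgebra_of_def range_basis ov.span_Un S2'_part_span by auto

text \<open>Agrees with the chosen representation \<open>S2'_coord\<close> on the carrier, but is
  explicit and linear on all operators, so that its rules carry no membership conditions.\<close>

definition gcoef :: "gen \<times> int \<Rightarrow> sop \<Rightarrow> complex" where
  "gcoef b D = Poly_Mapping.lookup (crd (fst b) D) (snd b + gshift (fst b))"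

lemma gcoef_basis: "gcoef b (S2'_basis \<alpha> b') = (if b = b' then 1 else 0)"
  by (cases b; cases b') (auto simp: gcoef_def basis_field crd_field lookup_single when_def simp del: S2'_basis.simps field.simps crd.simps)

lemma gcoef_add: "gcoef b (D + E) = gcoef b D + gcoef b E"
  by (simp add: gcoef_def crd_add lookup_add del: crd.simps)

lemma gcoef_scale: "gcoef b (sop_scale c D) = c * gcoef b D"
  by (simp add: gcoef_def crd_scale del: crd.simps)

lemma gcoef_sum: "gcoef b (sum f A) = (\<Sum>x\<in>A. gcoef b (f x))"
  by (simp add: gcoef_def crd_sum lookup_sum del: crd.simps)

lemma inj_basis: "inj (S2'_basis \<alpha>)"
proof (rule injI)
  fix b b' assume "S2'_basis \<alpha> b = S2'_basis \<alpha> b'"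
  then show "b = b'"
    using gcoef_basis[of b \<alpha> b] gcoef_basis[of b \<alpha> b'] by (auto split: if_splits)
qed

lemma independent_basis: "ov.independent (range (S2'_basis \<alpha>))"
  unfolding ov.independent_explicit_module
proof (intro allI impI)
  fix t u v
  assume t: "finite t" "t \<subseteq> range (S2'_basis \<alpha>)" and s: "(\<Sum>v\<in>t. sop_scale (u v) v) = 0" and v: "v \<in> t"
  then obtain b where b: "v = S2'_basis \<alpha> b" by auto
  have "0 = gcoef b (\<Sum>v\<in>t. sop_scale (u v) v)"
    unfolding s by (simp add: gcoef_def del: crd.simps)
  also have "\<dots> = (\<Sum>w\<in>t. u w * gcoef b w)"
    by (simp only: gcoef_sum gcoef_scale)
  also have "\<dots> = (\<Sum>w\<in>t. if w = v then u v else 0)"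
  proof (rule sum.cong[OF refl])
    fix w assume "w \<in> t"
    then obtain b' where "w = S2'_basis \<alpha> b'" using t by auto
    then show "u w * gcoef b w = (if w = v then u v else 0)"
      using injD[OF inj_basis, of \<alpha> b b'] by (auto simp: b gcoef_basis)
  qed
  also have "\<dots> = u v" using t v by simp
  finally show "u v = 0" by simp
qed

lemma S2'_coord_gcoef:
  assumes X: "X \<in> carrier (S2' \<alpha>)"
  shows "S2'_coord \<alpha> X b = gcoef b X"
proof -
  let ?R = "range (S2'_basis \<alpha>)"
  let ?r = "ov.representation ?R X"
  have X': "X \<in> ov.span ?R" using X by (simp add: carrier_S2')
  have fin: "finite {v. ?r v \<noteq> 0}" by (rule ov.finite_representation)
  have sub: "v \<in> ?R" if "?r v \<noteq> 0" for v using ov.representation_ne_zero[OF that] .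
  have "X = (\<Sum>v | ?r v \<noteq> 0. sop_scale (?r v) v)"
    using ov.sum_nonzero_representation_eq[OF independent_basis X'] by simp
  then have "gcoef b X = (\<Sum>v | ?r v \<noteq> 0. ?r v * gcoef b v)"
    by (metis (no_types, lifting) gcoef_scale gcoef_sum sum.cong)
  also have "\<dots> = (\<Sum>v | ?r v \<noteq> 0. if v = S2'_basis \<alpha> b then ?r v else 0)"
  proof (rule sum.cong[OF refl])
    fix w assume "w \<in> {v. ?r v \<noteq> 0}"
    then obtain b' where "w = S2'_basis \<alpha> b'" using sub by blast
    then show "?r w * gcoef b w = (if w = S2'_basis \<alpha> b then ?r w else 0)"
      using injD[OF inj_basis, of \<alpha> b b'] by (auto simp: gcoef_basis)
  qed
  also have "\<dots> = ?r (S2'_basis \<alpha> b)"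
    using fin by (simp add: sum.delta)
  finally show ?thesis by (simp add: S2'_coord_def)
qed

lemma finite_gcoef: "finite {b. gcoef b X \<noteq> 0}"
proof -
  have "{b. gcoef b X \<noteq> 0} \<subseteq> (\<Union>g\<in>UNIV. (\<lambda>m. (g, m - gshift g)) ` Poly_Mapping.keys (crd g X))"
  proof
    fix b assume "b \<in> {b. gcoef b X \<noteq> 0}"
    then have "snd b + gshift (fst b) \<in> Poly_Mapping.keys (crd (fst b) X)"
      by (simp add: gcoef_def in_keys_iff del: crd.simps)
    then show "b \<in> (\<Union>g\<in>UNIV. (\<lambda>m. (g, m - gshift g)) ` Poly_Mapping.keys (crd g X))"
      by (cases b) (force simp del: crd.simps)
  qed
  then show ?thesis
    by (rule finite_subset) (auto simp: UNIV_gen simp del: crd.simps)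
qed

text \<open>The cocycle written with \<open>gcoef\<close>: equal to \<open>S2'_cocycle\<close> on
  the carrier and bilinear without any side condition.\<close>

definition coc :: "complex \<Rightarrow> sop \<Rightarrow> sop \<Rightarrow> complex" where
  "coc \<alpha> X Y = (\<Sum>a | gcoef a X \<noteq> 0. \<Sum>b | gcoef b Y \<noteq> 0. gcoef a X * gcoef b Y * cocycle_basis \<alpha> a b)"

lemma S2'_cocycle_coc:
  assumes "X \<in> carrier (S2' \<alpha>)" "Y \<in> carrier (S2' \<alpha>)"
  shows "S2'_cocycle \<alpha> X Y = coc \<alpha> X Y"
  unfolding S2'_cocycle_def coc_def by (simp add: S2'_coord_gcoef assms)

lemma coc_superset:
  assumes "finite A" "{b. gcoef b X \<noteq> 0} \<subseteq> A" "finite B" "{b. gcoef b Y \<noteq> 0} \<subseteq> B"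
  shows "coc \<alpha> X Y = (\<Sum>a\<in>A. \<Sum>b\<in>B. gcoef a X * gcoef b Y * cocycle_basis \<alpha> a b)"
proof -
  have "coc \<alpha> X Y = (\<Sum>a\<in>A. \<Sum>b | gcoef b Y \<noteq> 0. gcoef a X * gcoef b Y * cocycle_basis \<alpha> a b)"
    unfolding coc_def by (rule sum.mono_neutral_left) (use assms in auto)
  also have "\<dots> = (\<Sum>a\<in>A. \<Sum>b\<in>B. gcoef a X * gcoef b Y * cocycle_basis \<alpha> a b)"
    by (rule sum.cong[OF refl], rule sum.mono_neutral_left) (use assms in auto)
  finally show ?thesis .
qed

lemma coc_add_left: "coc \<alpha> (X + X') Y = coc \<alpha> X Y + coc \<alpha> X' Y"
proof -
  let ?A = "{b. gcoef b X \<noteq> 0} \<union> {b. gcoef b X' \<noteq> 0}" and ?B = "{b. gcoef b Y \<noteq> 0}"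
  have s: "{b. gcoef b (X + X') \<noteq> 0} \<subseteq> ?A" by (auto simp: gcoef_add)
  have f: "finite ?A" "finite ?B" using finite_gcoef by auto
  show ?thesis
    unfolding coc_superset[OF f(1) s f(2) order_refl] coc_superset[OF f(1) Un_upper1 f(2) order_refl]
      coc_superset[OF f(1) Un_upper2 f(2) order_refl]
    by (simp add: gcoef_add distrib_right sum.distrib)
qed

lemma coc_add_right: "coc \<alpha> Y (X + X') = coc \<alpha> Y X + coc \<alpha> Y X'"
proof -
  let ?A = "{b. gcoef b X \<noteq> 0} \<union> {b. gcoef b X' \<noteq> 0}" and ?B = "{b. gcoef b Y \<noteq> 0}"
  have s: "{b. gcoef b (X + X') \<noteq> 0} \<subseteq> ?A" by (auto simp: gcoef_add)
  have f: "finite ?A" "finite ?B" using finite_gcoef by auto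
  show ?thesis
    unfolding coc_superset[OF f(2) order_refl f(1) s] coc_superset[OF f(2) order_refl f(1) Un_upper1]
      coc_superset[OF f(2) order_refl f(1) Un_upper2]
    by (simp add: gcoef_add distrib_right distrib_left sum.distrib)
qed

lemma coc_scale_left: "coc \<alpha> (sop_scale c X) Y = c * coc \<alpha> X Y"
proof -
  let ?A = "{b. gcoef b X \<noteq> 0}" and ?B = "{b. gcoef b Y \<noteq> 0}"
  have s: "{b. gcoef b (sop_scale c X) \<noteq> 0} \<subseteq> ?A" by (auto simp: gcoef_scale)
  have f: "finite ?A" "finite ?B" using finite_gcoef by auto
  show ?thesis
    by (subst coc_superset[OF f(1) s f(2) order_refl], subst coc_def)
       (simp add: gcoef_scale sum_distrib_left mult_ac)
qed

lemma coc_scale_right: "coc \<alpha> Y (sop_scale c X) = c * coc \<alpha> Y X"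
proof -
  let ?A = "{b. gcoef b X \<noteq> 0}" and ?B = "{b. gcoef b Y \<noteq> 0}"
  have s: "{b. gcoef b (sop_scale c X) \<noteq> 0} \<subseteq> ?A" by (auto simp: gcoef_scale)
  have f: "finite ?A" "finite ?B" using finite_gcoef by auto
  show ?thesis
    by (subst coc_superset[OF f(2) order_refl f(1) s], subst coc_def)
       (simp add: gcoef_scale sum_distrib_left mult_ac)
qed

lemma coc_basis: "coc \<alpha> (S2'_basis \<alpha> a) (S2'_basis \<alpha> b) = cocycle_basis \<alpha> a b"
proof -
  have "{b. gcoef b (S2'_basis \<alpha> a) \<noteq> 0} = {a}" for a by (auto simp: gcoef_basis)
  then show ?thesis by (simp add: coc_def gcoef_basis)
qed

section \<open>The oscillator representation of the superalgebra\<close>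

datatype mono = mOne | mTh1 | mTh2 | mTh12

lemma UNIV_mono: "(UNIV :: mono set) = {mOne, mTh1, mTh2, mTh12}"
proof (rule UNIV_eq_I)
  show "s \<in> {mOne, mTh1, mTh2, mTh12}" for s by (cases s) auto
qed

fun mono_coef :: "mono \<Rightarrow> salg \<Rightarrow> laurent" where
  "mono_coef mOne (a0, a1, a2, a3) = a0" | "mono_coef mTh1 (a0, a1, a2, a3) = a1"
| "mono_coef mTh2 (a0, a1, a2, a3) = a2" | "mono_coef mTh12 (a0, a1, a2, a3) = a3"

fun mono_el :: "mono \<Rightarrow> laurent \<Rightarrow> salg" where
  "mono_el mOne a = (a, 0, 0, 0)" | "mono_el mTh1 a = (0, a, 0, 0)"
| "mono_el mTh2 a = (0, 0, a, 0)" | "mono_el mTh12 a = (0, 0, 0, a)"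

lemma mono_coef_add: "mono_coef s (a + b) = mono_coef s a + mono_coef s b"
  by (cases s; cases a; cases b) auto

lemma mono_coef_scale: "mono_coef s (sscale c a) = pm_scale c (mono_coef s a)"
  by (cases s; cases a) auto

lemma salg_induct [case_names add scale mono]:
  assumes "\<And>a b. P a \<Longrightarrow> P b \<Longrightarrow> P (a + b)" "\<And>c a. P a \<Longrightarrow> P (sscale c a)" "\<And>s n. P (mono_el s (tpow n 1))"
  shows "P a"
proof -
  have 0: "P 0" using assms(2)[OF assms(3)[of mOne 0], of 0] by (simp add: zero_prod_def)
  have 1: "P (mono_el s x)" for s x
  proof (induction x rule: pm_induct)
    case zero
    then show ?case using 0 by (cases s) (simp_all add: zero_prod_def)
  next
    case (add p q)
    have "mono_el s (p + q) = mono_el s p + mono_el s q" by (cases s) auto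
    then show ?case using assms(1) add by simp
  next
    case (single k c)
    have "mono_el s (tpow k c) = sscale c (mono_el s (tpow k 1))" by (cases s) auto
    then show ?case using assms(2,3) by simp
  qed
  obtain w x y z where "a = (w, x, y, z)" by (metis surj_pair)
  then have "a = mono_el mOne w + mono_el mTh1 x + mono_el mTh2 y + mono_el mTh12 z" by simp
  then show ?thesis using 1 assms(1) by metis
qed

type_synonym 'v index = "mono \<times> int \<times> 'v"

definition vec :: "'v \<Rightarrow> salg \<Rightarrow> ('v index \<Rightarrow>\<^sub>0 complex)" where
  "vec v f = (\<Sum>s\<in>UNIV. pm_lin (\<lambda>n. Poly_Mapping.single (s, n, v) 1) (mono_coef s f))"

lemma vec_add: "vec v (a + b) = vec v a + vec v b"
  by (simp add: vec_def mono_coef_add pm_lin_add sum.distrib)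

lemma vec_scale: "vec v (sscale c a) = pm_scale c (vec v a)"
  by (simp add: vec_def mono_coef_scale pm_lin_scale pm.scale_sum_right)

lemma vec_diff: "vec v (a - b) = vec v a - vec v b"
  using vec_add[of v "a - b" b] by simp

lemma vec_mono: "vec v (mono_el s (tpow n c)) = Poly_Mapping.single (s, n, v) c"
  by (cases s) (simp_all add: vec_def UNIV_mono)

definition mat :: "sop \<Rightarrow> 'v index \<Rightarrow> ('v index \<Rightarrow>\<^sub>0 complex)" where
  "mat D = (\<lambda>(s, n, v). vec v (D (mono_el s (tpow n 1))))"

lemma mat_add: "mat (D + E) = (\<lambda>l. mat D l + mat E l)"
  by (auto simp: mat_def vec_add)

lemma mat_scale: "mat (sop_scale c D) = (\<lambda>l. pm_scale c (mat D l))"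
  by (auto simp: mat_def vec_scale op_scale_def)

lemma ext_mat_vec:
  assumes "\<And>a b. D (a + b) = D a + D b" "\<And>c a. D (sscale c a) = sscale c (D a)"
  shows "ext (mat D) (vec v f) = vec v (D f)"
proof (induction f rule: salg_induct)
  case (mono s n)
  then show ?case by (simp add: vec_mono ext_def mat_def)
qed (simp_all add: assms vec_add vec_scale ext_def pm_lin_add pm_lin_scale)

lemma tw_add: "X \<in> W2 i \<Longrightarrow> tw \<alpha> X (a + b) = tw \<alpha> X a + tw \<alpha> X b"
  by (simp add: tw_def W2_add smul_add_right)

lemma tw_scale: "X \<in> W2 i \<Longrightarrow> tw \<alpha> X (sscale c a) = sscale c (tw \<alpha> X a)"
  by (simp add: tw_def W2_scale sv.scale_right_distrib)

lemma tw_op_add: "tw \<alpha> (X + Y) = tw \<alpha> X + tw \<alpha> Y"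
  by (rule ext) (simp add: tw_def smul_add_left smul_add_right)

lemma tw_op_scale: "tw \<alpha> (sop_scale c X) = sop_scale c (tw \<alpha> X)"
  by (rule ext) (simp add: tw_def op_scale_def sv.scale_right_distrib)

definition tmat :: "complex \<Rightarrow> sop \<Rightarrow> 'v index \<Rightarrow> ('v index \<Rightarrow>\<^sub>0 complex)" where
  "tmat \<alpha> X = mat (tw \<alpha> X)"

lemma tmat_add: "tmat \<alpha> (X + Y) = (\<lambda>l. tmat \<alpha> X l + tmat \<alpha> Y l)"
  unfolding tmat_def tw_op_add by (rule mat_add)

lemma tmat_scale: "tmat \<alpha> (sop_scale c X) = (\<lambda>l. pm_scale c (tmat \<alpha> X l))"
  unfolding tmat_def tw_op_scale by (rule mat_scale)

lemma tmat_bracket: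
  assumes X: "X \<in> W2 i" and Y: "Y \<in> W2 j"
  shows "tmat \<alpha> (sbracket X Y) l = ext (tmat \<alpha> X) (tmat \<alpha> Y l) - pm_scale (ksign (i \<and> j)) (ext (tmat \<alpha> Y) (tmat \<alpha> X l))"
proof -
  obtain s n v where l: "l = (s, n, v)" by (cases l)
  have m: "tmat \<alpha> Z l = vec v (tw \<alpha> Z (mono_el s (tpow n 1)))" for Z
    by (simp add: tmat_def mat_def l)
  have e: "ext (tmat \<alpha> X) (vec v f) = vec v (tw \<alpha> X f)" "ext (tmat \<alpha> Y) (vec v f) = vec v (tw \<alpha> Y f)" for f
    unfolding tmat_def by (intro ext_mat_vec tw_add[OF X] tw_scale[OF X] tw_add[OF Y] tw_scale[OF Y])+
  show ?thesis
    unfolding m e tw_bracket[OF X Y] vec_diff vec_scale ..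
qed

subsection \<open>Matrix coefficients of the basis\<close>

text \<open>Under the twisted action a basis field sends a monomial to a multiple of one monomial:
  \<open>gtgt\<close> is its odd part, \<open>goff\<close> the extra shift of the exponent,
  \<open>gcf\<close> the coefficient. Where \<open>gcf\<close> vanishes, the value \<open>s\<close>
  of \<open>gtgt\<close> is a mere default.\<close>

fun gtgt :: "gen \<Rightarrow> mono \<Rightarrow> mono" where
  "gtgt gE mTh1 = mTh2"
| "gtgt gF mTh2 = mTh1"
| "gtgt gh mOne = mTh2" | "gtgt gh mTh1 = mTh12"
| "gtgt gp mTh2 = mOne" | "gtgt gp mTh12 = mTh1"
| "gtgt gx mTh1 = mOne" | "gtgt gx mTh12 = mTh2"
| "gtgt gy mOne = mTh1" | "gtgt gy mTh2 = mTh12"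
| "gtgt _ s = s"

fun goff :: "gen \<Rightarrow> int" where
  "goff gh = -1" | "goff gy = -1" | "goff gp = 1" | "goff gx = 1" | "goff _ = 0"

fun gcf :: "complex \<Rightarrow> gen \<Rightarrow> complex \<Rightarrow> mono \<Rightarrow> complex \<Rightarrow> complex" where
  "gcf \<alpha> gL n mOne m = - (m - \<alpha> / 2)"
| "gcf \<alpha> gL n mTh1 m = - (m - \<alpha> / 2) - (n + \<alpha> + 1) / 2"
| "gcf \<alpha> gL n mTh2 m = - (m - \<alpha> / 2) - (n + \<alpha> + 1) / 2"
| "gcf \<alpha> gL n mTh12 m = - (m - \<alpha> / 2) - (n + \<alpha> + 1)"
| "gcf \<alpha> gE n mTh1 m = 1"
| "gcf \<alpha> gH n mTh1 m = - 1"
| "gcf \<alpha> gH n mTh2 m = 1"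
| "gcf \<alpha> gF n mTh2 m = 1"
| "gcf \<alpha> gh n mOne m = m - \<alpha> / 2"
| "gcf \<alpha> gh n mTh1 m = - (m + n + \<alpha> / 2)"
| "gcf \<alpha> gp n mTh2 m = - 1"
| "gcf \<alpha> gp n mTh12 m = 1"
| "gcf \<alpha> gx n mTh1 m = 1"
| "gcf \<alpha> gx n mTh12 m = 1"
| "gcf \<alpha> gy n mOne m = m - \<alpha> / 2"
| "gcf \<alpha> gy n mTh2 m = m + n + \<alpha> / 2"
| "gcf \<alpha> _ n _ m = 0"

lemma tw_basis: "tw \<alpha> (S2'_basis \<alpha> (g, n)) (mono_el s (tpow m 1)) =
    mono_el (gtgt g s) (tpow (m + n + goff g) (gcf \<alpha> g (of_int n) s (of_int m)))"
  by (cases g; cases s;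
      simp add: tw_def vfield_apply zero_prod_def mult_single field_simps flip: single_add single_diff single_uminus;
      rule arg_cong[where f = "Poly_Mapping.single _"]; simp add: field_simps)

lemma tmat_basis: "tmat \<alpha> (S2'_basis \<alpha> (g, n)) (s, m, v) =
   Poly_Mapping.single (gtgt g s, m + n + goff g, v) (gcf \<alpha> g (of_int n) s (of_int m))"
  unfolding tmat_def mat_def by (simp only: prod.case tw_basis vec_mono)

fun mferm :: "mono \<Rightarrow> bool" where
  "mferm mOne = True" | "mferm mTh12 = True" | "mferm _ = False"

fun mdual :: "mono \<Rightarrow> mono" where
  "mdual mOne = mTh12" | "mdual mTh12 = mOne" | "mdual mTh1 = mTh2" | "mdual mTh2 = mTh1"

text \<open>The coefficient of \<open>\<theta>\<^sub>1 \<theta>\<^sub>2\<close> in the product of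
  \<open>mdual s\<close> and \<open>s\<close>, in this order; the sign at \<open>mTh1\<close> is
  that of \<open>(x, x') = - x'(x)\<close>.\<close>

fun mform :: "mono \<Rightarrow> complex" where
  "mform mTh1 = -1" | "mform _ = 1"

text \<open>
  The letter \<open>(s, n, v)\<close> stands for the function \<open>t^n s \<otimes> v\<close> and \<open>idual\<close> comes from the residue
  pairing. As \<open>t^n \<otimes> v\<close> is a letter for every vector \<open>v\<close>, only those with \<open>v\<close> in the basis \<open>B\<close> are live.
\<close>

definition ipar :: "'v index \<Rightarrow> bool" where "ipar = (\<lambda>(s, n, v). mferm s)"
definition idual :: "'v index \<Rightarrow> 'v index" where "idual = (\<lambda>(s, n, v). (mdual s, - 1 - n, v))"
definition iform :: "'v index \<Rightarrow> complex" where "iform = (\<lambda>(s, n, v). mform s)"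
definition iann :: "'v index \<Rightarrow> bool" where "iann = (\<lambda>(s, n, v). n < 0)"
definition ilive :: "'v set \<Rightarrow> 'v index \<Rightarrow> bool" where "ilive B = (\<lambda>(s, n, v). v \<in> B)"

lemma index_simps [simp]: "ipar (s, n, v) = mferm s" "idual (s, n, v) = (mdual s, - 1 - n, v)"
  "iform (s, n, v) = mform s" "iann (s, n, v) \<longleftrightarrow> n < 0" "ilive B (s, n, v) \<longleftrightarrow> v \<in> B"
  by (simp_all add: ipar_def idual_def iform_def iann_def ilive_def)

lemma mdual_simps [simp]: "mdual (mdual s) = s" "mferm (mdual s) = mferm s"
  by (cases s; simp)+

lemma mform_dual: "mform (mdual s) = - ksign (mferm s) * mform s" "mform s * mform s = 1"
  by (cases s; simp)+

locale fock =
  fixes B :: "'v set"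
  assumes finite_B: "finite B"

sublocale fock \<subseteq> oscillator ipar idual iform iann "ilive B"
  by unfold_locales (auto simp: mform_dual)

context fock begin

lemma pairing_single: "pairing (Poly_Mapping.single (s', m', v') c) (s, m, v) =
   (if v \<in> B \<and> v' = v \<and> s' = mdual s \<and> m' = - 1 - m then c * mform (mdual s) else 0)"
  by (auto simp: pairing_def lookup_single when_def)

text \<open>An annihilator has negative exponent and a creator a nonnegative one, so a shift by
  \<open>n + goff g\<close> can lead from one to the other only in a finite window.\<close>

lemma supp_basis: "supp (tmat \<alpha> (S2'_basis \<alpha> (g, n))) \<subseteq> UNIV \<times> {- (n + goff g)..<0} \<times> B"
proof
  fix l :: "'v index" assume *: "l \<in> supp (tmat \<alpha> (S2'_basis \<alpha> (g, n)))"
  obtain s m v where l: "l = (s, m, v)" by (cases l)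
  have "\<not> m + n + goff g < 0"
  proof
    assume "m + n + goff g < 0"
    then have "cre (tmat \<alpha> (S2'_basis \<alpha> (g, n)) l) = 0"
      unfolding l tmat_basis by (intro poly_mapping_eqI) (auto simp: lookup_single when_def)
    then show False using * by (simp add: supp_def)
  qed
  then show "l \<in> UNIV \<times> {- (n + goff g)..<0} \<times> B"
    using * by (auto simp: supp_def l)
qed

text \<open>Invariance of the residue pairing, coefficient by coefficient. For \<open>gL\<close> and
  the fields \<open>gh\<close>, \<open>gy\<close>, it is the shift by \<open>\<alpha> / 2\<close> in
  \<open>gcf\<close> that makes the coefficients at dual exponents match.\<close>

lemma osp_basis: "osp (gpar g) (tmat \<alpha> (S2'_basis \<alpha> (g, n)))"
  unfolding osp_def hmap_def
proof (intro conjI allI ballI impI)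
  fix l :: "'v index"
  obtain s m v where l: "l = (s, m, v)" by (cases l)
  show "hom (gpar g \<noteq> ipar l) (tmat \<alpha> (S2'_basis \<alpha> (g, n)) l)"
    unfolding l tmat_basis by (cases g; cases s) (simp_all add: hom_def)
  show "ilive B k = ilive B l" if "k \<in> Poly_Mapping.keys (tmat \<alpha> (S2'_basis \<alpha> (g, n)) l)" for k
    using that unfolding l tmat_basis by (auto split: if_splits)
  fix l' :: "'v index"
  obtain s' m' v' where l': "l' = (s', m', v')" by (cases l')
  have iff: "m + n + goff g = - 1 - m' \<longleftrightarrow> m' + n + goff g = - 1 - m" by auto
  show "pairing (tmat \<alpha> (S2'_basis \<alpha> (g, n)) l) l' = ksign (ipar l \<and> ipar l') * pairing (tmat \<alpha> (S2'_basis \<alpha> (g, n)) l') l"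
    if "ilive B l" "ilive B l'"
  proof (cases "v = v' \<and> m' + n + goff g = - 1 - m")
    case True
    then have e: "v' = v" "m' = - 1 - m - n - goff g" by auto
    show ?thesis
      using that unfolding l l' tmat_basis pairing_single e
      by (cases g; cases s; cases s') (simp_all add: field_simps)
  next
    case False
    then show ?thesis
      using iff unfolding l l' tmat_basis pairing_single by auto
  qed
next
  show "finite (supp (tmat \<alpha> (S2'_basis \<alpha> (g, n))))"
    by (rule finite_subset[OF supp_basis]) (auto simp: finite_B UNIV_mono)
qed

lemma osp_tmat:
  assumes "X \<in> gspan \<alpha> i"
  shows "osp i (tmat \<alpha> X)"
  using assms
proof (induction rule: ov.span_induct_alt)
  case base
  have "gpar (if i then gx else gL) = i" by simp
  then have "osp i (tmat \<alpha> (sop_scale 0 (S2'_basis \<alpha> (if i then gx else gL, 0))))"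
    unfolding tmat_scale using osp_basis[of "if i then gx else gL" \<alpha> 0] by (intro osp_scale) (simp only:)
  then show ?case by (simp only: ov.scale_zero_left)
next
  case (step c x y)
  from step(1) obtain g n where "x = S2'_basis \<alpha> (g, n)" "gpar g = i"
    unfolding gbasis_def by (elim imageE) (metis (mono_tags, lifting) mem_Collect_eq prod.collapse)
  then show ?case
    unfolding tmat_add tmat_scale using osp_basis[of g] step(2) by (intro osp_add osp_scale) simp_all
qed

end

section \<open>Bilinearity of the supertrace and of the anomaly\<close>

context oscillator begin

lemma tr_superset:
  assumes "finite J" "supp B \<subseteq> J" "J \<subseteq> {l. ann l \<and> live l}"
  shows "tr A B = (\<Sum>l\<in>J. ksign (par l) * Poly_Mapping.lookup (ext A (cre (B l))) l)"
  unfolding tr_def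
  by (rule sum.mono_neutral_left) (use assms in \<open>auto simp: supp_def ext_def\<close>)

lemma tr_add_left: "tr (\<lambda>l. A l + A' l) B = tr A B + tr A' B"
  by (simp add: tr_def ext_def pm_lin_fun_add lookup_add distrib_left sum.distrib)

lemma tr_scale_left: "tr (\<lambda>l. pm_scale c (A l)) B = c * tr A B"
  by (simp add: tr_def ext_def pm_lin_fun_scale sum_distrib_left mult_ac)

lemma tr_add_right:
  assumes B: "osp i B" and B': "osp i B'"
  shows "tr A (\<lambda>l. B l + B' l) = tr A B + tr A B'"
proof -
  let ?J = "supp B \<union> supp B'"
  have J: "finite ?J" "supp B \<subseteq> ?J" "supp B' \<subseteq> ?J" "?J \<subseteq> {l. ann l \<and> live l}"
    using osp_finite[OF B] osp_finite[OF B'] by (auto simp: supp_def)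
  show ?thesis
    unfolding tr_superset[OF J(1) supp_add J(4)] tr_superset[OF J(1,2,4)] tr_superset[OF J(1,3,4)]
    by (simp add: ext_def pm_lin_add lookup_add distrib_left sum.distrib)
qed

lemma tr_scale_right:
  assumes B: "osp i B"
  shows "tr A (\<lambda>l. pm_scale c (B l)) = c * tr A B"
proof -
  have J: "finite (supp B)" "supp (\<lambda>l. pm_scale c (B l)) \<subseteq> supp B" "supp B \<subseteq> {l. ann l \<and> live l}"
    using osp_finite[OF B] by (auto simp: supp_def)
  show ?thesis
    unfolding tr_superset[OF J] tr_def by (simp add: ext_def pm_lin_scale sum_distrib_left mult_ac)
qed

lemma anomaly_add_left: "osp i A \<Longrightarrow> osp i A' \<Longrightarrow> anomaly i j (\<lambda>l. A l + A' l) B = anomaly i j A B + anomaly i j A' B"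
  by (simp add: anomaly_def tr_add_left tr_add_right field_simps)

lemma anomaly_add_right: "osp j B \<Longrightarrow> osp j B' \<Longrightarrow> anomaly i j A (\<lambda>l. B l + B' l) = anomaly i j A B + anomaly i j A B'"
  by (simp add: anomaly_def tr_add_left tr_add_right field_simps)

lemma anomaly_scale_left: "osp i A \<Longrightarrow> anomaly i j (\<lambda>l. pm_scale c (A l)) B = c * anomaly i j A B"
  by (simp add: anomaly_def tr_scale_left tr_scale_right field_simps)

lemma anomaly_scale_right: "osp j B \<Longrightarrow> anomaly i j A (\<lambda>l. pm_scale c (B l)) = c * anomaly i j A B"
  by (simp add: anomaly_def tr_scale_left tr_scale_right field_simps)

end

subsection \<open>The anomaly on the basis\<close>

text \<open>
  A term of the supertrace is a priori quadratic in the exponent \<open>z\<close>; the leading terms cancel.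
\<close>

definition trace_term :: "complex \<Rightarrow> gen \<Rightarrow> gen \<Rightarrow> complex \<Rightarrow> complex \<Rightarrow> complex \<Rightarrow> complex" where
  "trace_term \<alpha> g g' n k z = (\<Sum>s\<in>UNIV. if gtgt g (gtgt g' s) = s
     then ksign (mferm s) * gcf \<alpha> g' k s (z - (k + of_int (goff g'))) * gcf \<alpha> g n (gtgt g' s) z else 0)"

lemma trace_term_affine: "trace_term \<alpha> g g' n k z = trace_term \<alpha> g g' n k 0 + (trace_term \<alpha> g g' n k 1 - trace_term \<alpha> g g' n k 0) * z"
  unfolding trace_term_def UNIV_mono by (cases g; cases g') (simp_all add: field_simps)

lemma sum_trace_term: "(\<Sum>j<K. trace_term \<alpha> g g' n k (of_nat j)) =
   trace_term \<alpha> g g' n k 0 * of_nat K + (trace_term \<alpha> g g' n k 1 - trace_term \<alpha> g g' n k 0) * (of_nat K * (of_nat K - 1) / 2)"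
proof (induction K)
  case (Suc K)
  then show ?case
    by (simp add: trace_term_affine[of \<alpha> g g' n k "of_nat K"]) (simp add: field_simps)
qed simp

text \<open>Here \<open>j\<close> is the exponent of the intermediate creator. The number of terms
  is the degree of \<open>b\<close>, and \<open>nat\<close> makes the sum empty when that degree is
  not positive.\<close>

definition basis_trace :: "complex \<Rightarrow> gen \<times> int \<Rightarrow> gen \<times> int \<Rightarrow> complex" where
  "basis_trace \<alpha> a b = (if snd a + goff (fst a) + snd b + goff (fst b) = 0
     then \<Sum>j<nat (snd b + goff (fst b)). trace_term \<alpha> (fst a) (fst b) (of_int (snd a)) (of_int (snd b)) (of_nat j) else 0)"

context fock begin

text \<open>The operators leave the index from \<open>B\<close> untouched, so each of its elements
  contributes the same supertrace.\<close>

lemma tr_basis: "tr (tmat \<alpha> (S2'_basis \<alpha> a)) (tmat \<alpha> (S2'_basis \<alpha> b)) = of_nat (card B) * basis_trace \<alpha> a b"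
proof -
  obtain g n where a: "a = (g, n)" by (cases a)
  obtain g' k where b: "b = (g', k)" by (cases b)
  define N where "N = k + goff g'"
  let ?A = "tmat \<alpha> (S2'_basis \<alpha> (g, n)) :: 'v index \<Rightarrow> _" and ?B = "tmat \<alpha> (S2'_basis \<alpha> (g', k)) :: 'v index \<Rightarrow> _"
  let ?c = "n + goff g + N = 0"
  let ?h = "\<lambda>s (m::int). if ?c then (if gtgt g (gtgt g' s) = s then ksign (mferm s) * gcf \<alpha> g' (of_int k) s (of_int m) *
             gcf \<alpha> g (of_int n) (gtgt g' s) (of_int (m + N)) else 0) else 0"
  have "tr ?A ?B = (\<Sum>l\<in>UNIV \<times> {- N..<0} \<times> B. ksign (ipar l) * Poly_Mapping.lookup (ext ?A (cre (?B l))) l)"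
    unfolding N_def by (rule tr_superset[OF _ supp_basis]) (auto simp: finite_B UNIV_mono)
  also have "\<dots> = (\<Sum>l\<in>UNIV \<times> {- N..<0} \<times> B. case l of (s, m, v) \<Rightarrow> ?h s m)"
  proof (rule sum.cong[OF refl])
    fix l :: "'v index" assume "l \<in> UNIV \<times> {- N..<0} \<times> B"
    then obtain s m v where l: "l = (s, m, v)" "- N \<le> m" by auto
    have "cre (?B l) = ?B l"
      unfolding l tmat_basis using l(2) by (intro poly_mapping_eqI) (auto simp: lookup_single when_def N_def)
    then have "ext ?A (cre (?B l)) = Poly_Mapping.single (gtgt g (gtgt g' s), m + N + n + goff g, v)
      (gcf \<alpha> g' (of_int k) s (of_int m) * gcf \<alpha> g (of_int n) (gtgt g' s) (of_int (m + N)))"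
      unfolding l tmat_basis ext_def by (simp add: tmat_basis N_def algebra_simps del: S2'_basis.simps)
    then show "ksign (ipar l) * Poly_Mapping.lookup (ext ?A (cre (?B l))) l = (case l of (s, m, v) \<Rightarrow> ?h s m)"
      by (auto simp: l lookup_single when_def)
  qed
  also have "\<dots> = (\<Sum>s\<in>UNIV. \<Sum>m\<in>{- N..<0}. \<Sum>v\<in>B. ?h s m)"
    by (simp only: sum.cartesian_product)
  also have "\<dots> = of_nat (card B) * (\<Sum>m\<in>{- N..<0}. \<Sum>s\<in>UNIV. ?h s m)"
    by (subst sum.swap) (simp add: sum_distrib_left)
  also have "(\<Sum>m\<in>{- N..<0}. \<Sum>s\<in>UNIV. ?h s m) = basis_trace \<alpha> a b"
  proof (cases ?c)
    case True
    have "(\<Sum>m\<in>{- N..<0}. \<Sum>s\<in>UNIV. ?h s m) = (\<Sum>j<nat N. \<Sum>s\<in>UNIV. ?h s (int j - N))"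
    proof (rule sum.reindex_bij_witness[of _ "\<lambda>j. int j - N" "\<lambda>m. nat (m + N)"])
      fix m assume "m \<in> {- N..<0}"
      then have e: "int (nat (m + N)) = m + N" by simp
      show "(\<Sum>s\<in>UNIV. ?h s (int (nat (m + N)) - N)) = (\<Sum>s\<in>UNIV. ?h s m)"
        unfolding e by (simp cong: if_cong)
    qed auto
    then show ?thesis
      using True by (simp add: basis_trace_def trace_term_def a b N_def add.assoc mult.assoc cong: if_cong)
  next
    case False
    then show ?thesis by (simp add: basis_trace_def a b N_def add.assoc)
  qed
  finally show ?thesis by (simp add: a b)
qed

end

text \<open>Only the component along \<open>gL\<close> is computed, because the correction by
  \<open>energy\<close> sees nothing but the coefficient of \<open>L_0\<close>.\<close>

lemma crd_gL_bracket: "crd gL (sbracket (field \<alpha> g a) (field \<alpha> g' b)) =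
  (case (g, g') of (gL, gL) \<Rightarrow> laurent_deriv a * b - a * laurent_deriv b
    | (gh, gp) \<Rightarrow> a * b | (gp, gh) \<Rightarrow> a * b | (gx, gy) \<Rightarrow> - a * b | (gy, gx) \<Rightarrow> - a * b | _ \<Rightarrow> 0)"
  unfolding crd.simps sbracket_W2[OF field_W2 field_W2]
  by (cases g; cases g') (auto simp: vfield_apply zero_prod_def algebra_simps)

lemma gcoef_L0_bracket: "gcoef (gL, 0) (sbracket (S2'_basis \<alpha> (g, n)) (S2'_basis \<alpha> (g', k))) =
  (if n = - k then (case (g, g') of (gL, gL) \<Rightarrow> of_int n - of_int k
    | (gh, gp) \<Rightarrow> 1 | (gp, gh) \<Rightarrow> 1 | (gx, gy) \<Rightarrow> - 1 | (gy, gx) \<Rightarrow> - 1 | _ \<Rightarrow> 0) else 0)"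
  unfolding gcoef_def fst_conv snd_conv basis_field crd_gL_bracket
  by (cases g; cases g') (auto simp: mult_single lookup_single lookup_minus when_def algebra_simps)

text \<open>
  The supertraces give \<open>3 dim V\<close> times the cocycle only up to a coboundary, which amounts to a
  shift of \<open>\<L>\<^sub>0\<close> by a constant.
\<close>

definition energy :: "complex \<Rightarrow> sop \<Rightarrow> complex" where
  "energy \<alpha> X = - (\<alpha> * (\<alpha> + 2) / 8) * gcoef (gL, 0) X"

text \<open>An identity of polynomials in \<open>k\<close> and \<open>\<alpha>\<close> for each pair
  of families. The constant in \<open>energy\<close> is forced by the pair \<open>h_1\<close>,
  \<open>p_(-1)\<close>: both have degree zero, so both traces are empty, while their bracket has
  \<open>L_0\<close> coefficient 1 and three times their cocycle is
  \<open>\<alpha> (\<alpha> + 2) / 8\<close>.\<close>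

lemma basis_trace_cocycle: "- (basis_trace \<alpha> a b - ksign (gpar (fst a) \<and> gpar (fst b)) * basis_trace \<alpha> b a) / 2 =
   3 * cocycle_basis \<alpha> a b + energy \<alpha> (sbracket (S2'_basis \<alpha> a) (S2'_basis \<alpha> b))"
proof -
  obtain g n where a: "a = (g, n)" by (cases a)
  obtain g' k where b: "b = (g', k)" by (cases b)
  show ?thesis
  proof (cases "n + goff g + k + goff g' = 0")
    case False
    then show ?thesis
      by (cases g; cases g')
        (auto simp: a b basis_trace_def energy_def gcoef_L0_bracket simp del: S2'_basis.simps split: if_splits)
  next
    case True
    then have n: "n = - k - goff g' - goff g" by simp
    \<comment> \<open>The two degrees are opposite, so at most one of the two traces is a nonempty
      sum, and the sign of the degree decides which.\<close>
    show ?thesis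
    proof (cases "0 \<le> k + goff g'")
      case pos: True
      then have "nat (n + goff g) = 0" "of_nat (nat (k + goff g')) = (of_int (k + goff g') :: complex)"
        using True by (simp_all add: of_nat_nat)
      then have e: "basis_trace \<alpha> b a = 0" "basis_trace \<alpha> a b = trace_term \<alpha> g g' (of_int n) (of_int k) 0 * of_int (k + goff g') +
         (trace_term \<alpha> g g' (of_int n) (of_int k) 1 - trace_term \<alpha> g g' (of_int n) (of_int k) 0) * (of_int (k + goff g') * (of_int (k + goff g') - 1) / 2)"
        using True by (simp_all add: basis_trace_def a b sum_trace_term)
      show ?thesis
        unfolding e unfolding a b energy_def gcoef_L0_bracket n fst_conv snd_conv trace_term_def UNIV_mono
        by (cases g; cases g') (auto simp: field_simps power2_eq_square)
    next
      case neg: False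
      then have "nat (k + goff g') = 0" "of_nat (nat (n + goff g)) = (of_int (n + goff g) :: complex)"
        using True by (simp_all add: of_nat_nat)
      then have e: "basis_trace \<alpha> a b = 0" "basis_trace \<alpha> b a = trace_term \<alpha> g' g (of_int k) (of_int n) 0 * of_int (n + goff g) +
         (trace_term \<alpha> g' g (of_int k) (of_int n) 1 - trace_term \<alpha> g' g (of_int k) (of_int n) 0) * (of_int (n + goff g) * (of_int (n + goff g) - 1) / 2)"
        using True by (simp_all add: basis_trace_def a b sum_trace_term algebra_simps)
      show ?thesis
        unfolding e unfolding a b energy_def gcoef_L0_bracket n fst_conv snd_conv trace_term_def UNIV_mono
        by (cases g; cases g') (auto simp: field_simps power2_eq_square)
    qed
  qed
qed

section \<open>The Fock space as a quotient of the free algebra\<close>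

locale loop_fock = V: finite_dimensional_vector_space sc B
  for sc :: "complex \<Rightarrow> 'v::ab_group_add \<Rightarrow> 'v" and B :: "'v set"

lemma loop_scale_lookup [simp]:
  assumes "vector_space sc"
  shows "Poly_Mapping.lookup (loop_scale sc c f) n = sc c (Poly_Mapping.lookup f n)"
proof -
  interpret vector_space sc by fact
  show ?thesis by (simp add: loop_scale_def Poly_Mapping.map.rep_eq when_def)
qed

lemma vector_space_loop_scale:
  assumes "vector_space sc"
  shows "vector_space (loop_scale sc)"
proof -
  interpret vector_space sc by fact
  show ?thesis
    by (rule vector_space.intro; rule poly_mapping_eqI; simp add: loop_scale_lookup[OF assms] lookup_add scale_left_distrib scale_right_distrib)
qed

sublocale loop_fock \<subseteq> double "loop_scale sc" loop_deg
  by (rule double.intro, rule vector_space_loop_scale, rule V.vector_space_axioms)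

sublocale loop_fock \<subseteq> fock B
  by unfold_locales (rule V.finite_Basis)

context loop_fock begin

lemma lookup_loop_scale [simp]: "Poly_Mapping.lookup (loop_scale sc c f) n = sc c (Poly_Mapping.lookup f n)"
  by (rule loop_scale_lookup[OF V.vector_space_axioms])

definition basis_coef :: "'v \<Rightarrow> 'v \<Rightarrow> complex" where
  "basis_coef b v = V.representation B v b"

lemma in_span_B: "v \<in> V.span B"
  using V.span_Basis by simp

lemma basis_coef_add: "basis_coef b (v + w) = basis_coef b v + basis_coef b w"
  by (simp add: basis_coef_def V.representation_add[OF V.independent_Basis in_span_B in_span_B])

lemma basis_coef_scale: "basis_coef b (sc c v) = c * basis_coef b v"
  by (simp add: basis_coef_def V.representation_scale[OF V.independent_Basis in_span_B])

lemma basis_coef_zero [simp]: "basis_coef b 0 = 0"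
  using basis_coef_scale[of b 0 0] by simp

lemma basis_coef_basis: "b' \<in> B \<Longrightarrow> basis_coef b b' = (if b = b' then 1 else 0)"
  by (auto simp: basis_coef_def V.representation_basis[OF V.independent_Basis])

lemma basis_coef_sum: "(\<Sum>b\<in>B. sc (basis_coef b v) b) = v"
  unfolding basis_coef_def by (rule V.sum_representation_eq[OF V.independent_Basis in_span_B V.finite_Basis order_refl])

lemma dual_linear:
  assumes "\<phi> \<in> restricted_dual (loop_scale sc) loop_deg"
  shows "\<phi> (x + y) = \<phi> x + \<phi> y" "\<phi> (loop_scale sc c x) = c * \<phi> x" "\<phi> 0 = 0"
proof -
  interpret l: Vector_Spaces.linear "loop_scale sc" "(*)" \<phi>
    using assms by (simp add: restricted_dual_def)
  show "\<phi> (x + y) = \<phi> x + \<phi> y" "\<phi> (loop_scale sc c x) = c * \<phi> x" "\<phi> 0 = 0"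
    by (simp_all add: l.add l.scale l.zero)
qed

lemma dual_sum:
  assumes "\<phi> \<in> restricted_dual (loop_scale sc) loop_deg"
  shows "\<phi> (sum f A) = (\<Sum>a\<in>A. \<phi> (f a))"
  by (induction A rule: infinite_finite_induct) (auto simp: dual_linear[OF assms])

lemma loop_decomp: "(x :: int \<Rightarrow>\<^sub>0 'v) = (\<Sum>n\<in>Poly_Mapping.keys x. \<Sum>b\<in>B. loop_scale sc (basis_coef b (Poly_Mapping.lookup x n)) (Poly_Mapping.single n b))"
proof (rule poly_mapping_eqI)
  fix k :: int
  have "(\<Sum>b\<in>B. sc (basis_coef b v) (b when n = k)) = (if n = k then v else 0)" for n v
    by (auto simp: basis_coef_sum)
  then show "Poly_Mapping.lookup x k = Poly_Mapping.lookup (\<Sum>n\<in>Poly_Mapping.keys x. \<Sum>b\<in>B. loop_scale sc (basis_coef b (Poly_Mapping.lookup x n)) (Poly_Mapping.single n b)) k"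
    by (simp add: lookup_sum lookup_single in_keys_iff)
qed

lemma dual_expand:
  assumes "\<phi> \<in> restricted_dual (loop_scale sc) loop_deg"
  shows "\<phi> x = (\<Sum>n\<in>Poly_Mapping.keys x. \<Sum>b\<in>B. basis_coef b (Poly_Mapping.lookup x n) * \<phi> (Poly_Mapping.single n b))"
  by (subst loop_decomp[of x]) (simp only: dual_sum[OF assms] dual_linear(2)[OF assms])

subsection \<open>Coordinates of the generators\<close>

text \<open>For Clifford (\<open>True\<close>) and Weyl (\<open>False\<close>) generators alike,
  \<open>vcomp\<close> is the monomial that carries vectors and \<open>dcomp\<close> the dual one
  that carries functionals.\<close>

definition vcomp :: "bool \<Rightarrow> mono" where "vcomp k = (if k then mOne else mTh1)"
definition dcomp :: "bool \<Rightarrow> mono" where "dcomp k = (if k then mTh12 else mTh2)"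

lemma comp_simps [simp]: "mferm (vcomp k) = k" "mferm (dcomp k) = k" "mdual (vcomp k) = dcomp k" "mdual (dcomp k) = vcomp k"
  "vcomp k \<noteq> dcomp k" "dcomp k \<noteq> vcomp k"
  by (cases k; simp add: vcomp_def dcomp_def)+

lemma mono_cases: "s = vcomp (mferm s) \<or> s = dcomp (mferm s)"
  by (cases s) (simp_all add: vcomp_def dcomp_def)

text \<open>
  The exponents change sign, so that annihilators have negative exponent: \<open>t^n \<otimes> b\<close> becomes a letter of
  exponent \<open>-n\<close>, and its dual one of exponent \<open>n - 1\<close>.
\<close>

definition coord_fun :: "bool \<Rightarrow> (int \<Rightarrow>\<^sub>0 'v) \<times> ((int \<Rightarrow>\<^sub>0 'v) \<Rightarrow> complex) \<Rightarrow> 'v index \<Rightarrow> complex" where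
  "coord_fun k u = (\<lambda>(s, m, b). if b \<in> B then (if s = vcomp k then basis_coef b (Poly_Mapping.lookup (fst u) (- m))
     else if s = dcomp k then snd u (Poly_Mapping.single (m + 1) b) else 0) else 0)"

definition coord_vec :: "bool \<Rightarrow> (int \<Rightarrow>\<^sub>0 'v) \<times> ((int \<Rightarrow>\<^sub>0 'v) \<Rightarrow> complex) \<Rightarrow> ('v index \<Rightarrow>\<^sub>0 complex)" where
  "coord_vec k u = Abs_poly_mapping (coord_fun k u)"

text \<open>Finite support is where the hypotheses enter: a vector has finitely many degrees, a
  functional in the restricted dual sees finitely many degrees, and \<open>B\<close> is
  finite.\<close>

lemma lookup_coord_vec:
  assumes "u \<in> U"
  shows "Poly_Mapping.lookup (coord_vec k u) = coord_fun k u"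
  unfolding coord_vec_def
proof (rule lookup_Abs_poly_mapping)
  obtain x \<phi> where u: "u = (x, \<phi>)" "\<phi> \<in> restricted_dual (loop_scale sc) loop_deg"
    using assms by (auto simp: double_space_def)
  let ?D = "{n. \<exists>v\<in>loop_deg n. \<phi> v \<noteq> 0}"
  have D: "finite ?D" using u by (simp add: restricted_dual_def)
  have "{l. coord_fun k u l \<noteq> 0} \<subseteq> ({vcomp k} \<times> uminus ` Poly_Mapping.keys x \<times> B) \<union> ({dcomp k} \<times> (\<lambda>n. n - 1) ` ?D \<times> B)"
  proof
    fix l assume l: "l \<in> {l. coord_fun k u l \<noteq> 0}"
    obtain s m b where e: "l = (s, m, b)" by (cases l)
    have "coord_fun k u (s, m, b) \<noteq> 0" using l e by simp
    then consider "b \<in> B" "s = vcomp k" "basis_coef b (Poly_Mapping.lookup x (- m)) \<noteq> 0"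
      | "b \<in> B" "s = dcomp k" "\<phi> (Poly_Mapping.single (m + 1) b) \<noteq> 0"
      by (auto simp: coord_fun_def u split: if_splits)
    then show "l \<in> ({vcomp k} \<times> uminus ` Poly_Mapping.keys x \<times> B) \<union> ({dcomp k} \<times> (\<lambda>n. n - 1) ` ?D \<times> B)"
    proof cases
      case 1
      have "- m \<in> Poly_Mapping.keys x" using 1(3) by (auto simp: in_keys_iff)
      then have "m \<in> uminus ` Poly_Mapping.keys x" by (metis imageI minus_minus)
      then show ?thesis using 1 e by simp
    next
      case 2
      have "m + 1 \<in> ?D" using 2(3) by (auto simp: loop_deg_def)
      then have "m \<in> (\<lambda>n. n - 1) ` ?D" by (metis (no_types, lifting) add_diff_cancel_right' image_eqI)
      then show ?thesis using 2 e by simp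
    qed
  qed
  then show "finite {l. coord_fun k u l \<noteq> 0}"
    by (rule finite_subset) (simp add: D V.finite_Basis)
qed

lemma coord_vec_add: "u \<in> U \<Longrightarrow> v \<in> U \<Longrightarrow> coord_vec k (u + v) = coord_vec k u + coord_vec k v"
  by (rule poly_mapping_eqI)
     (auto simp: lookup_coord_vec U_add lookup_add coord_fun_def basis_coef_add)

lemma coord_vec_scale: "u \<in> U \<Longrightarrow> coord_vec k (ds c u) = pm_scale c (coord_vec k u)"
  by (rule poly_mapping_eqI)
     (simp only: lookup_coord_vec[OF U_scale] lookup_coord_vec lookup_pm_scale, auto simp: coord_fun_def basis_coef_scale double_scale_def)

lemma coord_vec_zero: "coord_vec k (0, 0) = 0"
  using U_zero by (intro poly_mapping_eqI) (auto simp: lookup_coord_vec coord_fun_def)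

lemma hom_coord_vec:
  assumes "u \<in> U"
  shows "hom k (coord_vec k u)"
  using assms by (auto simp: hom_def in_keys_iff lookup_coord_vec coord_fun_def split: if_splits)

lemma coord_vec_inj:
  assumes u: "u \<in> U" and v: "v \<in> U" and e: "coord_vec k u = coord_vec k v"
  shows "u = v"
proof -
  obtain x \<phi> where u': "u = (x, \<phi>)" "\<phi> \<in> restricted_dual (loop_scale sc) loop_deg"
    using u by (auto simp: double_space_def)
  obtain y \<psi> where v': "v = (y, \<psi>)" "\<psi> \<in> restricted_dual (loop_scale sc) loop_deg"
    using v by (auto simp: double_space_def)
  have c: "coord_fun k u l = coord_fun k v l" for l
    using e lookup_coord_vec[OF u] lookup_coord_vec[OF v] by metis
  have 1: "basis_coef b (Poly_Mapping.lookup x n) = basis_coef b (Poly_Mapping.lookup y n)" if "b \<in> B" for b n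
    using c[of "(vcomp k, - n, b)"] that by (simp add: coord_fun_def u' v')
  have "Poly_Mapping.lookup x n = Poly_Mapping.lookup y n" for n
    using basis_coef_sum[of "Poly_Mapping.lookup x n"] basis_coef_sum[of "Poly_Mapping.lookup y n"] 1 by (metis (no_types, lifting) sum.cong)
  then have xy: "x = y" by (rule poly_mapping_eqI)
  have 2: "\<phi> (Poly_Mapping.single n b) = \<psi> (Poly_Mapping.single n b)" if "b \<in> B" for b n
    using c[of "(dcomp k, n - 1, b)"] that by (simp add: coord_fun_def u' v')
  have "\<phi> z = \<psi> z" for z
    unfolding dual_expand[OF u'(2), of z] dual_expand[OF v'(2), of z] by (intro sum.cong refl) (simp add: 2)
  then show ?thesis using xy u' v' by auto
qed

definition el :: "'v index \<Rightarrow> (int \<Rightarrow>\<^sub>0 'v) \<times> ((int \<Rightarrow>\<^sub>0 'v) \<Rightarrow> complex)" where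
  "el = (\<lambda>(s, m, b). if b \<in> B then (if s = vcomp (mferm s) then (Poly_Mapping.single (- m) b, 0)
     else (0, \<lambda>f. basis_coef b (Poly_Mapping.lookup f (m + 1)))) else (0, 0))"

lemma coord_dual: "(\<lambda>f. basis_coef b (Poly_Mapping.lookup f n)) \<in> restricted_dual (loop_scale sc) loop_deg"
proof -
  interpret l: vector_space "loop_scale sc" by (rule vs)
  have "Vector_Spaces.linear (loop_scale sc) (*) (\<lambda>f. basis_coef b (Poly_Mapping.lookup f n))"
    by unfold_locales (simp_all add: algebra_simps lookup_add basis_coef_add basis_coef_scale)
  moreover have "{m. \<exists>v\<in>loop_deg m. basis_coef b (Poly_Mapping.lookup v n) \<noteq> 0} \<subseteq> {n}"
    by (auto simp: loop_deg_def lookup_single when_def split: if_splits)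
  ultimately show ?thesis
    using finite_subset by (auto simp: restricted_dual_def)
qed

lemma zero_dual: "0 \<in> restricted_dual (loop_scale sc) loop_deg"
  using U_zero by (auto simp: double_space_def)

lemma el_U: "el l \<in> U"
  by (cases l) (auto simp: el_def double_space_def coord_dual zero_dual)

lemma coord_vec_el:
  assumes "ilive B l"
  shows "coord_vec (ipar l) (el l) = Poly_Mapping.single l 1"
proof (rule poly_mapping_eqI)
  fix l' :: "'v index"
  obtain s m b where l: "l = (s, m, b)" by (cases l)
  obtain s' m' b' where l': "l' = (s', m', b')" by (cases l')
  show "Poly_Mapping.lookup (coord_vec (ipar l) (el l)) l' = Poly_Mapping.lookup (Poly_Mapping.single l 1) l'"
    using assms mono_cases[of s]
    unfolding lookup_coord_vec[OF el_U]
    by (auto simp: l l' coord_fun_def el_def lookup_single when_def basis_coef_basis)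
qed

lemma el_dead: "\<not> ilive B l \<Longrightarrow> el l = (0, 0)"
  by (cases l) (simp add: el_def)

text \<open>For \<open>m < 0\<close> the vector lies in degree \<open>- m > 0\<close>, and the
  functional sees only degree \<open>m + 1 \<le> 0\<close>. The offset by one is what lets
  \<open>idual\<close> exchange annihilators and creators at the boundary.\<close>

lemma el_ann:
  assumes "iann l"
  shows "el l \<in> An"
proof -
  obtain s m b where l: "l = (s, m, b)" by (cases l)
  interpret l: vector_space "loop_scale sc" by (rule vs)
  have m: "m < 0" using assms l by simp
  have 1: "Poly_Mapping.single (- m) b \<in> l.span (\<Union>n\<in>{0<..}. loop_deg n)"
    by (rule l.span_base) (use m in \<open>auto simp: loop_deg_def intro!: bexI[of _ "- m"]\<close>)
  have 2: "basis_coef b (Poly_Mapping.lookup v (m + 1)) = 0" if "0 < n" "v \<in> loop_deg n" for n v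
    using that m by (auto simp: loop_deg_def lookup_single when_def)
  show ?thesis
    unfolding l el_def annihilators_def using 1 2 l.span_zero by (auto simp: coord_dual zero_dual)
qed

lemma el_form:
  assumes "ipar l = ipar m"
  shows "(if ipar l then sym_form else skew_form) (el l) (el m) = form l m"
proof -
  obtain s i b where l: "l = (s, i, b)" by (cases l)
  obtain s' j c where m: "m = (s', j, c)" by (cases m)
  show ?thesis
    using assms unfolding l m form_def
    by (cases s; cases s')
       (auto simp: el_def vcomp_def sym_form_def skew_form_def basis_coef_basis lookup_single when_def)
qed

lemma keys_coord_vec_ann:
  assumes u: "u \<in> An" and l: "l \<in> Poly_Mapping.keys (coord_vec k u)"
  shows "iann l"
proof -
  obtain s m b where e: "l = (s, m, b)" by (cases l)
  obtain x \<phi> where x: "u = (x, \<phi>)" by (cases u)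
  interpret l: vector_space "loop_scale sc" by (rule vs)
  have uU: "u \<in> U" using u An_U by blast
  have "x \<in> l.span (\<Union>n\<in>{0<..}. loop_deg n)" using u x by (auto simp: annihilators_def)
  then have xs: "Poly_Mapping.lookup x n = 0" if "n \<le> 0" for n
    using that
  proof (induction rule: l.span_induct_alt)
    case (step c y z)
    then show ?case by (auto simp: lookup_add loop_deg_def lookup_single when_def)
  qed simp
  have ph: "\<phi> (Poly_Mapping.single n b) = 0" if "n > 0" for n
    using u x that by (auto simp: annihilators_def loop_deg_def)
  have "coord_fun k u l \<noteq> 0" using l uU by (simp add: in_keys_iff lookup_coord_vec)
  then have "\<not> (- m \<le> 0) \<or> \<not> (m + 1 > 0)"
    using xs[of "- m"] ph[of "m + 1"] by (auto simp: e x coord_fun_def split: if_splits)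
  then show ?thesis by (auto simp: e)
qed

lemma live_coord_vec: "u \<in> U \<Longrightarrow> l \<in> Poly_Mapping.keys (coord_vec k u) \<Longrightarrow> ilive B l"
  by (cases l) (auto simp: in_keys_iff lookup_coord_vec coord_fun_def split: if_splits)

lemma U_sum: "(\<And>l. l \<in> A \<Longrightarrow> f l \<in> U) \<Longrightarrow> sum f A \<in> U"
  by (induction A rule: infinite_finite_induct) (auto simp: zero_prod_def U_zero intro: U_add)

lemma el_expand:
  assumes u: "u \<in> U"
  shows "u = (\<Sum>l\<in>Poly_Mapping.keys (coord_vec k u). ds (Poly_Mapping.lookup (coord_vec k u) l) (el l))"
proof (rule coord_vec_inj[OF u, where k = k])
  let ?K = "Poly_Mapping.keys (coord_vec k u)" and ?c = "Poly_Mapping.lookup (coord_vec k u)"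
  show "(\<Sum>l\<in>?K. ds (?c l) (el l)) \<in> U" by (intro U_sum U_scale el_U)
  have "coord_vec k (\<Sum>l\<in>A. ds (?c l) (el l)) = (\<Sum>l\<in>A. pm_scale (?c l) (Poly_Mapping.single l 1))" if "finite A" "A \<subseteq> ?K" for A
    using that
  proof induction
    case empty
    then show ?case using coord_vec_zero by (simp add: zero_prod_def)
  next
    case (insert l A)
    have "ipar l = k" using insert hom_coord_vec[OF u, of k] by (auto simp: hom_def)
    then have "coord_vec k (el l) = Poly_Mapping.single l 1"
      using coord_vec_el[OF live_coord_vec[OF u, of l k]] insert by simp
    moreover have "(\<Sum>l\<in>A. ds (?c l) (el l)) \<in> U" by (intro U_sum U_scale el_U)
    ultimately show ?case
      using insert by (simp add: coord_vec_add U_scale el_U coord_vec_scale)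
  qed
  from this[OF finite_keys order_refl]
  show "coord_vec k u = coord_vec k (\<Sum>l\<in>?K. ds (?c l) (el l))"
    using pm_decomp[of "coord_vec k u"] by simp
qed

end

section \<open>From the generators of the two algebras to letters\<close>

context loop_fock begin

notation eqt (infix "\<approx>" 50)
notation eqv (infix "\<doteq>" 50)

abbreviation "WU \<equiv> words_in U"
abbreviation "Uword us \<equiv> (Poly_Mapping.single (Word us) 1 :: (int \<Rightarrow>\<^sub>0 'v) tensors)"
abbreviation "Iword w \<equiv> (Poly_Mapping.single (Word w) 1 :: 'v index free)"

fun Phiw :: "bool \<Rightarrow> ((int \<Rightarrow>\<^sub>0 'v) \<times> ((int \<Rightarrow>\<^sub>0 'v) \<Rightarrow> complex)) list \<Rightarrow> 'v index free" where
  "Phiw k [] = 1"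
| "Phiw k (u # us) = ell (coord_vec k u) * Phiw k us"

lemma Phiw_append: "Phiw k (us @ vs) = Phiw k us * Phiw k vs"
  by (induction us) (simp_all add: mult.assoc)

text \<open>The algebra homomorphism replacing each generator by its coordinates, in Weyl letters
  for \<open>k = False\<close> and in Clifford letters for \<open>k = True\<close>. Both factors
  thus map into the same free algebra.\<close>

definition Phi :: "bool \<Rightarrow> (int \<Rightarrow>\<^sub>0 'v) tensors \<Rightarrow> 'v index free" where
  "Phi k = pm_lin (\<lambda>w. Phiw k (letters w))"

lemma Phi_simps [simp]: "Phi k 0 = 0" "Phi k (x + y) = Phi k x + Phi k y" "Phi k (x - y) = Phi k x - Phi k y"
  "Phi k (pm_scale c x) = pm_scale c (Phi k x)" "Phi k (- x) = - Phi k x"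
  by (simp_all add: Phi_def pm_lin_add pm_lin_diff pm_lin_scale pm_lin_minus)

lemma Phi_word: "Phi k (Uword us) = Phiw k us"
  by (simp add: Phi_def)

lemma Phi_letter [simp]: "Phi k (letter u) = ell (coord_vec k u)"
  by (simp add: letter_def Phi_word)

lemma Phi_one [simp]: "Phi k 1 = 1"
  using Phi_word[of k "[]"] by (simp flip: one_word)

lemma Phi_mult [simp]: "Phi k (x * y) = Phi k x * Phi k y"
proof (induction x rule: pm_induct)
  case (single m c)
  show ?case
  proof (induction y rule: pm_induct)
    case (single n d)
    show ?case by (simp add: mult_single Phi_def plus_word_def Phiw_append mult.commute)
  qed (simp_all add: distrib_left)
qed (simp_all add: distrib_right)

abbreviation "hw k \<equiv> words_in {l :: 'v index. ipar l = k}"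

lemma hw_ell:
  assumes "hom k v"
  shows "ell v \<in> hw k"
  unfolding ell_def pm_lin_def
  by (intro subsp_sum[OF subsp_words_in] subspD(3)[OF subsp_words_in] words_in_letter)
     (use assms in \<open>auto simp: hom_def\<close>)

lemma Phi_hw: "x \<in> WU \<Longrightarrow> Phi k x \<in> hw k"
proof (induction rule: words_in_induct)
  case (word w)
  then have "Phiw k w \<in> hw k"
    by (induction w) (auto intro: words_in_one words_in_mult hw_ell hom_coord_vec)
  then show ?case by (simp add: Phi_word)
qed (auto intro: subspD[OF subsp_words_in])

lemma letters_commute: "\<not> ipar a \<Longrightarrow> ipar b \<Longrightarrow> letter a * letter b \<approx> letter b * letter a"
  using swap_letters[of a b] by (auto simp: form_def split: if_splits)

lemma letter_hw_commute:
  assumes a: "\<not> ipar a" and q: "q \<in> hw True"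
  shows "letter a * q \<approx> q * letter a"
  using q
proof (induction rule: words_in_induct)
  case (word w)
  then show ?case
  proof (induction w)
    case (Cons b w)
    have 1: "letter a * letter b * Iword w \<approx> letter b * letter a * Iword w"
      by (rule eqt_mult_right, rule letters_commute) (use a Cons in auto)
    have 2: "letter b * (letter a * Iword w) \<approx> letter b * (Iword w * letter a)"
      by (rule eqt_mult_left) (use Cons in auto)
    show ?case unfolding word_Cons
      using eqt_trans[OF 1[unfolded mult.assoc] 2] by (simp add: mult.assoc)
  qed (simp flip: one_word)
next
  case (add p q)
  then show ?case using eqt_add by (simp add: distrib_left distrib_right)
next
  case (scale c p)
  then show ?case using eqt_scale by simp
qed simp

text \<open>Between letters of different parity the form vanishes and the exchange sign is trivial,
  so the two subalgebras commute.\<close>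

lemma hw_commute:
  assumes p: "p \<in> hw False" and q: "q \<in> hw True"
  shows "p * q \<approx> q * p"
  using p
proof (induction rule: words_in_induct)
  case (word w)
  then show ?case
  proof (induction w)
    case (Cons b w)
    have 1: "letter b * (Iword w * q) \<approx> letter b * (q * Iword w)"
      by (rule eqt_mult_left) (use Cons in auto)
    have 2: "letter b * q * Iword w \<approx> q * letter b * Iword w"
      by (rule eqt_mult_right, rule letter_hw_commute) (use Cons q in auto)
    show ?case unfolding word_Cons
      using eqt_trans[OF 1 2[unfolded mult.assoc]] by (simp add: mult.assoc)
  qed (simp flip: one_word)
next
  case (add p q)
  then show ?case using eqt_add by (simp add: distrib_left distrib_right)
next
  case (scale c p)
  then show ?case using eqt_scale by simp
qed simp

subsection \<open>The relations hold in the Fock space\<close>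

lemma Phi_linear_relations: "r \<in> linear_relations ds U \<Longrightarrow> Phi k r = 0"
  unfolding linear_relations_def
  by (elim UnE CollectE exE conjE) (simp_all only: Phi_simps Phi_letter coord_vec_add coord_vec_scale ell_simps, simp_all)

lemma Phi_ker_T: "x \<in> ker_T ds U \<Longrightarrow> Phi k x = 0"
  unfolding ker_T_def
proof (induction rule: ihull.induct)
  case (gen r a b)
  then have "Phi k r = 0" using Phi_linear_relations by auto
  then show ?case by simp
qed simp_all

definition kform :: "bool \<Rightarrow> (int \<Rightarrow>\<^sub>0 'v) \<times> ((int \<Rightarrow>\<^sub>0 'v) \<Rightarrow> complex) \<Rightarrow> (int \<Rightarrow>\<^sub>0 'v) \<times> ((int \<Rightarrow>\<^sub>0 'v) \<Rightarrow> complex) \<Rightarrow> complex" where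
  "kform k = (if k then sym_form else skew_form)"

lemma kform_right:
  assumes "u \<in> U" "v \<in> U" "v' \<in> U"
  shows "kform k u (v + v') = kform k u v + kform k u v'" "kform k u (ds c v) = c * kform k u v"
  using assms by (auto simp: kform_def sym_form_def skew_form_def double_space_def double_scale_def dual_linear algebra_simps)

lemma kform_left:
  assumes "u \<in> U" "v \<in> U" "v' \<in> U"
  shows "kform k (v + v') u = kform k v u + kform k v' u" "kform k (ds c v) u = c * kform k v u"
  using assms by (auto simp: kform_def sym_form_def skew_form_def double_space_def double_scale_def dual_linear algebra_simps)

lemma kform_sum_left:
  assumes "u \<in> U" "\<And>l. l \<in> A \<Longrightarrow> f l \<in> U"
  shows "kform k (sum f A) u = (\<Sum>l\<in>A. kform k (f l) u)"
  using assms(2)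
proof (induction A rule: infinite_finite_induct)
  case (insert l A)
  then show ?case by (simp add: kform_left(1)[OF assms(1)] U_sum)
qed (use assms(1) in \<open>auto simp: zero_prod_def kform_def sym_form_def skew_form_def double_space_def dual_linear\<close>)

lemma kform_sum_right:
  assumes "u \<in> U" "\<And>l. l \<in> A \<Longrightarrow> f l \<in> U"
  shows "kform k u (sum f A) = (\<Sum>l\<in>A. kform k u (f l))"
  using assms(2)
proof (induction A rule: infinite_finite_induct)
  case (insert l A)
  then show ?case by (simp add: kform_right(1)[OF assms(1)] U_sum)
qed (use assms(1) in \<open>auto simp: zero_prod_def kform_def sym_form_def skew_form_def double_space_def dual_linear\<close>)

text \<open>The relation between arbitrary generators follows from the one between letters: the
  exchange produces a sum of pairings, and expanding both arguments by \<open>el_expand\<close>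
  identifies it with the value of the form.\<close>

lemma swap_ell_ell:
  assumes "u \<in> U" "v \<in> U"
  shows "ell (coord_vec k u) * ell (coord_vec k v) \<approx> pm_scale (ksign k) (ell (coord_vec k v) * ell (coord_vec k u)) + pm_scale (kform k u v) 1"
proof -
  let ?a = "coord_vec k u" and ?b = "coord_vec k v"
  let ?Kb = "Poly_Mapping.keys ?b" and ?Ka = "Poly_Mapping.keys ?a"
  have pb: "ipar m = k" "ilive B m" if "m \<in> ?Kb" for m
    using that hom_coord_vec[OF assms(2), of k] live_coord_vec[OF assms(2)] by (auto simp: hom_def)
  have pa: "ipar m = k" if "m \<in> ?Ka" for m
    using that hom_coord_vec[OF assms(1), of k] by (auto simp: hom_def)
  have "ell ?a * ell ?b = (\<Sum>m\<in>?Kb. pm_scale (Poly_Mapping.lookup ?b m) (ell ?a * letter m))"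
    by (simp add: ell_def pm_lin_def[of _ ?b] sum_distrib_left)
  moreover have "(\<Sum>m\<in>?Kb. pm_scale (Poly_Mapping.lookup ?b m) (ell ?a * letter m)) \<approx>
     (\<Sum>m\<in>?Kb. pm_scale (Poly_Mapping.lookup ?b m) (pm_scale (ksign (k \<and> ipar m)) (letter m * ell ?a) + pm_scale (pairing ?a m) 1))"
    by (rule eqt_sum, rule eqt_scale, rule swap_ell[OF hom_coord_vec[OF assms(1)]])
  moreover have "(\<Sum>m\<in>?Kb. pm_scale (Poly_Mapping.lookup ?b m) (pm_scale (ksign (k \<and> ipar m)) (letter m * ell ?a) + pm_scale (pairing ?a m) 1))
    = pm_scale (ksign k) (ell ?b * ell ?a) + pm_scale (\<Sum>m\<in>?Kb. Poly_Mapping.lookup ?b m * pairing ?a m) 1"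
  proof -
    have "ell ?b * ell ?a = (\<Sum>m\<in>?Kb. pm_scale (Poly_Mapping.lookup ?b m) (letter m * ell ?a))"
      by (simp add: ell_def pm_lin_def[of _ ?b] sum_distrib_right)
    then have "pm_scale (ksign k) (ell ?b * ell ?a) = (\<Sum>m\<in>?Kb. pm_scale (Poly_Mapping.lookup ?b m) (pm_scale (ksign (k \<and> ipar m)) (letter m * ell ?a)))"
      by (simp add: pm.scale_sum_right pb mult.commute)
    then show ?thesis by (simp add: pm.scale_right_distrib sum.distrib pm.scale_sum_left)
  qed
  moreover have "(\<Sum>m\<in>?Kb. Poly_Mapping.lookup ?b m * pairing ?a m) = kform k u v"
  proof -
    have "kform k u v = kform k u (\<Sum>m\<in>?Kb. ds (Poly_Mapping.lookup ?b m) (el m))"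
      using el_expand[OF assms(2), of k] by simp
    also have "\<dots> = (\<Sum>m\<in>?Kb. Poly_Mapping.lookup ?b m * kform k u (el m))"
      by (simp add: kform_sum_right assms(1) U_scale el_U kform_right(2)[OF assms(1) el_U assms(1)])
    also have "\<dots> = (\<Sum>m\<in>?Kb. Poly_Mapping.lookup ?b m * pairing ?a m)"
    proof (rule sum.cong[OF refl])
      fix m assume m: "m \<in> ?Kb"
      have "kform k u (el m) = kform k (\<Sum>l\<in>?Ka. ds (Poly_Mapping.lookup ?a l) (el l)) (el m)"
        using el_expand[OF assms(1), of k] by simp
      also have "\<dots> = (\<Sum>l\<in>?Ka. Poly_Mapping.lookup ?a l * kform k (el l) (el m))"
        by (simp add: kform_sum_left U_scale el_U kform_left(2)[OF el_U el_U assms(1)])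
      also have "\<dots> = (\<Sum>l\<in>?Ka. Poly_Mapping.lookup ?a l * form l m)"
        using el_form[of _ m] by (intro sum.cong refl) (auto simp: kform_def pa pb[OF m])
      finally show "Poly_Mapping.lookup ?b m * kform k u (el m) = Poly_Mapping.lookup ?b m * pairing ?a m"
        by (simp add: pairing_sum)
    qed
    finally show ?thesis by simp
  qed
  ultimately show ?thesis by metis
qed

definition krels :: "bool \<Rightarrow> (int \<Rightarrow>\<^sub>0 'v) tensors set" where
  "krels k = sign_rels (ksign k) (kform k) U"

lemma krels_eq: "hrels = krels False" "crels = krels True"
  by (simp_all add: krels_def hrels_def crels_def kform_def)

abbreviation "kerk k \<equiv> ker_M ds U (krels k) An"
abbreviation "kerA k \<equiv> ker_A ds U (krels k)"

lemma Phi_kerA: "x \<in> kerA k \<Longrightarrow> Phi k x \<in> two_sided"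
  unfolding ker_A_def
proof (induction rule: ihull.induct)
  case (gen r a b)
  have "Phi k r \<in> two_sided"
  proof (cases "r \<in> ker_T ds U")
    case True
    then show ?thesis using Phi_ker_T[of r k] by (simp add: two_sided.zero)
  next
    case False
    then obtain u v where r: "r = sign_rel (ksign k) (kform k) u v" "u \<in> U" "v \<in> U"
      using gen by (auto simp: krels_def sign_rels_def)
    then show ?thesis
      using swap_ell_ell[OF r(2,3), of k] unfolding r(1) by (simp add: sign_rel_def eqt_def diff_diff_eq)
  qed
  then show ?case by (simp add: two_mult)
qed (auto intro: two_sided.intros)

lemma ell_An:
  assumes "u \<in> An"
  shows "x * ell (coord_vec k u) \<in> vac_ideal"
  unfolding ell_def pm_lin_def sum_distrib_left mult_scale_right
  by (intro vac_sum vac_scale vac_ideal.ann keys_coord_vec_ann[OF assms])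

lemma Phi_kerL: "x \<in> kerk True \<Longrightarrow> y * Phi True x \<in> vac_ideal"
  unfolding ker_M_def
proof (induction rule: lhull.induct)
  case (gen r c)
  have "y * Phi True r \<in> vac_ideal"
  proof (cases "r \<in> kerA True")
    case True
    then show ?thesis by (intro vac_mult vac_ideal.two Phi_kerA)
  next
    case False
    then obtain p u where "r = p * letter u" "u \<in> An" using gen by blast
    then show ?thesis using ell_An[of u "y * Phi True p" True] by (simp add: mult.assoc)
  qed
  then show ?case by (simp add: vac_scale)
qed (auto simp: distrib_left intro: vac_ideal.intros)

text \<open>In \<open>Phi False x * y\<close> the Weyl factor stands on the left, so its annihilator
  has to pass the Clifford words before it meets the vacuum; this is possible because the two kinds
  of letters commute. For \<open>Phi_kerL\<close> no such move is needed.\<close>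

lemma Phi_kerS: "x \<in> kerk False \<Longrightarrow> y \<in> hw True \<Longrightarrow> Phi False x * y \<in> vac_ideal"
  unfolding ker_M_def
proof (induction rule: lhull.induct)
  case (gen r c)
  have "Phi False r * y \<in> vac_ideal"
  proof (cases "r \<in> kerA False")
    case True
    then show ?thesis by (intro vac_ideal.two two_mult_right Phi_kerA)
  next
    case False
    then obtain p u where r: "r = p * letter u" "u \<in> An" "p \<in> WU" using gen by blast
    then have uU: "u \<in> U" using An_U by blast
    have "ell (coord_vec False u) * y \<approx> y * ell (coord_vec False u)"
      by (rule hw_commute[OF hw_ell[OF hom_coord_vec[OF uU]] gen(2)])
    from eqt_eqv[OF eqt_mult_left[OF this, of "Phi False p"]]
    have "Phi False r * y \<doteq> (Phi False p * y) * ell (coord_vec False u)"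
      by (simp add: r mult.assoc)
    then show ?thesis by (rule eqv_mem) (rule ell_An[OF r(2)])
  qed
  then show ?case by (simp add: vac_scale)
qed (auto simp: distrib_right intro: vac_ideal.intros)

end

section \<open>From letters back to generators and to the tensor product\<close>

context loop_fock begin

text \<open>One map back for both kinds of letters. It forgets the parity of a letter, so it is
  applied only to words of a single parity.\<close>

definition Psi :: "'v index free \<Rightarrow> (int \<Rightarrow>\<^sub>0 'v) tensors" where
  "Psi = pm_lin (\<lambda>w. Uword (map el (letters w)))"

lemma Psi_simps [simp]: "Psi 0 = 0" "Psi (x + y) = Psi x + Psi y" "Psi (x - y) = Psi x - Psi y"
  "Psi (pm_scale c x) = pm_scale c (Psi x)" "Psi (- x) = - Psi x"
  by (simp_all add: Psi_def pm_lin_add pm_lin_diff pm_lin_scale pm_lin_minus)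

lemma Psi_word: "Psi (Iword w) = Uword (map el w)"
  by (simp add: Psi_def)

lemma Psi_mult: "Psi (x * y) = Psi x * Psi y"
proof (induction x rule: pm_induct)
  case (single m c)
  show ?case
  proof (induction y rule: pm_induct)
    case (single n d)
    show ?case by (simp add: mult_single Psi_def plus_word_def mult.commute)
  qed (simp_all add: distrib_left)
qed (simp_all add: distrib_right)

lemma Psi_WU: "Psi x \<in> WU"
proof (induction x rule: pm_induct)
  case (single k c)
  have "set (map el (letters k)) \<subseteq> U" using el_U by auto
  then show ?case by (simp add: Psi_def words_in_word)
qed (auto intro: subspD[OF subsp_words_in])

lemma ker_T_ihull: "ker_T ds U \<subseteq> WU" "subsp (ker_T ds U)"
  "\<And>x a. x \<in> ker_T ds U \<Longrightarrow> a \<in> WU \<Longrightarrow> a * x \<in> ker_T ds U"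
  "\<And>x a. x \<in> ker_T ds U \<Longrightarrow> a \<in> WU \<Longrightarrow> x * a \<in> ker_T ds U"
  using T.N T.N_ideal by auto

lemma linear_rel_ker_T: "r \<in> linear_relations ds U \<Longrightarrow> r \<in> ker_T ds U"
  unfolding ker_T_def using ihull.gen[of r _ 1 WU 1] words_in_one by auto

lemma linear_rel_add: "u \<in> U \<Longrightarrow> v \<in> U \<Longrightarrow> letter (u + v) - letter u - letter v \<in> ker_T ds U"
  by (rule linear_rel_ker_T, unfold linear_relations_def, rule UnI1, rule CollectI, intro exI conjI, rule refl)

lemma linear_rel_scale: "u \<in> U \<Longrightarrow> letter (ds c u) - pm_scale c (letter u) \<in> ker_T ds U"
  by (rule linear_rel_ker_T, unfold linear_relations_def, rule UnI2, rule CollectI, intro exI conjI, rule refl)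

lemma letter_linear:
  assumes "\<And>l. l \<in> A \<Longrightarrow> f l \<in> U" "finite A"
  shows "letter (\<Sum>l\<in>A. ds (c l) (f l)) - (\<Sum>l\<in>A. pm_scale (c l) (letter (f l))) \<in> ker_T ds U"
  using assms(2,1)
proof (induction A)
  case empty
  have "letter ((0,0) + (0,0)) - letter (0,0) - letter (0,0) \<in> ker_T ds U"
    by (rule linear_rel_add[OF U_zero U_zero])
  then have "- letter (0, 0) \<in> ker_T ds U" by (simp add: zero_prod_def[symmetric])
  from subsp_minus[OF ker_T_ihull(2) this] show ?case by (simp add: zero_prod_def)
next
  case (insert l A)
  let ?u = "ds (c l) (f l)" and ?v = "\<Sum>l\<in>A. ds (c l) (f l)"
  have U: "?u \<in> U" "?v \<in> U" "f l \<in> U" using insert by (auto intro!: U_scale U_sum)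
  have 1: "letter (?u + ?v) - letter ?u - letter ?v \<in> ker_T ds U"
    by (rule linear_rel_add[OF U(1,2)])
  have 2: "letter ?u - pm_scale (c l) (letter (f l)) \<in> ker_T ds U"
    by (rule linear_rel_scale[OF U(3)])
  have 3: "letter ?v - (\<Sum>l\<in>A. pm_scale (c l) (letter (f l))) \<in> ker_T ds U"
    using insert by auto
  from subspD(2)[OF ker_T_ihull(2) subspD(2)[OF ker_T_ihull(2) 1 2] 3]
  show ?case using insert by (simp add: algebra_simps)
qed

lemma Psi_ell: "Psi (ell v) = (\<Sum>l\<in>Poly_Mapping.keys v. pm_scale (Poly_Mapping.lookup v l) (letter (el l)))"
proof -
  have "Psi (letter l) = letter (el l)" for l by (simp add: letter_def Psi_word)
  then show ?thesis
    unfolding ell_def by (subst pm_lin_def) (simp add: Psi_def pm_lin_sum pm_lin_scale)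
qed

text \<open>Expanding a generator in coordinates and naming the letters again uses nothing but the
  linear relations, hence the difference already lies in \<open>ker_T\<close>.\<close>

lemma Psi_Phi: "x \<in> WU \<Longrightarrow> x - Psi (Phi k x) \<in> ker_T ds U"
proof (induction rule: words_in_induct)
  case (word w)
  then show ?case
  proof (induction w)
    case Nil
    have "Psi 1 = 1" using Psi_word[of "[]"] by (simp flip: one_word)
    then show ?case by (simp add: subspD(1)[OF ker_T_ihull(2)] flip: one_word)
  next
    case (Cons u w)
    let ?e = "Psi (ell (coord_vec k u))" and ?w = "Psi (Phi k (Uword w))"
    have u: "u \<in> U" using Cons by simp
    have 1: "letter u - ?e \<in> ker_T ds U"
    proof -
      have "letter (\<Sum>l\<in>Poly_Mapping.keys (coord_vec k u). ds (Poly_Mapping.lookup (coord_vec k u) l) (el l))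
          - (\<Sum>l\<in>Poly_Mapping.keys (coord_vec k u). pm_scale (Poly_Mapping.lookup (coord_vec k u) l) (letter (el l))) \<in> ker_T ds U"
        by (rule letter_linear) (simp_all add: el_U)
      then show ?thesis unfolding Psi_ell el_expand[OF u, of k, symmetric] .
    qed
    have 2: "Uword w - ?w \<in> ker_T ds U" using Cons by auto
    have "(letter u - ?e) * Uword w + ?e * (Uword w - ?w) \<in> ker_T ds U"
      by (intro subspD(2)[OF ker_T_ihull(2)] ker_T_ihull(3,4) 1 2 Psi_WU words_in_word) (use Cons in auto)
    moreover have "Uword (u # w) - Psi (Phi k (Uword (u # w))) = (letter u - ?e) * Uword w + ?e * (Uword w - ?w)"
      by (simp add: word_Cons Psi_mult algebra_simps)
    ultimately show ?case by simp
  qed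
next
  case (add p q)
  from subspD(2)[OF ker_T_ihull(2) add] show ?case by (simp add: algebra_simps)
next
  case (scale c p)
  from subspD(3)[OF ker_T_ihull(2) scale, of c] show ?case by (simp add: pm.scale_right_diff_distrib)
qed (simp add: subspD(1)[OF ker_T_ihull(2)])

lemma ker_T_kerA: "x \<in> ker_T ds U \<Longrightarrow> x \<in> kerA k"
  unfolding ker_A_def using ihull.gen[of x _ 1 WU 1] words_in_one by auto

lemma kerA_kerk: "x \<in> kerA k \<Longrightarrow> x \<in> kerk k"
  unfolding ker_M_def by (rule lhull_base) simp

lemma piS_eq: "x \<in> WU \<Longrightarrow> y \<in> WU \<Longrightarrow> x - y \<in> kerk False \<Longrightarrow> piS x = piS y"
  using S.q_eq by (simp add: krels_eq)

lemma piL_eq: "x \<in> WU \<Longrightarrow> y \<in> WU \<Longrightarrow> x - y \<in> kerk True \<Longrightarrow> piL x = piL y"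
  using L.q_eq by (simp add: krels_eq)

subsection \<open>From the free algebra to the tensor product\<close>

definition ptensor :: "(int \<Rightarrow>\<^sub>0 'v) tensors \<Rightarrow> _ \<Rightarrow> _" where
  "ptensor x y = Poly_Mapping.single (piS x, piL y) (1 :: complex)"

abbreviation weq (infix "\<cong>w" 50) where "p \<cong>w q \<equiv> teq SS LL p q"

lemma ptensor_bilinear:
  assumes "x \<in> WU" "x' \<in> WU" "y \<in> WU" "y' \<in> WU"
  shows "ptensor (x + x') y \<cong>w ptensor x y + ptensor x' y" "ptensor x (y + y') \<cong>w ptensor x y + ptensor x y'"
    "ptensor (pm_scale c x) y \<cong>w pm_scale c (ptensor x y)" "ptensor x (pm_scale c y) \<cong>w pm_scale c (ptensor x y)"
  using assms unfolding ptensor_def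
  by (simp_all only: S.q_add L.q_add S.q_scale L.q_scale, (intro teq_bilinear; simp add: S.carrier L.carrier)+)

lemma ptensor_zero:
  assumes "y \<in> WU"
  shows "ptensor 0 y \<cong>w 0" "ptensor y 0 \<cong>w 0"
proof -
  have 0: "0 \<in> WU" by (rule subspD(1)[OF subsp_words_in])
  show "ptensor 0 y \<cong>w 0" "ptensor y 0 \<cong>w 0"
    using ptensor_bilinear(3)[OF 0 0 assms assms, of 0] ptensor_bilinear(4)[OF assms assms 0 0, of 0] by simp_all
qed

lemma ptensor_diff:
  assumes "x \<in> WU" "x' \<in> WU" "y \<in> WU" "y' \<in> WU"
  shows "ptensor (x - x') y \<cong>w ptensor x y - ptensor x' y" "ptensor x (y - y') \<cong>w ptensor x y - ptensor x y'"
proof -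
  have m: "pm_scale (-1) x' \<in> WU" "pm_scale (-1) y' \<in> WU" using assms subspD(3)[OF subsp_words_in] by blast+
  from teq_trans[OF ptensor_bilinear(1)[OF assms(1) m(1) assms(3,3)] teq_add[OF teq_refl ptensor_bilinear(3)[OF assms(2,2,3,3)]]]
  show "ptensor (x - x') y \<cong>w ptensor x y - ptensor x' y" by simp
  from teq_trans[OF ptensor_bilinear(2)[OF assms(1,1,3) m(2)] teq_add[OF teq_refl ptensor_bilinear(4)[OF assms(1,1,4,4)]]]
  show "ptensor x (y - y') \<cong>w ptensor x y - ptensor x y'" by simp
qed

definition fw :: "bool \<Rightarrow> 'v index list \<Rightarrow> 'v index list" where
  "fw k w = filter (\<lambda>l. ipar l = k) w"

lemma fw_simps [simp]: "fw k [] = []" "fw k (l # w) = (if ipar l = k then l # fw k w else fw k w)"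
  "fw k (u @ v) = fw k u @ fw k v"
  by (simp_all add: fw_def)

definition ew :: "bool \<Rightarrow> 'v index list \<Rightarrow> _" where
  "ew k w = Uword (map el (fw k w))"

lemma ew_WU: "ew k w \<in> WU"
  unfolding ew_def by (rule words_in_word) (use el_U in auto)

text \<open>Sorts each word into its Weyl and its Clifford letters. No sign appears because the two
  kinds commute.\<close>

definition tensor_lift :: "'v index free \<Rightarrow> _" where
  "tensor_lift = pm_lin (\<lambda>w. ptensor (ew False (letters w)) (ew True (letters w)))"

lemma tensor_lift_simps [simp]: "tensor_lift 0 = 0" "tensor_lift (x + y) = tensor_lift x + tensor_lift y" "tensor_lift (x - y) = tensor_lift x - tensor_lift y"
  "tensor_lift (pm_scale c x) = pm_scale c (tensor_lift x)" "tensor_lift (- x) = - tensor_lift x"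
  by (simp_all add: tensor_lift_def pm_lin_add pm_lin_diff pm_lin_scale pm_lin_minus)

lemma tensor_lift_word: "tensor_lift (Iword w) = ptensor (ew False w) (ew True w)"
  by (simp add: tensor_lift_def)

lemma ptensor_supported: "x \<in> WU \<Longrightarrow> y \<in> WU \<Longrightarrow> ptensor x y \<in> supported (carrier SS \<times> carrier LL)"
  unfolding ptensor_def by (rule supported_single) (auto simp: S.carrier L.carrier)

lemma tensor_lift_supported: "tensor_lift p \<in> supported (carrier SS \<times> carrier LL)"
proof (induction p rule: pm_induct)
  case (single k c)
  have "ptensor (ew False (letters k)) (ew True (letters k)) \<in> supported (carrier SS \<times> carrier LL)"
    by (intro ptensor_supported ew_WU)
  then show ?case unfolding tensor_lift_def pm_lin_single by (rule subspD(3)[OF subsp_supported])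
qed (auto intro: subspD[OF subsp_supported])

lemma tensor_lift_mult:
  assumes p: "p \<in> hw False" and q: "q \<in> hw True"
  shows "tensor_lift (p * q) \<cong>w ptensor (Psi p) (Psi q)"
  using p
proof (induction rule: words_in_induct)
  case zero
  show ?case using teq_sym[OF ptensor_zero(1)[OF Psi_WU]] by simp
next
  case (add p p')
  from teq_trans[OF teq_add[OF add] teq_sym[OF ptensor_bilinear(1)[OF Psi_WU Psi_WU Psi_WU Psi_WU]]]
  show ?case by (simp add: distrib_right)
next
  case (scale c p)
  from teq_trans[OF teq_scale[OF scale] teq_sym[OF ptensor_bilinear(3)[OF Psi_WU Psi_WU Psi_WU Psi_WU]]]
  show ?case by simp
next
  case (word u)
  show ?case using q
  proof (induction rule: words_in_induct)
    case zero
    show ?case using teq_sym[OF ptensor_zero(2)[OF Psi_WU]] by simp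
  next
    case (add p p')
    from teq_trans[OF teq_add[OF add] teq_sym[OF ptensor_bilinear(2)[OF Psi_WU Psi_WU Psi_WU Psi_WU]]]
    show ?case by (simp add: distrib_left)
  next
    case (scale c p)
    from teq_trans[OF teq_scale[OF scale] teq_sym[OF ptensor_bilinear(4)[OF Psi_WU Psi_WU Psi_WU Psi_WU]]]
    show ?case by simp
  next
    case (word v)
    have "fw False u = u" "fw True u = []" "fw False v = []" "fw True v = v"
      using word \<open>set u \<subseteq> _\<close> by (auto simp: fw_def filter_id_conv filter_empty_conv)
    then show ?case by (simp add: word_mult tensor_lift_word ew_def Psi_word)
  qed
qed

lemma tensor_lift_Phi:
  assumes "x \<in> WU" "y \<in> WU"
  shows "tensor_lift (Phi False x * Phi True y) \<cong>w ptensor x y"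
proof -
  have "piS x = piS (Psi (Phi False x))" "piL y = piL (Psi (Phi True y))"
    by (rule piS_eq[OF assms(1) Psi_WU kerA_kerk[OF ker_T_kerA[OF Psi_Phi[OF assms(1)]]]],
        rule piL_eq[OF assms(2) Psi_WU kerA_kerk[OF ker_T_kerA[OF Psi_Phi[OF assms(2)]]]])
  then have "ptensor (Psi (Phi False x)) (Psi (Phi True y)) = ptensor x y" by (simp add: ptensor_def)
  then show ?thesis using tensor_lift_mult[OF Phi_hw[OF assms(1)] Phi_hw[OF assms(2)]] by simp
qed

lemma tensor_lift_surj:
  assumes "p \<in> supported (carrier SS \<times> carrier LL)"
  shows "\<exists>r. tensor_lift r \<cong>w p"
proof -
  have "\<exists>r. tensor_lift r \<cong>w (\<Sum>k\<in>A. Poly_Mapping.single k (Poly_Mapping.lookup p k))" if "finite A" "A \<subseteq> Poly_Mapping.keys p" for A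
    using that
  proof induction
    case empty
    show ?case by (rule exI[of _ 0]) simp
  next
    case (insert k A)
    then obtain r where r: "tensor_lift r \<cong>w (\<Sum>k\<in>A. Poly_Mapping.single k (Poly_Mapping.lookup p k))" by auto
    have "k \<in> carrier SS \<times> carrier LL" using assms insert by (auto simp: supported_def)
    then obtain x y where k: "k = (piS x, piL y)" "x \<in> WU" "y \<in> WU" by (auto simp: S.carrier L.carrier)
    have "tensor_lift (pm_scale (Poly_Mapping.lookup p k) (Phi False x * Phi True y)) \<cong>w Poly_Mapping.single k (Poly_Mapping.lookup p k)"
      using teq_scale[OF tensor_lift_Phi[OF k(2,3)], of "Poly_Mapping.lookup p k"] by (simp add: ptensor_def k(1))
    from teq_add[OF this r] show ?case
      using insert by (intro exI[of _ "pm_scale (Poly_Mapping.lookup p k) (Phi False x * Phi True y) + r"]) simp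
  qed
  from this[OF finite_keys order_refl] show ?thesis
    unfolding pm_decomp[of p, symmetric] .
qed

end

context loop_fock begin

notation weq (infix "\<cong>w" 50)

subsection \<open>The kernel\<close>

lemma ker_tensor_sub: "subsp (ker_tensor SS LL)"
  by (rule subsp_ker_tensor)

lemma weq_zero_iff: "p \<cong>w 0 \<longleftrightarrow> p \<in> ker_tensor SS LL"
  by (simp add: teq_def)

definition ptensor_of :: "bool \<Rightarrow> _ \<Rightarrow> _ \<Rightarrow> _" where
  "ptensor_of k x y = (if k then ptensor y x else ptensor x y)"

lemma ptensor_of_simps:
  assumes "x \<in> WU" "x' \<in> WU" "y \<in> WU"
  shows "ptensor_of k (x + x') y \<cong>w ptensor_of k x y + ptensor_of k x' y" "ptensor_of k (x - x') y \<cong>w ptensor_of k x y - ptensor_of k x' y"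
    "ptensor_of k (pm_scale c x) y \<cong>w pm_scale c (ptensor_of k x y)"
  using ptensor_bilinear[OF assms(1,2,3,3)] ptensor_bilinear[OF assms(3,3,1,2)] ptensor_diff[OF assms(1,2,3,3)] ptensor_diff[OF assms(3,3,1,2)]
  by (simp_all add: ptensor_of_def)

lemma ptensor_of_ker:
  assumes "x \<in> WU" "y \<in> WU" "x \<in> kerk k"
  shows "ptensor_of k x y \<cong>w 0"
proof -
  have 0: "0 \<in> WU" by (rule subspD(1)[OF subsp_words_in])
  have "ptensor_of k x y = ptensor_of k 0 y"
    using piS_eq[OF assms(1) 0] piL_eq[OF assms(1) 0] assms(3) by (cases k) (simp_all add: ptensor_of_def ptensor_def)
  then show ?thesis using ptensor_zero[OF assms(2)] by (simp add: ptensor_of_def)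
qed

lemma tensor_lift_kword: "tensor_lift (Iword w) = ptensor_of k (ew k w) (ew (\<not> k) w)"
  by (cases k) (simp_all add: tensor_lift_word ptensor_of_def)

lemma kerA_mult: "x \<in> kerA k \<Longrightarrow> a \<in> WU \<Longrightarrow> b \<in> WU \<Longrightarrow> a * x * b \<in> kerA k"
proof -
  interpret A: presented_algebra "A_alg ds U (krels k)" "A_map ds U (krels k)" "words_in U" "kerA k"
    by (rule presented_A[OF linear_relations_words]) (simp add: krels_def sign_rels_words)
  show "x \<in> kerA k \<Longrightarrow> a \<in> WU \<Longrightarrow> b \<in> WU \<Longrightarrow> a * x * b \<in> kerA k"
    by (intro A.N_ideal)
qed

lemma kerA_WU: "x \<in> kerA k \<Longrightarrow> x \<in> WU"
proof -
  interpret A: presented_algebra "A_alg ds U (krels k)" "A_map ds U (krels k)" "words_in U" "kerA k"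
    by (rule presented_A[OF linear_relations_words]) (simp add: krels_def sign_rels_words)
  show "x \<in> kerA k \<Longrightarrow> x \<in> WU" using A.N by auto
qed

lemma sign_rel_kerA:
  assumes "u \<in> U" "v \<in> U"
  shows "sign_rel (ksign k) (kform k) u v \<in> kerA k"
proof -
  have "sign_rel (ksign k) (kform k) u v \<in> krels k"
    unfolding krels_def sign_rels_def by (rule CollectI, rule exI[of _ u], rule exI[of _ v]) (use assms in simp)
  then have "1 * sign_rel (ksign k) (kform k) u v * 1 \<in> kerA k"
    unfolding ker_A_def by (intro ihull.gen UnI2 words_in_one)
  then show ?thesis by simp
qed

lemma letter_zero_kerA: "letter (0, 0) \<in> kerA k"
  using ker_T_kerA[OF letter_linear[of "{}" el "\<lambda>_. 0"]] by (simp add: zero_prod_def)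

text \<open>For letters of different parity both orders sort to the same pair of words. For equal
  parity the relation lies entirely in one tensor factor, where it is a defining relation.\<close>

lemma tensor_lift_word_ccr: "tensor_lift (Iword u * ccr l m * Iword v) \<cong>w 0"
proof (cases "ipar l = ipar m")
  case False
  then have "form l m = 0" by (auto simp: form_def)
  moreover have "tensor_lift (Iword u * (letter l * letter m) * Iword v) = tensor_lift (Iword u * (letter m * letter l) * Iword v)"
    using False unfolding letter_def by (simp add: word_mult tensor_lift_word ew_def)
  ultimately show ?thesis
    using False by (simp add: ccr_def algebra_simps)
next
  case True
  define k where "k = ipar l"
  have k: "ipar l = k" "ipar m = k" using True by (auto simp: k_def)
  let ?a = "ew k u" and ?b = "ew k v" and ?y = "ew (\<not> k) (u @ v)"
  let ?l = "letter (el l)" and ?m = "letter (el m)"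
  have e1: "tensor_lift (Iword u * (letter l * letter m) * Iword v) = ptensor_of k (?a * (?l * ?m) * ?b) ?y"
    unfolding letter_def by (simp add: word_mult tensor_lift_kword[of _ k] ew_def k)
  have e2: "tensor_lift (Iword u * (letter m * letter l) * Iword v) = ptensor_of k (?a * (?m * ?l) * ?b) ?y"
    unfolding letter_def by (simp add: word_mult tensor_lift_kword[of _ k] ew_def k)
  have e3: "tensor_lift (Iword u * Iword v) = ptensor_of k (?a * ?b) ?y"
    by (simp add: word_mult tensor_lift_kword[of _ k] ew_def)
  have W: "?a * (?l * ?m) * ?b \<in> WU" "?a * (?m * ?l) * ?b \<in> WU" "?a * ?b \<in> WU" "?y \<in> WU"
    by (intro words_in_mult ew_WU words_in_letter el_U)+
  have fm: "kform k (el l) (el m) = form l m"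
    using el_form[OF True] by (simp add: kform_def k)
  let ?X = "?a * sign_rel (ksign k) (kform k) (el l) (el m) * ?b"
  have X: "?X \<in> kerA k" by (intro kerA_mult sign_rel_kerA el_U ew_WU)
  have Xe: "?X = ?a * (?l * ?m) * ?b - pm_scale (ksign k) (?a * (?m * ?l) * ?b) - pm_scale (form l m) (?a * ?b)"
    by (simp add: sign_rel_def fm algebra_simps)
  have sW: "pm_scale c x \<in> WU" if "x \<in> WU" for c x using that by (rule subspD(3)[OF subsp_words_in])
  have dW: "x - x' \<in> WU" if "x \<in> WU" "x' \<in> WU" for x x' using that by (rule subsp_diff[OF subsp_words_in])
  have td: "p - p' \<cong>w q - q'" if "p \<cong>w q" "p' \<cong>w q'" for p p' q q'
    using subsp_diff[OF ker_tensor_sub, of "p - q" "p' - q'"] that by (simp add: teq_def algebra_simps)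
  have "ptensor_of k ?X ?y \<cong>w ptensor_of k (?a * (?l * ?m) * ?b) ?y - pm_scale (ksign k) (ptensor_of k (?a * (?m * ?l) * ?b) ?y) - pm_scale (form l m) (ptensor_of k (?a * ?b) ?y)"
    unfolding Xe
    by (rule teq_trans[OF ptensor_of_simps(2)[OF dW[OF W(1) sW[OF W(2)]] sW[OF W(3)] W(4)] td[OF teq_trans[OF ptensor_of_simps(2)[OF W(1) sW[OF W(2)] W(4)] td[OF teq_refl ptensor_of_simps(3)[OF W(2,2,4)]]] ptensor_of_simps(3)[OF W(3,3,4)]]])
  moreover have "ptensor_of k ?X ?y \<cong>w 0" by (rule ptensor_of_ker[OF kerA_WU[OF X] W(4) kerA_kerk[OF X]])
  moreover have "tensor_lift (Iword u * ccr l m * Iword v) = ptensor_of k (?a * (?l * ?m) * ?b) ?y - pm_scale (ksign k) (ptensor_of k (?a * (?m * ?l) * ?b) ?y) - pm_scale (form l m) (ptensor_of k (?a * ?b) ?y)"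
    unfolding e1[symmetric] e2[symmetric] e3[symmetric] tensor_lift_simps(3,4)[symmetric]
    by (rule arg_cong[of _ _ tensor_lift]) (simp add: ccr_def k algebra_simps del: pm_scale_single)
  ultimately show ?thesis using teq_trans[OF teq_sym] by simp
qed

lemma tensor_lift_word_dead:
  assumes "\<not> ilive B l"
  shows "tensor_lift (Iword u * letter l * Iword v) \<cong>w 0"
proof -
  define k where "k = ipar l"
  let ?X = "ew k u * letter (0, 0) * ew k v"
  have "tensor_lift (Iword u * letter l * Iword v) = ptensor_of k ?X (ew (\<not> k) (u @ v))"
    unfolding letter_def using el_dead[OF assms] by (simp add: word_mult tensor_lift_kword[of _ k] ew_def k_def)
  moreover have X: "?X \<in> kerA k" by (intro kerA_mult letter_zero_kerA ew_WU)
  ultimately show ?thesis using ptensor_of_ker[OF kerA_WU[OF X] ew_WU kerA_kerk[OF X]] by simp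
qed

lemma tensor_lift_word_ann:
  assumes "iann l"
  shows "tensor_lift (Iword u * letter l) \<cong>w 0"
proof -
  define k where "k = ipar l"
  let ?X = "ew k u * letter (el l)"
  have "tensor_lift (Iword u * letter l) = ptensor_of k ?X (ew (\<not> k) u)"
    unfolding letter_def by (simp add: word_mult tensor_lift_kword[of _ k] ew_def k_def)
  moreover have "?X \<in> kerk k"
    unfolding ker_M_def by (rule lhull_base) (use el_ann[OF assms] ew_WU in blast)
  moreover have "?X \<in> WU" by (intro words_in_mult ew_WU words_in_letter el_U)
  ultimately show ?thesis using ptensor_of_ker[of ?X "ew (\<not> k) u" k] ew_WU by simp
qed

lemma weq_add0: "p \<cong>w 0 \<Longrightarrow> q \<cong>w 0 \<Longrightarrow> p + q \<cong>w 0"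
  using teq_add[of SS LL p 0 q 0] by simp

lemma weq_scale0: "p \<cong>w 0 \<Longrightarrow> pm_scale c p \<cong>w 0"
  using teq_scale[of SS LL p 0 c] by simp

lemma word_span_induct:
  fixes p :: "'v index free"
  assumes "P 0" "\<And>p q. P p \<Longrightarrow> P q \<Longrightarrow> P (p + q)" "\<And>c p. P p \<Longrightarrow> P (pm_scale c p)" "\<And>w. P (Iword w)"
  shows "P p"
proof (induction p rule: pm_induct)
  case (single k c)
  show ?case using assms(3)[OF assms(4)[of "letters k"], of c] by simp
qed (use assms in auto)

lemma tensor_lift_sandwich:
  assumes "\<And>u v. tensor_lift (Iword u * r * Iword v) \<cong>w 0"
  shows "tensor_lift (x * r * y) \<cong>w 0"
proof (induction x rule: word_span_induct)
  case (4 u)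
  show ?case
  proof (induction y rule: word_span_induct)
    case (2 p q)
    then show ?case using weq_add0 by (simp add: distrib_left)
  next
    case (3 c p)
    then show ?case using weq_scale0 by simp
  qed (simp_all add: assms)
next
  case (2 p q)
  then show ?case using weq_add0 by (simp add: distrib_right)
next
  case (3 c p)
  then show ?case using weq_scale0 by simp
qed simp

lemma tensor_lift_vac: "p \<in> vac_ideal \<Longrightarrow> tensor_lift p \<cong>w 0"
proof (induction rule: vac_ideal.induct)
  case (two p)
  then show ?case
  proof (induction rule: two_sided.induct)
    case (ccr x l m y)
    show ?case by (rule tensor_lift_sandwich[OF tensor_lift_word_ccr])
  next
    case (dead l x y)
    show ?case by (rule tensor_lift_sandwich[OF tensor_lift_word_dead[OF dead]])
  qed (simp_all add: weq_add0)
next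
  case (add p q)
  then show ?case by (simp add: weq_add0)
next
  case (ann l x)
  show ?case
  proof (induction x rule: word_span_induct)
    case (2 p q)
    then show ?case using weq_add0 by (simp add: distrib_right)
  next
    case (3 c p)
    then show ?case using weq_scale0 by simp
  next
    case (4 w)
    show ?case by (rule tensor_lift_word_ann[OF ann])
  qed simp
qed

definition rep_S where "rep_S s = (SOME x. x \<in> WU \<and> piS x = s)"
definition rep_L where "rep_L s = (SOME x. x \<in> WU \<and> piL x = s)"

lemma rep_S: "s \<in> carrier SS \<Longrightarrow> rep_S s \<in> WU \<and> piS (rep_S s) = s"
  unfolding rep_S_def by (rule someI_ex) (auto simp: S.carrier)

lemma rep_L: "s \<in> carrier LL \<Longrightarrow> rep_L s \<in> WU \<and> piL (rep_L s) = s"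
  unfolding rep_L_def by (rule someI_ex) (auto simp: L.carrier)

text \<open>The representatives are arbitrary: by \<open>Phi_piS\<close> and \<open>Phi_piL\<close>
  another choice changes the result only within \<open>vac_ideal\<close>.\<close>

definition tensor_inv :: "_ \<Rightarrow> 'v index free" where
  "tensor_inv = pm_lin (\<lambda>k. Phi False (rep_S (fst k)) * Phi True (rep_L (snd k)))"

lemma tensor_inv_simps [simp]: "tensor_inv 0 = 0" "tensor_inv (x + y) = tensor_inv x + tensor_inv y" "tensor_inv (x - y) = tensor_inv x - tensor_inv y"
  "tensor_inv (pm_scale c x) = pm_scale c (tensor_inv x)"
  by (simp_all add: tensor_inv_def pm_lin_add pm_lin_diff pm_lin_scale)

lemma Phi_piS:
  assumes "x \<in> WU" "x' \<in> WU" "piS x = piS x'" "y \<in> hw True"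
  shows "Phi False x * y \<doteq> Phi False x' * y"
proof -
  have "x - x' \<in> kerk False" using assms S.q_eq by (simp add: krels_eq)
  from Phi_kerS[OF this assms(4)] show ?thesis by (simp add: eqv_def algebra_simps)
qed

lemma Phi_piL:
  assumes "x \<in> WU" "x' \<in> WU" "piL x = piL x'"
  shows "y * Phi True x \<doteq> y * Phi True x'"
proof -
  have "x - x' \<in> kerk True" using assms L.q_eq by (simp add: krels_eq)
  from Phi_kerL[OF this, of y] show ?thesis by (simp add: eqv_def algebra_simps)
qed

lemma tensor_inv_ptensor:
  assumes "x \<in> WU" "y \<in> WU"
  shows "tensor_inv (ptensor x y) \<doteq> Phi False x * Phi True y"
proof -
  have r: "rep_S (piS x) \<in> WU" "piS (rep_S (piS x)) = piS x" "rep_L (piL y) \<in> WU" "piL (rep_L (piL y)) = piL y"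
    using rep_S[of "piS x"] rep_L[of "piL y"] assms by (auto simp: S.carrier L.carrier)
  have "tensor_inv (ptensor x y) = Phi False (rep_S (piS x)) * Phi True (rep_L (piL y))"
    by (simp add: ptensor_def tensor_inv_def)
  moreover have "\<dots> \<doteq> Phi False x * Phi True (rep_L (piL y))"
    by (rule Phi_piS[OF r(1) assms(1) r(2) Phi_hw[OF r(3)]])
  moreover have "Phi False x * Phi True (rep_L (piL y)) \<doteq> Phi False x * Phi True y"
    by (rule Phi_piL[OF r(3) assms(2) r(4)])
  ultimately show ?thesis using eqv_trans by metis
qed

lemma tensor_inv_bilinear:
  assumes "p \<in> bilinear_relations SS LL"
  shows "tensor_inv p \<in> vac_ideal"
proof -
  have sp: "Poly_Mapping.single (piS x, piL y) c = pm_scale c (ptensor x y)" for x y c by (simp add: ptensor_def)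
  note s = subspD[OF subsp_words_in[of U]]
  consider x x' y where "x \<in> carrier SS" "x' \<in> carrier SS" "y \<in> carrier LL"
      "p = Poly_Mapping.single (x \<oplus>\<^bsub>SS\<^esub> x', y) 1 - Poly_Mapping.single (x, y) 1 - Poly_Mapping.single (x', y) 1"
    | x y y' where "x \<in> carrier SS" "y \<in> carrier LL" "y' \<in> carrier LL"
      "p = Poly_Mapping.single (x, y \<oplus>\<^bsub>LL\<^esub> y') 1 - Poly_Mapping.single (x, y) 1 - Poly_Mapping.single (x, y') 1"
    | c x y where "x \<in> carrier SS" "y \<in> carrier LL" "p = Poly_Mapping.single (c \<odot>\<^bsub>SS\<^esub> x, y) 1 - Poly_Mapping.single (x, y) c"
    | c x y where "x \<in> carrier SS" "y \<in> carrier LL" "p = Poly_Mapping.single (x, c \<odot>\<^bsub>LL\<^esub> y) 1 - Poly_Mapping.single (x, y) c"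
    using assms unfolding bilinear_relations_def by (elim UnE CollectE exE conjE) metis+
  then show ?thesis
  proof cases
    case 1
    then obtain a a' b where e: "x = piS a" "x' = piS a'" "y = piL b" "a \<in> WU" "a' \<in> WU" "b \<in> WU"
      by (auto simp: S.carrier L.carrier)
    have p: "p = ptensor (a + a') b - ptensor a b - ptensor a' b" using 1 e by (simp add: ptensor_def S.q_add)
    have "tensor_inv p \<doteq> Phi False (a + a') * Phi True b - Phi False a * Phi True b - Phi False a' * Phi True b"
      unfolding p tensor_inv_simps by (intro eqv_diff tensor_inv_ptensor s e)
    then show ?thesis by (simp add: distrib_right eqv_zero_iff)
  next
    case 2
    then obtain a b b' where e: "x = piS a" "y = piL b" "y' = piL b'" "a \<in> WU" "b \<in> WU" "b' \<in> WU"
      by (auto simp: S.carrier L.carrier)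
    have p: "p = ptensor a (b + b') - ptensor a b - ptensor a b'" using 2 e by (simp add: ptensor_def L.q_add)
    have "tensor_inv p \<doteq> Phi False a * Phi True (b + b') - Phi False a * Phi True b - Phi False a * Phi True b'"
      unfolding p tensor_inv_simps by (intro eqv_diff tensor_inv_ptensor s e)
    then show ?thesis by (simp add: distrib_left eqv_zero_iff)
  next
    case 3
    then obtain a b where e: "x = piS a" "y = piL b" "a \<in> WU" "b \<in> WU"
      by (auto simp: S.carrier L.carrier)
    have p: "p = ptensor (pm_scale c a) b - pm_scale c (ptensor a b)" using 3 e by (simp add: ptensor_def S.q_scale)
    have "tensor_inv p \<doteq> Phi False (pm_scale c a) * Phi True b - pm_scale c (Phi False a * Phi True b)"
      unfolding p tensor_inv_simps by (intro eqv_diff eqv_scale tensor_inv_ptensor s e)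
    then show ?thesis by (simp add: eqv_zero_iff)
  next
    case 4
    then obtain a b where e: "x = piS a" "y = piL b" "a \<in> WU" "b \<in> WU"
      by (auto simp: S.carrier L.carrier)
    have p: "p = ptensor a (pm_scale c b) - pm_scale c (ptensor a b)" using 4 e by (simp add: ptensor_def L.q_scale)
    have "tensor_inv p \<doteq> Phi False a * Phi True (pm_scale c b) - pm_scale c (Phi False a * Phi True b)"
      unfolding p tensor_inv_simps by (intro eqv_diff eqv_scale tensor_inv_ptensor s e)
    then show ?thesis by (simp add: eqv_zero_iff)
  qed
qed

lemma tensor_inv_ker: "p \<in> ker_tensor SS LL \<Longrightarrow> tensor_inv p \<in> vac_ideal"
  unfolding ker_tensor_def
proof (induction rule: lhull.induct)
  case (gen r c)
  then have "tensor_inv r \<in> vac_ideal" using tensor_inv_bilinear by auto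
  then show ?case by (simp add: vac_scale)
qed (auto intro: vac_ideal.add)

lemma Phi_ew: "Phi k (Uword (map el w)) \<approx> Iword w" if "\<And>l. l \<in> set w \<Longrightarrow> ipar l = k"
  using that
proof (induction w)
  case Nil
  then show ?case by (simp add: Phi_word flip: one_word)
next
  case (Cons l w)
  have 1: "ell (coord_vec k (el l)) \<approx> letter l"
  proof (cases "ilive B l")
    case True
    then show ?thesis using coord_vec_el[OF True] Cons by simp
  next
    case False
    then show ?thesis using eqt_sym[OF dead_zero[OF False]] by (simp add: el_dead coord_vec_zero)
  qed
  have 2: "Phi k (Uword (map el w)) \<approx> Iword w" using Cons by auto
  from eqt_trans[OF eqt_mult_right[OF 1] eqt_mult_left[OF 2]]
  show ?case by (simp add: word_Cons)
qed

lemma sort_word: "Iword (fw False w) * Iword (fw True w) \<approx> Iword w"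
proof (induction w)
  case Nil
  show ?case by (simp flip: one_word)
next
  case (Cons l w)
  show ?case
  proof (cases "ipar l")
    case False
    then show ?thesis using eqt_mult_left[OF Cons, of "letter l"] by (simp add: word_Cons mult.assoc)
  next
    case True
    have "Iword (fw False w) * letter l \<approx> letter l * Iword (fw False w)"
      by (rule hw_commute) (use True in \<open>auto simp: fw_def intro: words_in_word words_in_letter\<close>)
    from eqt_trans[OF eqt_mult_right[OF this, of "Iword (fw True w)"]] eqt_mult_left[OF Cons, of "letter l"]
    show ?thesis using True by (simp add: word_Cons mult.assoc)
  qed
qed

text \<open>Renaming letters as generators and taking coordinates again restores each letter up to
  \<open>\<approx>\<close>; what remains is to undo the sorting. This left inverse gives injectivity
  of the comparison with the tensor product.\<close>

lemma tensor_inv_lift: "tensor_inv (tensor_lift p) \<doteq> p"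
proof (induction p rule: word_span_induct)
  case (4 w)
  have 1: "tensor_inv (tensor_lift (Iword w)) \<doteq> Phi False (ew False w) * Phi True (ew True w)"
    unfolding tensor_lift_word by (rule tensor_inv_ptensor[OF ew_WU ew_WU])
  have a: "Phi False (ew False w) \<approx> Iword (fw False w)" "Phi True (ew True w) \<approx> Iword (fw True w)"
    unfolding ew_def by (rule Phi_ew; simp add: fw_def)+
  from eqt_trans[OF eqt_trans[OF eqt_mult_right[OF a(1)] eqt_mult_left[OF a(2)]] sort_word]
  have 2: "Phi False (ew False w) * Phi True (ew True w) \<approx> Iword w" .
  show ?case by (rule eqv_trans[OF 1 eqt_eqv[OF 2]])
next
  case (2 p q)
  then show ?case using eqv_add by simp
next
  case (3 c p)
  then show ?case using eqv_scale by simp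
qed simp

subsection \<open>The isomorphism\<close>

abbreviation "WW \<equiv> semi_inf_W (loop_scale sc) (loop_deg :: int \<Rightarrow> (int \<Rightarrow>\<^sub>0 'v) set)"

definition fock_map :: "'v index free \<Rightarrow> _" where
  "fock_map p = Wmap (tensor_lift p)"

lemma fock_map_add: "fock_map (p + q) = fock_map p \<oplus>\<^bsub>WW\<^esub> fock_map q"
  by (simp add: fock_map_def W.q_add tensor_lift_supported)

lemma fock_map_scale: "fock_map (pm_scale c p) = c \<odot>\<^bsub>WW\<^esub> fock_map p"
  by (simp add: fock_map_def W.q_scale tensor_lift_supported)

lemma fock_map_diff: "fock_map (p - q) = fock_map p \<ominus>\<^bsub>WW\<^esub> fock_map q"
  by (simp add: fock_map_def W.q_diff tensor_lift_supported)

text \<open>One direction applies the left inverse \<open>tensor_inv\<close>, which carries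
  \<open>ker_tensor\<close> into \<open>vac_ideal\<close>; the other is that
  \<open>tensor_lift\<close> carries \<open>vac_ideal\<close> into
  \<open>ker_tensor\<close>.\<close>

lemma fock_map_eq_iff: "fock_map p = fock_map q \<longleftrightarrow> p - q \<in> vac_ideal"
proof
  assume "fock_map p = fock_map q"
  then have "tensor_lift (p - q) \<in> ker_tensor SS LL"
    by (simp add: fock_map_def W.q_eq tensor_lift_supported)
  from tensor_inv_ker[OF this] show "p - q \<in> vac_ideal"
    using eqv_mem[OF eqv_sym[OF tensor_inv_lift[of "p - q"]]] by simp
next
  assume "p - q \<in> vac_ideal"
  from tensor_lift_vac[OF this] show "fock_map p = fock_map q"
    by (simp add: weq_zero_iff fock_map_def W.q_eq tensor_lift_supported)
qed

lemma fock_map_carrier: "carrier WW = range fock_map"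
proof (intro equalityI subsetI)
  fix z assume "z \<in> carrier WW"
  then obtain p where p: "p \<in> supported (carrier SS \<times> carrier LL)" "z = Wmap p" by (auto simp: W.carrier)
  obtain r where "tensor_lift r \<cong>w p" using tensor_lift_surj[OF p(1)] by auto
  then have "z = fock_map r" using p W.q_eq[OF tensor_lift_supported p(1), of r] by (simp add: fock_map_def teq_def)
  then show "z \<in> range fock_map" by simp
next
  fix z assume "z \<in> range fock_map"
  then show "z \<in> carrier WW" using tensor_lift_supported by (auto simp: fock_map_def W.carrier)
qed

text \<open>The component of parity \<open>i\<close> as an eigenspace of the parity automorphism;
  \<open>i = False\<close> is the even one.\<close>

definition even_part :: "bool \<Rightarrow> 'v index free set" where
  "even_part i = {p. sig True p = pm_scale (ksign i) p}"

lemma subsp_even_part: "subsp (even_part i)"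
  by (auto simp: subsp_def even_part_def pm.scale_right_distrib mult.commute)

lemma wpar_ew: "wpar w = odd (length (map el (fw True w)))"
  by (simp add: wpar_def fw_def)

lemma fock_map_part: "part WW i = fock_map ` even_part i"
proof (intro equalityI subsetI)
  let ?R = "{Poly_Mapping.single (x, y) (1::complex) | x y. x \<in> carrier SS \<and> y \<in> Lambda_part (loop_scale sc) loop_deg i}"
  fix z assume "z \<in> part WW i"
  then obtain t where t: "t \<in> lhull (ker_tensor SS LL \<union> ?R)" "z = Wmap t"
    unfolding W_part_eq by (rule imageE)
  \<comment> \<open>An element of the hull may contain summands from \<open>kerL\<close> of the
    wrong parity. Replacing these by 0 keeps the class and makes the image under
    \<open>Phi True\<close> homogeneous.\<close>
  have L: "\<exists>b'\<in>WU. piL b' = piL b \<and> b \<in> WU \<and> Phi True b' \<in> even_part i"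
    if "b \<in> lhull (kerL \<union> {Uword us | us. set us \<subseteq> U \<and> odd (length us) = i})" for b
    using that
  proof (induction rule: lhull.induct)
    case zero
    have "0 \<in> WU" by (rule subspD(1)[OF subsp_words_in])
    then show ?case using subspD(1)[OF subsp_even_part[of i]] by (intro bexI[of _ 0]) auto
  next
    case (add x y)
    then obtain x' y' where e: "x' \<in> WU" "piL x' = piL x" "x \<in> WU" "Phi True x' \<in> even_part i"
      "y' \<in> WU" "piL y' = piL y" "y \<in> WU" "Phi True y' \<in> even_part i" by blast
    show ?case
      by (rule bexI[of _ "x' + y'"]) (use e in \<open>auto simp: L.q_add subspD[OF subsp_words_in] subspD[OF subsp_even_part]\<close>)
  next
    case (gen r c)
    show ?case
    proof (cases "r \<in> kerL")
      case True
      have 0: "0 \<in> WU" by (rule subspD(1)[OF subsp_words_in])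
      have r: "r \<in> WU" using True L.N by auto
      have "piL r = piL 0" using L.q_eq[OF r 0] True by simp
      then have "piL (pm_scale c r) = piL 0" using L.q_scale[OF r, of c] L.q_scale[OF 0, of c] by simp
      then show ?thesis using 0 r subspD(1)[OF subsp_even_part[of i]] subspD(3)[OF subsp_words_in r] by (intro bexI[of _ 0]) auto
    next
      case False
      then obtain us where us: "r = Uword us" "set us \<subseteq> U" "odd (length us) = i" using gen by blast
      have "sig True (Phiw True us) = pm_scale (ksign (odd (length us))) (Phiw True us)"
        using us(2)
      proof (induction us)
        case (Cons u us)
        then show ?case by (simp add: sig_ell[OF hom_coord_vec]) (auto simp: ksign_def)
      qed simp
      then have "Phi True r \<in> even_part i" by (simp add: us Phi_word even_part_def)
      then have "Phi True (pm_scale c r) \<in> even_part i" using subspD(3)[OF subsp_even_part] by simp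
      moreover have "pm_scale c r \<in> WU" using us words_in_word subspD(3)[OF subsp_words_in] by blast
      ultimately show ?thesis by blast
    qed
  qed
  have "\<exists>p\<in>even_part i. tensor_lift p \<cong>w t \<and> t \<in> supported (carrier SS \<times> carrier LL)"
    using t(1)
  proof (induction rule: lhull.induct)
    case zero
    show ?case using subspD(1)[OF subsp_even_part[of i]] subspD(1)[OF subsp_supported] by (intro bexI[of _ 0]) auto
  next
    case (add x y)
    then obtain p q where e: "p \<in> even_part i" "tensor_lift p \<cong>w x" "x \<in> supported (carrier SS \<times> carrier LL)"
      "q \<in> even_part i" "tensor_lift q \<cong>w y" "y \<in> supported (carrier SS \<times> carrier LL)" by blast
    show ?case
      by (rule bexI[of _ "p + q"]) (use e teq_add[OF e(2,5)] in \<open>auto simp: subspD[OF subsp_supported] subspD[OF subsp_even_part]\<close>)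
  next
    case (gen r c)
    have "\<exists>p\<in>even_part i. tensor_lift p \<cong>w r \<and> r \<in> supported (carrier SS \<times> carrier LL)"
    proof (cases "r \<in> ker_tensor SS LL")
      case True
      then show ?thesis
        using teq_sym[of SS LL r 0] W.N subspD(1)[OF subsp_even_part[of i]] by (intro bexI[of _ 0]) (auto simp: weq_zero_iff)
    next
      case False
      then obtain x y where r: "r = Poly_Mapping.single (x, y) 1" "x \<in> carrier SS" "y \<in> Lambda_part (loop_scale sc) loop_deg i"
        using gen by blast
      obtain a where a: "x = piS a" "a \<in> WU" using r(2) by (auto simp: S.carrier)
      obtain b where b0: "b \<in> lhull (kerL \<union> {Uword us | us. set us \<subseteq> U \<and> odd (length us) = i})" "y = piL b"
        using r(3) unfolding Lambda_part_eq by (rule imageE)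
      obtain b' where "b' \<in> WU" "piL b' = piL b" "Phi True b' \<in> even_part i" using L[OF b0(1)] by (elim bexE conjE)
      with b0(2) have b: "b' \<in> WU" "y = piL b'" "Phi True b' \<in> even_part i" by simp_all
      have ra: "r = ptensor a b'" by (simp add: r a b ptensor_def)
      have "sig True (Phi False a) = Phi False a"
        using Phi_hw[OF a(2), of False]
      proof (induction rule: words_in_induct)
        case (word w)
        then have "filter ipar w = []" by (auto simp: filter_empty_conv)
        then have "\<not> wpar w" by (simp add: wpar_def)
        then show ?case by (simp add: sig_word)
      qed auto
      then have "Phi False a * Phi True b' \<in> even_part i" using b by (simp add: even_part_def)
      then show ?thesis using tensor_lift_Phi[OF a(2) b(1)] ptensor_supported[OF a(2) b(1)] unfolding ra by blast
    qed
    then obtain p where p: "p \<in> even_part i" "tensor_lift p \<cong>w r" "r \<in> supported (carrier SS \<times> carrier LL)" by blast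
    show ?case
      by (rule bexI[of _ "pm_scale c p"]) (use p teq_scale[OF p(2)] in \<open>auto simp: subspD[OF subsp_supported] subspD[OF subsp_even_part] simp del: pm_scale_single\<close>)
  qed
  then obtain p where p: "p \<in> even_part i" "tensor_lift p \<cong>w t" "t \<in> supported (carrier SS \<times> carrier LL)" by blast
  then have "z = fock_map p" using t W.q_eq[OF tensor_lift_supported p(3), of p] by (simp add: fock_map_def teq_def)
  then show "z \<in> fock_map ` even_part i" using p by simp
next
  let ?R = "{Poly_Mapping.single (x, y) (1::complex) | x y. x \<in> carrier SS \<and> y \<in> Lambda_part (loop_scale sc) loop_deg i}"
  fix z assume "z \<in> fock_map ` even_part i"
  then obtain p where p: "p \<in> even_part i" "z = fock_map p" by blast
  have par: "wpar (letters w) = i" if "w \<in> Poly_Mapping.keys p" for w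
  proof -
    have "Poly_Mapping.lookup (sig True p) w = ksign (wpar (letters w)) * Poly_Mapping.lookup p w"
    proof -
      have "Poly_Mapping.lookup (sig True p) w = (\<Sum>k\<in>Poly_Mapping.keys p. if k = w then ksign (wpar (letters w)) * Poly_Mapping.lookup p w else 0)"
        unfolding sig_def lookup_pm_lin by (rule sum.cong) (auto simp: lookup_single when_def)
      then show ?thesis by (auto simp: in_keys_iff)
    qed
    then have "ksign (wpar (letters w)) = ksign i"
      using p(1) that by (simp add: even_part_def in_keys_iff)
    then show ?thesis by (auto simp: ksign_def split: if_splits)
  qed
  have "(\<Sum>w\<in>Poly_Mapping.keys p. pm_scale (Poly_Mapping.lookup p w) (ptensor (ew False (letters w)) (ew True (letters w)))) \<in> lhull (ker_tensor SS LL \<union> ?R)"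
  proof (rule subsp_sum[OF subsp_lhull])
    fix w assume w: "w \<in> Poly_Mapping.keys p"
    have "ew True (letters w) \<in> {Uword us | us. set us \<subseteq> U \<and> odd (length us) = i}"
      using par[OF w] wpar_ew[of "letters w"] el_U unfolding ew_def by (intro CollectI exI[of _ "map el (fw True (letters w))"]) auto
    then have "piL (ew True (letters w)) \<in> Lambda_part (loop_scale sc) loop_deg i"
      unfolding Lambda_part_eq by (intro imageI lhull_base) simp
    moreover have "piS (ew False (letters w)) \<in> carrier SS" using ew_WU by (auto simp: S.carrier)
    ultimately have "ptensor (ew False (letters w)) (ew True (letters w)) \<in> ?R" unfolding ptensor_def by blast
    then show "pm_scale (Poly_Mapping.lookup p w) (ptensor (ew False (letters w)) (ew True (letters w))) \<in> lhull (ker_tensor SS LL \<union> ?R)"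
      by (intro lhull.gen) simp
  qed
  then show "z \<in> part WW i"
    unfolding W_part_eq p(2) fock_map_def tensor_lift_def pm_lin_def by (rule imageI)
qed

end

section \<open>The bracket relations\<close>

lemma span_zero_map:
  assumes "X \<in> ov.span A"
    and "\<And>X Y. X \<in> ov.span A \<Longrightarrow> Y \<in> ov.span A \<Longrightarrow> f X = 0 \<Longrightarrow> f Y = 0 \<Longrightarrow> f (X + Y) = 0"
    and "\<And>c X. X \<in> ov.span A \<Longrightarrow> f X = 0 \<Longrightarrow> f (sop_scale c X) = 0"
    and "\<And>X. X \<in> A \<Longrightarrow> f X = 0" "f 0 = 0"
  shows "f X = 0"
proof -
  have "X \<in> ov.span A \<and> f X = 0"
    using assms(1)
  proof (induction rule: ov.span_induct_alt)
    case (step c x y)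
    have x: "x \<in> ov.span A" using step(1) by (rule ov.span_base)
    have cx: "sop_scale c x \<in> ov.span A" using x by (rule ov.span_scale)
    have y: "y \<in> ov.span A" "f y = 0" using step(2) by simp_all
    show ?case
      by (rule conjI[OF ov.span_add[OF cx y(1)] assms(2)[OF cx y(1) assms(3)[OF x assms(4)[OF step(1)]] y(2)]])
  qed (rule conjI[OF ov.span_zero assms(5)])
  then show ?thesis by simp
qed

lemma gbasis_cases:
  assumes "x \<in> gbasis \<alpha> i"
  obtains b where "x = S2'_basis \<alpha> b" "gpar (fst b) = i"
  using assms unfolding gbasis_def by blast

lemma span_W2: "X \<in> gspan \<alpha> i \<Longrightarrow> X \<in> W2 i"
  unfolding S2'_part_span[symmetric] S2'_part_iff sdiv_def S2_def by simp

lemma span_bracket: "X \<in> gspan \<alpha> i \<Longrightarrow> Y \<in> gspan \<alpha> j \<Longrightarrow>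
    sbracket X Y \<in> gspan \<alpha> (i \<noteq> j)"
  unfolding S2'_part_span[symmetric] S2'_part_iff by (rule sdiv_bracket) (simp_all add: sdiv_def)

abbreviation sop_part :: "bool \<Rightarrow> sop \<Rightarrow> sop" where
  "sop_part \<equiv> op_part sscale sparity"

lemma sop_part_add: "sop_part i (X + Y) = sop_part i X + sop_part i Y"
  by (rule ext) (simp add: op_part_def sparity_add sv.scale_right_distrib)

lemma sop_part_scale: "sop_part i (sop_scale c X) = sop_scale c (sop_part i X)"
  by (rule ext) (simp add: op_part_def op_scale_def sparity_scale sv.scale_right_distrib mult.commute mult.left_commute)

lemma sbracket_sum:
  "sbracket X Y = (\<lambda>a. \<Sum>i\<in>UNIV. \<Sum>j\<in>UNIV. sop_part i X (sop_part j Y a) - sscale (ksign (i \<and> j)) (sop_part j Y (sop_part i X a)))"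
  by (simp add: supercommutator_def)

lemma W2_sb_add_right:
  assumes "X \<in> W2 i"
  shows "sbracket X (Y + Y') = sbracket X Y + sbracket X Y'"
proof (rule ext)
  fix a
  have X: "sop_part j X = (if i = j then X else 0)" for j by (rule W2_op_part[OF assms])
  show "sbracket X (Y + Y') a = (sbracket X Y + sbracket X Y') a"
    unfolding sbracket_sum sop_part_add X
    by (cases i) (simp_all add: W2_add[OF assms] UNIV_bool sv.scale_right_distrib)
qed

lemma W2_sb_scale_right:
  assumes "X \<in> W2 i"
  shows "sbracket X (sop_scale c Y) = sop_scale c (sbracket X Y)"
proof (rule ext)
  fix a
  have e: "sop_part i (sop_scale c Y) b = sscale c (sop_part i Y b)" for i b
    by (simp only: sop_part_scale) (simp only: op_scale_def)
  have X: "sop_part j X = (if i = j then X else 0)" for j by (rule W2_op_part[OF assms])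
  show "sbracket X (sop_scale c Y) a = sop_scale c (sbracket X Y) a"
    unfolding sbracket_sum e X unfolding op_scale_def sbracket_sum X
    by (cases i) (simp_all add: W2_scale[OF assms] UNIV_bool sv.scale_right_distrib sv.scale_right_diff_distrib mult.commute)
qed

lemma sbracket_add_left: "X \<in> W2 i \<Longrightarrow> X' \<in> W2 i \<Longrightarrow> Y \<in> W2 j \<Longrightarrow> sbracket (X + X') Y = sbracket X Y + sbracket X' Y"
  by (rule ext) (simp add: sbracket_W2[of _ i _ j] W2_subspace_add W2_add[of Y j] sv.scale_right_distrib)

lemma sbracket_scale_left: "X \<in> W2 i \<Longrightarrow> Y \<in> W2 j \<Longrightarrow> sbracket (sop_scale c X) Y = sop_scale c (sbracket X Y)"
proof (rule ext)
  fix a assume X: "X \<in> W2 i" and Y: "Y \<in> W2 j"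
  show "sbracket (sop_scale c X) Y a = sop_scale c (sbracket X Y) a"
    unfolding sbracket_W2[OF W2_subspace_scale[OF X] Y] unfolding op_scale_def sbracket_W2[OF X Y] W2_scale[OF Y]
    by (simp add: sv.scale_right_diff_distrib mult.commute)
qed

lemma energy_add: "energy \<alpha> (X + Y) = energy \<alpha> X + energy \<alpha> Y"
  by (simp only: energy_def gcoef_add distrib_left)

lemma energy_scale: "energy \<alpha> (sop_scale c X) = c * energy \<alpha> X"
  by (simp add: energy_def gcoef_scale)

lemma gcoef_zero: "gcoef b 0 = 0"
  using gcoef_scale[of b 0 0] by simp

lemma coc_zero: "coc \<alpha> 0 Y = 0" "coc \<alpha> Y 0 = 0"
  using coc_scale_left[of \<alpha> 0 0 Y] coc_scale_right[of \<alpha> Y 0 0] by simp_all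

lemma energy_zero: "energy \<alpha> 0 = 0"
  by (simp add: energy_def gcoef_zero)

lemma energy_odd:
  assumes "X \<in> gspan \<alpha> True"
  shows "energy \<alpha> X = 0"
proof (rule span_zero_map[OF assms])
  fix X assume "X \<in> gbasis \<alpha> True"
  then obtain b where "X = S2'_basis \<alpha> b" "gpar (fst b)" by (rule gbasis_cases) simp
  then show "energy \<alpha> X = 0" by (auto simp: energy_def gcoef_basis simp del: S2'_basis.simps)
qed (simp_all only: energy_add energy_scale energy_zero mult_zero_right add_0)

text \<open>The derivation \<open>calH\<close> written with the coordinates \<open>crd\<close>: it
  agrees with \<open>calH\<close> on the carrier and is linear on all operators.\<close>

definition Hop :: "complex \<Rightarrow> sop \<Rightarrow> sop" where
  "Hop \<alpha> X = (\<Sum>g\<in>UNIV. sop_scale (calH_weight g) (field \<alpha> g (crd g X)))"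

lemma Hop_add: "Hop \<alpha> (X + Y) = Hop \<alpha> X + Hop \<alpha> Y"
  unfolding Hop_def sum.distrib[symmetric] by (rule sum.cong) (simp_all only: crd_add field_add ov.scale_right_distrib)

lemma Hop_scale: "Hop \<alpha> (sop_scale c X) = sop_scale c (Hop \<alpha> X)"
  unfolding Hop_def ov.scale_sum_right by (rule sum.cong) (simp_all only: crd_scale field_scale ov.scale_scale mult.commute)

lemma Hop_zero: "Hop \<alpha> 0 = 0"
  using Hop_scale[of \<alpha> 0 0] by simp

lemma Hop_basis: "Hop \<alpha> (S2'_basis \<alpha> b) = sop_scale (calH_weight (fst b)) (S2'_basis \<alpha> b)"
proof (cases b)
  case (Pair g n)
  have "Hop \<alpha> (S2'_basis \<alpha> (g, n)) = (\<Sum>g'\<in>UNIV. if g' = g then sop_scale (calH_weight g) (S2'_basis \<alpha> (g, n)) else 0)"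
    unfolding Hop_def basis_field crd_field by (rule sum.cong) (auto simp del: field.simps)
  moreover have "finite (UNIV :: gen set)" by (simp add: UNIV_gen)
  ultimately show ?thesis unfolding Pair by (simp del: S2'_basis.simps)
qed

lemma Hop_span: "X \<in> gspan \<alpha> i \<Longrightarrow> Hop \<alpha> X \<in> gspan \<alpha> i"
proof (induction rule: ov.span_induct_alt)
  case base
  show ?case unfolding Hop_zero by (rule ov.span_zero)
next
  case (step c x y)
  from step(1) obtain b where b: "x = S2'_basis \<alpha> b" by (rule gbasis_cases)
  show ?case
    unfolding Hop_add Hop_scale b Hop_basis
    by (intro ov.span_add ov.span_scale) (use step b ov.span_base in \<open>simp_all del: S2'_basis.simps\<close>)
qed

lemma gcoef_Hop:
  assumes "X \<in> ov.span (range (S2'_basis \<alpha>))"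
  shows "gcoef b (Hop \<alpha> X) = calH_weight (fst b) * gcoef b X"
proof -
  have "gcoef b (Hop \<alpha> X) - calH_weight (fst b) * gcoef b X = 0"
  proof (rule span_zero_map[OF assms])
    fix X assume "X \<in> range (S2'_basis \<alpha>)"
    then show "gcoef b (Hop \<alpha> X) - calH_weight (fst b) * gcoef b X = 0"
      by (auto simp: Hop_basis gcoef_scale gcoef_basis simp del: S2'_basis.simps)
  next
    show "gcoef b (Hop \<alpha> 0) - calH_weight (fst b) * gcoef b 0 = 0"
      unfolding Hop_zero gcoef_zero by simp
  qed (simp_all only: Hop_add Hop_scale gcoef_add gcoef_scale right_minus_eq distrib_left mult.left_commute)
  then show ?thesis by simp
qed

lemma span_carrier: "X \<in> gspan \<alpha> i \<Longrightarrow> X \<in> ov.span (range (S2'_basis \<alpha>))"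
  unfolding gbasis_def using ov.span_mono[of "S2'_basis \<alpha> ` {b. gpar (fst b) = i}" "range (S2'_basis \<alpha>)"] by blast

lemma energy_Hop: "X \<in> gspan \<alpha> i \<Longrightarrow> energy \<alpha> (Hop \<alpha> X) = 0"
  by (simp add: energy_def gcoef_Hop[OF span_carrier])

section \<open>The derivation \<open>calH\<close> as an operator on letters\<close>

fun mono_weight :: "mono \<Rightarrow> complex" where
  "mono_weight mOne = 1" | "mono_weight mTh12 = -1" | "mono_weight _ = 0"

text \<open>The weight is 1 minus the degree in the odd variables. The shift by 1 gives dual
  monomials opposite weights, which is what preserving the form means for a diagonal
  operator.\<close>

definition hmat :: "'v index \<Rightarrow> ('v index \<Rightarrow>\<^sub>0 complex)" where
  "hmat = (\<lambda>(s, m, v). Poly_Mapping.single (s, m, v) (mono_weight s))"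

lemma ext_simps: "ext A (p + q) = ext A p + ext A q" "ext A (p - q) = ext A p - ext A q"
  "ext A (pm_scale c p) = pm_scale c (ext A p)" "ext A 0 = 0" "ext A (Poly_Mapping.single k c) = pm_scale c (A k)"
  by (simp_all add: ext_def pm_lin_add pm_lin_diff pm_lin_scale)

lemma ext_fun_add: "ext (\<lambda>l. A l + A' l) p = ext A p + ext A' p"
  by (simp add: ext_def pm_lin_fun_add)

lemma ext_fun_scale: "ext (\<lambda>l. pm_scale c (A l)) p = pm_scale c (ext A p)"
  by (simp add: ext_def pm_lin_fun_scale)

lemma gcf_weight: "mono_weight (gtgt g s) * gcf \<alpha> g n s m = (calH_weight g + mono_weight s) * gcf \<alpha> g n s m"
  by (cases g; cases s) auto

lemma tmat_zero: "tmat \<alpha> 0 = (\<lambda>l. 0)"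
  using tmat_scale[of \<alpha> 0 0] by simp

text \<open>Wherever its coefficient is nonzero, a basis field changes the weight of a monomial by
  its own \<open>calH_weight\<close>.\<close>

lemma hmat_bracket:
  assumes "X \<in> gspan \<alpha> i"
  shows "ext hmat (tmat \<alpha> X l) - ext (tmat \<alpha> X) (hmat l) = tmat \<alpha> (Hop \<alpha> X) l"
proof -
  have "ext hmat (tmat \<alpha> X l) - ext (tmat \<alpha> X) (hmat l) - tmat \<alpha> (Hop \<alpha> X) l = 0"
  proof (rule span_zero_map[OF assms])
    fix X assume "X \<in> gbasis \<alpha> i"
    then obtain b where "X = S2'_basis \<alpha> b" by (rule gbasis_cases)
    moreover obtain g n where "b = (g, n)" by (cases b)
    moreover obtain s m v where "l = (s, m, v)" by (cases l)
    moreover have "gcf \<alpha> g n s m * mono_weight (gtgt g s) - mono_weight s * gcf \<alpha> g n s m - calH_weight g * gcf \<alpha> g n s m = 0" for n m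
      using gcf_weight[of g s \<alpha> n m] by (simp add: algebra_simps)
    ultimately show "ext hmat (tmat \<alpha> X l) - ext (tmat \<alpha> X) (hmat l) - tmat \<alpha> (Hop \<alpha> X) l = 0"
      by (simp add: Hop_basis tmat_scale tmat_basis hmat_def ext_simps del: S2'_basis.simps flip: single_diff)
  next
    fix X Y
    show "ext hmat (tmat \<alpha> X l) - ext (tmat \<alpha> X) (hmat l) - tmat \<alpha> (Hop \<alpha> X) l = 0 \<Longrightarrow>
      ext hmat (tmat \<alpha> Y l) - ext (tmat \<alpha> Y) (hmat l) - tmat \<alpha> (Hop \<alpha> Y) l = 0 \<Longrightarrow>
      ext hmat (tmat \<alpha> (X + Y) l) - ext (tmat \<alpha> (X + Y)) (hmat l) - tmat \<alpha> (Hop \<alpha> (X + Y)) l = 0"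
      by (simp add: tmat_add ext_simps ext_fun_add Hop_add algebra_simps)
  next
    fix c X
    show "ext hmat (tmat \<alpha> X l) - ext (tmat \<alpha> X) (hmat l) - tmat \<alpha> (Hop \<alpha> X) l = 0 \<Longrightarrow>
      ext hmat (tmat \<alpha> (sop_scale c X) l) - ext (tmat \<alpha> (sop_scale c X)) (hmat l) - tmat \<alpha> (Hop \<alpha> (sop_scale c X)) l = 0"
      by (simp add: tmat_scale ext_simps ext_fun_scale Hop_scale flip: pm.scale_right_diff_distrib)
  next
    show "ext hmat (tmat \<alpha> 0 l) - ext (tmat \<alpha> 0) (hmat l) - tmat \<alpha> (Hop \<alpha> 0) l = 0"
      unfolding Hop_zero tmat_zero by (simp add: ext_def pm_lin_def)
  qed
  then show ?thesis by simp
qed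

context fock begin

lemma supp_hmat: "supp hmat = {}"
proof -
  have "cre (hmat l) = 0" if "iann l" for l
    using that by (cases l) (auto intro!: poly_mapping_eqI simp: hmat_def lookup_single when_def)
  then show ?thesis by (auto simp: supp_def)
qed

lemma osp_hmat: "osp False hmat"
  unfolding osp_def hmap_def
proof (intro conjI allI ballI impI)
  fix l :: "'v index"
  obtain s m v where l: "l = (s, m, v)" by (cases l)
  show "hom (False \<noteq> ipar l) (hmat l)" by (simp add: l hmat_def hom_def)
  show "ilive B k = ilive B l" if "k \<in> Poly_Mapping.keys (hmat l)" for k
    using that by (auto simp: l hmat_def split: if_splits)
  fix l' :: "'v index"
  obtain s' m' v' where l': "l' = (s', m', v')" by (cases l')
  show "pairing (hmat l) l' = ksign (ipar l \<and> ipar l') * pairing (hmat l') l"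
    unfolding l l' hmat_def prod.case pairing_single
    by (cases s; cases s') (auto simp: ksign_def)
qed (simp add: supp_hmat)

text \<open>A diagonal operator never links an annihilator with a creator, so both supertraces
  vanish and adding \<open>hmat\<close> does not alter the anomaly.\<close>

lemma tr_hmat: "tr A hmat = 0" "tr hmat A = 0"
proof -
  show "tr A hmat = 0" by (simp add: tr_def supp_hmat)
  have *: "Poly_Mapping.lookup (ext hmat p) l = 0" if "Poly_Mapping.lookup p l = 0" for p and l :: "'v index"
  proof -
    have "Poly_Mapping.lookup (ext hmat p) l = (\<Sum>k\<in>Poly_Mapping.keys p. if k = l then Poly_Mapping.lookup p l * Poly_Mapping.lookup (hmat l) l else 0)"
      unfolding ext_def lookup_pm_lin by (rule sum.cong) (auto simp: hmat_def lookup_single when_def split: prod.splits)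
    then show ?thesis using that by simp
  qed
  show "tr hmat A = 0"
    unfolding tr_def by (rule sum.neutral) (auto simp: supp_def intro!: *)
qed

definition amat :: "complex \<Rightarrow> sop \<Rightarrow> complex \<Rightarrow> 'v index \<Rightarrow> ('v index \<Rightarrow>\<^sub>0 complex)" where
  "amat \<alpha> X h = (\<lambda>l. tmat \<alpha> X l + pm_scale h (hmat l))"

lemma amat_zero: "amat \<alpha> X 0 = tmat \<alpha> X"
  by (simp add: amat_def)

lemma osp_amat:
  assumes "X \<in> gspan \<alpha> i" "i \<Longrightarrow> h = 0"
  shows "osp i (amat \<alpha> X h)"
proof (cases i)
  case True
  then show ?thesis using assms osp_tmat[OF assms(1)] by (simp add: amat_zero)
next
  case False
  then show ?thesis
    using osp_add[OF osp_tmat[OF assms(1)] osp_scale[of i hmat h]] osp_hmat unfolding amat_def by simp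
qed

lemma tr_amat:
  assumes "Y \<in> gspan \<alpha> j" "j \<Longrightarrow> h' = 0"
  shows "tr (amat \<alpha> X h) (amat \<alpha> Y h') = tr (tmat \<alpha> X) (tmat \<alpha> Y)"
proof -
  have "tr A (amat \<alpha> Y h') = tr A (tmat \<alpha> Y)" for A
  proof (cases j)
    case True
    then show ?thesis using assms by (simp add: amat_zero)
  next
    case False
    then have "osp j hmat" using osp_hmat by simp
    from tr_add_right[OF osp_tmat[OF assms(1)] osp_scale[OF this], of A h'] show ?thesis
      unfolding amat_def tr_scale_right[OF \<open>osp j hmat\<close>] tr_hmat by simp
  qed
  moreover have "tr (amat \<alpha> X h) A = tr (tmat \<alpha> X) A" for A
    unfolding amat_def tr_add_left tr_scale_left tr_hmat by simp
  ultimately show ?thesis by simp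
qed

lemma anomaly_tmat:
  assumes X: "X \<in> gspan \<alpha> i" and Y: "Y \<in> gspan \<alpha> j"
  shows "anomaly i j (tmat \<alpha> X) (tmat \<alpha> Y) = of_nat (card B) * (3 * coc \<alpha> X Y + energy \<alpha> (sbracket X Y))"
proof -
  let ?f = "\<lambda>X Y. anomaly i j (tmat \<alpha> X) (tmat \<alpha> Y) - of_nat (card B) * (3 * coc \<alpha> X Y + energy \<alpha> (sbracket X Y))"
  have z: "osp k (tmat \<alpha> 0)" for k by (rule osp_tmat[OF ov.span_zero])
  have add1: "?f (X + X') Y = ?f X Y + ?f X' Y"
    if "X \<in> gspan \<alpha> i" "X' \<in> gspan \<alpha> i" "Y \<in> gspan \<alpha> j" for X X' Y
    unfolding tmat_add anomaly_add_left[OF osp_tmat[OF that(1)] osp_tmat[OF that(2)]] coc_add_left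
      sbracket_add_left[OF span_W2[OF that(1)] span_W2[OF that(2)] span_W2[OF that(3)]] energy_add
    by (simp add: algebra_simps)
  have add2: "?f X (Y + Y') = ?f X Y + ?f X Y'"
    if "X \<in> gspan \<alpha> i" "Y' \<in> gspan \<alpha> j" "Y \<in> gspan \<alpha> j" for X Y Y'
    unfolding tmat_add anomaly_add_right[OF osp_tmat[OF that(3)] osp_tmat[OF that(2)]] coc_add_right
      W2_sb_add_right[OF span_W2[OF that(1)]] energy_add
    by (simp add: algebra_simps)
  have sc1: "?f (sop_scale c X) Y = c * ?f X Y"
    if "X \<in> gspan \<alpha> i" "Y \<in> gspan \<alpha> j" for c X Y
    unfolding tmat_scale anomaly_scale_left[OF osp_tmat[OF that(1)]] coc_scale_left
      sbracket_scale_left[OF span_W2[OF that(1)] span_W2[OF that(2)]] energy_scale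
    by (simp add: algebra_simps)
  have sc2: "?f X (sop_scale c Y) = c * ?f X Y"
    if "X \<in> gspan \<alpha> i" "Y \<in> gspan \<alpha> j" for c X Y
    unfolding tmat_scale anomaly_scale_right[OF osp_tmat[OF that(2)]] coc_scale_right
      W2_sb_scale_right[OF span_W2[OF that(1)]] energy_scale
    by (simp add: algebra_simps)
  have 0: "?f 0 Y = 0" if "Y \<in> gspan \<alpha> j" for Y
    using sc1[OF ov.span_zero that, of 0] by simp
  have z0: "?f X 0 = 0" if "X \<in> gspan \<alpha> i" for X
    using sc2[OF that ov.span_zero, of 0] by simp
  have "?f X Y = 0"
  proof (rule span_zero_map[OF X, of "\<lambda>X. ?f X Y"])
    fix X assume Xb: "X \<in> gbasis \<alpha> i"
    then obtain a where a: "X = S2'_basis \<alpha> a" "gpar (fst a) = i" by (rule gbasis_cases)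
    have X: "X \<in> gspan \<alpha> i" using Xb by (rule ov.span_base)
    show "?f X Y = 0"
    proof (rule span_zero_map[OF Y, of "\<lambda>Y. ?f X Y"])
      fix Y assume "Y \<in> gbasis \<alpha> j"
      then obtain b where b: "Y = S2'_basis \<alpha> b" "gpar (fst b) = j" by (rule gbasis_cases)
      have "of_nat (card B) * (- (basis_trace \<alpha> a b - ksign (i \<and> j) * basis_trace \<alpha> b a) / 2)
          = of_nat (card B) * (3 * cocycle_basis \<alpha> a b + energy \<alpha> (sbracket X Y))"
        using basis_trace_cocycle[of \<alpha> a b] unfolding a b by simp
      then show "?f X Y = 0"
        unfolding anomaly_def a(1) b(1) tr_basis coc_basis by (simp add: algebra_simps del: S2'_basis.simps)
    qed (use X z0 in \<open>simp_all only: add2 sc2 mult_zero_right add_0\<close>)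
  qed (use Y 0 in \<open>simp_all only: add1 sc1 mult_zero_right add_0\<close>)
  then show ?thesis by simp
qed

lemma amat_bracket:
  assumes X: "X \<in> gspan \<alpha> i" "i \<Longrightarrow> h = 0" and Y: "Y \<in> gspan \<alpha> j" "j \<Longrightarrow> h' = 0"
  shows "amat \<alpha> (sbracket X Y + sop_scale h (Hop \<alpha> Y) + sop_scale (- h') (Hop \<alpha> X)) 0 l =
     ext (amat \<alpha> X h) (amat \<alpha> Y h' l) - pm_scale (ksign (i \<and> j)) (ext (amat \<alpha> Y h') (amat \<alpha> X h l))"
proof -
  have hh: "ext hmat (hmat l) = pm_scale (mono_weight (fst l)) (hmat l)"
    by (cases l) (simp add: hmat_def ext_simps)
  have s: "pm_scale (ksign (i \<and> j)) (pm_scale h v) = pm_scale h v" "pm_scale (ksign (i \<and> j)) (pm_scale h' v) = pm_scale h' v" for v :: "'v index \<Rightarrow>\<^sub>0 complex"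
    using X(2) Y(2) by (auto simp: ksign_def)
  show ?thesis
    unfolding amat_zero tmat_add tmat_scale tmat_bracket[OF span_W2[OF X(1)] span_W2[OF Y(1)]]
      hmat_bracket[OF X(1), symmetric] hmat_bracket[OF Y(1), symmetric]
    unfolding amat_def ext_simps ext_fun_add ext_fun_scale pm.scale_right_distrib s pm.scale_right_diff_distrib
    by (simp add: mult.commute)
qed

text \<open>The operator for \<open>X + h calH + a C\<close>. The multiple of \<open>energy\<close>
  absorbs the coboundary left by the supertraces, and the scalar 3 per element of \<open>B\<close>
  is the central charge.\<close>

definition hact :: "complex \<Rightarrow> bool \<Rightarrow> sop \<Rightarrow> complex \<Rightarrow> complex \<Rightarrow> 'v index free \<Rightarrow> 'v index free" where
  "hact \<alpha> i X h a p = rho i (amat \<alpha> X h) p + pm_scale (of_nat (card B) * (energy \<alpha> X + 3 * a)) p"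

text \<open>Scalars drop out of the supercommutator, so the left side contributes only the anomaly,
  \<open>card B\<close> times \<open>3 * coc \<alpha> X Y + energy \<alpha> (sbracket X Y)\<close>.
  These are the scalars of the operator on the right, as \<open>Hop\<close> has no component along
  \<open>L_0\<close>.\<close>

theorem hact_bracket:
  assumes X: "X \<in> gspan \<alpha> i" "i \<Longrightarrow> h = 0 \<and> a = 0" and Y: "Y \<in> gspan \<alpha> j" "j \<Longrightarrow> h' = 0 \<and> a' = 0"
  shows "eqv (hact \<alpha> i X h a (hact \<alpha> j Y h' a' p) - pm_scale (ksign (i \<and> j)) (hact \<alpha> j Y h' a' (hact \<alpha> i X h a p)))
    (hact \<alpha> (i \<noteq> j) (sbracket X Y + sop_scale h (Hop \<alpha> Y) + sop_scale (- h') (Hop \<alpha> X)) 0 (coc \<alpha> X Y) p)"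
proof -
  let ?Z = "sbracket X Y + sop_scale h (Hop \<alpha> Y) + sop_scale (- h') (Hop \<alpha> X)"
  let ?x = "of_nat (card B) * (energy \<alpha> X + 3 * a)" and ?y = "of_nat (card B) * (energy \<alpha> Y + 3 * a')"
  have sY: "sop_scale h (Hop \<alpha> Y) \<in> gspan \<alpha> (i \<noteq> j)"
  proof (cases i)
    case True
    then show ?thesis using X(2) ov.span_zero by simp
  next
    case False
    then show ?thesis using ov.span_scale[OF Hop_span[OF Y(1)]] by simp
  qed
  have sX: "sop_scale (- h') (Hop \<alpha> X) \<in> gspan \<alpha> (i \<noteq> j)"
  proof (cases j)
    case True
    then show ?thesis using Y(2) ov.span_zero by simp
  next
    case False
    then show ?thesis using ov.span_scale[OF Hop_span[OF X(1)], of "- h'"] by (simp del: ov.scale_minus_left)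
  qed
  have Z: "?Z \<in> gspan \<alpha> (i \<noteq> j)"
    by (intro ov.span_add span_bracket X Y sY sX)
  have oX: "osp i (amat \<alpha> X h)" and oY: "osp j (amat \<alpha> Y h')" and oZ: "osp (i \<noteq> j) (amat \<alpha> ?Z 0)"
    using X Y Z by (auto intro!: osp_amat)
  have an: "anomaly i j (amat \<alpha> X h) (amat \<alpha> Y h') = of_nat (card B) * (3 * coc \<alpha> X Y + energy \<alpha> (sbracket X Y))"
    unfolding anomaly_tmat[OF X(1) Y(1), symmetric] anomaly_def
    using X Y by (subst tr_amat[of Y \<alpha> j], simp, simp, subst tr_amat[of X \<alpha> i], simp_all)
  have eZ: "energy \<alpha> ?Z = energy \<alpha> (sbracket X Y)"
    unfolding energy_add energy_scale energy_Hop[OF X(1)] energy_Hop[OF Y(1)] by simp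
  have xy: "pm_scale (ksign (i \<and> j)) (pm_scale ?x v) = pm_scale ?x v" "pm_scale (ksign (i \<and> j)) (pm_scale ?y v) = pm_scale ?y v" for v
    using X Y energy_odd by (auto simp: ksign_def)
  have "eqv (rho i (amat \<alpha> X h) (rho j (amat \<alpha> Y h') p) - pm_scale (ksign (i \<and> j)) (rho j (amat \<alpha> Y h') (rho i (amat \<alpha> X h) p))
      - rho (i \<noteq> j) (amat \<alpha> ?Z 0) p) (pm_scale (of_nat (card B) * (3 * coc \<alpha> X Y + energy \<alpha> (sbracket X Y))) p)"
    unfolding an[symmetric]
    by (rule rho_bracket[OF oX oY oZ]) (rule amat_bracket; use X Y in auto)
  moreover have "hact \<alpha> i X h a (hact \<alpha> j Y h' a' p) - pm_scale (ksign (i \<and> j)) (hact \<alpha> j Y h' a' (hact \<alpha> i X h a p))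
     - hact \<alpha> (i \<noteq> j) ?Z 0 (coc \<alpha> X Y) p =
    (rho i (amat \<alpha> X h) (rho j (amat \<alpha> Y h') p) - pm_scale (ksign (i \<and> j)) (rho j (amat \<alpha> Y h') (rho i (amat \<alpha> X h) p))
      - rho (i \<noteq> j) (amat \<alpha> ?Z 0) p) - pm_scale (of_nat (card B) * (3 * coc \<alpha> X Y + energy \<alpha> (sbracket X Y))) p"
    unfolding hact_def eZ rho_simps pm.scale_right_distrib xy
    by (simp add: algebra_simps pm.scale_left_commute)
  ultimately show ?thesis
    unfolding eqv_def by simp
qed

end

lemma sop_part_span: "X \<in> gspan \<alpha> i \<Longrightarrow> sop_part j X = (if i = j then X else 0)"
  by (rule W2_op_part[OF span_W2])

lemma carrier_S2'_cases:
  assumes "X \<in> carrier (S2' \<alpha>)"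
  obtains X0 X1 where "X = X0 + X1" "X0 \<in> gspan \<alpha> False" "X1 \<in> gspan \<alpha> True"
  using assms unfolding S2'_def lie_superalgebra_of_def S2'_part_span by auto

lemma sop_part_carrier:
  assumes "X \<in> carrier (S2' \<alpha>)"
  shows "sop_part i X \<in> gspan \<alpha> i"
proof -
  obtain X0 X1 where X: "X = X0 + X1" "X0 \<in> gspan \<alpha> False" "X1 \<in> gspan \<alpha> True"
    using carrier_S2'_cases[OF assms] .
  show ?thesis
    unfolding X(1) sop_part_add sop_part_span[OF X(2)] sop_part_span[OF X(3)]
    using X ov.span_zero by (cases i) simp_all
qed

lemma span_in_carrier: "X \<in> gspan \<alpha> i \<Longrightarrow> X \<in> carrier (S2' \<alpha>)"
  unfolding carrier_S2' by (rule span_carrier)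

lemma coc_parity:
  assumes X: "X \<in> gspan \<alpha> i" and Y: "Y \<in> gspan \<alpha> j" and "i \<noteq> j"
  shows "coc \<alpha> X Y = 0"
proof (rule span_zero_map[OF X, of "\<lambda>X. coc \<alpha> X Y"])
  fix X assume "X \<in> gbasis \<alpha> i"
  then obtain a where a: "X = S2'_basis \<alpha> a" "gpar (fst a) = i" by (rule gbasis_cases)
  show "coc \<alpha> X Y = 0"
  proof (rule span_zero_map[OF Y, of "\<lambda>Y. coc \<alpha> X Y"])
    fix Y assume "Y \<in> gbasis \<alpha> j"
    then obtain b where b: "Y = S2'_basis \<alpha> b" "gpar (fst b) = j" by (rule gbasis_cases)
    obtain g n g' k where "a = (g, n)" "b = (g', k)" by (cases a; cases b)
    then show "coc \<alpha> X Y = 0"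
      unfolding a(1) b(1) coc_basis using a b \<open>i \<noteq> j\<close> by (cases g; cases g') auto
  qed (simp_all only: coc_add_right coc_scale_right coc_zero mult_zero_right add_0)
qed (simp_all only: coc_add_left coc_scale_left coc_zero mult_zero_right add_0)

section \<open>Action of elements without definite parity\<close>

context fock begin

text \<open>\<open>calH\<close> and \<open>C\<close> are even, so their coefficients
  \<open>h\<close> and \<open>a\<close> go with the even component only.\<close>

definition act :: "complex \<Rightarrow> sop \<Rightarrow> complex \<Rightarrow> complex \<Rightarrow> 'v index free \<Rightarrow> 'v index free" where
  "act \<alpha> X h a p = hact \<alpha> False (sop_part False X) h a p + hact \<alpha> True (sop_part True X) 0 0 p"

lemma hact_zero: "hact \<alpha> i 0 0 0 p = 0"
proof -
  have "osp i (amat \<alpha> 0 0)" by (rule osp_amat[OF ov.span_zero]) simp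
  from rho_scale[OF this, of 0 p] have "rho i (\<lambda>l. 0) p = 0" by simp
  then show ?thesis unfolding hact_def amat_zero tmat_zero energy_zero by simp
qed

lemma hact_add:
  assumes "X \<in> gspan \<alpha> i" "i \<Longrightarrow> h = 0" "Y \<in> gspan \<alpha> i" "i \<Longrightarrow> h' = 0"
  shows "hact \<alpha> i (X + Y) (h + h') (a + a') p = hact \<alpha> i X h a p + hact \<alpha> i Y h' a' p"
proof -
  have e: "amat \<alpha> (X + Y) (h + h') = (\<lambda>l. amat \<alpha> X h l + amat \<alpha> Y h' l)"
    by (rule ext) (simp add: amat_def tmat_add pm.scale_left_distrib)
  have o: "osp i (amat \<alpha> X h)" "osp i (amat \<alpha> Y h')" using assms by (auto intro: osp_amat)
  show ?thesis
    unfolding hact_def e rho_add[OF o] energy_add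
    by (simp add: algebra_simps pm.scale_left_distrib)
qed

lemma hact_scale:
  assumes "X \<in> gspan \<alpha> i" "i \<Longrightarrow> h = 0"
  shows "hact \<alpha> i (sop_scale c X) (c * h) (c * a) p = pm_scale c (hact \<alpha> i X h a p)"
proof -
  have e: "amat \<alpha> (sop_scale c X) (c * h) = (\<lambda>l. pm_scale c (amat \<alpha> X h l))"
    by (rule ext) (simp add: amat_def tmat_scale pm.scale_right_distrib)
  have o: "osp i (amat \<alpha> X h)" using assms by (auto intro: osp_amat)
  show ?thesis
    unfolding hact_def e rho_scale[OF o] energy_scale
    by (simp add: pm.scale_right_distrib algebra_simps)
qed

lemma act_simps:
  "act \<alpha> X h a (p + q) = act \<alpha> X h a p + act \<alpha> X h a q"
  "act \<alpha> X h a (p - q) = act \<alpha> X h a p - act \<alpha> X h a q"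
  "act \<alpha> X h a (pm_scale c p) = pm_scale c (act \<alpha> X h a p)"
  by (simp_all add: act_def hact_def pm.scale_right_distrib pm.scale_right_diff_distrib mult.commute)

lemma hact_vac:
  assumes "X \<in> gspan \<alpha> i" "i \<Longrightarrow> h = 0" "p \<in> vac_ideal"
  shows "hact \<alpha> i X h a p \<in> vac_ideal"
  unfolding hact_def by (intro vac_ideal.add vac_scale rho_vac osp_amat assms)

lemma act_vac: "X \<in> carrier (S2' \<alpha>) \<Longrightarrow> p \<in> vac_ideal \<Longrightarrow> act \<alpha> X h a p \<in> vac_ideal"
  unfolding act_def by (intro vac_ideal.add hact_vac sop_part_carrier) simp_all

lemma act_hom:
  assumes "X \<in> gspan \<alpha> i" "i \<Longrightarrow> h = 0 \<and> a = 0"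
  shows "act \<alpha> X h a p = hact \<alpha> i X h a p"
  unfolding act_def sop_part_span[OF assms(1)]
  using assms(2) hact_zero by (cases i) simp_all

lemma act_add:
  assumes "X \<in> carrier (S2' \<alpha>)" "Y \<in> carrier (S2' \<alpha>)"
  shows "act \<alpha> (X + Y) (h + h') (a + a') p = act \<alpha> X h a p + act \<alpha> Y h' a' p"
  using hact_add[OF sop_part_carrier[OF assms(1)] _ sop_part_carrier[OF assms(2)], of False h h' a a' p]
    hact_add[OF sop_part_carrier[OF assms(1)] _ sop_part_carrier[OF assms(2)], of True 0 0 0 0 p]
  by (simp add: act_def sop_part_add)

lemma act_scale:
  assumes "X \<in> carrier (S2' \<alpha>)"
  shows "act \<alpha> (sop_scale c X) (c * h) (c * a) p = pm_scale c (act \<alpha> X h a p)"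
  using hact_scale[OF sop_part_carrier[OF assms], of False h c a p]
    hact_scale[OF sop_part_carrier[OF assms], of True 0 c 0 p]
  by (simp add: act_def sop_part_scale pm.scale_right_distrib)

lemma act_parity:
  assumes "X \<in> gspan \<alpha> i" "i \<Longrightarrow> h = 0 \<and> a = 0"
  shows "sig True (act \<alpha> X h a p) = pm_scale (ksign i) (act \<alpha> X h a (sig True p))"
proof -
  have "osp i (amat \<alpha> X h)" using assms by (auto intro: osp_amat)
  moreover have "pm_scale (ksign i) (pm_scale (of_nat (card B) * (energy \<alpha> X + 3 * a)) q) = pm_scale (of_nat (card B) * (energy \<alpha> X + 3 * a)) q" for q
    using assms energy_odd by (cases i) (simp_all add: ksign_def)
  moreover have "act \<alpha> X h a q = hact \<alpha> i X h a q" for q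
    by (rule act_hom) (use assms in auto)
  ultimately show ?thesis
    unfolding hact_def by (simp only: sig_rho pm.scale_right_distrib sig_simps) simp
qed

lemma act_bracket:
  assumes X: "X \<in> gspan \<alpha> i" "i \<Longrightarrow> h = 0 \<and> a = 0" and Y: "Y \<in> gspan \<alpha> j" "j \<Longrightarrow> h' = 0 \<and> a' = 0"
    and Z: "sbracket X Y + sop_scale h (Hop \<alpha> Y) + sop_scale (- h') (Hop \<alpha> X) \<in> gspan \<alpha> (i \<noteq> j)"
  shows "eqv (act \<alpha> X h a (act \<alpha> Y h' a' p) - pm_scale (ksign (i \<and> j)) (act \<alpha> Y h' a' (act \<alpha> X h a p)))
    (act \<alpha> (sbracket X Y + sop_scale h (Hop \<alpha> Y) + sop_scale (- h') (Hop \<alpha> X)) 0 (coc \<alpha> X Y) p)"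
proof -
  have c: "coc \<alpha> X Y = 0" if "i \<noteq> j"
    using coc_parity[OF X(1) Y(1) that] .
  show ?thesis
  proof -
    have e: "act \<alpha> X h a q = hact \<alpha> i X h a q" "act \<alpha> Y h' a' q = hact \<alpha> j Y h' a' q" for q
      by (rule act_hom; use X Y in auto)+
    have e': "act \<alpha> (sbracket X Y + sop_scale h (Hop \<alpha> Y) + sop_scale (- h') (Hop \<alpha> X)) 0 (coc \<alpha> X Y) p =
        hact \<alpha> (i \<noteq> j) (sbracket X Y + sop_scale h (Hop \<alpha> Y) + sop_scale (- h') (Hop \<alpha> X)) 0 (coc \<alpha> X Y) p"
      by (rule act_hom[OF Z]) (use c in auto)
    show ?thesis unfolding e e' by (rule hact_bracket) (use X Y in auto)
  qed
qed

end

section \<open>Transport of the action to the semi-infinite space\<close>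

context loop_fock begin

definition fock_rep :: "_ \<Rightarrow> 'v index free" where
  "fock_rep m = (SOME p. fock_map p = m)"

lemma fock_map_rep: "fock_map (fock_rep (fock_map p)) = fock_map p"
  unfolding fock_rep_def by (rule someI) (rule refl)

text \<open>The choice of a representative does not matter on the carrier, since the action
  preserves \<open>vac_ideal\<close>; this is \<open>wact_fock_map\<close>.\<close>

definition wact :: "complex \<Rightarrow> sop \<Rightarrow> complex \<Rightarrow> complex \<Rightarrow> _ \<Rightarrow> _" where
  "wact \<alpha> X h a m = fock_map (act \<alpha> X h a (fock_rep m))"

lemma wact_fock_map: "X \<in> carrier (S2' \<alpha>) \<Longrightarrow> wact \<alpha> X h a (fock_map p) = fock_map (act \<alpha> X h a p)"
  using act_vac[of X \<alpha> "fock_rep (fock_map p) - p" h a] fock_map_rep[of p] unfolding fock_map_eq_iff wact_def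
  by (simp add: act_simps)

text \<open>Serves both central extensions: \<open>K\<close>, \<open>h\<close> and \<open>a\<close>
  are the coordinates of an element along \<open>S2' \<alpha>\<close>, \<open>calH\<close> and
  \<open>C\<close>. The bracket assumption prescribes the bracket of \<open>S2' \<alpha>\<close>
  extended by \<open>calH\<close> and the cocycle.\<close>

theorem lie_super_module_lift:
  fixes K :: "'g \<Rightarrow> sop" and h a :: "'g \<Rightarrow> complex" and g :: "('g, 'm) lie_superalgebra_scheme"
  assumes K: "\<And>x. x \<in> carrier g \<Longrightarrow> K x \<in> carrier (S2' \<alpha>)"
    and add: "\<And>x y. x \<in> carrier g \<Longrightarrow> y \<in> carrier g \<Longrightarrow>
       K (x \<oplus>\<^bsub>g\<^esub> y) = K x + K y \<and> h (x \<oplus>\<^bsub>g\<^esub> y) = h x + h y \<and> a (x \<oplus>\<^bsub>g\<^esub> y) = a x + a y"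
    and scale: "\<And>x c. x \<in> carrier g \<Longrightarrow>
       K (c \<odot>\<^bsub>g\<^esub> x) = sop_scale c (K x) \<and> h (c \<odot>\<^bsub>g\<^esub> x) = c * h x \<and> a (c \<odot>\<^bsub>g\<^esub> x) = c * a x"
    and part: "\<And>x i. x \<in> part g i \<Longrightarrow> K x \<in> S2'_part \<alpha> i \<and> (i \<longrightarrow> h x = 0 \<and> a x = 0)"
    and bracket: "\<And>x y i j. x \<in> part g i \<Longrightarrow> y \<in> part g j \<Longrightarrow>
       K (lie_bracket g x y) = sbracket (K x) (K y) + sop_scale (h x) (Hop \<alpha> (K y)) + sop_scale (- h y) (Hop \<alpha> (K x))
       \<and> h (lie_bracket g x y) = 0 \<and> a (lie_bracket g x y) = coc \<alpha> (K x) (K y)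
       \<and> K (lie_bracket g x y) \<in> S2'_part \<alpha> (i \<noteq> j)"
  shows "lie_super_module g WW (\<lambda>x. wact \<alpha> (K x) (h x) (a x))"
  unfolding lie_super_module_def
proof (intro conjI ballI allI)
  fix x m assume x: "x \<in> carrier g" and "m \<in> carrier WW"
  then obtain p where p: "m = fock_map p" unfolding fock_map_carrier by blast
  show "wact \<alpha> (K x) (h x) (a x) m \<in> carrier WW"
    unfolding p wact_fock_map[OF K[OF x]] fock_map_carrier by (rule rangeI)
  show "wact \<alpha> (K x) (h x) (a x) (c \<odot>\<^bsub>WW\<^esub> m) = c \<odot>\<^bsub>WW\<^esub> wact \<alpha> (K x) (h x) (a x) m" for c
    unfolding p fock_map_scale[symmetric] wact_fock_map[OF K[OF x]] act_simps ..
  show "wact \<alpha> (K (c \<odot>\<^bsub>g\<^esub> x)) (h (c \<odot>\<^bsub>g\<^esub> x)) (a (c \<odot>\<^bsub>g\<^esub> x)) m = c \<odot>\<^bsub>WW\<^esub> wact \<alpha> (K x) (h x) (a x) m" for c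
  proof -
    have Kc: "K (c \<odot>\<^bsub>g\<^esub> x) \<in> carrier (S2' \<alpha>)"
      using scale[OF x] K[OF x] unfolding carrier_S2' by (simp add: ov.span_scale)
    show ?thesis
      unfolding p wact_fock_map[OF K[OF x]] fock_map_scale[symmetric] wact_fock_map[OF Kc]
      using scale[OF x, of c] act_scale[OF K[OF x]] by simp
  qed
  show "wact \<alpha> (K x) (h x) (a x) (m \<oplus>\<^bsub>WW\<^esub> n) = wact \<alpha> (K x) (h x) (a x) m \<oplus>\<^bsub>WW\<^esub> wact \<alpha> (K x) (h x) (a x) n" if n: "n \<in> carrier WW" for n
  proof -
    obtain q where q: "n = fock_map q" using n unfolding fock_map_carrier by blast
    show ?thesis unfolding p q fock_map_add[symmetric] wact_fock_map[OF K[OF x]] act_simps ..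
  qed
  fix y assume y: "y \<in> carrier g"
  have "K (x \<oplus>\<^bsub>g\<^esub> y) \<in> carrier (S2' \<alpha>)"
    using add[OF x y] K[OF x] K[OF y] unfolding carrier_S2' by (simp only: ov.span_add)
  then show "wact \<alpha> (K (x \<oplus>\<^bsub>g\<^esub> y)) (h (x \<oplus>\<^bsub>g\<^esub> y)) (a (x \<oplus>\<^bsub>g\<^esub> y)) m =
      wact \<alpha> (K x) (h x) (a x) m \<oplus>\<^bsub>WW\<^esub> wact \<alpha> (K y) (h y) (a y) m"
    unfolding p wact_fock_map[OF K[OF x]] wact_fock_map[OF K[OF y]] fock_map_add[symmetric]
    using add[OF x y] act_add[OF K[OF x] K[OF y]] by (simp only: wact_fock_map)
next
  fix i j x m assume x: "x \<in> part g i" and "m \<in> part WW j"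
  then obtain p where p: "m = fock_map p" "p \<in> even_part j" unfolding fock_map_part by blast
  have X: "K x \<in> gspan \<alpha> i" "i \<Longrightarrow> h x = 0 \<and> a x = 0"
    using part[OF x] by (auto simp: S2'_part_span)
  have "act \<alpha> (K x) (h x) (a x) p \<in> even_part (i \<noteq> j)"
  proof -
    have "sig True (act \<alpha> (K x) (h x) (a x) p) = pm_scale (ksign i) (act \<alpha> (K x) (h x) (a x) (sig True p))"
      by (rule act_parity) (use X in simp_all)
    moreover have "sig True p = pm_scale (ksign j) p" using p(2) by (simp add: even_part_def)
    moreover have "ksign i * ksign j = ksign (i \<noteq> j)" by (simp add: ksign_def)
    ultimately show ?thesis by (simp only: even_part_def mem_Collect_eq act_simps pm.scale_scale)
  qed
  then show "wact \<alpha> (K x) (h x) (a x) m \<in> part WW (i \<noteq> j)"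
    unfolding p(1) wact_fock_map[OF span_in_carrier[OF X(1)]] fock_map_part by (rule imageI)
next
  fix i j x y m assume x: "x \<in> part g i" and y: "y \<in> part g j" and "m \<in> carrier WW"
  then obtain p where p: "m = fock_map p" unfolding fock_map_carrier by blast
  have X: "K x \<in> gspan \<alpha> i" "i \<Longrightarrow> h x = 0 \<and> a x = 0"
    using part[OF x] by (auto simp: S2'_part_span)
  have Y: "K y \<in> gspan \<alpha> j" "j \<Longrightarrow> h y = 0 \<and> a y = 0"
    using part[OF y] by (auto simp: S2'_part_span)
  note b0 = bracket[OF x y]
  note b = b0[THEN conjunct1] b0[THEN conjunct2, THEN conjunct1] b0[THEN conjunct2, THEN conjunct2, THEN conjunct1]
    b0[THEN conjunct2, THEN conjunct2, THEN conjunct2]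
  have Z: "sbracket (K x) (K y) + sop_scale (h x) (Hop \<alpha> (K y)) + sop_scale (- h y) (Hop \<alpha> (K x)) \<in> gspan \<alpha> (i \<noteq> j)"
    using b(4) unfolding b(1) S2'_part_span .
  note c = span_in_carrier[OF X(1)] span_in_carrier[OF Y(1)] span_in_carrier[OF Z]
  have "fock_map (act \<alpha> (K x) (h x) (a x) (act \<alpha> (K y) (h y) (a y) p) - pm_scale (ksign (i \<and> j)) (act \<alpha> (K y) (h y) (a y) (act \<alpha> (K x) (h x) (a x) p)))
     = fock_map (act \<alpha> (sbracket (K x) (K y) + sop_scale (h x) (Hop \<alpha> (K y)) + sop_scale (- h y) (Hop \<alpha> (K x))) 0 (coc \<alpha> (K x) (K y)) p)"
    unfolding fock_map_eq_iff eqv_def[symmetric] by (rule act_bracket[OF _ _ _ _ Z]) (use X Y in simp_all)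
  then show "wact \<alpha> (K (lie_bracket g x y)) (h (lie_bracket g x y)) (a (lie_bracket g x y)) m =
     wact \<alpha> (K x) (h x) (a x) (wact \<alpha> (K y) (h y) (a y) m) \<ominus>\<^bsub>WW\<^esub> (ksign (i \<and> j) \<odot>\<^bsub>WW\<^esub> wact \<alpha> (K y) (h y) (a y) (wact \<alpha> (K x) (h x) (a x) m))"
    unfolding p wact_fock_map[OF c(1)] wact_fock_map[OF c(2)] fock_map_diff fock_map_scale
    unfolding b(1-3) wact_fock_map[OF c(3)] by (rule sym)
qed

lemma wact_central: "m \<in> carrier WW \<Longrightarrow> wact \<alpha> 0 0 1 m = (3 * of_nat (card B)) \<odot>\<^bsub>WW\<^esub> m"
proof -
  assume "m \<in> carrier WW"
  then obtain p where p: "m = fock_map p" unfolding fock_map_carrier by blast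
  have 0: "0 \<in> gspan \<alpha> False" by (rule ov.span_zero)
  have "act \<alpha> 0 0 1 p = pm_scale (3 * of_nat (card B)) p"
    using act_add[OF span_in_carrier[OF 0] span_in_carrier[OF 0], of 0 0 0 1 p]
    unfolding act_hom[OF 0, of 0 1, simplified] using hact_zero[of \<alpha> False p]
    by (simp only: hact_def energy_zero) (simp add: mult.commute)
  then show ?thesis
    unfolding p wact_fock_map[OF span_in_carrier[OF 0]] fock_map_scale[symmetric] by simp
qed

lemma dim_card: "vector_space.dim sc (UNIV :: 'v set) = card B"
  by (rule V.dim_UNIV)

theorem hat_S2'_module:
  "lie_super_module (hat_S2' \<alpha>) WW (\<lambda>(X, a). wact \<alpha> X 0 a)"
  "has_central_charge (S2' \<alpha>) WW (\<lambda>(X, a). wact \<alpha> X 0 a) (3 * of_nat (card B))"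
proof -
  have "lie_super_module (hat_S2' \<alpha>) WW (\<lambda>x. wact \<alpha> (fst x) 0 (snd x))"
  proof (rule lie_super_module_lift[where h = "\<lambda>_. 0"])
    fix x y i j assume x: "x \<in> part (hat_S2' \<alpha>) i" and y: "y \<in> part (hat_S2' \<alpha>) j"
    have X: "fst x \<in> gspan \<alpha> i" and Y: "fst y \<in> gspan \<alpha> j"
      using x y by (auto simp: hat_S2'_def central_extension_def S2'_def lie_superalgebra_of_def S2'_part_span)
    have b: "lie_bracket (hat_S2' \<alpha>) x y = (sbracket (fst x) (fst y), coc \<alpha> (fst x) (fst y))"
      using S2'_cocycle_coc[OF span_in_carrier[OF X] span_in_carrier[OF Y]]
      by (simp add: hat_S2'_def central_extension_def S2'_def lie_superalgebra_of_def split_beta)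
    show "fst (lie_bracket (hat_S2' \<alpha>) x y) = sbracket (fst x) (fst y) + sop_scale 0 (Hop \<alpha> (fst y)) + sop_scale (- 0) (Hop \<alpha> (fst x)) \<and>
      0 = (0::complex) \<and> snd (lie_bracket (hat_S2' \<alpha>) x y) = coc \<alpha> (fst x) (fst y) \<and> fst (lie_bracket (hat_S2' \<alpha>) x y) \<in> S2'_part \<alpha> (i \<noteq> j)"
      unfolding b S2'_part_span using span_bracket[OF X Y] by simp
  qed (auto 0 3 simp: hat_S2'_def central_extension_def S2'_def lie_superalgebra_of_def split: if_splits)
  then show "lie_super_module (hat_S2' \<alpha>) WW (\<lambda>(X, a). wact \<alpha> X 0 a)"
    by (simp add: split_beta')
  show "has_central_charge (S2' \<alpha>) WW (\<lambda>(X, a). wact \<alpha> X 0 a) (3 * of_nat (card B))"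
    unfolding has_central_charge_def using wact_central by (simp add: S2'_def lie_superalgebra_of_def)
qed

end

section \<open>Derivations\<close>

lemma W2_of_carrier: "X \<in> carrier (S2' \<alpha>) \<Longrightarrow> sop_part i X \<in> W2 i"
  by (rule span_W2[OF sop_part_carrier])

lemma sb_add_right: "X \<in> carrier (S2' \<alpha>) \<Longrightarrow> sbracket X (Y + Y') = sbracket X Y + sbracket X Y'"
  by (rule ext) (simp add: sbracket_sum sop_part_add W2_add[OF W2_of_carrier[of X \<alpha>]] UNIV_bool sv.scale_right_distrib)

lemma sb_add_left: "X \<in> carrier (S2' \<alpha>) \<Longrightarrow> sbracket (Y + Y') X = sbracket Y X + sbracket Y' X"
  by (rule ext) (simp add: sbracket_sum sop_part_add W2_add[OF W2_of_carrier[of X \<alpha>]] UNIV_bool sv.scale_right_distrib)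

lemma sb_scale_right:
  assumes "X \<in> carrier (S2' \<alpha>)"
  shows "sbracket X (sop_scale c Y) = sop_scale c (sbracket X Y)"
proof (rule ext)
  fix a
  have e: "sop_part i (sop_scale c Y) b = sscale c (sop_part i Y b)" for i b
    by (simp only: sop_part_scale) (simp only: op_scale_def)
  show "sbracket X (sop_scale c Y) a = sop_scale c (sbracket X Y) a"
    unfolding sbracket_sum e W2_scale[OF W2_of_carrier[OF assms]] unfolding op_scale_def sbracket_sum
    by (simp add: UNIV_bool sv.scale_right_distrib sv.scale_right_diff_distrib mult.commute)
qed

lemma sb_scale_left:
  assumes "X \<in> carrier (S2' \<alpha>)"
  shows "sbracket (sop_scale c Y) X = sop_scale c (sbracket Y X)"
proof (rule ext)
  fix a
  have e: "sop_part i (sop_scale c Y) b = sscale c (sop_part i Y b)" for i b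
    by (simp only: sop_part_scale) (simp only: op_scale_def)
  show "sbracket (sop_scale c Y) X a = sop_scale c (sbracket Y X) a"
    unfolding sbracket_sum e W2_scale[OF W2_of_carrier[OF assms]] unfolding op_scale_def sbracket_sum
    by (simp add: UNIV_bool sv.scale_right_distrib sv.scale_right_diff_distrib mult.commute)
qed

lemma jacobi:
  assumes X: "X \<in> W2 i" and Y: "Y \<in> W2 j" and Z: "Z \<in> W2 k"
  shows "sbracket X (sbracket Y Z) = sbracket (sbracket X Y) Z + sop_scale (ksign (i \<and> j)) (sbracket Y (sbracket X Z))"
proof (rule ext)
  fix a
  have d: "D (b - c) = D b - D c" if "D \<in> W2 l" for D l b c
    using W2_add[OF that, of "b - c" c] by simp
  note e = sbracket_W2[OF X W2_bracket[OF Y Z]] sbracket_W2[OF Y Z] sbracket_W2[OF W2_bracket[OF X Y] Z] sbracket_W2[OF X Y]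
    sbracket_W2[OF Y W2_bracket[OF X Z]] sbracket_W2[OF X Z] d[OF X] d[OF Y] d[OF Z] W2_scale[OF X] W2_scale[OF Y] W2_scale[OF Z]
  have s: "(f + sop_scale c g) a = f a + sscale c (g a)" for f g c by (simp add: op_scale_def)
  show "sbracket X (sbracket Y Z) a = (sbracket (sbracket X Y) Z + sop_scale (ksign (i \<and> j)) (sbracket Y (sbracket X Z))) a"
    unfolding s e
    by (cases i; cases j; cases k) (simp_all add: ksign_def sv.scale_right_diff_distrib sv.scale_right_distrib)
qed

lemma sbracket_skew: "X \<in> W2 i \<Longrightarrow> Y \<in> W2 j \<Longrightarrow> sbracket X Y = sop_scale (- ksign (i \<and> j)) (sbracket Y X)"
  by (rule ext) (simp add: sbracket_W2[of X i Y j] sbracket_W2[of Y j X i] op_scale_def conj_commute ksign_def sv.scale_right_diff_distrib)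

lemma carrier_add: "X \<in> carrier (S2' \<alpha>) \<Longrightarrow> Y \<in> carrier (S2' \<alpha>) \<Longrightarrow> X + Y \<in> carrier (S2' \<alpha>)"
  unfolding carrier_S2' by (rule ov.span_add)

lemma carrier_scale: "X \<in> carrier (S2' \<alpha>) \<Longrightarrow> sop_scale c X \<in> carrier (S2' \<alpha>)"
  unfolding carrier_S2' by (rule ov.span_scale)

lemma basis_span: "S2'_basis \<alpha> b \<in> ov.span (gbasis \<alpha> (gpar (fst b)))"
  by (rule ov.span_base) (auto simp: gbasis_def)

lemma basis_carrier: "S2'_basis \<alpha> b \<in> carrier (S2' \<alpha>)"
  by (rule span_in_carrier[OF basis_span])

lemma sbracket_carrier:
  assumes "X \<in> carrier (S2' \<alpha>)" "Y \<in> carrier (S2' \<alpha>)"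
  shows "sbracket X Y \<in> carrier (S2' \<alpha>)"
proof -
  obtain X0 X1 where X: "X = X0 + X1" "X0 \<in> gspan \<alpha> False" "X1 \<in> gspan \<alpha> True"
    using carrier_S2'_cases[OF assms(1)] .
  obtain Y0 Y1 where Y: "Y = Y0 + Y1" "Y0 \<in> gspan \<alpha> False" "Y1 \<in> gspan \<alpha> True"
    using carrier_S2'_cases[OF assms(2)] .
  have "sbracket X Y = sbracket X0 Y0 + sbracket X0 Y1 + (sbracket X1 Y0 + sbracket X1 Y1)"
    unfolding X(1) sb_add_left[OF assms(2)] unfolding Y(1) sb_add_right[OF span_in_carrier[OF X(2)]] sb_add_right[OF span_in_carrier[OF X(3)]] ..
  then show ?thesis
    using carrier_add[OF carrier_add[OF span_in_carrier[OF span_bracket[OF X(2) Y(2)]] span_in_carrier[OF span_bracket[OF X(2) Y(3)]]]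
      carrier_add[OF span_in_carrier[OF span_bracket[OF X(3) Y(2)]] span_in_carrier[OF span_bracket[OF X(3) Y(3)]]]]
    by (simp only:)
qed

lemma gcoef_parity:
  assumes "X \<in> gspan \<alpha> i" "gcoef b X \<noteq> 0"
  shows "gpar (fst b) = i"
proof (rule ccontr)
  assume ne: "gpar (fst b) \<noteq> i"
  have "gcoef b X = 0"
  proof (rule span_zero_map[OF assms(1)])
    fix X assume "X \<in> gbasis \<alpha> i"
    then obtain b' where "X = S2'_basis \<alpha> b'" "gpar (fst b') = i" by (rule gbasis_cases)
    then show "gcoef b X = 0" using ne by (auto simp: gcoef_basis simp del: S2'_basis.simps)
  qed (simp_all only: gcoef_add gcoef_scale gcoef_zero mult_zero_right add_0)
  then show False using assms(2) by simp
qed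

lemma carrier_decomp:
  assumes "X \<in> carrier (S2' \<alpha>)"
  shows "X = (\<Sum>g\<in>UNIV. field \<alpha> g (crd g X))"
proof -
  have "X - (\<Sum>g\<in>UNIV. field \<alpha> g (crd g X)) = 0"
  proof (rule span_zero_map[OF assms[unfolded carrier_S2'], of "\<lambda>X. X - (\<Sum>g\<in>UNIV. field \<alpha> g (crd g X))"])
    fix X assume "X \<in> range (S2'_basis \<alpha>)"
    then obtain g n where X: "X = field \<alpha> g (tpow (n + gshift g) 1)" using basis_field by auto
    have "(\<Sum>g'\<in>UNIV. field \<alpha> g' (crd g' X)) = (\<Sum>g'\<in>UNIV. if g' = g then X else 0)"
      unfolding X crd_field by (rule sum.cong) (auto simp del: field.simps)
    moreover have "finite (UNIV :: gen set)" by (simp add: UNIV_gen)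
    ultimately show "X - (\<Sum>g\<in>UNIV. field \<alpha> g (crd g X)) = 0" by simp
  next
    fix X Y :: sop assume "X - (\<Sum>g\<in>UNIV. field \<alpha> g (crd g X)) = 0" "Y - (\<Sum>g\<in>UNIV. field \<alpha> g (crd g Y)) = 0"
    moreover have "(\<Sum>g\<in>UNIV. field \<alpha> g (crd g (X + Y))) = (\<Sum>g\<in>UNIV. field \<alpha> g (crd g X)) + (\<Sum>g\<in>UNIV. field \<alpha> g (crd g Y))"
      unfolding crd_add field_add by (rule sum.distrib)
    ultimately show "X + Y - (\<Sum>g\<in>UNIV. field \<alpha> g (crd g (X + Y))) = 0" by simp
  next
    fix c and X :: sop assume "X - (\<Sum>g\<in>UNIV. field \<alpha> g (crd g X)) = 0"
    moreover have "(\<Sum>g\<in>UNIV. field \<alpha> g (crd g (sop_scale c X))) = sop_scale c (\<Sum>g\<in>UNIV. field \<alpha> g (crd g X))"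
      unfolding crd_scale field_scale by (rule ov.scale_sum_right[symmetric])
    ultimately show "sop_scale c X - (\<Sum>g\<in>UNIV. field \<alpha> g (crd g (sop_scale c X))) = 0" by simp
  next
    show "0 - (\<Sum>g\<in>UNIV. field \<alpha> g (crd g 0)) = 0" unfolding crd_zero field_zero by simp
  qed
  then show ?thesis by simp
qed

lemma gcoef_eq_0:
  assumes "X \<in> carrier (S2' \<alpha>)" "\<And>b. gcoef b X = 0"
  shows "X = 0"
proof -
  have "crd g X = 0" for g
  proof (rule poly_mapping_eqI)
    fix n show "Poly_Mapping.lookup (crd g X) n = Poly_Mapping.lookup 0 n"
      using assms(2)[of "(g, n - gshift g)"] by (simp add: gcoef_def del: crd.simps)
  qed
  then show ?thesis using carrier_decomp[OF assms(1)] by (simp only: field_zero sum.neutral_const)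
qed

lemma gcoef_minus: "gcoef b (X - Y) = gcoef b X - gcoef b Y"
  using gcoef_add[of b "X - Y" Y] by simp

lemma gcoef_eqI:
  assumes "X \<in> carrier (S2' \<alpha>)" "Y \<in> carrier (S2' \<alpha>)" "\<And>b. gcoef b X = gcoef b Y"
  shows "X = Y"
proof -
  have "X - Y = X + sop_scale (-1) Y" by simp
  then have "X - Y \<in> carrier (S2' \<alpha>)" using carrier_add[OF assms(1) carrier_scale[OF assms(2), of "-1"]] by (simp only:)
  from gcoef_eq_0[OF this] show ?thesis using assms(3) by (simp add: gcoef_minus)
qed

lemma carrier_map_eqI:
  assumes "X \<in> carrier (S2' \<alpha>)"
    and "\<And>X Y. X \<in> carrier (S2' \<alpha>) \<Longrightarrow> Y \<in> carrier (S2' \<alpha>) \<Longrightarrow> f (X + Y) = f X + (f Y :: sop)"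
    and "\<And>c X. X \<in> carrier (S2' \<alpha>) \<Longrightarrow> f (sop_scale c X) = sop_scale c (f X)"
    and "\<And>b. f (S2'_basis \<alpha> b) = 0"
  shows "f X = 0"
proof (rule span_zero_map[OF assms(1)[unfolded carrier_S2']])
  show "f 0 = 0" using assms(3)[OF assms(1), of 0] by simp
next
  fix X assume "X \<in> range (S2'_basis \<alpha>)"
  then show "f X = 0" using assms(4) by blast
next
  fix X Y assume "X \<in> ov.span (range (S2'_basis \<alpha>))" "Y \<in> ov.span (range (S2'_basis \<alpha>))" "f X = 0" "f Y = 0"
  then show "f (X + Y) = 0" using assms(2)[of X Y] unfolding carrier_S2' by simp
next
  fix c X assume "X \<in> ov.span (range (S2'_basis \<alpha>))" "f X = 0"
  then show "f (sop_scale c X) = 0" using assms(3)[of X c] unfolding carrier_S2' by simp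
qed

subsection \<open>Diagonal operators\<close>

text \<open>
  On \<open>S'(2,\<alpha>)\<close>, the derivation \<open>\<H>\<close> is the bracket with \<open>-\<theta>\<^sub>1 \<partial>\<^sub>1 - \<theta>\<^sub>2 \<partial>\<^sub>2\<close>, so that it is covered by
  the Jacobi identity.
\<close>

definition neg_euler :: sop where
  "neg_euler = vfield 0 (0, - 1, 0, 0) (0, 0, - 1, 0)"

lemma neg_euler_W2: "neg_euler \<in> W2 False"
  unfolding neg_euler_def by (rule vfield_W2) simp_all

lemma neg_euler_field: "sbracket neg_euler (field \<alpha> g b) = sop_scale (calH_weight g) (field \<alpha> g b)"
proof (rule bracket_eqI[OF neg_euler_W2 field_W2 W2_subspace_scale[OF field_W2]])
  show "neg_euler (field \<alpha> g b a) - sscale (ksign (False \<and> gpar g)) (field \<alpha> g b (neg_euler a)) = sop_scale (calH_weight g) (field \<alpha> g b) a"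
    if "a \<in> {t_elem, th1, th2}" for a
    using that by (cases g) (auto simp: neg_euler_def vfield_apply t_elem_def th1_def th2_def zero_prod_def op_scale_def ksign_def)
qed simp

lemma Hop_neg_euler:
  assumes "X \<in> carrier (S2' \<alpha>)"
  shows "Hop \<alpha> X = sbracket neg_euler X"
proof -
  have "Hop \<alpha> X - sbracket neg_euler X = 0"
  proof (rule carrier_map_eqI[OF assms, of "\<lambda>X. Hop \<alpha> X - sbracket neg_euler X"])
    fix b show "Hop \<alpha> (S2'_basis \<alpha> b) - sbracket neg_euler (S2'_basis \<alpha> b) = 0"
    proof (cases b)
      case (Pair g n)
      show ?thesis unfolding Pair Hop_basis unfolding basis_field neg_euler_field by simp
    qed
  next
    fix X Y show "Hop \<alpha> (X + Y) - sbracket neg_euler (X + Y) = Hop \<alpha> X - sbracket neg_euler X + (Hop \<alpha> Y - sbracket neg_euler Y)"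
      unfolding Hop_add W2_sb_add_right[OF neg_euler_W2] by simp
  next
    fix c X show "Hop \<alpha> (sop_scale c X) - sbracket neg_euler (sop_scale c X) = sop_scale c (Hop \<alpha> X - sbracket neg_euler X)"
      unfolding Hop_scale W2_sb_scale_right[OF neg_euler_W2] by (simp only: ov.scale_right_diff_distrib)
  qed
  then show ?thesis by simp
qed

fun gH_weight :: "gen \<Rightarrow> complex" where
  "gH_weight gE = 2" | "gH_weight gF = -2" | "gH_weight gx = 1" | "gH_weight gp = -1"
| "gH_weight gh = 1" | "gH_weight gy = -1" | "gH_weight _ = 0"

lemma H0_basis: "sbracket (S2'_basis \<alpha> (gH, 0)) (S2'_basis \<alpha> (g, n)) = sop_scale (gH_weight g) (S2'_basis \<alpha> (g, n))"
proof -
  have "sbracket (field \<alpha> gH 1) (field \<alpha> g b) = sop_scale (gH_weight g) (field \<alpha> g b)" for b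
  proof (rule bracket_eqI[OF field_W2 field_W2 W2_subspace_scale[OF field_W2]])
    show "field \<alpha> gH 1 (field \<alpha> g b a) - sscale (ksign (gpar gH \<and> gpar g)) (field \<alpha> g b (field \<alpha> gH 1 a)) = sop_scale (gH_weight g) (field \<alpha> g b) a"
      if "a \<in> {t_elem, th1, th2}" for a
    proof -
      have 2: "pm_scale 2 b = b + b" "pm_scale (- 2) b = - b - b" for b :: laurent
        using pm.scale_left_distrib[of 1 1 b] pm.scale_left_distrib[of "-1" "-1" b] by simp_all
      show ?thesis
        using that by (cases g) (auto simp: vfield_apply t_elem_def th1_def th2_def zero_prod_def op_scale_def ksign_def 2)
    qed
  qed simp
  then show ?thesis unfolding basis_field by simp
qed

definition L0_weight :: "complex \<Rightarrow> gen \<Rightarrow> int \<Rightarrow> complex" where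
  "L0_weight \<alpha> g n = calH_weight g * ((\<alpha> - 1) / 2) - of_int n"

lemma L0_basis: "sbracket (S2'_basis \<alpha> (gL, 0)) (S2'_basis \<alpha> (g, n)) = sop_scale (L0_weight \<alpha> g n) (S2'_basis \<alpha> (g, n))"
proof (rule bracket_eqI)
  show "S2'_basis \<alpha> (gL, 0) \<in> W2 False" "S2'_basis \<alpha> (g, n) \<in> W2 (gpar g)" "sop_scale (L0_weight \<alpha> g n) (S2'_basis \<alpha> (g, n)) \<in> W2 (gpar g)"
    using field_W2[of \<alpha> gL] unfolding basis_field by (auto intro: W2_subspace_scale field_W2 simp del: field.simps)
  show "S2'_basis \<alpha> (gL, 0) (S2'_basis \<alpha> (g, n) a) - sscale (ksign (False \<and> gpar g)) (S2'_basis \<alpha> (g, n) (S2'_basis \<alpha> (gL, 0) a))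
     = sop_scale (L0_weight \<alpha> g n) (S2'_basis \<alpha> (g, n)) a"
    if "a \<in> {t_elem, th1, th2}" for a
    using that
    by (cases g) (auto simp: vfield_apply t_elem_def th1_def th2_def zero_prod_def op_scale_def ksign_def L0_weight_def mult_single
        field_simps simp flip: single_add single_diff single_uminus intro!: arg_cong[where f = "Poly_Mapping.single _"])
qed simp

lemma field_bracketI:
  assumes "gpar g'' = (gpar g \<noteq> gpar g')"
    and "\<And>a. a \<in> {t_elem, th1, th2} \<Longrightarrow> field \<alpha> g x (field \<alpha> g' y a) - sscale (ksign (gpar g \<and> gpar g')) (field \<alpha> g' y (field \<alpha> g x a))
      = sop_scale c (field \<alpha> g'' z) a"
  shows "sbracket (field \<alpha> g x) (field \<alpha> g' y) = sop_scale c (field \<alpha> g'' z)"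
  by (rule bracket_eqI[OF field_W2 field_W2 W2_subspace_scale[OF field_W2] assms])

text \<open>The first two link the eigenvalues of a diagonal derivation on \<open>gE\<close>,
  \<open>gF\<close>, \<open>gx\<close> and \<open>gp\<close>; the others carry its vanishing over to
  \<open>gH\<close>, \<open>gh\<close> and \<open>gy\<close>, where
  \<open>\<alpha> \<noteq> 1\<close> keeps the last two coefficients nonzero.\<close>

lemma basis_brackets_scaled:
  "sbracket (S2'_basis \<alpha> (gE, m)) (S2'_basis \<alpha> (gp, n)) = sop_scale 1 (S2'_basis \<alpha> (gx, m + n))"
  "sbracket (S2'_basis \<alpha> (gF, m)) (S2'_basis \<alpha> (gx, n)) = sop_scale 1 (S2'_basis \<alpha> (gp, m + n))"
  "sbracket (S2'_basis \<alpha> (gE, m)) (S2'_basis \<alpha> (gF, n)) = sop_scale 1 (S2'_basis \<alpha> (gH, m + n))"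
  "sbracket (S2'_basis \<alpha> (gx, n)) (S2'_basis \<alpha> (gh, n)) = sop_scale (1 - \<alpha>) (S2'_basis \<alpha> (gE, n + n))"
  "sbracket (S2'_basis \<alpha> (gp, n)) (S2'_basis \<alpha> (gy, n)) = sop_scale (\<alpha> - 1) (S2'_basis \<alpha> (gF, n + n))"
  unfolding basis_field
  by (rule field_bracketI;
      auto simp: vfield_apply t_elem_def th1_def th2_def zero_prod_def op_scale_def mult_single algebra_simps
        simp flip: single_add single_diff single_uminus)+

lemmas basis_brackets = basis_brackets_scaled[unfolded ov.scale_one]

text \<open>
  The imaginary part separates the weights of \<open>\<L>\<^sub>0 + diag_coef \<alpha> H\<^sub>0\<close>, except that \<open>\<L>\<^sub>n\<close> and \<open>H\<^sub>n\<close> have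
  the same weight.
\<close>

definition diag_coef :: "complex \<Rightarrow> complex" where
  "diag_coef \<alpha> = Complex 0 (\<bar>Im \<alpha>\<bar> + 1)"

definition diag_op :: "complex \<Rightarrow> sop" where
  "diag_op \<alpha> = S2'_basis \<alpha> (gL, 0) + sop_scale (diag_coef \<alpha>) (S2'_basis \<alpha> (gH, 0))"

definition wt :: "complex \<Rightarrow> gen \<times> int \<Rightarrow> complex" where
  "wt \<alpha> b = L0_weight \<alpha> (fst b) (snd b) + diag_coef \<alpha> * gH_weight (fst b)"

lemma diag_op_span: "diag_op \<alpha> \<in> gspan \<alpha> False"
  using basis_span[of \<alpha> "(gL, 0)"] basis_span[of \<alpha> "(gH, 0)"]
  unfolding diag_op_def by (intro ov.span_add ov.span_scale) simp_all

lemma diag_op_basis: "sbracket (diag_op \<alpha>) (S2'_basis \<alpha> b) = sop_scale (wt \<alpha> b) (S2'_basis \<alpha> b)"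
proof (cases b)
  case (Pair g n)
  show ?thesis
    unfolding Pair diag_op_def sb_add_left[OF basis_carrier] sb_scale_left[OF basis_carrier] L0_basis H0_basis wt_def fst_conv snd_conv
    by (simp only: ov.scale_scale ov.scale_left_distrib)
qed

text \<open>The \<open>\<L>\<^sub>0\<close> eigenvalues have imaginary parts in absolute value at
  most half of \<open>\<bar>Im \<alpha>\<bar>\<close>, while different values of
  \<open>gH_weight\<close> contribute a gap of at least
  \<open>\<bar>Im \<alpha>\<bar> + 1\<close>.\<close>

lemma gH_weight_eq:
  assumes "wt \<alpha> (g, n) = wt \<alpha> (g', n')"
  shows "gH_weight g = gH_weight g'"
proof -
  have "Im (wt \<alpha> (g, n)) = Im (wt \<alpha> (g', n'))" using assms by simp
  moreover have "Im \<alpha> \<le> \<bar>Im \<alpha>\<bar>" "- Im \<alpha> \<le> \<bar>Im \<alpha>\<bar>" by simp_all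
  ultimately show ?thesis
    by (cases g; cases g'; simp add: wt_def L0_weight_def diag_coef_def; argo)
qed

text \<open>With equal \<open>gH_weight\<close>, the values of \<open>calH_weight\<close> can differ
  only as 1 and -1. Equality of the real weights would then make \<open>\<alpha>\<close> an integer,
  up to the shift of the exponents.\<close>

lemma wt_eq:
  assumes "\<alpha> \<notin> \<int>" "wt \<alpha> (g, n) = wt \<alpha> (g', n')"
  shows "n = n'" "g = g' \<or> {g, g'} \<subseteq> {gL, gH}"
proof -
  have h: "gH_weight g = gH_weight g'" by (rule gH_weight_eq[OF assms(2)])
  have ni: "\<alpha> \<noteq> of_int k" for k using assms(1) by auto
  have e: "calH_weight g * ((\<alpha> - 1) / 2) - of_int n = calH_weight g' * ((\<alpha> - 1) / 2) - of_int n'"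
    using assms(2) h by (simp add: wt_def L0_weight_def)
  have c: "calH_weight g = calH_weight g'"
  proof (rule ccontr)
    assume "calH_weight g \<noteq> calH_weight g'"
    then have "(calH_weight g = 1 \<and> calH_weight g' = - 1) \<or> (calH_weight g = - 1 \<and> calH_weight g' = 1)"
      using h by (cases g; cases g') simp_all
    moreover obtain \<gamma> where \<gamma>: "(\<alpha> - 1) / 2 = \<gamma>" "\<alpha> = 2 * \<gamma> + 1"
      using that[of "(\<alpha> - 1) / 2"] by (simp add: field_simps)
    ultimately have "\<gamma> - of_int n = - \<gamma> - of_int n' \<or> - \<gamma> - of_int n = \<gamma> - of_int n'"
      using e unfolding \<gamma>(1) by auto
    then have "\<alpha> = 1 + of_int n - of_int n' \<or> \<alpha> = 1 - of_int n + of_int n'"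
      unfolding \<gamma>(2)
    proof (rule disj_forward)
      assume "\<gamma> - of_int n = - \<gamma> - of_int n'"
      from arg_cong[OF this, of "\<lambda>x. x + \<gamma> + of_int n + 1"]
      show "2 * \<gamma> + 1 = 1 + of_int n - of_int n'" by simp
    next
      assume "- \<gamma> - of_int n = \<gamma> - of_int n'"
      from arg_cong[OF this, of "\<lambda>x. x + \<gamma> + of_int n' + 1"]
      show "2 * \<gamma> + 1 = 1 - of_int n + of_int n'" by simp
    qed
    then have "\<alpha> = of_int (1 + n - n') \<or> \<alpha> = of_int (1 - n + n')" by simp
    then show False using ni by blast
  qed
  then show "n = n'" using e by simp
  show "g = g' \<or> {g, g'} \<subseteq> {gL, gH}" using c h by (cases g; cases g') simp_all
qed

lemma wt_eq_0:
  assumes "\<alpha> \<notin> \<int>" "wt \<alpha> b = 0"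
  shows "b = (gL, 0) \<or> b = (gH, 0)"
proof -
  have "wt \<alpha> (fst b, snd b) = wt \<alpha> (gL, 0)" using assms(2) by (simp add: wt_def[of _ "(gL, 0)"] L0_weight_def)
  from wt_eq[OF assms(1) this] show ?thesis by (cases b) auto
qed

section \<open>Triviality of the centre and classification of the derivations\<close>

lemma sbracket_zero_left: "X \<in> carrier (S2' \<alpha>) \<Longrightarrow> sbracket 0 X = 0"
  using sb_scale_left[of X \<alpha> 0 0] by simp

lemma sbracket_zero_right: "X \<in> carrier (S2' \<alpha>) \<Longrightarrow> sbracket X 0 = 0"
  using sb_scale_right[of X \<alpha> 0 0] by simp

lemma gcoef_diag_op:
  assumes "X \<in> carrier (S2' \<alpha>)"
  shows "gcoef b (sbracket (diag_op \<alpha>) X) = wt \<alpha> b * gcoef b X"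
proof -
  note T = span_in_carrier[OF diag_op_span]
  have "gcoef b (sbracket (diag_op \<alpha>) X) - wt \<alpha> b * gcoef b X = 0"
  proof (rule span_zero_map[OF assms[unfolded carrier_S2'], of "\<lambda>X. gcoef b (sbracket (diag_op \<alpha>) X) - wt \<alpha> b * gcoef b X"])
    fix X assume "X \<in> range (S2'_basis \<alpha>)"
    then obtain b' where b': "X = S2'_basis \<alpha> b'" by blast
    show "gcoef b (sbracket (diag_op \<alpha>) X) - wt \<alpha> b * gcoef b X = 0"
      unfolding b' diag_op_basis gcoef_scale gcoef_basis by simp
  qed (simp_all only: sb_add_right[OF T] sb_scale_right[OF T] gcoef_add gcoef_scale right_minus_eq distrib_left mult.left_commute
        sbracket_zero_right[OF T] gcoef_zero mult_zero_right)
  then show ?thesis by simp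
qed

lemma sbracket_skew_even:
  assumes X: "X \<in> carrier (S2' \<alpha>)" and T: "T \<in> gspan \<alpha> False"
  shows "sbracket X T = sop_scale (- 1) (sbracket T X)"
proof -
  obtain X0 X1 where e: "X = X0 + X1" "X0 \<in> gspan \<alpha> False" "X1 \<in> gspan \<alpha> True"
    using carrier_S2'_cases[OF X] .
  have s: "- ksign (i \<and> False) = - 1" for i by (simp add: ksign_def)
  show ?thesis
    unfolding e(1) sb_add_left[OF span_in_carrier[OF T]] sb_add_right[OF span_in_carrier[OF T]]
      sbracket_skew[OF span_W2[OF e(2)] span_W2[OF T]] sbracket_skew[OF span_W2[OF e(3)] span_W2[OF T]] s
    by (simp only: ov.scale_right_distrib)
qed

text \<open>Annihilating \<open>diag_op \<alpha>\<close> forces \<open>X\<close> to have weight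
  zero, so it is a combination of \<open>L_0\<close> and \<open>H_0\<close>. Testing on
  \<open>L_1\<close>, \<open>E_0\<close> and \<open>x_0\<close> then removes the coefficients of
  \<open>L_0\<close>, \<open>H_0\<close> and \<open>calH\<close> in turn.\<close>

lemma centre_trivial:
  assumes \<alpha>: "\<alpha> \<notin> \<int>" and X: "X \<in> carrier (S2' \<alpha>)"
    and c: "\<And>Y. Y \<in> carrier (S2' \<alpha>) \<Longrightarrow> sbracket X Y + sop_scale l (Hop \<alpha> Y) = 0"
  shows "X = 0" "l = 0"
proof -
  let ?L = "S2'_basis \<alpha> (gL, 0)" and ?H = "S2'_basis \<alpha> (gH, 0)"
  note T = span_in_carrier[OF diag_op_span]
  have "Hop \<alpha> (diag_op \<alpha>) = 0"
    unfolding diag_op_def Hop_add Hop_scale Hop_basis by simp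
  then have "sbracket X (diag_op \<alpha>) = 0" using c[OF T] by simp
  then have "sbracket (diag_op \<alpha>) X = 0"
    unfolding sbracket_skew_even[OF X diag_op_span] using ov.scale_eq_0_iff[of "-1" "sbracket (diag_op \<alpha>) X"] by simp
  then have z: "wt \<alpha> b * gcoef b X = 0" for b
    using gcoef_diag_op[OF X, of b] by (simp only: gcoef_zero)
  define a d where "a = gcoef (gL, 0) X" and "d = gcoef (gH, 0) X"
  have Xe: "X = sop_scale a ?L + sop_scale d ?H"
  proof (rule gcoef_eqI[OF X])
    show "sop_scale a ?L + sop_scale d ?H \<in> carrier (S2' \<alpha>)" by (intro carrier_add carrier_scale basis_carrier)
    show "gcoef b X = gcoef b (sop_scale a ?L + sop_scale d ?H)" for b
    proof (cases "wt \<alpha> b = 0")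
      case True
      from wt_eq_0[OF \<alpha> this] show ?thesis
        unfolding gcoef_add gcoef_scale gcoef_basis a_def d_def by auto
    next
      case False
      then have "b \<noteq> (gL, 0)" "b \<noteq> (gH, 0)" by (auto simp: wt_def L0_weight_def)
      then show ?thesis using z[of b] False unfolding gcoef_add gcoef_scale gcoef_basis by simp
    qed
  qed
  have br: "a * L0_weight \<alpha> g n + d * gH_weight g + l * calH_weight g = 0" for g n
  proof -
    have "sop_scale (a * L0_weight \<alpha> g n + d * gH_weight g + l * calH_weight g) (S2'_basis \<alpha> (g, n)) = 0"
      using c[OF basis_carrier, of "(g, n)"]
      unfolding Xe sb_add_left[OF basis_carrier] sb_scale_left[OF basis_carrier] L0_basis H0_basis Hop_basis fst_conv
      by (simp only: ov.scale_scale ov.scale_left_distrib)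
    then have "gcoef (g, n) (sop_scale (a * L0_weight \<alpha> g n + d * gH_weight g + l * calH_weight g) (S2'_basis \<alpha> (g, n))) = gcoef (g, n) 0"
      by (simp only:)
    then show ?thesis unfolding gcoef_scale gcoef_basis gcoef_zero by simp
  qed
  have a0: "a = 0" using br[of gL 1] by (simp add: L0_weight_def)
  have "d = 0" using br[of gE 0] a0 by simp
  then show "X = 0" using a0 unfolding Xe by simp
  show "l = 0" using br[of gx 0] a0 \<open>d = 0\<close> by simp
qed

text \<open>Homogeneous derivations as in \<open>derivations\<close>, without the convention that
  they vanish outside the carrier, so that \<open>sbracket Z\<close> and \<open>Hop \<alpha>\<close>
  qualify as they are.\<close>

definition dern :: "complex \<Rightarrow> bool \<Rightarrow> (sop \<Rightarrow> sop) \<Rightarrow> bool" where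
  "dern \<alpha> i \<delta> \<longleftrightarrow> (\<forall>X\<in>carrier (S2' \<alpha>). \<forall>Y\<in>carrier (S2' \<alpha>). \<delta> (X + Y) = \<delta> X + \<delta> Y)
    \<and> (\<forall>X\<in>carrier (S2' \<alpha>). \<forall>c. \<delta> (sop_scale c X) = sop_scale c (\<delta> X))
    \<and> (\<forall>j. \<forall>X\<in>gspan \<alpha> j. \<delta> X \<in> gspan \<alpha> (i \<noteq> j))
    \<and> (\<forall>j k. \<forall>X\<in>gspan \<alpha> j. \<forall>Y\<in>gspan \<alpha> k.
         \<delta> (sbracket X Y) = sbracket (\<delta> X) Y + sop_scale (ksign (i \<and> j)) (sbracket X (\<delta> Y)))"

lemma
  assumes "dern \<alpha> i \<delta>"
  shows dern_add: "X \<in> carrier (S2' \<alpha>) \<Longrightarrow> Y \<in> carrier (S2' \<alpha>) \<Longrightarrow> \<delta> (X + Y) = \<delta> X + \<delta> Y"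
    and dern_scale: "X \<in> carrier (S2' \<alpha>) \<Longrightarrow> \<delta> (sop_scale c X) = sop_scale c (\<delta> X)"
    and dern_span: "X \<in> gspan \<alpha> j \<Longrightarrow> \<delta> X \<in> gspan \<alpha> (i \<noteq> j)"
    and dern_leibniz: "X \<in> gspan \<alpha> j \<Longrightarrow> Y \<in> gspan \<alpha> k \<Longrightarrow>
         \<delta> (sbracket X Y) = sbracket (\<delta> X) Y + sop_scale (ksign (i \<and> j)) (sbracket X (\<delta> Y))"
  using assms unfolding dern_def by blast+

lemma dern_ad:
  assumes U: "U \<in> W2 i" and P: "\<And>j X. X \<in> gspan \<alpha> j \<Longrightarrow> sbracket U X \<in> gspan \<alpha> (i \<noteq> j)"
  shows "dern \<alpha> i (sbracket U)"
  unfolding dern_def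
  using P by (intro conjI ballI allI W2_sb_add_right[OF U] W2_sb_scale_right[OF U]) (auto intro: jacobi[OF U span_W2 span_W2])

lemma dern_comb:
  assumes D: "dern \<alpha> i \<delta>" and D': "dern \<alpha> i \<delta>'"
  shows "dern \<alpha> i (\<lambda>X. \<delta> X + sop_scale c (\<delta>' X))"
  unfolding dern_def
proof (intro conjI ballI allI)
  fix X Y assume "X \<in> carrier (S2' \<alpha>)" "Y \<in> carrier (S2' \<alpha>)"
  then show "\<delta> (X + Y) + sop_scale c (\<delta>' (X + Y)) = \<delta> X + sop_scale c (\<delta>' X) + (\<delta> Y + sop_scale c (\<delta>' Y))"
    unfolding dern_add[OF D \<open>X \<in> _\<close> \<open>Y \<in> _\<close>] dern_add[OF D' \<open>X \<in> _\<close> \<open>Y \<in> _\<close>] ov.scale_right_distrib by (simp only: ac_simps)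
next
  fix X k assume "X \<in> carrier (S2' \<alpha>)"
  then show "\<delta> (sop_scale k X) + sop_scale c (\<delta>' (sop_scale k X)) = sop_scale k (\<delta> X + sop_scale c (\<delta>' X))"
    unfolding dern_scale[OF D \<open>X \<in> _\<close>] dern_scale[OF D' \<open>X \<in> _\<close>] ov.scale_right_distrib ov.scale_scale by (simp only: mult.commute)
next
  fix j X assume "X \<in> gspan \<alpha> j"
  then show "\<delta> X + sop_scale c (\<delta>' X) \<in> gspan \<alpha> (i \<noteq> j)"
    by (intro ov.span_add ov.span_scale dern_span[OF D] dern_span[OF D'])
next
  fix j k X Y assume X: "X \<in> gspan \<alpha> j" and Y: "Y \<in> gspan \<alpha> k"
  note XC = span_in_carrier[OF X] and YC = span_in_carrier[OF Y]
  show "\<delta> (sbracket X Y) + sop_scale c (\<delta>' (sbracket X Y)) =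
    sbracket (\<delta> X + sop_scale c (\<delta>' X)) Y + sop_scale (ksign (i \<and> j)) (sbracket X (\<delta> Y + sop_scale c (\<delta>' Y)))"
    unfolding dern_leibniz[OF D X Y] dern_leibniz[OF D' X Y] sb_add_left[OF YC] sb_scale_left[OF YC] sb_add_right[OF XC] sb_scale_right[OF XC]
      ov.scale_right_distrib ov.scale_scale by (simp only: mult.commute add.assoc add.left_commute)
qed

lemma dern_inner: "Z \<in> gspan \<alpha> i \<Longrightarrow> dern \<alpha> i (sbracket Z)"
  by (rule dern_ad[OF span_W2 span_bracket])

lemma dern_Hop: "dern \<alpha> False (Hop \<alpha>)"
proof -
  have e: "Hop \<alpha> X = sbracket neg_euler X" if "X \<in> gspan \<alpha> j" for X j
    using that by (intro Hop_neg_euler span_in_carrier)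
  have "dern \<alpha> False (sbracket neg_euler)"
  proof (rule dern_ad[OF neg_euler_W2])
    fix j X assume X: "X \<in> gspan \<alpha> j"
    show "sbracket neg_euler X \<in> gspan \<alpha> (False \<noteq> j)"
      using Hop_span[OF X] unfolding e[OF X] by simp
  qed
  then show ?thesis
    unfolding dern_def by (simp add: Hop_neg_euler span_in_carrier carrier_add carrier_scale sbracket_carrier)
qed

text \<open>A derivation that kills \<open>diag_op \<alpha>\<close> commutes with bracketing by it
  and therefore preserves its eigenspaces.\<close>

lemma dern_eigen:
  assumes D: "dern \<alpha> i \<delta>" and T: "\<delta> (diag_op \<alpha>) = 0" and ne: "gcoef b' (\<delta> (S2'_basis \<alpha> b)) \<noteq> 0"
  shows "wt \<alpha> b' = wt \<alpha> b"
proof -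
  have k: "ksign (i \<and> False) = 1" by (simp add: ksign_def)
  have "sop_scale (wt \<alpha> b) (\<delta> (S2'_basis \<alpha> b)) = sbracket (diag_op \<alpha>) (\<delta> (S2'_basis \<alpha> b))"
    using dern_leibniz[OF D diag_op_span basis_span, of b]
    unfolding diag_op_basis dern_scale[OF D basis_carrier] T sbracket_zero_left[OF basis_carrier] k by simp
  then have "gcoef b' (sop_scale (wt \<alpha> b) (\<delta> (S2'_basis \<alpha> b))) = gcoef b' (sbracket (diag_op \<alpha>) (\<delta> (S2'_basis \<alpha> b)))"
    by (simp only:)
  then show ?thesis
    unfolding gcoef_scale gcoef_diag_op[OF span_in_carrier[OF dern_span[OF D basis_span]]] using ne by simp
qed

text \<open>The components of the image of \<open>diag_op \<alpha>\<close> with nonzero weight are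
  cancelled by an explicit inner derivation, dividing each coefficient by its weight. The remainder
  \<open>Z0\<close> has weight zero; it turns out to be central and hence zero.\<close>

lemma dern_normalize:
  assumes \<alpha>: "\<alpha> \<notin> \<int>" and D: "dern \<alpha> i \<delta>"
  obtains Z where "Z \<in> gspan \<alpha> i" "\<delta> (diag_op \<alpha>) + sop_scale 1 (sbracket Z (diag_op \<alpha>)) = 0"
proof -
  let ?D = "\<delta> (diag_op \<alpha>)"
  note TC = span_in_carrier[OF diag_op_span]
  have D0: "?D \<in> gspan \<alpha> i" using dern_span[OF D diag_op_span] by simp
  define A where "A = {b. gcoef b ?D \<noteq> 0 \<and> wt \<alpha> b \<noteq> 0}"
  have A: "finite A" unfolding A_def by (rule finite_subset[OF _ finite_gcoef[of ?D]]) blast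
  define Z where "Z = (\<Sum>b\<in>A. sop_scale (gcoef b ?D / wt \<alpha> b) (S2'_basis \<alpha> b))"
  have Z: "Z \<in> gspan \<alpha> i"
    unfolding Z_def
  proof (rule ov.span_sum)
    fix b assume "b \<in> A"
    then have "gpar (fst b) = i" using gcoef_parity[OF D0] unfolding A_def by blast
    then show "sop_scale (gcoef b ?D / wt \<alpha> b) (S2'_basis \<alpha> b) \<in> gspan \<alpha> i"
      using basis_span[of \<alpha> b] by (intro ov.span_scale) (simp only:)
  qed
  have gZ: "gcoef b Z = (if b \<in> A then gcoef b ?D / wt \<alpha> b else 0)" for b
  proof -
    have "gcoef b Z = (\<Sum>b'\<in>A. if b' = b then gcoef b ?D / wt \<alpha> b else 0)"
      unfolding Z_def gcoef_sum gcoef_scale gcoef_basis by (rule sum.cong) auto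
    then show ?thesis using A by simp
  qed
  define \<delta>' where "\<delta>' = (\<lambda>X. \<delta> X + sop_scale 1 (sbracket Z X))"
  have D': "dern \<alpha> i \<delta>'" unfolding \<delta>'_def by (rule dern_comb[OF D dern_inner[OF Z]])
  define Z0 where "Z0 = \<delta>' (diag_op \<alpha>)"
  have Z0: "Z0 \<in> gspan \<alpha> i" using dern_span[OF D' diag_op_span] by (simp add: Z0_def)
  note Z0C = span_in_carrier[OF Z0]
  have g0: "wt \<alpha> b * gcoef b Z0 = 0" for b
    unfolding Z0_def \<delta>'_def sbracket_skew_even[OF span_in_carrier[OF Z] diag_op_span] gcoef_add gcoef_scale gcoef_diag_op[OF span_in_carrier[OF Z]] gZ
    by (auto simp: A_def)
  have TZ0: "sbracket (diag_op \<alpha>) Z0 = 0"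
    by (rule gcoef_eq_0[OF sbracket_carrier[OF TC Z0C]]) (simp only: gcoef_diag_op[OF Z0C] g0)
  \<comment> \<open>The bracket of \<open>Z0\<close> with a basis element of weight \<open>w\<close>
    lies both in the kernel and in the image of the bracket with \<open>diag_op \<alpha>\<close>
    minus \<open>w\<close>. These meet only in 0, because the operator is diagonal.\<close>
  have c: "sbracket Z0 (S2'_basis \<alpha> b) = 0" for b
  proof (rule gcoef_eq_0[OF sbracket_carrier[OF Z0C basis_carrier]])
    fix b'
    let ?W = "sbracket Z0 (S2'_basis \<alpha> b)"
    have k: "ksign (i \<and> False) = 1" "ksign (False \<and> i) = 1" by (simp_all add: ksign_def)
    have "sop_scale (wt \<alpha> b) (\<delta>' (S2'_basis \<alpha> b)) = ?W + sbracket (diag_op \<alpha>) (\<delta>' (S2'_basis \<alpha> b))"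
      using dern_leibniz[OF D' diag_op_span basis_span, of b]
      unfolding diag_op_basis dern_scale[OF D' basis_carrier] k Z0_def[symmetric] by simp
    then have "gcoef b' (sop_scale (wt \<alpha> b) (\<delta>' (S2'_basis \<alpha> b))) = gcoef b' (?W + sbracket (diag_op \<alpha>) (\<delta>' (S2'_basis \<alpha> b)))"
      by (simp only:)
    then have 1: "wt \<alpha> b * gcoef b' (\<delta>' (S2'_basis \<alpha> b)) = gcoef b' ?W + wt \<alpha> b' * gcoef b' (\<delta>' (S2'_basis \<alpha> b))"
      unfolding gcoef_scale gcoef_add gcoef_diag_op[OF span_in_carrier[OF dern_span[OF D' basis_span]]] .
    have "sbracket (diag_op \<alpha>) ?W = sop_scale (wt \<alpha> b) ?W"
      using jacobi[OF span_W2[OF diag_op_span[of \<alpha>]] span_W2[OF Z0] span_W2[OF basis_span[of \<alpha> b]]]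
      unfolding TZ0 diag_op_basis sbracket_zero_left[OF basis_carrier] sb_scale_right[OF Z0C] k by simp
    then have "gcoef b' (sbracket (diag_op \<alpha>) ?W) = gcoef b' (sop_scale (wt \<alpha> b) ?W)"
      by (simp only:)
    then have 2: "wt \<alpha> b' * gcoef b' ?W = wt \<alpha> b * gcoef b' ?W"
      unfolding gcoef_scale gcoef_diag_op[OF sbracket_carrier[OF Z0C basis_carrier]] .
    show "gcoef b' ?W = 0" using 1 2 by (cases "wt \<alpha> b = wt \<alpha> b'") auto
  qed
  have "sbracket Z0 Y + sop_scale 0 (Hop \<alpha> Y) = 0" if "Y \<in> carrier (S2' \<alpha>)" for Y
    using carrier_map_eqI[OF that, of "sbracket Z0"] c sb_add_right[OF Z0C] sb_scale_right[OF Z0C] by simp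
  then have "Z0 = 0" by (rule centre_trivial[OF \<alpha> Z0C])
  then show ?thesis using that[OF Z] unfolding Z0_def \<delta>'_def by simp
qed

lemma int_additive:
  fixes \<phi> :: "int \<Rightarrow> complex"
  assumes "\<And>m n. \<phi> (m + n) = \<phi> m + \<phi> n"
  shows "\<phi> n = of_int n * \<phi> 1"
proof -
  have 0: "\<phi> 0 = 0" using assms[of 0 0] by simp
  have m: "\<phi> (- n) = - \<phi> n" for n using assms[of n "- n"] 0 by (simp add: eq_neg_iff_add_eq_0 add.commute)
  have "\<phi> (int k) = of_int (int k) * \<phi> 1" for k
    by (induction k) (simp_all add: 0 assms algebra_simps)
  then show ?thesis by (cases n rule: int_cases2) (simp_all add: m)
qed

lemma gcoef_single_expand:
  assumes "X \<in> carrier (S2' \<alpha>)" "\<And>b'. gcoef b' X \<noteq> 0 \<Longrightarrow> b' = b"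
  shows "X = sop_scale (gcoef b X) (S2'_basis \<alpha> b)"
proof (rule gcoef_eqI[OF assms(1) carrier_scale[OF basis_carrier]])
  show "gcoef b' X = gcoef b' (sop_scale (gcoef b X) (S2'_basis \<alpha> b))" for b'
    using assms(2)[of b'] unfolding gcoef_scale gcoef_basis by auto
qed

lemma basis_scale_inj: "sop_scale c (S2'_basis \<alpha> b) = sop_scale d (S2'_basis \<alpha> b) \<longleftrightarrow> c = d"
proof
  assume "sop_scale c (S2'_basis \<alpha> b) = sop_scale d (S2'_basis \<alpha> b)"
  then have "gcoef b (sop_scale c (S2'_basis \<alpha> b)) = gcoef b (sop_scale d (S2'_basis \<alpha> b))" by (simp only:)
  then show "c = d" unfolding gcoef_scale gcoef_basis by simp
qed simp

text \<open>The components along \<open>gE\<close>, \<open>gH\<close> and \<open>gF\<close> may stay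
  unknown: where this is used, the derivation already vanishes on them.\<close>

lemma xy_bracket_even:
  obtains e k f where "sbracket (S2'_basis \<alpha> (gx, n)) (S2'_basis \<alpha> (gy, 0)) =
    sop_scale (- 1) (S2'_basis \<alpha> (gL, n)) + (field \<alpha> gE e + (field \<alpha> gH k + field \<alpha> gF f))"
proof -
  let ?X = "sbracket (S2'_basis \<alpha> (gx, n)) (S2'_basis \<alpha> (gy, 0))"
  have "?X \<in> gspan \<alpha> False"
    using span_bracket[OF basis_span[of \<alpha> "(gx, n)"] basis_span[of \<alpha> "(gy, 0)"]] by simp
  then have "sdiv \<alpha> False ?X" unfolding S2'_part_span[symmetric] S2'_part_iff .
  from sdiv_decomp[OF this] have "?X = field \<alpha> gL (crd gL ?X) + (field \<alpha> gE (crd gE ?X) + (field \<alpha> gH (crd gH ?X) + field \<alpha> gF (crd gF ?X)))"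
    unfolding gpar_sets(1)[unfolded not_True_eq_False] by (simp add: gpar_sets del: field.simps crd.simps S2'_basis.simps)
  moreover have "field \<alpha> gL (crd gL ?X) = sop_scale (- 1) (S2'_basis \<alpha> (gL, n))"
  proof -
    have "crd gL ?X = pm_scale (- 1) (tpow (n + gshift gL) 1)"
      unfolding basis_field crd_gL_bracket by (simp add: mult_single single_uminus)
    then show ?thesis unfolding basis_field by (simp only: field_scale)
  qed
  ultimately show ?thesis using that by (simp only:)
qed

text \<open>The vanishing spreads along brackets: \<open>gH\<close> from \<open>gE\<close> and
  \<open>gF\<close>, the unknown eigenvalues on \<open>gh\<close> and \<open>gy\<close> from
  brackets landing in \<open>gE\<close> and \<open>gF\<close>, and finally \<open>gL\<close> from
  \<open>gx\<close> and \<open>gy\<close>.\<close>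

lemma dern_vanish:
  assumes \<alpha>: "\<alpha> \<notin> \<int>" and D: "dern \<alpha> False \<delta>"
    and k: "\<And>g n. g \<in> {gE, gF, gx, gp} \<Longrightarrow> \<delta> (S2'_basis \<alpha> (g, n)) = 0"
    and hy: "\<And>g n. g \<in> {gh, gy} \<Longrightarrow> \<exists>c. \<delta> (S2'_basis \<alpha> (g, n)) = sop_scale c (S2'_basis \<alpha> (g, n))"
  shows "\<delta> (S2'_basis \<alpha> b) = 0"
proof -
  have 1: "\<alpha> \<noteq> 1" using \<alpha> by auto
  have ks: "ksign (False \<and> i) = 1" for i by (simp add: ksign_def)
  note L = dern_leibniz[OF D basis_span basis_span, unfolded ks ov.scale_one]
  have H: "\<delta> (S2'_basis \<alpha> (gH, n)) = 0" for n
    using L[of "(gE, n)" "(gF, 0)"] unfolding basis_brackets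
    by (simp add: k sbracket_zero_left[OF basis_carrier] sbracket_zero_right[OF basis_carrier] del: S2'_basis.simps)
  have h: "\<delta> (S2'_basis \<alpha> (gh, n)) = 0" for n
  proof -
    obtain c where c: "\<delta> (S2'_basis \<alpha> (gh, n)) = sop_scale c (S2'_basis \<alpha> (gh, n))" using hy[of gh n] by blast
    have "sop_scale c (sop_scale (1 - \<alpha>) (S2'_basis \<alpha> (gE, n + n))) = 0"
      using L[of "(gx, n)" "(gh, n)"] unfolding basis_brackets c dern_scale[OF D basis_carrier] sb_scale_right[OF basis_carrier]
      by (simp add: k sbracket_zero_left[OF basis_carrier] del: S2'_basis.simps ov.scale_scale)
    then have "sop_scale (c * (1 - \<alpha>)) (S2'_basis \<alpha> (gE, n + n)) = sop_scale 0 (S2'_basis \<alpha> (gE, n + n))"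
      by (simp del: S2'_basis.simps)
    then have "c = 0" unfolding basis_scale_inj using 1 by simp
    then show ?thesis using c by simp
  qed
  have y: "\<delta> (S2'_basis \<alpha> (gy, n)) = 0" for n
  proof -
    obtain c where c: "\<delta> (S2'_basis \<alpha> (gy, n)) = sop_scale c (S2'_basis \<alpha> (gy, n))" using hy[of gy n] by blast
    have "sop_scale c (sop_scale (\<alpha> - 1) (S2'_basis \<alpha> (gF, n + n))) = 0"
      using L[of "(gp, n)" "(gy, n)"] unfolding basis_brackets c dern_scale[OF D basis_carrier] sb_scale_right[OF basis_carrier]
      by (simp add: k sbracket_zero_left[OF basis_carrier] del: S2'_basis.simps ov.scale_scale)
    then have "sop_scale (c * (\<alpha> - 1)) (S2'_basis \<alpha> (gF, n + n)) = sop_scale 0 (S2'_basis \<alpha> (gF, n + n))"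
      by (simp del: S2'_basis.simps)
    then have "c = 0" unfolding basis_scale_inj using 1 by simp
    then show ?thesis using c by simp
  qed
  have z: "\<delta> 0 = 0" using dern_scale[OF D basis_carrier[of \<alpha> b], of 0] by simp
  have fld: "field \<alpha> g p \<in> carrier (S2' \<alpha>)" for g p by (rule span_in_carrier[OF field_gbasis])
  have f: "\<delta> (field \<alpha> g p) = 0" if "\<And>n. \<delta> (S2'_basis \<alpha> (g, n)) = 0" for g p
  proof (induction p rule: pm_induct)
    case zero
    show ?case unfolding field_zero by (rule z)
  next
    case (add p q)
    then show ?case unfolding field_add dern_add[OF D fld fld] by simp
  next
    case (single n c)
    have "field \<alpha> g (tpow n c) = sop_scale c (S2'_basis \<alpha> (g, n - gshift g))"
      unfolding basis_field by (simp flip: field_scale)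
    then show ?case unfolding \<open>field \<alpha> g (tpow n c) = _\<close> dern_scale[OF D basis_carrier] that by simp
  qed
  have Lz: "\<delta> (S2'_basis \<alpha> (gL, n)) = 0" for n
  proof -
    obtain e l f' where x: "sbracket (S2'_basis \<alpha> (gx, n)) (S2'_basis \<alpha> (gy, 0)) =
      sop_scale (- 1) (S2'_basis \<alpha> (gL, n)) + (field \<alpha> gE e + (field \<alpha> gH l + field \<alpha> gF f'))"
      by (rule xy_bracket_even)
    have "\<delta> (sbracket (S2'_basis \<alpha> (gx, n)) (S2'_basis \<alpha> (gy, 0))) = 0"
      using L[of "(gx, n)" "(gy, 0)"] k[of gx n] y[of 0]
      by (simp add: sbracket_zero_left[OF basis_carrier] sbracket_zero_right[OF basis_carrier] del: S2'_basis.simps)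
    then have "sop_scale (- 1) (\<delta> (S2'_basis \<alpha> (gL, n))) + (\<delta> (field \<alpha> gE e) + (\<delta> (field \<alpha> gH l) + \<delta> (field \<alpha> gF f'))) = 0"
      unfolding x dern_add[OF D carrier_scale[OF basis_carrier] carrier_add[OF fld carrier_add[OF fld fld]]] dern_add[OF D fld carrier_add[OF fld fld]]
        dern_add[OF D fld fld] dern_scale[OF D basis_carrier] .
    moreover have "\<delta> (field \<alpha> gE e) = 0" "\<delta> (field \<alpha> gH l) = 0" "\<delta> (field \<alpha> gF f') = 0"
      by (rule f, rule k, simp, rule f, rule H, rule f, rule k, simp)
    ultimately show ?thesis
      using ov.scale_eq_0_iff[of "-1" "\<delta> (S2'_basis \<alpha> (gL, n))"] by (simp only:) simp
  qed
  obtain g n where "b = (g, n)" by (cases b)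
  then show ?thesis using k H h y Lz by (cases g) (simp_all del: S2'_basis.simps)
qed

text \<open>After normalization the derivation is diagonal outside \<open>gL\<close> and
  \<open>gH\<close>. Its eigenvalues on \<open>gE\<close>, \<open>gF\<close>, \<open>gx\<close> and
  \<open>gp\<close> turn out to be affine in the exponent, and \<open>L_0\<close>,
  \<open>H_0\<close> and \<open>calH\<close> realize exactly the possible families.\<close>

theorem dern_form:
  assumes \<alpha>: "\<alpha> \<notin> \<int>" and D: "dern \<alpha> i \<delta>"
  shows "\<exists>X l. X \<in> gspan \<alpha> i \<and> (i \<longrightarrow> l = 0) \<and> (\<forall>Y\<in>carrier (S2' \<alpha>). \<delta> Y = sbracket X Y + sop_scale l (Hop \<alpha> Y))"
proof -
  obtain Z where Z: "Z \<in> gspan \<alpha> i" "\<delta> (diag_op \<alpha>) + sop_scale 1 (sbracket Z (diag_op \<alpha>)) = 0"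
    using dern_normalize[OF \<alpha> D] .
  define \<delta>1 where "\<delta>1 = (\<lambda>X. \<delta> X + sop_scale 1 (sbracket Z X))"
  have D1: "dern \<alpha> i \<delta>1" unfolding \<delta>1_def by (rule dern_comb[OF D dern_inner[OF Z(1)]])
  have T1: "\<delta>1 (diag_op \<alpha>) = 0" unfolding \<delta>1_def by (rule Z(2))
  have par: "gpar (fst b') = (i \<noteq> gpar (fst b))" if "gcoef b' (\<delta>1 (S2'_basis \<alpha> b)) \<noteq> 0" for b b'
    by (rule gcoef_parity[OF dern_span[OF D1 basis_span] that])
  show ?thesis
  proof (cases i)
    case True
    \<comment> \<open>Weights coincide only for \<open>gL\<close> and \<open>gH\<close>, both even,
      so an odd operator preserving weights is zero.\<close>
    have z: "\<delta>1 (S2'_basis \<alpha> b) = 0" for b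
    proof (rule gcoef_eq_0[OF span_in_carrier[OF dern_span[OF D1 basis_span]]], rule ccontr)
      fix b' assume ne: "gcoef b' (\<delta>1 (S2'_basis \<alpha> b)) \<noteq> 0"
      have "wt \<alpha> (fst b', snd b') = wt \<alpha> (fst b, snd b)" using dern_eigen[OF D1 T1 ne] by simp
      from wt_eq(2)[OF \<alpha> this] have "gpar (fst b') = gpar (fst b)" by auto
      then show False using par[OF ne] True by simp
    qed
    have "\<delta> Y = sbracket (sop_scale (- 1) Z) Y + sop_scale 0 (Hop \<alpha> Y)" if Y: "Y \<in> carrier (S2' \<alpha>)" for Y
    proof -
      have "\<delta>1 Y = 0" by (rule carrier_map_eqI[OF Y dern_add[OF D1] dern_scale[OF D1] z])
      then show ?thesis unfolding \<delta>1_def sb_scale_left[OF Y] by (simp add: eq_neg_iff_add_eq_0)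
    qed
    then show ?thesis using ov.span_scale[OF Z(1), of "-1"] by blast
  next
    case False
    define \<sigma> where "\<sigma> g n = gcoef (g, n) (\<delta>1 (S2'_basis \<alpha> (g, n)))" for g n
    have \<sigma>: "\<delta>1 (S2'_basis \<alpha> (g, n)) = sop_scale (\<sigma> g n) (S2'_basis \<alpha> (g, n))" if "g \<notin> {gL, gH}" for g n
      unfolding \<sigma>_def
    proof (rule gcoef_single_expand[OF span_in_carrier[OF dern_span[OF D1 basis_span]]])
      fix b' assume ne: "gcoef b' (\<delta>1 (S2'_basis \<alpha> (g, n))) \<noteq> 0"
      have "wt \<alpha> (fst b', snd b') = wt \<alpha> (g, n)" using dern_eigen[OF D1 T1 ne] by simp
      from wt_eq[OF \<alpha> this] show "b' = (g, n)" using that by (cases b') auto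
    qed
    have ks: "ksign (i \<and> j) = 1" for j using False by (simp add: ksign_def)
    note L = dern_leibniz[OF D1 basis_span basis_span, unfolded ks ov.scale_one]
    have Ep: "\<sigma> gx (m + n) = \<sigma> gE m + \<sigma> gp n" for m n
    proof -
      have "sop_scale (\<sigma> gx (m + n)) (S2'_basis \<alpha> (gx, m + n)) = sop_scale (\<sigma> gE m + \<sigma> gp n) (S2'_basis \<alpha> (gx, m + n))"
        using L[of "(gE, m)" "(gp, n)"]
        by (simp add: basis_brackets \<sigma> sb_scale_left[OF basis_carrier] sb_scale_right[OF basis_carrier] ov.scale_left_distrib del: S2'_basis.simps)
      then show ?thesis unfolding basis_scale_inj .
    qed
    have Fx: "\<sigma> gp (m + n) = \<sigma> gF m + \<sigma> gx n" for m n
    proof -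
      have "sop_scale (\<sigma> gp (m + n)) (S2'_basis \<alpha> (gp, m + n)) = sop_scale (\<sigma> gF m + \<sigma> gx n) (S2'_basis \<alpha> (gp, m + n))"
        using L[of "(gF, m)" "(gx, n)"]
        by (simp add: basis_brackets \<sigma> sb_scale_left[OF basis_carrier] sb_scale_right[OF basis_carrier] ov.scale_left_distrib del: S2'_basis.simps)
      then show ?thesis unfolding basis_scale_inj .
    qed
    \<comment> \<open>The slope \<open>\<kappa>\<close> is matched by \<open>L_0\<close>, whose
      eigenvalues contain \<open>- n\<close>. The eigenvalue \<open>e\<close> on \<open>gE\<close>
      at 0 is matched by half of \<open>H_0\<close>, which acts there by 2. Finally \<open>l\<close>
      is what remains on \<open>gx\<close> at 0 after both corrections.\<close>
    define \<kappa> e l where "\<kappa> = \<sigma> gx 1 - \<sigma> gx 0" and "e = \<sigma> gE 0" and "l = \<sigma> gx 0 + \<kappa> * ((\<alpha> - 1) / 2) - e / 2"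
    have p: "\<sigma> gp n = \<sigma> gx n - e" for n using Ep[of 0 n] by (simp add: e_def)
    have E: "\<sigma> gE n = \<sigma> gx n - \<sigma> gx 0 + e" for n using Ep[of n 0] p[of 0] by simp
    have F: "\<sigma> gF n = \<sigma> gx n - \<sigma> gx 0 - e" for n using Fx[of n 0] p[of n] by (simp add: algebra_simps)
    have x: "\<sigma> gx n = \<sigma> gx 0 + of_int n * \<kappa>" for n
    proof -
      have "\<sigma> gx (m + n) - \<sigma> gx 0 = (\<sigma> gx m - \<sigma> gx 0) + (\<sigma> gx n - \<sigma> gx 0)" for m n
        using Ep[of m n] E[of m] p[of n] by simp
      from int_additive[of "\<lambda>n. \<sigma> gx n - \<sigma> gx 0", OF this, of n] show ?thesis by (simp add: \<kappa>_def algebra_simps)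
    qed
    let ?L = "S2'_basis \<alpha> (gL, 0)" and ?H = "S2'_basis \<alpha> (gH, 0)"
    have LH: "?L \<in> gspan \<alpha> False" "?H \<in> gspan \<alpha> False"
      using basis_span[of \<alpha> "(gL, 0)"] basis_span[of \<alpha> "(gH, 0)"] by simp_all
    define \<delta>2 where "\<delta>2 = (\<lambda>X. (\<delta>1 X + sop_scale \<kappa> (sbracket ?L X)) + sop_scale (- e / 2) (sbracket ?H X) + sop_scale (- l) (Hop \<alpha> X))"
    have D2: "dern \<alpha> False \<delta>2"
      unfolding \<delta>2_def using D1 False by (intro dern_comb dern_inner LH dern_Hop) simp
    have \<tau>: "\<delta>2 (S2'_basis \<alpha> (g, n)) = sop_scale (\<sigma> g n + \<kappa> * L0_weight \<alpha> g n + - e / 2 * gH_weight g + - l * calH_weight g) (S2'_basis \<alpha> (g, n))"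
      if "g \<notin> {gL, gH}" for g n
      unfolding \<delta>2_def \<sigma>[OF that] L0_basis H0_basis Hop_basis fst_conv ov.scale_scale ov.scale_left_distrib ..
    have v: "\<delta>2 (S2'_basis \<alpha> b) = 0" for b
    proof (rule dern_vanish[OF \<alpha> D2])
      show "\<delta>2 (S2'_basis \<alpha> (g, n)) = 0" if "g \<in> {gE, gF, gx, gp}" for g n
      proof -
        have "\<sigma> g n + \<kappa> * L0_weight \<alpha> g n + - e / 2 * gH_weight g + - l * calH_weight g = 0"
        proof -
          define s where "s = \<sigma> gx 0"
          have *: "\<sigma> gx n = s + of_int n * \<kappa>" "\<sigma> gp n = s + of_int n * \<kappa> - e"
            "\<sigma> gE n = of_int n * \<kappa> + e" "\<sigma> gF n = of_int n * \<kappa> - e" "l = s + \<kappa> * ((\<alpha> - 1) / 2) - e / 2"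
            unfolding p E F x[of n] s_def l_def by simp_all
          show ?thesis using that by (auto simp: * L0_weight_def) (simp_all add: field_simps)
        qed
        then show ?thesis using that \<tau>[of g n] by auto
      qed
      show "\<exists>c. \<delta>2 (S2'_basis \<alpha> (g, n)) = sop_scale c (S2'_basis \<alpha> (g, n))" if "g \<in> {gh, gy}" for g n
        using \<tau>[of g n] that by blast
    qed
    let ?X = "sop_scale (- 1) Z + sop_scale (- \<kappa>) ?L + sop_scale (e / 2) ?H"
    have X: "?X \<in> gspan \<alpha> i"
      using Z(1) LH False by (intro ov.span_add ov.span_scale) simp_all
    have "\<delta> Y = sbracket ?X Y + sop_scale l (Hop \<alpha> Y)" if Y: "Y \<in> carrier (S2' \<alpha>)" for Y
    proof -
      have "\<delta>2 Y = 0" by (rule carrier_map_eqI[OF Y dern_add[OF D2] dern_scale[OF D2] v])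
      then show ?thesis
        unfolding \<delta>2_def \<delta>1_def sb_add_left[OF Y] sb_scale_left[OF Y] by (simp add: algebra_simps eq_neg_iff_add_eq_0)
    qed
    then show ?thesis using X False by blast
  qed
qed

section \<open>Derivations written as inner ones plus multiples of \<open>calH\<close>\<close>

lemma S2'_simps [simp]:
  "add (S2' \<alpha>) = (+)" "smult (S2' \<alpha>) = sop_scale" "lie_bracket (S2' \<alpha>) = sbracket" "part (S2' \<alpha>) = S2'_part \<alpha>" "\<zero>\<^bsub>S2' \<alpha>\<^esub> = 0"
  by (simp_all add: S2'_def lie_superalgebra_of_def)

lemma derivations_dern:
  assumes "\<delta> \<in> derivations (S2' \<alpha>) i"
  shows "dern \<alpha> i \<delta>"
  using assms span_in_carrier[of _ \<alpha>]
  unfolding derivations_def dern_def S2'_simps S2'_part_span mem_Collect_eq by blast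

lemma derivations_outside: "\<delta> \<in> derivations (S2' \<alpha>) i \<Longrightarrow> Y \<notin> carrier (S2' \<alpha>) \<Longrightarrow> \<delta> Y = 0"
  unfolding derivations_def by blast

lemma carrier_sum: "(\<And>x. x \<in> A \<Longrightarrow> f x \<in> carrier (S2' \<alpha>)) \<Longrightarrow> sum f A \<in> carrier (S2' \<alpha>)"
  unfolding carrier_S2' by (rule ov.span_sum)

lemma Hop_carrier: "X \<in> carrier (S2' \<alpha>) \<Longrightarrow> Hop \<alpha> X \<in> carrier (S2' \<alpha>)"
  unfolding Hop_def by (intro carrier_sum carrier_scale span_in_carrier[OF field_gbasis])

lemma calH_Hop:
  assumes Y: "Y \<in> carrier (S2' \<alpha>)"
  shows "calH \<alpha> Y = Hop \<alpha> Y"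
proof -
  let ?S = "\<Sum>b | gcoef b Y \<noteq> 0. sop_scale (gcoef b Y * calH_weight (fst b)) (S2'_basis \<alpha> b)"
  have "calH \<alpha> Y = ?S" using Y by (simp add: calH_def S2'_coord_gcoef[OF Y])
  also have "?S = Hop \<alpha> Y"
  proof (rule gcoef_eqI[OF _ Hop_carrier[OF Y]])
    show "?S \<in> carrier (S2' \<alpha>)" by (intro carrier_sum carrier_scale basis_carrier)
    fix b
    have "gcoef b ?S = (\<Sum>b' | gcoef b' Y \<noteq> 0. if b' = b then gcoef b Y * calH_weight (fst b) else 0)"
      unfolding gcoef_sum gcoef_scale gcoef_basis by (rule sum.cong) auto
    then show "gcoef b ?S = gcoef b (Hop \<alpha> Y)"
      using finite_gcoef[of Y] unfolding gcoef_Hop[OF Y[unfolded carrier_S2']] by auto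
  qed
  finally show ?thesis .
qed

definition adH :: "complex \<Rightarrow> sop \<Rightarrow> complex \<Rightarrow> sop \<Rightarrow> sop" where
  "adH \<alpha> X l = ad \<alpha> X + op_scale sop_scale l (calH \<alpha>)"

lemma adH_apply: "adH \<alpha> X l Y = (if Y \<in> carrier (S2' \<alpha>) then sbracket X Y + sop_scale l (Hop \<alpha> Y) else 0)"
proof (cases "Y \<in> carrier (S2' \<alpha>)")
  case True
  have "adH \<alpha> X l Y = ad \<alpha> X Y + sop_scale l (calH \<alpha> Y)"
    unfolding adH_def op_scale_def[of sop_scale] plus_fun_def ..
  then show ?thesis using True unfolding calH_Hop[OF True] by (simp add: ad_def)
next
  case False
  have "adH \<alpha> X l Y = ad \<alpha> X Y + sop_scale l (calH \<alpha> Y)"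
    unfolding adH_def op_scale_def[of sop_scale] plus_fun_def ..
  then show ?thesis using False by (simp add: ad_def calH_def)
qed

text \<open>The difference of two presentations satisfies the hypothesis of
  \<open>centre_trivial\<close>. This makes the definite description in
  \<open>inner_component\<close> meaningful.\<close>

lemma adH_unique:
  assumes \<alpha>: "\<alpha> \<notin> \<int>" and X: "X \<in> carrier (S2' \<alpha>)" "X' \<in> carrier (S2' \<alpha>)" and e: "adH \<alpha> X l = adH \<alpha> X' l'"
  shows "X = X'" "l = l'"
proof -
  have D: "X + sop_scale (- 1) X' \<in> carrier (S2' \<alpha>)" by (intro carrier_add carrier_scale X)
  have "sbracket (X + sop_scale (- 1) X') Y + sop_scale (l - l') (Hop \<alpha> Y) = 0" if Y: "Y \<in> carrier (S2' \<alpha>)" for Y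
  proof -
    have "sbracket X Y + sop_scale l (Hop \<alpha> Y) = sbracket X' Y + sop_scale l' (Hop \<alpha> Y)"
      using fun_cong[OF e, of Y] Y unfolding adH_apply by (simp only: if_True)
    then show ?thesis
      unfolding sb_add_left[OF Y] sb_scale_left[OF Y] ov.scale_left_diff_distrib by (simp add: algebra_simps)
  qed
  note c = centre_trivial[OF \<alpha> D this]
  show "l = l'" using c(2) by simp
  have "X - X' = 0" using c(1) by simp
  then show "X = X'" by simp
qed

definition lcomp :: "complex \<Rightarrow> (sop \<Rightarrow> sop) \<Rightarrow> complex" where
  "lcomp \<alpha> \<delta> = (THE l. \<exists>X\<in>carrier (S2' \<alpha>). \<delta> = adH \<alpha> X l)"

lemma comp_adH:
  assumes \<alpha>: "\<alpha> \<notin> \<int>" and X: "X \<in> carrier (S2' \<alpha>)"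
  shows "inner_component \<alpha> (adH \<alpha> X l) = X" "lcomp \<alpha> (adH \<alpha> X l) = l"
proof -
  show "inner_component \<alpha> (adH \<alpha> X l) = X"
    unfolding inner_component_def adH_def[symmetric]
    by (rule the_equality) (use X adH_unique(1)[OF \<alpha> X] in \<open>blast+\<close>)
  show "lcomp \<alpha> (adH \<alpha> X l) = l"
    unfolding lcomp_def
    by (rule the_equality) (use X adH_unique(2)[OF \<alpha> X] in \<open>blast+\<close>)
qed

lemma adH_add:
  assumes "X \<in> carrier (S2' \<alpha>)" "X' \<in> carrier (S2' \<alpha>)"
  shows "adH \<alpha> X l + adH \<alpha> X' l' = adH \<alpha> (X + X') (l + l')"
proof (rule ext)
  fix Y
  have "(adH \<alpha> X l + adH \<alpha> X' l') Y = adH \<alpha> X l Y + adH \<alpha> X' l' Y" unfolding plus_fun_def ..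
  then show "(adH \<alpha> X l + adH \<alpha> X' l') Y = adH \<alpha> (X + X') (l + l') Y"
    using sb_add_left[of Y \<alpha> X X'] unfolding adH_apply by (cases "Y \<in> carrier (S2' \<alpha>)") (simp_all only: if_True if_False ov.scale_left_distrib ac_simps add_0)
qed

lemma adH_scale: "op_scale sop_scale c (adH \<alpha> X l) = adH \<alpha> (sop_scale c X) (c * l)"
proof (rule ext)
  fix Y
  have "op_scale sop_scale c (adH \<alpha> X l) Y = sop_scale c (adH \<alpha> X l Y)" unfolding op_scale_def[of sop_scale] ..
  then show "op_scale sop_scale c (adH \<alpha> X l) Y = adH \<alpha> (sop_scale c X) (c * l) Y"
    using sb_scale_left[of Y \<alpha> c X] unfolding adH_apply
    by (cases "Y \<in> carrier (S2' \<alpha>)") (simp_all only: if_True if_False ov.scale_right_distrib ov.scale_scale ov.scale_zero_right)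
qed

lemma adH_zero: "adH \<alpha> 0 0 = 0"
proof (rule ext)
  fix Y show "adH \<alpha> 0 0 Y = 0 Y"
    unfolding adH_apply using sbracket_zero_left[of Y \<alpha>] by (cases "Y \<in> carrier (S2' \<alpha>)") simp_all
qed

lemma derivations_adH:
  assumes \<alpha>: "\<alpha> \<notin> \<int>" and d: "\<delta> \<in> derivations (S2' \<alpha>) i"
  obtains X l where "X \<in> gspan \<alpha> i" "i \<longrightarrow> l = 0" "\<delta> = adH \<alpha> X l"
proof -
  obtain X l where X: "X \<in> gspan \<alpha> i" "i \<longrightarrow> l = 0" "\<forall>Y\<in>carrier (S2' \<alpha>). \<delta> Y = sbracket X Y + sop_scale l (Hop \<alpha> Y)"
    using dern_form[OF \<alpha> derivations_dern[OF d]] by (elim exE conjE)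
  have "\<delta> = adH \<alpha> X l"
    by (rule ext) (simp add: adH_apply X(3) derivations_outside[OF d])
  then show ?thesis using that X by blast
qed

lemma sop_parity_add: "sop_parity (X + Y) = sop_parity X + sop_parity Y"
  by (rule ext) (simp add: sop_parity_def sparity_add)

lemma sop_parity_span:
  assumes "X \<in> gspan \<alpha> i"
  shows "sop_parity X = sop_scale (ksign i) X"
  by (rule ext) (simp add: sop_parity_def op_scale_def W2_parity[OF span_W2[OF assms]])

lemma sop_parity_scale: "sop_parity (sop_scale c X) = sop_scale c (sop_parity X)"
  by (rule ext) (simp add: sop_parity_def op_scale_def sparity_scale)

lemma sop_parity_carrier:
  assumes "X \<in> carrier (S2' \<alpha>)"
  shows "sop_parity X \<in> carrier (S2' \<alpha>)"
proof -
  obtain X0 X1 where X: "X = X0 + X1" "X0 \<in> gspan \<alpha> False" "X1 \<in> gspan \<alpha> True"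
    using carrier_S2'_cases[OF assms] .
  show ?thesis
    unfolding X(1) sop_parity_add sop_parity_span[OF X(2)] sop_parity_span[OF X(3)]
    by (intro carrier_add carrier_scale span_in_carrier[OF X(2)] span_in_carrier[OF X(3)])
qed

lemma sop_parity_involution: "sop_parity (sop_parity X) = X"
  by (rule ext) (simp add: sop_parity_def)

text \<open>On the carrier this is homogeneity of the derivation. Outside it, both values are zero:
  \<open>sop_parity\<close> is an involution preserving the carrier, hence also its
  complement.\<close>

lemma der_op_part:
  assumes d: "\<delta> \<in> derivations (S2' \<alpha>) i"
  shows "op_part sop_scale sop_parity j \<delta> = (if i = j then \<delta> else 0)"
proof (rule ext)
  fix Y
  note D = derivations_dern[OF d]
  have k2: "sop_scale (1 / 2) (X + X) = X" for X
    using ov.scale_left_distrib[of "1/2" "1/2" X] by (simp add: ov.scale_right_distrib)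
  show "op_part sop_scale sop_parity j \<delta> Y = (if i = j then \<delta> else 0) Y"
  proof (cases "Y \<in> carrier (S2' \<alpha>)")
    case True
    obtain Y0 Y1 where Y: "Y = Y0 + Y1" "Y0 \<in> gspan \<alpha> False" "Y1 \<in> gspan \<alpha> True"
      using carrier_S2'_cases[OF True] .
    note C = span_in_carrier[OF Y(2)] span_in_carrier[OF Y(3)]
    have ki: "ksign False * ksign (i \<noteq> False) = ksign i" "ksign True * ksign (i \<noteq> True) = ksign i" by (simp_all add: ksign_def)
    have "sop_parity (\<delta> (sop_parity Y)) = sop_scale (ksign i) (\<delta> Y)"
      unfolding Y(1) sop_parity_add sop_parity_span[OF Y(2)] sop_parity_span[OF Y(3)]
        dern_add[OF D carrier_scale[OF C(1)] carrier_scale[OF C(2)]] dern_add[OF D C] dern_scale[OF D C(1)] dern_scale[OF D C(2)]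
        sop_parity_scale sop_parity_span[OF dern_span[OF D Y(2)]] sop_parity_span[OF dern_span[OF D Y(3)]] ov.scale_scale ki
        ov.scale_right_distrib ..
    then show ?thesis
      unfolding op_part_def[of sop_scale] by (cases i; cases j) (simp_all add: ksign_def k2)
  next
    case False
    have "sop_parity Y \<notin> carrier (S2' \<alpha>)"
      using False sop_parity_carrier[of "sop_parity Y" \<alpha>] unfolding sop_parity_involution by blast
    then have "\<delta> (sop_parity Y) = 0" "\<delta> Y = 0" using derivations_outside[OF d] False by blast+
    moreover have "sop_parity 0 = 0" using sop_parity_scale[of 0 0] by simp
    ultimately show ?thesis
      unfolding op_part_def[of sop_scale] by (simp only:) simp
  qed
qed

lemma der_zero: "\<delta> \<in> derivations (S2' \<alpha>) i \<Longrightarrow> \<delta> 0 = 0"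
  using dern_scale[OF derivations_dern basis_carrier, of \<delta> \<alpha> i 0 undefined] by simp

lemma der_supercommutator:
  assumes d: "\<delta> \<in> derivations (S2' \<alpha>) i" and d': "\<delta>' \<in> derivations (S2' \<alpha>) j"
  shows "supercommutator sop_scale sop_parity \<delta> \<delta>' Y = \<delta> (\<delta>' Y) - sop_scale (ksign (i \<and> j)) (\<delta>' (\<delta> Y))"
proof -
  have z: "(0 :: sop \<Rightarrow> sop) X = 0" for X unfolding zero_fun_def ..
  show ?thesis
    unfolding supercommutator_def[of sop_scale] der_op_part[OF d] der_op_part[OF d'] UNIV_bool
    by (cases i; cases j) (simp_all add: z der_zero[OF d] der_zero[OF d'] del: zero_fun_def zero_fun_apply)
qed

text \<open>Both operators are brackets with the elements \<open>X + sop_scale l neg_euler\<close>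
  and \<open>X' + sop_scale l' neg_euler\<close> of \<open>W2\<close>, so the claim is the Jacobi
  identity there. The bracket of these two elements lies in \<open>S2' \<alpha>\<close> again, as
  the Euler field commutes with itself.\<close>

lemma adH_bracket:
  assumes X: "X \<in> gspan \<alpha> i" "i \<Longrightarrow> l = 0" and X': "X' \<in> gspan \<alpha> j" "j \<Longrightarrow> l' = 0"
  shows "adH \<alpha> X l (adH \<alpha> X' l' Y) - sop_scale (ksign (i \<and> j)) (adH \<alpha> X' l' (adH \<alpha> X l Y)) =
    adH \<alpha> (sbracket X X' + sop_scale l (Hop \<alpha> X') + sop_scale (- l') (Hop \<alpha> X)) 0 Y"
proof (cases "Y \<in> carrier (S2' \<alpha>)")
  case False
  have "0 \<in> carrier (S2' \<alpha>)" unfolding carrier_S2' by (rule ov.span_zero)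
  then have "adH \<alpha> X l 0 = 0" "adH \<alpha> X' l' 0 = 0"
    unfolding adH_apply using sbracket_zero_right[OF span_in_carrier[OF X(1)]] sbracket_zero_right[OF span_in_carrier[OF X'(1)]]
    by (simp_all add: Hop_zero)
  then show ?thesis using False by (simp add: adH_apply[of _ _ _ Y])
next
  case Y: True
  have U: "X + sop_scale l neg_euler \<in> W2 i" and U': "X' + sop_scale l' neg_euler \<in> W2 j"
    using X X' span_W2 W2_subspace_add[OF span_W2 W2_subspace_scale[OF neg_euler_W2]] by (cases i; cases j; simp)+
  let ?U = "X + sop_scale l neg_euler" and ?U' = "X' + sop_scale l' neg_euler"
  have DU: "adH \<alpha> X l Z = sbracket ?U Z" "adH \<alpha> X' l' Z = sbracket ?U' Z" if "Z \<in> carrier (S2' \<alpha>)" for Z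
    using that unfolding adH_apply sb_add_left[OF that] sb_scale_left[OF that] Hop_neg_euler[OF that] by simp_all
  have DC: "adH \<alpha> V m Z \<in> carrier (S2' \<alpha>)" if "V \<in> carrier (S2' \<alpha>)" "Z \<in> carrier (S2' \<alpha>)" for V m Z
    using that unfolding adH_apply by (simp add: carrier_add carrier_scale sbracket_carrier Hop_carrier)
  note XC = span_in_carrier[OF X(1)] and XC' = span_in_carrier[OF X'(1)]
  have NN: "sbracket neg_euler neg_euler = 0"
    by (rule ext) (simp add: sbracket_W2[OF neg_euler_W2 neg_euler_W2] ksign_def)
  have UN: "sop_scale l' (sbracket ?U neg_euler) = sop_scale (- l') (Hop \<alpha> X)"
  proof (cases j)
    case True
    then show ?thesis using X'(2) by simp
  next
    case False
    have k: "- ksign (i \<and> False) = - 1" by (simp add: ksign_def)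
    show ?thesis
      unfolding sbracket_skew[OF U neg_euler_W2] k W2_sb_add_right[OF neg_euler_W2] W2_sb_scale_right[OF neg_euler_W2] NN Hop_neg_euler[OF XC, symmetric]
      by simp
  qed
  have UU: "sbracket ?U ?U' = sbracket X X' + sop_scale l (Hop \<alpha> X') + sop_scale (- l') (Hop \<alpha> X)"
    unfolding W2_sb_add_right[OF U] W2_sb_scale_right[OF U] UN
    unfolding sb_add_left[OF XC'] sb_scale_left[OF XC'] Hop_neg_euler[OF XC', symmetric] ..
  define BB where "BB = sbracket ?U ?U'"
  have BB: "BB \<in> W2 (i \<noteq> j)" unfolding BB_def by (rule W2_bracket[OF U U'])
  \<comment> \<open>The Jacobi identity is available for homogeneous arguments only; it is therefore
    tested on the basis and extended linearly to \<open>Z\<close>.\<close>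
  have J: "sbracket ?U (sbracket ?U' Z) + sop_scale (- ksign (i \<and> j)) (sbracket ?U' (sbracket ?U Z)) + sop_scale (- 1) (sbracket BB Z) = 0"
    if "Z \<in> carrier (S2' \<alpha>)" for Z
  proof (rule carrier_map_eqI[OF that, of "\<lambda>Z. sbracket ?U (sbracket ?U' Z) + sop_scale (- ksign (i \<and> j)) (sbracket ?U' (sbracket ?U Z)) + sop_scale (- 1) (sbracket BB Z)"])
    fix b
    show "sbracket ?U (sbracket ?U' (S2'_basis \<alpha> b)) + sop_scale (- ksign (i \<and> j)) (sbracket ?U' (sbracket ?U (S2'_basis \<alpha> b))) +
       sop_scale (- 1) (sbracket BB (S2'_basis \<alpha> b)) = 0"
      unfolding BB_def jacobi[OF U U' span_W2[OF basis_span]] by simp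
  next
    fix Z Z'
    show "sbracket ?U (sbracket ?U' (Z + Z')) + sop_scale (- ksign (i \<and> j)) (sbracket ?U' (sbracket ?U (Z + Z'))) + sop_scale (- 1) (sbracket BB (Z + Z')) =
      sbracket ?U (sbracket ?U' Z) + sop_scale (- ksign (i \<and> j)) (sbracket ?U' (sbracket ?U Z)) + sop_scale (- 1) (sbracket BB Z) +
      (sbracket ?U (sbracket ?U' Z') + sop_scale (- ksign (i \<and> j)) (sbracket ?U' (sbracket ?U Z')) + sop_scale (- 1) (sbracket BB Z'))"
      unfolding W2_sb_add_right[OF U] W2_sb_add_right[OF U'] W2_sb_add_right[OF BB] ov.scale_right_distrib
      by (simp only: ac_simps)
  next
    fix c Z
    show "sbracket ?U (sbracket ?U' (sop_scale c Z)) + sop_scale (- ksign (i \<and> j)) (sbracket ?U' (sbracket ?U (sop_scale c Z))) + sop_scale (- 1) (sbracket BB (sop_scale c Z)) =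
      sop_scale c (sbracket ?U (sbracket ?U' Z) + sop_scale (- ksign (i \<and> j)) (sbracket ?U' (sbracket ?U Z)) + sop_scale (- 1) (sbracket BB Z))"
      unfolding W2_sb_scale_right[OF U] W2_sb_scale_right[OF U'] W2_sb_scale_right[OF BB] ov.scale_right_distrib ov.scale_scale
      by (simp only: mult.commute)
  qed
  have "adH \<alpha> X l (adH \<alpha> X' l' Y) = sbracket ?U (sbracket ?U' Y)" "adH \<alpha> X' l' (adH \<alpha> X l Y) = sbracket ?U' (sbracket ?U Y)"
    using DU(1)[OF DC[OF XC' Y, of l']] DU(2)[OF DC[OF XC Y, of l]] unfolding DU[OF Y] .
  moreover have "adH \<alpha> (sbracket X X' + sop_scale l (Hop \<alpha> X') + sop_scale (- l') (Hop \<alpha> X)) 0 Y = sbracket (sbracket ?U ?U') Y"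
    unfolding UU adH_apply using Y by simp
  ultimately show ?thesis using J[OF Y] by (simp add: eq_diff_eq BB_def)
qed

section \<open>The module over the central extension of the derivation algebra\<close>

context loop_fock begin

text \<open>The coordinates of a derivation along \<open>S2' \<alpha>\<close> and
  \<open>calH\<close> are well defined and linear for \<open>\<alpha> \<notin> \<int>\<close>. The
  bracket of two derivations has no component along \<open>calH\<close>, as required by
  \<open>lie_super_module_lift\<close>.\<close>

theorem hat_Der_S2'_module:
  assumes \<alpha>: "\<alpha> \<notin> \<int>"
  shows "lie_super_module (hat_Der_S2' \<alpha>) WW (\<lambda>x. wact \<alpha> (inner_component \<alpha> (fst x)) (lcomp \<alpha> (fst x)) (snd x))"
    and "has_central_charge (Der_S2' \<alpha>) WW (\<lambda>x. wact \<alpha> (inner_component \<alpha> (fst x)) (lcomp \<alpha> (fst x)) (snd x)) (3 * of_nat (card B))"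
proof -
  let ?g = "hat_Der_S2' \<alpha>"
  have gadd: "x \<oplus>\<^bsub>?g\<^esub> y = (fst x + fst y, snd x + snd y)" for x y
    by (simp add: hat_Der_S2'_def central_extension_def Der_S2'_def lie_superalgebra_of_def split_beta)
  have gsc: "c \<odot>\<^bsub>?g\<^esub> x = (op_scale sop_scale c (fst x), c * snd x)" for c x
    by (simp add: hat_Der_S2'_def central_extension_def Der_S2'_def lie_superalgebra_of_def split_beta)
  have gbr: "lie_bracket ?g x y = (supercommutator sop_scale sop_parity (fst x) (fst y), Der_cocycle \<alpha> (fst x) (fst y))" for x y
    by (simp add: hat_Der_S2'_def central_extension_def Der_S2'_def lie_superalgebra_of_def split_beta)
  have gpart: "x \<in> part ?g i \<longleftrightarrow> fst x \<in> derivations (S2' \<alpha>) i \<and> (i \<longrightarrow> snd x = 0)" for x i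
    by (cases x) (simp add: hat_Der_S2'_def central_extension_def Der_S2'_def lie_superalgebra_of_def)
  have gcar: "\<exists>X l. X \<in> carrier (S2' \<alpha>) \<and> fst x = adH \<alpha> X l" if x: "x \<in> carrier ?g" for x
  proof -
    obtain d0 d1 where d: "fst x = d0 + d1" "d0 \<in> derivations (S2' \<alpha>) False" "d1 \<in> derivations (S2' \<alpha>) True"
      using x by (cases x) (auto simp: hat_Der_S2'_def central_extension_def Der_S2'_def lie_superalgebra_of_def)
    obtain X0 l0 where 0: "X0 \<in> gspan \<alpha> False" "d0 = adH \<alpha> X0 l0"
      using derivations_adH[OF \<alpha> d(2)] by metis
    obtain X1 l1 where 1: "X1 \<in> gspan \<alpha> True" "d1 = adH \<alpha> X1 l1"
      using derivations_adH[OF \<alpha> d(3)] by metis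
    note c = span_in_carrier[OF 0(1)] span_in_carrier[OF 1(1)]
    show ?thesis
      unfolding d(1) 0(2) 1(2) adH_add[OF c] using carrier_add[OF c] by blast
  qed
  show "lie_super_module ?g WW (\<lambda>x. wact \<alpha> (inner_component \<alpha> (fst x)) (lcomp \<alpha> (fst x)) (snd x))"
  proof (rule lie_super_module_lift)
    fix x assume "x \<in> carrier ?g"
    then obtain X l where X: "X \<in> carrier (S2' \<alpha>)" "fst x = adH \<alpha> X l" using gcar by blast
    show "inner_component \<alpha> (fst x) \<in> carrier (S2' \<alpha>)"
      unfolding X(2) comp_adH[OF \<alpha> X(1)] by (rule X(1))
    show "inner_component \<alpha> (fst (c \<odot>\<^bsub>?g\<^esub> x)) = sop_scale c (inner_component \<alpha> (fst x)) \<and>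
       lcomp \<alpha> (fst (c \<odot>\<^bsub>?g\<^esub> x)) = c * lcomp \<alpha> (fst x) \<and> snd (c \<odot>\<^bsub>?g\<^esub> x) = c * snd x" for c
      unfolding gsc fst_conv snd_conv X(2) adH_scale comp_adH[OF \<alpha> X(1)] comp_adH[OF \<alpha> carrier_scale[OF X(1)]] by simp
    fix y assume "y \<in> carrier ?g"
    then obtain Y m where Y: "Y \<in> carrier (S2' \<alpha>)" "fst y = adH \<alpha> Y m" using gcar by blast
    show "inner_component \<alpha> (fst (x \<oplus>\<^bsub>?g\<^esub> y)) = inner_component \<alpha> (fst x) + inner_component \<alpha> (fst y) \<and>
       lcomp \<alpha> (fst (x \<oplus>\<^bsub>?g\<^esub> y)) = lcomp \<alpha> (fst x) + lcomp \<alpha> (fst y) \<and> snd (x \<oplus>\<^bsub>?g\<^esub> y) = snd x + snd y"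
      unfolding gadd fst_conv snd_conv X(2) Y(2) adH_add[OF X(1) Y(1)] comp_adH[OF \<alpha> X(1)] comp_adH[OF \<alpha> Y(1)] comp_adH[OF \<alpha> carrier_add[OF X(1) Y(1)]]
      by (intro conjI refl)
  next
    fix x i assume "x \<in> part ?g i"
    then have d: "fst x \<in> derivations (S2' \<alpha>) i" and s: "i \<longrightarrow> snd x = 0" unfolding gpart by simp_all
    obtain X l where X: "X \<in> gspan \<alpha> i" "i \<longrightarrow> l = 0" "fst x = adH \<alpha> X l"
      using derivations_adH[OF \<alpha> d] .
    show "inner_component \<alpha> (fst x) \<in> S2'_part \<alpha> i \<and> (i \<longrightarrow> lcomp \<alpha> (fst x) = 0 \<and> snd x = 0)"
      unfolding X(3) comp_adH[OF \<alpha> span_in_carrier[OF X(1)]] S2'_part_span using X(1,2) s by blast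
  next
    fix x y i j assume "x \<in> part ?g i" "y \<in> part ?g j"
    then have d: "fst x \<in> derivations (S2' \<alpha>) i" "fst y \<in> derivations (S2' \<alpha>) j" unfolding gpart by simp_all
    obtain X l where X: "X \<in> gspan \<alpha> i" "i \<longrightarrow> l = 0" "fst x = adH \<alpha> X l"
      using derivations_adH[OF \<alpha> d(1)] .
    obtain Y m where Y: "Y \<in> gspan \<alpha> j" "j \<longrightarrow> m = 0" "fst y = adH \<alpha> Y m"
      using derivations_adH[OF \<alpha> d(2)] .
    let ?Z = "sbracket X Y + sop_scale l (Hop \<alpha> Y) + sop_scale (- m) (Hop \<alpha> X)"
    have "supercommutator sop_scale sop_parity (fst x) (fst y) = adH \<alpha> ?Z 0"
    proof (rule ext)
      fix V
      show "supercommutator sop_scale sop_parity (fst x) (fst y) V = adH \<alpha> ?Z 0 V"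
        unfolding der_supercommutator[OF d] unfolding X(3) Y(3) by (rule adH_bracket) (use X Y in auto)
    qed
    note b = this
    have 1: "sop_scale l (Hop \<alpha> Y) \<in> gspan \<alpha> (i \<noteq> j)"
    proof (cases i)
      case True
      then show ?thesis using X(2) ov.span_zero by simp
    next
      case False
      then show ?thesis using ov.span_scale[OF Hop_span[OF Y(1)]] by simp
    qed
    have 2: "sop_scale (- m) (Hop \<alpha> X) \<in> gspan \<alpha> (i \<noteq> j)"
    proof (cases j)
      case True
      then show ?thesis using Y(2) ov.span_zero by simp
    next
      case False
      then show ?thesis using ov.span_scale[OF Hop_span[OF X(1)], of "- m"] by (simp del: ov.scale_minus_left)
    qed
    have Z: "?Z \<in> gspan \<alpha> (i \<noteq> j)"
      by (intro ov.span_add span_bracket X Y 1 2)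
    note c = comp_adH[OF \<alpha> span_in_carrier[OF X(1)]] comp_adH[OF \<alpha> span_in_carrier[OF Y(1)]] comp_adH[OF \<alpha> span_in_carrier[OF Z]]
    show "inner_component \<alpha> (fst (lie_bracket ?g x y)) = sbracket (inner_component \<alpha> (fst x)) (inner_component \<alpha> (fst y)) +
        sop_scale (lcomp \<alpha> (fst x)) (Hop \<alpha> (inner_component \<alpha> (fst y))) + sop_scale (- lcomp \<alpha> (fst y)) (Hop \<alpha> (inner_component \<alpha> (fst x))) \<and>
       lcomp \<alpha> (fst (lie_bracket ?g x y)) = 0 \<and>
       snd (lie_bracket ?g x y) = coc \<alpha> (inner_component \<alpha> (fst x)) (inner_component \<alpha> (fst y)) \<and>
       inner_component \<alpha> (fst (lie_bracket ?g x y)) \<in> S2'_part \<alpha> (i \<noteq> j)"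
      unfolding gbr fst_conv snd_conv b Der_cocycle_def unfolding X(3) Y(3) c S2'_part_span
        S2'_cocycle_coc[OF span_in_carrier[OF X(1)] span_in_carrier[OF Y(1)]]
      by (intro conjI refl Z)
  qed
  have "\<zero>\<^bsub>Der_S2' \<alpha>\<^esub> = adH \<alpha> 0 0" unfolding adH_zero by (simp add: Der_S2'_def lie_superalgebra_of_def)
  moreover have "0 \<in> carrier (S2' \<alpha>)" unfolding carrier_S2' by (rule ov.span_zero)
  ultimately show "has_central_charge (Der_S2' \<alpha>) WW (\<lambda>x. wact \<alpha> (inner_component \<alpha> (fst x)) (lcomp \<alpha> (fst x)) (snd x)) (3 * of_nat (card B))"
    unfolding has_central_charge_def using comp_adH[OF \<alpha>, of 0 0] wact_central[of _ \<alpha>] by (simp only: fst_conv snd_conv) blast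
qed

end

theorem theorem5p1:
  fixes sc :: "complex \<Rightarrow> 'v::ab_group_add \<Rightarrow> 'v" and B :: "'v set"
  assumes V: "finite_dimensional_vector_space sc B"
  defines "W \<equiv> semi_inf_W (loop_scale sc) loop_deg"
    and "k \<equiv> 3 * of_nat (vector_space.dim sc (UNIV :: 'v set))"
  shows "(\<forall>\<alpha>::complex. \<exists>\<rho>. lie_super_module (hat_S2' \<alpha>) W \<rho>
            \<and> has_central_charge (S2' \<alpha>) W \<rho> k)
       \<and> (\<forall>\<alpha>::complex. \<alpha> \<notin> \<int> \<longrightarrow>
            (\<exists>\<rho>. lie_super_module (hat_Der_S2' \<alpha>) W \<rho>
               \<and> has_central_charge (Der_S2' \<alpha>) W \<rho> k))"
proof -
  interpret loop_fock sc B by (rule loop_fock.intro) (rule V)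
  show ?thesis
    unfolding W_def k_def dim_card
    using hat_S2'_module hat_Der_S2'_module by blast
qed

end
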